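(* For all integers $n,k\ge1$ there exists an $O(\log k)$-stretch correlated sampling algorithm for $\Delta_{n,k}$ (implied constant independent of $n,k$) whose sample time is $O(\mathrm{nnz}\cdot\log^* n)$ in the worst case, where $\mathrm{nnz}$ is the number of nonzero coordinates of the input vector.
   Context: $\Delta_{n,k}=\{\mathbf{x}\in[0,1]^n:\|\mathbf{x}\|_1\le k\}$. A correlated sampling algorithm for $\Delta_{n,k}$ is a distribution $\mathcal{D}$ over deterministic maps $\mathcal{A}:\Delta_{n,k}\to2^{[n]}$, drawn once and applied to all inputs; it has stretch $\alpha$ if for all $\mathbf{x},\mathbf{y}\in\Delta_{n,k}$: (P1) $|\mathcal{A}(\mathbf{x})|\in\{\lfloor\|\mathbf{x}\|_1\rfloor,\lceil\|\mathbf{x}\|_1\rceil\}$ for all $\mathcal{A}$ in the support; (P2) $\Pr[i\in\mathcal{A}(\mathbf{x})]=x_i$ for all $i$; (P3) $\mathbb{E}|\mathcal{A}(\mathbf{x})\oplus\mathcal{A}(\mathbf{y})|\le\alpha\|\mathbf{x}-\mathbf{y}\|_1$. Sample time is the time to compute $\mathcal{A}(\mathbf{x})$ (random bits are drawn lazily, the first time they are needed, so initialization is constant time), in the word-RAM model with $O(1)$-time bitwise XOR, AND, NOT, with the input given in a sparse representation allowing iteration over its nonzero coordinates in increasing order in $O(\mathrm{nnz})$ time. $\log^{(i)}n$ is the $i$-fold iterated base-2 logarithm and $\log^* n=\min\{i:\log^{(i)}n\le1\}$. *)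

theory Defs
  imports "HOL-Probability.Probability"
begin

section \<open>Correlated sampling for \<open>\<Delta>\<^sub>n\<^sub>,\<^sub>k\<close>\<close>

text \<open>Vectors of \<open>\<real>\<^sup>n\<close> are functions on the index set \<open>{1..n}\<close>, extended by 0.\<close>

definition l1_norm :: "nat \<Rightarrow> (nat \<Rightarrow> real) \<Rightarrow> real" where
  "l1_norm n x = (\<Sum>i=1..n. \<bar>x i\<bar>)"

definition Delta :: "nat \<Rightarrow> nat \<Rightarrow> (nat \<Rightarrow> real) set" where
  "Delta n k = {x. (\<forall>i\<in>{1..n}. 0 \<le> x i \<and> x i \<le> 1) \<and> (\<forall>i. i \<notin> {1..n} \<longrightarrow> x i = 0)
                 \<and> l1_norm n x \<le> real k}"

definition nonzeros :: "nat \<Rightarrow> (nat \<Rightarrow> real) \<Rightarrow> nat set" where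
  "nonzeros n x = {i \<in> {1..n}. x i \<noteq> 0}"

definition nnz :: "nat \<Rightarrow> (nat \<Rightarrow> real) \<Rightarrow> nat" where
  "nnz n x = card (nonzeros n x)"

text \<open>
  A distribution over maps \<open>\<Delta>\<^sub>n\<^sub>,\<^sub>k \<rightarrow> 2\<^sup>[\<^sup>n\<^sup>]\<close> is given by a probability space \<open>M\<close> of seeds together
  with the map \<open>A \<omega>\<close> selected by each seed \<open>\<omega>\<close>.
\<close>

definition correlated_sampling ::
  "'s measure \<Rightarrow> nat \<Rightarrow> nat \<Rightarrow> ('s \<Rightarrow> (nat \<Rightarrow> real) \<Rightarrow> nat set) \<Rightarrow> bool" where
  "correlated_sampling M n k A \<longleftrightarrow>
     prob_space M \<and>
     (\<forall>x\<in>Delta n k.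
        (\<forall>\<omega>\<in>space M. A \<omega> x \<subseteq> {1..n}) \<and>
        (\<forall>i\<in>{1..n}. {\<omega>\<in>space M. i \<in> A \<omega> x} \<in> sets M) \<and>
        (\<forall>\<omega>\<in>space M. int (card (A \<omega> x)) \<in> {\<lfloor>l1_norm n x\<rfloor>, \<lceil>l1_norm n x\<rceil>}) \<and>
        (\<forall>i\<in>{1..n}. measure M {\<omega>\<in>space M. i \<in> A \<omega> x} = x i))"

definition has_stretch ::
  "'s measure \<Rightarrow> nat \<Rightarrow> nat \<Rightarrow> ('s \<Rightarrow> (nat \<Rightarrow> real) \<Rightarrow> nat set) \<Rightarrow> real \<Rightarrow> bool" where
  "has_stretch M n k A \<alpha> \<longleftrightarrow>
     (\<forall>x\<in>Delta n k. \<forall>y\<in>Delta n k.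
        (\<integral>\<omega>. real (card (sym_diff (A \<omega> x) (A \<omega> y))) \<partial>M) \<le> \<alpha> * l1_norm n (\<lambda>i. x i - y i))"

definition log_star :: "nat \<Rightarrow> nat" where
  "log_star n = (LEAST i. (log 2 ^^ i) (real n) \<le> 1)"


section \<open>Word-RAM with real cells and lazily drawn randomness\<close>

text \<open>
  Words are natural numbers below \<open>2 ^ w\<close>. Since the coordinates of the input are exact reals,
  there are also real registers and real memory cells. They support field arithmetic and comparison,
  but no rounding: information passes from reals to words only through comparisons.

  A seed assigns to each address an independent uniform element of \<open>[0,1)\<close>, that is, an infinite
  string of fair bits. Reading a cell of the seed costs one step; as a cell always returns
  the same value, this is the same as drawing it when it is first read and remembering it.
\<close>

definition seed_space :: "(nat \<Rightarrow> real) measure" where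
  "seed_space = (\<Pi>\<^sub>M a\<in>UNIV. restrict_space lborel {0..<1})"

lemma prob_space_seed_space: "prob_space seed_space"
proof -
  have "prob_space (restrict_space lborel {0..<1::real})"
    by (intro prob_spaceI) (simp add: space_restrict_space emeasure_restrict_space)
  then show ?thesis
    unfolding seed_space_def by (intro prob_space_PiM)
qed

record state =
  wreg :: "nat \<Rightarrow> nat"
  wmem :: "nat \<Rightarrow> nat"
  rreg :: "nat \<Rightarrow> real"
  rmem :: "nat \<Rightarrow> real"

datatype word_op = WAdd | WSub | WMul | WDiv | WMod | WShl | WShr | WAnd | WOr | WXor

datatype real_op = RAdd | RSub | RMul | RDiv

fun word_op_val :: "nat \<Rightarrow> word_op \<Rightarrow> nat \<Rightarrow> nat \<Rightarrow> nat" where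
  "word_op_val w WAdd a b = (a + b) mod 2 ^ w"
| "word_op_val w WSub a b = (a + 2 ^ w - b) mod 2 ^ w"
| "word_op_val w WMul a b = (a * b) mod 2 ^ w"
| "word_op_val w WDiv a b = a div b"
| "word_op_val w WMod a b = a mod b"
| "word_op_val w WShl a b = (a * 2 ^ b) mod 2 ^ w"
| "word_op_val w WShr a b = a div 2 ^ b"
| "word_op_val w WAnd a b = Bit_Operations.and a b"
| "word_op_val w WOr a b = Bit_Operations.or a b"
| "word_op_val w WXor a b = Bit_Operations.xor a b"

fun real_op_val :: "real_op \<Rightarrow> real \<Rightarrow> real \<Rightarrow> real" where
  "real_op_val RAdd a b = a + b"
| "real_op_val RSub a b = a - b"
| "real_op_val RMul a b = a * b"
| "real_op_val RDiv a b = a / b"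

text \<open>
  The first argument of an instruction is the target register, except for \<open>WStore\<close> and
  \<open>RStore\<close>, where it is the word register holding the address. \<open>RandWord\<close> returns the first \<open>w\<close>
  bits of a cell of the seed.
\<close>

datatype instr =
    WConst nat nat
  | WOp word_op nat nat nat
  | WNot nat nat
  | WLoad nat nat
  | WStore nat nat
  | ROfWord nat nat
  | ROp real_op nat nat nat
  | RLoad nat nat
  | RStore nat nat
  | RandReal nat nat
  | RandWord nat nat

fun step :: "nat \<Rightarrow> (nat \<Rightarrow> real) \<Rightarrow> instr \<Rightarrow> state \<Rightarrow> state" where
  "step w \<omega> (WConst r v) s = s\<lparr>wreg := (wreg s)(r := v mod 2 ^ w)\<rparr>"
| "step w \<omega> (WOp f r a b) s =
     s\<lparr>wreg := (wreg s)(r := word_op_val w f (wreg s a) (wreg s b))\<rparr>"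
| "step w \<omega> (WNot r a) s = s\<lparr>wreg := (wreg s)(r := 2 ^ w - 1 - wreg s a)\<rparr>"
| "step w \<omega> (WLoad r a) s = s\<lparr>wreg := (wreg s)(r := wmem s (wreg s a))\<rparr>"
| "step w \<omega> (WStore a r) s = s\<lparr>wmem := (wmem s)(wreg s a := wreg s r)\<rparr>"
| "step w \<omega> (ROfWord r a) s = s\<lparr>rreg := (rreg s)(r := real (wreg s a))\<rparr>"
| "step w \<omega> (ROp f r a b) s =
     s\<lparr>rreg := (rreg s)(r := real_op_val f (rreg s a) (rreg s b))\<rparr>"
| "step w \<omega> (RLoad r a) s = s\<lparr>rreg := (rreg s)(r := rmem s (wreg s a))\<rparr>"
| "step w \<omega> (RStore a r) s = s\<lparr>rmem := (rmem s)(wreg s a := rreg s r)\<rparr>"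
| "step w \<omega> (RandReal r a) s = s\<lparr>rreg := (rreg s)(r := \<omega> (wreg s a))\<rparr>"
| "step w \<omega> (RandWord r a) s =
     s\<lparr>wreg := (wreg s)(r := nat \<lfloor>2 ^ w * \<omega> (wreg s a)\<rfloor>)\<rparr>"

datatype test = WLess nat nat | WEq nat nat | RLess nat nat | REq nat nat

fun holds :: "test \<Rightarrow> state \<Rightarrow> bool" where
  "holds (WLess a b) s \<longleftrightarrow> wreg s a < wreg s b"
| "holds (WEq a b) s \<longleftrightarrow> wreg s a = wreg s b"
| "holds (RLess a b) s \<longleftrightarrow> rreg s a < rreg s b"
| "holds (REq a b) s \<longleftrightarrow> rreg s a = rreg s b"

datatype program =
    Skip
  | Instr instr
  | Seq program program
  | Cond test program program
  | While test program

text \<open>\<open>exec w \<omega> P s t s'\<close>: from \<open>s\<close>, program \<open>P\<close> halts in \<open>s'\<close> after \<open>t\<close> instructions and tests.\<close>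

inductive exec :: "nat \<Rightarrow> (nat \<Rightarrow> real) \<Rightarrow> program \<Rightarrow> state \<Rightarrow> nat \<Rightarrow> state \<Rightarrow> bool"
  for w :: nat and \<omega> :: "nat \<Rightarrow> real" where
  Skip: "exec w \<omega> Skip s 0 s"
| Instr: "exec w \<omega> (Instr i) s 1 (step w \<omega> i s)"
| Seq: "exec w \<omega> P s t s' \<Longrightarrow> exec w \<omega> Q s' t' s'' \<Longrightarrow> exec w \<omega> (Seq P Q) s (t + t') s''"
| CondTrue: "holds b s \<Longrightarrow> exec w \<omega> P s t s' \<Longrightarrow> exec w \<omega> (Cond b P Q) s (t + 1) s'"
| CondFalse: "\<not> holds b s \<Longrightarrow> exec w \<omega> Q s t s' \<Longrightarrow> exec w \<omega> (Cond b P Q) s (t + 1) s'"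
| WhileFalse: "\<not> holds b s \<Longrightarrow> exec w \<omega> (While b P) s 1 s"
| WhileTrue: "holds b s \<Longrightarrow> exec w \<omega> P s t s' \<Longrightarrow> exec w \<omega> (While b P) s' t' s''
    \<Longrightarrow> exec w \<omega> (While b P) s (t + t' + 1) s''"

inductive_cases exec_SkipE: "exec w \<omega> Skip s t s'"
inductive_cases exec_InstrE: "exec w \<omega> (Instr i) s t s'"
inductive_cases exec_SeqE: "exec w \<omega> (Seq P Q) s t s'"
inductive_cases exec_CondE: "exec w \<omega> (Cond b P Q) s t s'"
inductive_cases exec_WhileE: "exec w \<omega> (While b P) s t s'"

lemma exec_deterministic:
  "exec w \<omega> P s t s' \<Longrightarrow> exec w \<omega> P s u s'' \<Longrightarrow> u = t \<and> s'' = s'"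
proof (induction arbitrary: u s'' rule: exec.induct)
  case (Skip s)
  then show ?case by (auto elim: exec_SkipE)
next
  case (Instr i s)
  then show ?case by (auto elim: exec_InstrE)
next
  case (Seq P s t s1 Q t' s2)
  from Seq.prems show ?case by (rule exec_SeqE) (metis Seq.IH)
next
  case (CondTrue b s P t s' Q)
  from CondTrue.prems show ?case
    by (rule exec_CondE) (use CondTrue.IH CondTrue.hyps(1) in \<open>metis Suc_eq_plus1\<close>)+
next
  case (CondFalse b s Q t s' P)
  from CondFalse.prems show ?case
    by (rule exec_CondE) (use CondFalse.IH CondFalse.hyps(1) in \<open>metis Suc_eq_plus1\<close>)+
next
  case (WhileFalse b s P)
  from WhileFalse.prems show ?case
    by (rule exec_WhileE) (use WhileFalse.hyps in auto)
next
  case (WhileTrue b s P t s1 t' s2)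
  from WhileTrue.prems show ?case
    by (rule exec_WhileE) (use WhileTrue.IH WhileTrue.hyps(1) in \<open>metis Suc_eq_plus1\<close>)+
qed

text \<open>
  The sparse input: cell \<open>j < nnz n x\<close> of the word memory holds the \<open>j\<close>-th nonzero coordinate in
  increasing order (counting from 0), and cell \<open>j\<close> of the real memory its value. All other cells are
  0. The parameter \<open>k\<close> is passed as \<open>min k n\<close>, so that it fits into \<open>O(log n)\<close> bits; this loses
  nothing, because \<open>\<Delta>\<^sub>n\<^sub>,\<^sub>k = \<Delta>\<^sub>n\<^sub>,\<^sub>n\<close> for \<open>k \<ge> n\<close>.
\<close>

definition input_state :: "nat \<Rightarrow> nat \<Rightarrow> (nat \<Rightarrow> real) \<Rightarrow> state" where
  "input_state n k x = (let is = sorted_list_of_set (nonzeros n x) in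
     \<lparr>wreg = (\<lambda>_. 0)(0 := n, 1 := min k n, 2 := nnz n x),
      wmem = (\<lambda>j. if j < nnz n x then is ! j else 0),
      rreg = (\<lambda>_. 0),
      rmem = (\<lambda>j. if j < nnz n x then x (is ! j) else 0)\<rparr>)"

text \<open>The output is the set listed in the first \<open>m\<close> word memory cells, \<open>m\<close> being word register 0.\<close>

definition output_set :: "state \<Rightarrow> nat set" where
  "output_set s = wmem s ` {..<wreg s 0}"

text \<open>On seed \<open>\<omega>\<close> and with word size \<open>w\<close>, the program computes \<open>S\<close> from \<open>x\<close> in \<open>t\<close> steps.\<close>

definition computes ::
  "nat \<Rightarrow> program \<Rightarrow> nat \<Rightarrow> nat \<Rightarrow> (nat \<Rightarrow> real) \<Rightarrow> (nat \<Rightarrow> real) \<Rightarrow> nat set \<Rightarrow> nat \<Rightarrow> bool" where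
  "computes w P n k \<omega> x S t \<longleftrightarrow> (\<exists>s. exec w \<omega> P (input_state n k x) t s \<and> output_set s = S)"

end

(*
  An input of mass s is scattered over K = 2^d buckets, where d is least with s <= K * rho for a
  random rho in [1/2, 1), so that a small change of s seldom changes K and every bucket receives
  O(1) mass in expectation. Inside a bucket the small items are laid out on a line that is cut into
  cells of length 1/2, and a large item is a cell of its own. In every cell one item is drawn with
  probability proportional to its share and takes over the whole mass of the cell; only O(1) items
  per bucket survive. The remaining vector z is rounded by pivotal sampling along a caterpillar tree
  in every bucket and a binary tree on top; moving z by e in one coordinate disturbs each of the
  O(log k) nodes above it by O(e), which gives the stretch.

  Drawing an item from a cell must itself have constant stretch and be fast. Plain reservoir sampling
  has logarithmic stretch. If the items are read in log* n + O(1) passes in which their masses grow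
  tower-fast from 1/n to 1, a pass that multiplies the mass by M costs stretch O(log M), but weighted
  by the mass present, and these contributions sum to O(1).

  All random numbers are read from disjoint seed addresses, so the expectation is taken first over
  rho, then over the hash values, then over the drawings and finally over the tree.
*)
theory Submission
  imports Defs
begin

text \<open>Pivotal rounding jumps where a partial sum reaches an integer, because the merge rule
  changes there. Hence the label of a node is kept apart from its mass: for fixed labels the
  expected disagreement is Lipschitz, between two jumps the labels can stay fixed, and at a jump
  both labels yield the same set, so the pieces add up. An item that crosses the cut between light
  and heavy disturbs its whole bucket; the cut is therefore \<open>\<rho> / 2\<close> with the
  random \<open>\<rho>\<close>, and is crossed only with probability O(e). The mass of a bucket
  enters twice, as disturbed mass and as depth of the caterpillar, so a second moment over the hash
  values is needed. Every random quantity matters only through finitely many values; all integrands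
  are simple functions, and conditioning means splicing two seeds. On the machine no real can be
  rounded: the number of buckets is found by doubling and cell indices by counting overflows. At
  most 4 nnz buckets occur and items without mass can be skipped, which keeps each pass within
  O(nnz).\<close>

section \<open>The seed space: spliced seeds, finite-valued functions, independent coins\<close>

abbreviation SF :: "((nat \<Rightarrow> real) \<Rightarrow> 'a) \<Rightarrow> bool" where
  "SF \<equiv> simple_function seed_space"

text \<open>Splicing replaces conditioning: the coordinates in \<open>H\<close> stay fixed while all
  others are resampled, and no product decomposition of the index set is needed.\<close>

definition comb :: "nat set \<Rightarrow> (nat \<Rightarrow> real) \<Rightarrow> (nat \<Rightarrow> real) \<Rightarrow> nat \<Rightarrow> real" where
  "comb H \<omega> \<omega>' = (\<lambda>a. if a \<in> H then \<omega> a else \<omega>' a)"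

interpretation seed: prob_space seed_space
  by (rule prob_space_seed_space)

lemma prob_space_unit: "prob_space (restrict_space lborel {0..<1::real})"
  by (intro prob_spaceI) (simp add: space_restrict_space emeasure_restrict_space)

lemma space_seed_iff: "\<omega> \<in> space seed_space \<longleftrightarrow> (\<forall>a. 0 \<le> \<omega> a \<and> \<omega> a < 1)"
  unfolding seed_space_def space_PiM
  by (auto simp: PiE_def Pi_def space_restrict_space)

lemma seed_bounds: "\<omega> \<in> space seed_space \<Longrightarrow> 0 \<le> \<omega> a" "\<omega> \<in> space seed_space \<Longrightarrow> \<omega> a < 1"
  by (auto simp: space_seed_iff)

lemma seed_component_measurable: "(\<lambda>\<omega>. \<omega> a) \<in> borel_measurable seed_space"
proof -
  have "(\<lambda>\<omega>. \<omega> a) \<in> measurable seed_space (restrict_space lborel {0..<1::real})"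
    unfolding seed_space_def by (rule measurable_component_singleton) simp
  then show ?thesis
    by (simp add: measurable_restrict_space2_iff)
qed

lemma seed_sets_less: "{\<omega> \<in> space seed_space. \<omega> a < c} \<in> sets seed_space"
  using seed_component_measurable[of a] by measurable

lemma prob_less:
  assumes "0 \<le> c" "c \<le> 1"
  shows "seed.prob {\<omega> \<in> space seed_space. \<omega> a < c} = c"
proof -
  interpret P: product_prob_space "\<lambda>_::nat. restrict_space lborel {0..<1::real}" UNIV
    by (intro product_prob_spaceI prob_space_unit)
  have 0: "{0..<c} \<in> sets (restrict_space lborel {0..<1::real})"
    using assms by (auto simp: sets_restrict_space_iff)
  have "emeasure seed_space {\<omega> \<in> space seed_space. \<omega> a \<in> {0..<c}}
      = emeasure (restrict_space lborel {0..<1::real}) {0..<c}"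
    unfolding seed_space_def using P.emeasure_PiM_Collect_single[OF UNIV_I 0] .
  also have "\<dots> = ennreal c"
    using assms by (subst emeasure_restrict_space) auto
  also have "{\<omega> \<in> space seed_space. \<omega> a \<in> {0..<c}} = {\<omega> \<in> space seed_space. \<omega> a < c}"
    by (auto simp: seed_bounds)
  finally show ?thesis
    using assms by (simp add: measure_def)
qed

lemma comb_measurable:
  "(\<lambda>p. comb H (fst p) (snd p)) \<in> measurable (seed_space \<Otimes>\<^sub>M seed_space) seed_space"
proof -
  have "(\<lambda>p. comb H (fst p) (snd p) a)
      \<in> measurable (seed_space \<Otimes>\<^sub>M seed_space) (restrict_space lborel {0..<1::real})" for a
  proof (cases "a \<in> H")
    case True
    have "(\<lambda>p. fst p a) \<in> measurable (seed_space \<Otimes>\<^sub>M seed_space) (restrict_space lborel {0..<1::real})"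
      unfolding seed_space_def by measurable
    then show ?thesis using True by (simp add: comb_def)
  next
    case False
    have "(\<lambda>p. snd p a) \<in> measurable (seed_space \<Otimes>\<^sub>M seed_space) (restrict_space lborel {0..<1::real})"
      unfolding seed_space_def by measurable
    then show ?thesis using False by (simp add: comb_def)
  qed
  then have "(\<lambda>p. comb H (fst p) (snd p))
      \<in> measurable (seed_space \<Otimes>\<^sub>M seed_space) (\<Pi>\<^sub>M a\<in>UNIV. restrict_space lborel {0..<1::real})"
    by (intro measurable_PiM_single') (auto simp: space_restrict_space space_pair_measure space_seed_iff comb_def)
  then show ?thesis by (simp add: seed_space_def[symmetric])
qed

text \<open>A cylinder over a finite \<open>J\<close> splits into a condition on
  \<open>J \<inter> H\<close> for the first seed and one on \<open>J - H\<close> for the second, so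
  its measure factors; cylinders determine the product measure.\<close>

lemma distr_comb:
  "distr (seed_space \<Otimes>\<^sub>M seed_space) seed_space (\<lambda>p. comb H (fst p) (snd p)) = seed_space"
proof -
  interpret P: product_prob_space "\<lambda>_::nat. restrict_space lborel {0..<1::real}" UNIV
    by (intro product_prob_spaceI prob_space_unit)
  let ?U = "restrict_space lborel {0..<1::real}"
  let ?M = "distr (seed_space \<Otimes>\<^sub>M seed_space) seed_space (\<lambda>p. comb H (fst p) (snd p))"
  have "?M = (\<Pi>\<^sub>M a\<in>UNIV. ?U)"
  proof (rule P.PiM_eq)
    show "sets ?M = sets (\<Pi>\<^sub>M a\<in>UNIV. ?U)" by (simp add: seed_space_def)
    fix J :: "nat set" and F :: "nat \<Rightarrow> real set"
    assume J: "finite J" "J \<subseteq> UNIV" "\<And>j. j \<in> J \<Longrightarrow> F j \<in> sets ?U"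
    let ?emb = "prod_emb UNIV (\<lambda>_. ?U) J (Pi\<^sub>E J F)"
    have embm: "prod_emb UNIV (\<lambda>_. ?U) I (Pi\<^sub>E I F) \<in> sets seed_space" if "I \<subseteq> J" for I
      unfolding seed_space_def using J that by (intro sets_PiM_I) (auto intro: finite_subset)
    have emb: "prod_emb UNIV (\<lambda>_. ?U) I (Pi\<^sub>E I F) = {\<omega> \<in> space seed_space. \<forall>j\<in>I. \<omega> j \<in> F j}" for I
      by (auto simp: prod_emb_def seed_space_def space_PiM PiE_def Pi_def extensional_def)
    have "emeasure ?M ?emb = emeasure (seed_space \<Otimes>\<^sub>M seed_space)
        ((\<lambda>p. comb H (fst p) (snd p)) -` ?emb \<inter> space (seed_space \<Otimes>\<^sub>M seed_space))"
      using embm by (intro emeasure_distr comb_measurable) auto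
    also have "(\<lambda>p. comb H (fst p) (snd p)) -` ?emb \<inter> space (seed_space \<Otimes>\<^sub>M seed_space)
       = prod_emb UNIV (\<lambda>_. ?U) (J \<inter> H) (Pi\<^sub>E (J \<inter> H) F) \<times> prod_emb UNIV (\<lambda>_. ?U) (J - H) (Pi\<^sub>E (J - H) F)"
      unfolding emb space_pair_measure by (fastforce simp: comb_def space_seed_iff)
    also have "emeasure (seed_space \<Otimes>\<^sub>M seed_space) \<dots>
       = emeasure seed_space (prod_emb UNIV (\<lambda>_. ?U) (J \<inter> H) (Pi\<^sub>E (J \<inter> H) F))
         * emeasure seed_space (prod_emb UNIV (\<lambda>_. ?U) (J - H) (Pi\<^sub>E (J - H) F))"
      by (intro seed.emeasure_pair_measure_Times embm) auto
    also have "emeasure seed_space (prod_emb UNIV (\<lambda>_. ?U) (J \<inter> H) (Pi\<^sub>E (J \<inter> H) F))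
        = (\<Prod>j\<in>J \<inter> H. emeasure ?U (F j))"
      unfolding seed_space_def using J by (intro P.emeasure_PiM_emb) auto
    also have "emeasure seed_space (prod_emb UNIV (\<lambda>_. ?U) (J - H) (Pi\<^sub>E (J - H) F))
        = (\<Prod>j\<in>J - H. emeasure ?U (F j))"
      unfolding seed_space_def using J by (intro P.emeasure_PiM_emb) auto
    also have "(\<Prod>j\<in>J \<inter> H. emeasure ?U (F j)) * (\<Prod>j\<in>J - H. emeasure ?U (F j)) = (\<Prod>j\<in>J. emeasure ?U (F j))"
      using J(1) by (subst prod.union_disjoint[symmetric]) (auto intro!: prod.cong)
    finally show "emeasure ?M ?emb = (\<Prod>j\<in>J. emeasure ?U (F j))" .
  qed
  then show ?thesis by (simp add: seed_space_def)
qed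

lemma SF_measurable: "SF (f :: _ \<Rightarrow> real) \<Longrightarrow> f \<in> borel_measurable seed_space"
  by (rule borel_measurable_simple_function)

lemma SF_integrable:
  assumes "SF (f :: _ \<Rightarrow> real)"
  shows "integrable seed_space f"
proof -
  have "finite (f ` space seed_space)" using assms by (rule simple_functionD)
  then have "bounded (f ` space seed_space)" by (rule finite_imp_bounded)
  then obtain B where "\<And>\<omega>. \<omega> \<in> space seed_space \<Longrightarrow> norm (f \<omega>) \<le> B"
    by (auto simp: bounded_iff)
  then show ?thesis
    by (intro seed.integrable_const_bound[of f B] AE_I2 SF_measurable assms) auto
qed

lemma SF_comb:
  assumes "SF f" "\<omega> \<in> space seed_space"
  shows "SF (\<lambda>\<omega>'. f (comb H \<omega> \<omega>'))"
proof -
  let ?c = "\<lambda>\<omega>'. comb H \<omega> \<omega>'"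
  have m: "?c \<in> measurable seed_space seed_space"
    using measurable_compose[OF measurable_Pair1'[OF assms(2), of seed_space] comb_measurable[of H]] by simp
  have sp: "?c p \<in> space seed_space" if "p \<in> space seed_space" for p
    using measurable_space[OF m that] .
  show ?thesis unfolding simple_function_def
  proof safe
    have "(\<lambda>p. f (?c p)) ` space seed_space \<subseteq> f ` space seed_space"
      using sp by auto
    then show "finite ((\<lambda>p. f (?c p)) ` space seed_space)"
      using simple_functionD(1)[OF assms(1)] finite_subset by blast
    fix a
    have "?c -` (f -` {f (?c a)} \<inter> space seed_space) \<inter> space seed_space \<in> sets seed_space"
      by (rule measurable_sets[OF m simple_functionD(2)[OF assms(1)]])
    also have "?c -` (f -` {f (?c a)} \<inter> space seed_space) \<inter> space seed_space
      = (\<lambda>p. f (?c p)) -` {f (?c a)} \<inter> space seed_space"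
      using sp by auto
    finally show "(\<lambda>p. f (?c p)) -` {f (?c a)} \<inter> space seed_space \<in> sets seed_space" .
  qed
qed

lemma split_integrable:
  assumes "SF (f :: _ \<Rightarrow> real)"
  shows "integrable (seed_space \<Otimes>\<^sub>M seed_space) (\<lambda>p. f (comb H (fst p) (snd p)))"
  using SF_integrable[OF assms] 
  by (subst (asm) distr_comb[symmetric, of H], subst (asm) integrable_distr_eq)
     (auto intro: comb_measurable SF_measurable assms)

lemma integrable_inner:
  assumes "SF (f :: _ \<Rightarrow> real)"
  shows "integrable seed_space (\<lambda>\<omega>. \<integral>\<omega>'. f (comb H \<omega> \<omega>') \<partial>seed_space)"
proof -
  interpret pair_sigma_finite seed_space seed_space ..
  from integrable_fst'[OF split_integrable[OF assms, of H]] show ?thesis by simp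
qed

lemma integral_split:
  assumes "SF (f :: _ \<Rightarrow> real)"
  shows "(\<integral>\<omega>. f \<omega> \<partial>seed_space) = (\<integral>\<omega>. (\<integral>\<omega>'. f (comb H \<omega> \<omega>') \<partial>seed_space) \<partial>seed_space)"
proof -
  interpret pair_sigma_finite seed_space seed_space ..
  have "(\<integral>\<omega>. f \<omega> \<partial>seed_space) = (\<integral>p. f (comb H (fst p) (snd p)) \<partial>(seed_space \<Otimes>\<^sub>M seed_space))"
    by (subst distr_comb[symmetric, of H], subst integral_distr)
       (auto intro: comb_measurable SF_measurable assms)
  also have "\<dots> = (\<integral>\<omega>. (\<integral>\<omega>'. f (comb H \<omega> \<omega>') \<partial>seed_space) \<partial>seed_space)"
    using integral_fst'[OF split_integrable[OF assms, of H]] by simp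
  finally show ?thesis .
qed

text \<open>Serves to peel off the stages of the algorithm: the inner expectation is bounded for
  every outcome of the coordinates in \<open>H\<close>, and only the bound is integrated.\<close>

lemma integral_split_le:
  assumes f: "SF (f :: _ \<Rightarrow> real)" and g: "SF g"
    and le: "\<And>\<omega>. \<omega> \<in> space seed_space \<Longrightarrow> (\<integral>\<omega>'. f (comb H \<omega> \<omega>') \<partial>seed_space) \<le> g \<omega>"
  shows "(\<integral>\<omega>. f \<omega> \<partial>seed_space) \<le> (\<integral>\<omega>. g \<omega> \<partial>seed_space)"
  unfolding integral_split[OF f, of H]
  by (intro integral_mono integrable_inner f SF_integrable g le)

lemma SF_less:
  assumes "SF d"
  shows "SF (\<lambda>\<omega>. \<omega> a < (c (d \<omega>) :: real))"
proof -
  let ?R = "d ` space seed_space"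
  have eq: "{\<omega> \<in> space seed_space. \<omega> a < c (d \<omega>)}
      = (\<Union>v\<in>?R. {\<omega> \<in> space seed_space. \<omega> a < c v} \<inter> (d -` {v} \<inter> space seed_space))"
    by auto
  have m: "{\<omega> \<in> space seed_space. \<omega> a < c (d \<omega>)} \<in> sets seed_space"
    unfolding eq by (intro sets.finite_UN sets.Int seed_sets_less simple_functionD assms)
  have m': "{\<omega> \<in> space seed_space. \<not> \<omega> a < c (d \<omega>)} \<in> sets seed_space"
    using sets.compl_sets[OF m] by (auto simp: set_diff_eq intro: back_subst[where P="\<lambda>x. x \<in> sets seed_space"])
  have "(\<lambda>\<omega>. \<omega> a < c (d \<omega>)) -` {b} \<inter> space seed_space \<in> sets seed_space" for b
    using m m' by (cases b) (simp_all add: vimage_def Collect_conj_eq Int_commute)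
  then show ?thesis unfolding simple_function_def by (auto intro: finite_subset[of _ UNIV])
qed

lemma SF_if: "SF b \<Longrightarrow> SF f \<Longrightarrow> SF g \<Longrightarrow> SF (\<lambda>\<omega>. if b \<omega> then f \<omega> else g \<omega>)"
  using simple_function_compose1[OF simple_function_Pair[OF _ simple_function_Pair], of seed_space b f g
     "\<lambda>(b, f, g). if b then f else g"] by simp

lemma SF_comp: "SF f \<Longrightarrow> SF (\<lambda>\<omega>. g (f \<omega>))"
  by (rule simple_function_compose1)

lemma SF_comp2: "SF f \<Longrightarrow> SF g \<Longrightarrow> SF (\<lambda>\<omega>. k (f \<omega>) (g \<omega>))"
  by (rule simple_function_compose2)

lemma SF_finite_fun:
  assumes "finite I" "\<And>i. i \<in> I \<Longrightarrow> SF (\<lambda>\<omega>. f \<omega> i)" 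
  shows "SF (\<lambda>\<omega>. (\<lambda>i. if i \<in> I then f \<omega> i else c i))"
  using assms
proof (induction I)
  case empty then show ?case by simp
next
  case (insert j I)
  have "SF (\<lambda>\<omega>. (\<lambda>i. if i \<in> I then f \<omega> i else c i)(j := f \<omega> j))"
    by (rule SF_comp2[where k = "\<lambda>F v. F(j := v)"]) (use insert in auto)
  moreover have "(\<lambda>i. if i \<in> I then f \<omega> i else c i)(j := f \<omega> j)
     = (\<lambda>i. if i \<in> insert j I then f \<omega> i else c i)" for \<omega>
    by auto
  ultimately show ?case by simp
qed

lemma SF_finite_range:
  assumes "f \<in> measurable seed_space (count_space UNIV)" "finite (f ` space seed_space)"
  shows "SF f"
  unfolding simple_function_def using assms by (auto intro!: measurable_sets[of f])

text \<open>A pointwise substitute for independence of one coordinate: it is checked by rewriting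
  and suffices for the product formula that follows.\<close>

definition indep_of :: "((nat \<Rightarrow> real) \<Rightarrow> 'a) \<Rightarrow> nat \<Rightarrow> bool" where
  "indep_of f a \<longleftrightarrow> (\<forall>\<omega> v. f (fun_upd \<omega> a v) = f \<omega>)"

text \<open>Splicing at the single coordinate \<open>a\<close> makes \<open>Y\<close> a function of
  the second seed alone, so the double integral is a product.\<close>

lemma integral_less_mult:
  assumes Y: "SF (Y :: _ \<Rightarrow> real)" and ind: "indep_of Y a" and c: "0 \<le> c" "c \<le> 1"
  shows "(\<integral>\<omega>. of_bool (\<omega> a < c) * Y \<omega> \<partial>seed_space) = c * (\<integral>\<omega>. Y \<omega> \<partial>seed_space)"
proof -
  have sf: "SF (\<lambda>\<omega>. of_bool (\<omega> a < c) * Y \<omega>)"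
    by (intro SF_comp2[where k = "(*)"] SF_comp[where g = of_bool] Y SF_less[where d="\<lambda>_. ()"]) simp
  have Yc: "Y (comb {a} \<omega> \<omega>') = Y \<omega>'" for \<omega> \<omega>'
  proof -
    have "comb {a} \<omega> \<omega>' = \<omega>'(a := \<omega> a)" by (auto simp: comb_def)
    then show ?thesis using ind by (simp add: indep_of_def)
  qed
  have "(\<integral>\<omega>. of_bool (\<omega> a < c) * Y \<omega> \<partial>seed_space)
      = (\<integral>\<omega>. of_bool (\<omega> a < c) * (\<integral>\<omega>'. Y \<omega>' \<partial>seed_space) \<partial>seed_space)"
    by (subst integral_split[OF sf, of "{a}"]) (simp add: Yc, simp add: comb_def)
  also have "\<dots> = (\<integral>\<omega>. of_bool (\<omega> a < c) \<partial>seed_space) * (\<integral>\<omega>'. Y \<omega>' \<partial>seed_space)"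
    by simp
  also have "(\<integral>\<omega>. of_bool (\<omega> a < c) \<partial>seed_space) = (c::real)"
  proof -
    have "(\<integral>\<omega>. of_bool (\<omega> a < c) \<partial>seed_space)
        = (\<integral>\<omega>. indicator {\<omega> \<in> space seed_space. \<omega> a < c} \<omega> \<partial>seed_space :: real)"
      by (intro Bochner_Integration.integral_cong) (auto simp: indicator_def)
    also have "\<dots> = c" using prob_less[OF c, of a] by (simp add: Int_absorb2)
    finally show ?thesis .
  qed
  finally show ?thesis .
qed

section \<open>Pivotal rounding along a tree\<close>

definition sdc :: "'a set \<Rightarrow> 'a set \<Rightarrow> real" where
  "sdc A B = real (card (sym_diff A B))"

lemma sdc_refl [simp]: "sdc A A = 0" by (simp add: sdc_def)

lemma sdc_nonneg [simp]: "0 \<le> sdc A B" by (simp add: sdc_def)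

lemma sdc_commute: "sdc A B = sdc B A" by (simp add: sdc_def Un_commute)

lemma sdc_triangle:
  assumes "finite A" "finite B" "finite C"
  shows "sdc A C \<le> sdc A B + sdc B C"
proof -
  have "card (sym_diff A C) \<le> card (sym_diff A B \<union> sym_diff B C)"
    using assms by (intro card_mono) auto
  also have "\<dots> \<le> card (sym_diff A B) + card (sym_diff B C)" by (rule card_Un_le)
  finally show ?thesis by (simp add: sdc_def flip: of_nat_add)
qed

lemma sdc_Un:
  assumes "finite A" "finite B" "finite C" "finite D"
  shows "sdc (A \<union> C) (B \<union> D) \<le> sdc A B + sdc C D"
proof -
  have "card (sym_diff (A \<union> C) (B \<union> D)) \<le> card (sym_diff A B \<union> sym_diff C D)"
    using assms by (intro card_mono) auto
  also have "\<dots> \<le> card (sym_diff A B) + card (sym_diff C D)" by (rule card_Un_le)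
  finally show ?thesis by (simp add: sdc_def flip: of_nat_add)
qed

lemma sdc_le_card:
  assumes "finite A" "finite B"
  shows "sdc A B \<le> real (card A) + real (card B)"
proof -
  have "card (sym_diff A B) \<le> card (A \<union> B)" using assms by (intro card_mono) auto
  also have "\<dots> \<le> card A + card B" by (rule card_Un_le)
  finally show ?thesis by (simp add: sdc_def flip: of_nat_add)
qed

text \<open>The number at a \<open>Node\<close> is the seed address of its coin, the one at a
  \<open>Leaf\<close> is an item. \<open>Tip\<close> stands for an empty bucket.\<close>

datatype tree = Tip | Leaf nat | Node nat tree tree

fun leaves :: "tree \<Rightarrow> nat set" where
  "leaves Tip = {}"
| "leaves (Leaf i) = {i}"
| "leaves (Node a l r) = leaves l \<union> leaves r"

fun addrs :: "tree \<Rightarrow> nat set" where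
  "addrs (Node a l r) = insert a (addrs l \<union> addrs r)"
| "addrs _ = {}"

fun wf_tree :: "tree \<Rightarrow> bool" where
  "wf_tree (Node a l r) \<longleftrightarrow> wf_tree l \<and> wf_tree r \<and> a \<notin> addrs l \<and> a \<notin> addrs r \<and>
     addrs l \<inter> addrs r = {} \<and> leaves l \<inter> leaves r = {}"
| "wf_tree _ \<longleftrightarrow> True"

text \<open>
  A labelling \<open>lam\<close> says at which nodes the masses \<open>f\<close>, \<open>g\<close> of the two children are regarded as
  exceeding 1, so that one item is selected and mass \<open>f + g - 1\<close> is carried on. It is kept apart
  from the masses, because it may be chosen freely where \<open>f + g = 1\<close>.
\<close>

fun fr :: "(tree \<Rightarrow> bool) \<Rightarrow> (nat \<Rightarrow> real) \<Rightarrow> tree \<Rightarrow> real" where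
  "fr lam z Tip = 0"
| "fr lam z (Leaf i) = z i"
| "fr lam z (Node a l r) = fr lam z l + fr lam z r - of_bool (lam (Node a l r))"

text \<open>Written with products, so that vanishing masses need no case and the program can
  evaluate the same test. In the low case the left item stays the carried one with probability f /
  (f + g); in the high case it is settled as selected with probability (1 - g) / (2 - (f + g)) when
  the carried item ends up unselected.\<close>

definition left_wins :: "bool \<Rightarrow> real \<Rightarrow> real \<Rightarrow> real \<Rightarrow> bool" where
  "left_wins b f g u \<longleftrightarrow> (if b then u * (2 - (f + g)) < 1 - g else u * (f + g) < f)"

text \<open>\<open>sel lam z \<omega> t b\<close> is the set selected below \<open>t\<close> when the carried item of \<open>t\<close> is finally
  selected (\<open>b\<close>) or not (\<open>\<not> b\<close>).\<close>

fun sel :: "(tree \<Rightarrow> bool) \<Rightarrow> (nat \<Rightarrow> real) \<Rightarrow> (nat \<Rightarrow> real) \<Rightarrow> tree \<Rightarrow> bool \<Rightarrow> nat set" where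
  "sel lam z \<omega> Tip b = {}"
| "sel lam z \<omega> (Leaf i) b = (if b then {i} else {})"
| "sel lam z \<omega> (Node a l r) b =
    (if b = lam (Node a l r) then sel lam z \<omega> l b \<union> sel lam z \<omega> r b
     else if left_wins (lam (Node a l r)) (fr lam z l) (fr lam z r) (\<omega> a)
     then sel lam z \<omega> l True \<union> sel lam z \<omega> r False
     else sel lam z \<omega> l False \<union> sel lam z \<omega> r True)"

text \<open>The labels fit the masses: what is carried upwards stays between 0 and 1. Where the
  children add up to exactly 1, both labels pass.\<close>

fun valid :: "(tree \<Rightarrow> bool) \<Rightarrow> (nat \<Rightarrow> real) \<Rightarrow> tree \<Rightarrow> bool" where
  "valid lam z Tip \<longleftrightarrow> True"
| "valid lam z (Leaf i) \<longleftrightarrow> 0 \<le> z i \<and> z i \<le> 1"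
| "valid lam z (Node a l r) \<longleftrightarrow> valid lam z l \<and> valid lam z r \<and>
     0 \<le> fr lam z (Node a l r) \<and> fr lam z (Node a l r) \<le> 1"

lemma valid_fr: "valid lam z t \<Longrightarrow> 0 \<le> fr lam z t \<and> fr lam z t \<le> 1"
  by (cases t) auto

lemma finite_leaves [simp]: "finite (leaves t)" by (induction t) auto

lemma sel_subset: "sel lam z \<omega> t b \<subseteq> leaves t"
  by (induction t arbitrary: b) auto

lemma finite_sel [simp]: "finite (sel lam z \<omega> t b)"
  using sel_subset finite_leaves by (rule finite_subset)

lemma sel_upd: "a \<notin> addrs t \<Longrightarrow> sel lam z (fun_upd \<omega> a v) t b = sel lam z \<omega> t b"
  by (induction t arbitrary: b) auto

lemma sel_cong_addrs: "(\<And>a. a \<in> addrs t \<Longrightarrow> \<omega> a = \<omega>' a) \<Longrightarrow> sel lam z \<omega> t b = sel lam z \<omega>' t b"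
  by (induction t arbitrary: b) auto

lemma fr_cong: "(\<And>i. i \<in> leaves t \<Longrightarrow> z i = z' i) \<Longrightarrow> fr lam z t = fr lam z' t"
  by (induction t) auto

lemma sel_cong: "(\<And>i. i \<in> leaves t \<Longrightarrow> z i = z' i) \<Longrightarrow> sel lam z \<omega> t b = sel lam z' \<omega> t b"
proof (induction t arbitrary: b)
  case (Node a l r)
  have "fr lam z l = fr lam z' l" "fr lam z r = fr lam z' r"
    using Node.prems by (intro fr_cong; simp)+
  then show ?case using Node by simp
qed auto

text \<open>At every node the two values of \<open>b\<close> hand different bits to exactly one
  child, so the difference follows a single path down to at most one leaf.\<close>

lemma sdc_sel: "sdc (sel lam z \<omega> t True) (sel lam z \<omega> t False) \<le> 1"
proof (induction t)
  case (Node a l r)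
  let ?s = "sel lam z \<omega>"
  have 1: "sdc (?s l b \<union> ?s r c) (?s l b' \<union> ?s r c') \<le> sdc (?s l b) (?s l b') + sdc (?s r c) (?s r c')"
    for b c b' c' by (intro sdc_Un) auto
  have 2: "sdc (?s l False) (?s l True) \<le> 1" "sdc (?s r False) (?s r True) \<le> 1"
    using Node by (auto simp: sdc_commute)
  show ?case
    using 1[of True True True False] 1[of True True False True] 1[of True False False False]
      1[of False True False False] Node 2
    by auto
qed (auto simp: sdc_def)

section \<open>Stability of a single merge\<close>

definition thr :: "bool \<Rightarrow> real \<Rightarrow> real \<Rightarrow> real" where
  "thr b f g = (if b then (1 - g) / (2 - (f + g)) else f / (f + g))"

text \<open>The probability that the final bit of the node differs from its label, which is the only
  case where the coin of the node is consulted.\<close>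

definition wgt :: "bool \<Rightarrow> real \<Rightarrow> real \<Rightarrow> real" where
  "wgt b f g = (if b then 2 - (f + g) else f + g)"

lemma left_wins_thr:
  assumes "0 \<le> f" "f \<le> 1" "0 \<le> g" "g \<le> 1" "0 \<le> u"
  shows "left_wins b f g u \<longleftrightarrow> u < thr b f g"
proof (cases b)
  case True
  then show ?thesis
  proof (cases "f + g = 2")
    case True
    then show ?thesis using assms \<open>b\<close> by (simp add: left_wins_def thr_def)
  next
    case False
    then have "2 - (f + g) > 0" using assms by linarith
    then show ?thesis using \<open>b\<close> by (simp add: left_wins_def thr_def pos_less_divide_eq)
  qed
next
  case F: False
  then show ?thesis
  proof (cases "f + g = 0")
    case True
    then show ?thesis using assms F by (simp add: left_wins_def thr_def)
  next
    case False
    then have "f + g > 0" using assms by linarith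
    then show ?thesis using F by (simp add: left_wins_def thr_def pos_less_divide_eq)
  qed
qed

lemma thr_range:
  assumes "0 \<le> f" "f \<le> 1" "0 \<le> g" "g \<le> 1"
  shows "0 \<le> thr b f g" "thr b f g \<le> 1"
  using assms by (auto simp: thr_def divide_le_eq_1)

lemma wgt_thr:
  assumes "0 \<le> f" "f \<le> 1" "0 \<le> g" "g \<le> 1"
  shows "wgt b f g * thr b f g = (if b then 1 - g else f)"
  using assms by (auto simp: thr_def wgt_def)

text \<open>In the low case the weighted difference is g * (f' - f) / (f' + g), and the high case is
  the same with complements. The indicator records that a sibling without freedom (mass 0, or mass 1
  at a high node) fixes the coin; this is why only merges with nonzero leaves will be
  counted.\<close>

lemma wgt_thr_diff_left:
  assumes "0 \<le> f" "f \<le> 1" "0 \<le> g" "g \<le> 1" "0 \<le> f'" "f' \<le> 1" "f \<le> f'"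
  shows "wgt b f g * \<bar>thr b f g - thr b f' g\<bar> \<le> (f' - f) * of_bool (if b then g < 1 else g > 0)"
proof (cases b)
  case True
  show ?thesis
  proof (cases "g = 1")
    case True
    then show ?thesis using \<open>b\<close> by (simp add: thr_def)
  next
    case False
    define h where "h = 1 - g"
    define e where "e = 1 - f'"
    have h: "h > 0" "e \<ge> 0" "2 - (f + g) = (1 - f) + h" "2 - (f' + g) = e + h" "1 - f = e + (f' - f)"
      using False assms by (auto simp: h_def e_def)
    have "wgt b f g * \<bar>thr b f g - thr b f' g\<bar> = (1 - f + h) * \<bar>h / (1 - f + h) - h / (e + h)\<bar>"
      using \<open>b\<close> by (simp only: wgt_def thr_def if_True h(3,4) h_def[symmetric])
    also have "h / (1 - f + h) - h / (e + h) = - (h * (f' - f) / ((1 - f + h) * (e + h)))"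
    proof (cases "e + h = 0")
      case False
      have "h / (1 - f + h) - h / (e + h) = (h * (e + h) - h * (1 - f + h)) / ((1 - f + h) * (e + h))"
        using h assms False by (intro diff_frac_eq) auto
      also have "h * (e + h) - h * (1 - f + h) = - (h * (f' - f))" by (simp add: e_def algebra_simps)
      finally show ?thesis by simp
    qed (use h in simp)
    also have "(1 - f + h) * \<bar>- (h * (f' - f) / ((1 - f + h) * (e + h)))\<bar> = h * (f' - f) / (e + h)"
      using h assms by (simp add: abs_mult)
    also have "\<dots> \<le> f' - f"
      using h assms by (simp add: divide_le_eq mult_right_mono mult.commute distrib_left)
    finally show ?thesis using \<open>b\<close> False assms by simp
  qed
next
  case F: False
  show ?thesis
  proof (cases "g = 0")
    case True
    then show ?thesis using F assms by (auto simp: thr_def wgt_def)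
  next
    case False
    then have g: "g > 0" using assms by simp
    have "wgt b f g * \<bar>thr b f g - thr b f' g\<bar> = (f + g) * \<bar>f / (f + g) - f' / (f' + g)\<bar>"
      using F by (simp add: wgt_def thr_def)
    also have "f / (f + g) - f' / (f' + g) = - (g * (f' - f) / ((f + g) * (f' + g)))"
    proof -
      have "f / (f + g) - f' / (f' + g) = (f * (f' + g) - f' * (f + g)) / ((f + g) * (f' + g))"
        using g assms by (intro diff_frac_eq) auto
      also have "f * (f' + g) - f' * (f + g) = - (g * (f' - f))" by (simp add: algebra_simps)
      finally show ?thesis by simp
    qed
    also have "(f + g) * \<bar>- (g * (f' - f) / ((f + g) * (f' + g)))\<bar> = g * (f' - f) / (f' + g)"
      using g assms by (simp add: abs_mult)
    also have "\<dots> \<le> f' - f"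
      using g assms by (simp add: divide_le_eq mult_right_mono mult.commute distrib_left)
    finally show ?thesis using F g by simp
  qed
qed

lemma thr_sym: 
  assumes "wgt b f g \<noteq> 0"
  shows "thr b f g = 1 - thr b g f"
proof -
  define d where "d = wgt b f g"
  have "x / d + y / d = 1" if "x + y = d" for x y :: real
    using that assms by (simp add: d_def flip: add_divide_distrib)
  from this[of "1 - g" "1 - f"] this[of f g] show ?thesis
    by (auto simp: thr_def wgt_def d_def add.commute)
qed

text \<open>Reduced to the left child by \<open>thr_sym\<close>. That symmetry fails where the
  weight vanishes; at the larger mass this happens only for \<open>f = g' = 1\<close> at a high
  node.\<close>

lemma wgt_thr_diff_right:
  assumes "0 \<le> f" "f \<le> 1" "0 \<le> g" "g \<le> 1" "0 \<le> g'" "g' \<le> 1" "g \<le> g'"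
  shows "wgt b f g * \<bar>thr b f g - thr b f g'\<bar> \<le> g' - g"
proof (cases "wgt b f g = 0")
  case True then show ?thesis using assms by simp
next
  case False
  have w: "wgt b f g = wgt b g f" by (simp add: wgt_def add.commute)
  show ?thesis
  proof (cases "wgt b f g' = 0")
    case True
    then have "b" "f = 1" "g' = 1" using assms False by (auto simp: wgt_def split: if_splits)
    then show ?thesis using assms by (auto simp: wgt_def thr_def)
  next
    case F: False
    have "\<bar>thr b f g - thr b f g'\<bar> = \<bar>thr b g f - thr b g' f\<bar>"
      using thr_sym[OF False] thr_sym[OF F] by simp
    then have "wgt b f g * \<bar>thr b f g - thr b f g'\<bar> = wgt b g f * \<bar>thr b g f - thr b g' f\<bar>"
      using w by simp
    also have "\<dots> \<le> (g' - g) * of_bool (if b then f < 1 else f > 0)"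
      by (rule wgt_thr_diff_left) (use assms in auto)
    also have "\<dots> \<le> g' - g" using assms by auto
    finally show ?thesis .
  qed
qed

lemma SF_less_const: "SF (\<lambda>\<omega>. \<omega> a < (c :: real))"
  using SF_less[of "\<lambda>_. ()" a "\<lambda>_. c"] by simp

lemma SF_sel:
  assumes "valid lam z t"
  shows "SF (\<lambda>\<omega>. sel lam z \<omega> t b)"
  using assms
proof (induction t arbitrary: b)
  case (Node a l r)
  let ?b = "lam (Node a l r)" and ?f = "fr lam z l" and ?g = "fr lam z r"
  have v: "valid lam z l" "valid lam z r" using Node.prems by auto
  have 1: "SF (\<lambda>\<omega>. \<omega> a < thr ?b ?f ?g)" by (rule SF_less_const)
  have 2: "SF (\<lambda>\<omega>. if b = ?b then sel lam z \<omega> l b \<union> sel lam z \<omega> r b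
     else if \<omega> a < thr ?b ?f ?g then sel lam z \<omega> l True \<union> sel lam z \<omega> r False
     else sel lam z \<omega> l False \<union> sel lam z \<omega> r True)"
    by (intro SF_if 1 SF_comp2[where k="(\<union>)"] Node.IH v simple_function_const)
  have 3: "left_wins ?b ?f ?g (\<omega> a) \<longleftrightarrow> \<omega> a < thr ?b ?f ?g" if "\<omega> \<in> space seed_space" for \<omega>
    using valid_fr[OF v(1)] valid_fr[OF v(2)] seed_bounds(1)[OF that] by (intro left_wins_thr) auto
  show ?case
    by (rule simple_function_cong[THEN iffD1, OF _ 2]) (auto simp: 3)
qed auto

section \<open>Expected disagreement caused by one leaf\<close>

definition disc :: "(tree \<Rightarrow> bool) \<Rightarrow> (nat \<Rightarrow> real) \<Rightarrow> (nat \<Rightarrow> real) \<Rightarrow> tree \<Rightarrow> bool \<Rightarrow> (nat \<Rightarrow> real) \<Rightarrow> real" where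
  "disc lam z z' t b \<omega> = sdc (sel lam z \<omega> t b) (sel lam z' \<omega> t b)"

lemma SF_disc: "valid lam z t \<Longrightarrow> valid lam z' t \<Longrightarrow> SF (disc lam z z' t b)"
  unfolding disc_def by (intro SF_comp2[where k=sdc] SF_sel)

lemma indep_disc: "a \<notin> addrs t \<Longrightarrow> indep_of (disc lam z z' t b) a"
  by (simp add: indep_of_def disc_def sel_upd)

definition edisc where
  "edisc lam z z' t b = (\<integral>\<omega>. disc lam z z' t b \<omega> \<partial>seed_space)"

lemma edisc_nonneg: "0 \<le> edisc lam z z' t b"
  unfolding edisc_def by (intro Bochner_Integration.integral_nonneg) (simp add: disc_def)

text \<open>Number of proper merges above leaf \<open>i\<close>, when only leaves in \<open>S\<close> carry mass.\<close>

fun cnt :: "nat set \<Rightarrow> tree \<Rightarrow> nat \<Rightarrow> nat" where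
  "cnt S (Node a l r) i = (if i \<in> leaves l then of_bool (leaves r \<inter> S \<noteq> {}) + cnt S l i
      else if i \<in> leaves r then 1 + cnt S r i else 0)"
| "cnt S _ i = 0"

text \<open>Neither \<open>A\<close> nor \<open>B\<close> reads the coin at \<open>a\<close>, so its
  outcome only chooses between them. The coins of the two runs differ on an interval of length
  \<bar>p - p'\<bar>, where 2 more is paid.\<close>

lemma integral_mixed:
  assumes A: "SF (A :: _ \<Rightarrow> real)" "indep_of A a" and B: "SF B" "indep_of B a"
    and p: "0 \<le> p" "p \<le> 1" "0 \<le> p'" "p' \<le> 1"
    and X: "SF X" and le: "\<And>\<omega>. \<omega> \<in> space seed_space \<Longrightarrow> X \<omega> \<le>
      (if \<omega> a < p then A \<omega> else B \<omega>) + 2 * of_bool (\<omega> a < p \<longleftrightarrow> \<not> \<omega> a < p')"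
  shows "(\<integral>\<omega>. X \<omega> \<partial>seed_space) \<le> p * (\<integral>\<omega>. A \<omega> \<partial>seed_space) + (1 - p) * (\<integral>\<omega>. B \<omega> \<partial>seed_space) + 2 * \<bar>p - p'\<bar>"
proof -
  let ?I = "\<lambda>c \<omega>. of_bool (\<omega> a < c) :: real"
  have SI: "SF (?I c)" for c by (intro SF_comp[where g=of_bool] SF_less_const)
  have S1: "SF (\<lambda>\<omega>. ?I p \<omega> * A \<omega>)" "SF (\<lambda>\<omega>. ?I p \<omega> * B \<omega>)"
    by (intro SF_comp2[where k="(*)"] SI A B)+
  \<comment> \<open>The indicator of differing coins is written as a difference of two threshold
    events, each of which integrates to its threshold.\<close>
  have "(\<integral>\<omega>. X \<omega> \<partial>seed_space) \<le> (\<integral>\<omega>. (?I p \<omega> * A \<omega> + (B \<omega> - ?I p \<omega> * B \<omega>))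
      + 2 * (?I (max p p') \<omega> - ?I (min p p') \<omega>) \<partial>seed_space)"
  proof (intro integral_mono SF_integrable X)
    show "SF (\<lambda>\<omega>. (?I p \<omega> * A \<omega> + (B \<omega> - ?I p \<omega> * B \<omega>)) + 2 * (?I (max p p') \<omega> - ?I (min p p') \<omega>))"
      by (intro SF_comp2[where k="(+)"] SF_comp2[where k="(-)"] SF_comp[where g="(*) 2"] S1 SI B)
    fix \<omega> assume "\<omega> \<in> space seed_space"
    from le[OF this] show "X \<omega> \<le> (?I p \<omega> * A \<omega> + (B \<omega> - ?I p \<omega> * B \<omega>))
      + 2 * (?I (max p p') \<omega> - ?I (min p p') \<omega>)"
      by (auto simp: max_def min_def split: if_splits)
  qed
  also have "\<dots> = p * (\<integral>\<omega>. A \<omega> \<partial>seed_space) + ((\<integral>\<omega>. B \<omega> \<partial>seed_space) - p * (\<integral>\<omega>. B \<omega> \<partial>seed_space))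
      + 2 * (max p p' - min p p')"
  proof -
    have I: "(\<integral>\<omega>. ?I c \<omega> \<partial>seed_space) = c" if "0 \<le> c" "c \<le> 1" for c
      using integral_less_mult[of "\<lambda>_. 1" a c] that by (simp add: indep_of_def seed.prob_space)
    show ?thesis
      by (subst Bochner_Integration.integral_add Bochner_Integration.integral_diff
          integral_mult_right_zero;
          (intro SF_integrable SF_comp2[where k="(+)"] SF_comp2[where k="(-)"] SF_comp[where g="(*) 2"] S1 SI B)?)+
        (use p in \<open>simp add: integral_less_mult A B I del: less_max_iff_disj min_less_iff_conj\<close>)
  qed
  also have "max p p' - min p p' = \<bar>p - p'\<bar>" by (simp add: max_def min_def)
  finally show ?thesis by (simp add: algebra_simps)
qed

lemma mix_both:
  fixes w :: real
  assumes "F * T \<le> F * A" "w * T' \<le> w * (p * A' + (1 - p) * B' + 2 * d)" "w * p = q"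
  shows "F * T + w * T' \<le> F * A + q * A' + (w - q) * B' + 2 * (w * d)"
proof -
  have "w * (p * A' + (1 - p) * B' + 2 * d) = (w * p) * A' + (w - w * p) * B' + 2 * (w * d)"
    by (simp add: algebra_simps)
  then show ?thesis using assms by simp
qed

lemma disc_same: "(\<And>j. j \<in> leaves t \<Longrightarrow> z j = z' j) \<Longrightarrow> disc lam z z' t b \<omega> = 0"
  unfolding disc_def by (subst sel_cong[of t z z']) auto

text \<open>The potential on the left is the expected disagreement when the carried item is selected
  with its own probability. The bits handed to the changed child then follow the mass of that child,
  so the potential passes from child to parent unchanged, except for
  \<open>2 * (wgt * \<bar>p - p'\<bar>)\<close>, which is at most 2e and vanishes if the other side
  is empty. Both vectors use the same labels, so all masses above \<open>i\<close> grow by exactly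
  \<open>e\<close>.\<close>

lemma psi_bound:
  assumes "wf_tree t" "valid lam z t" "valid lam z' t"
    and "z' = z(i := z i + e)" "0 \<le> e" "i \<in> leaves t"
    and S: "\<And>j. j \<in> leaves t \<Longrightarrow> j \<noteq> i \<Longrightarrow> j \<notin> S \<Longrightarrow> z j = 0"
  shows "fr lam z t * edisc lam z z' t True + (1 - fr lam z t) * edisc lam z z' t False
     \<le> 2 * e * real (cnt S t i) \<and> fr lam z' t = fr lam z t + e"
  using assms
proof (induction t)
  case (Leaf j)
  then show ?case by (simp add: edisc_def disc_def)
next
  case (Node a l r)
  let ?t = "Node a l r"
  let ?b = "lam ?t"
  define f g f' g' where defs: "f = fr lam z l" "g = fr lam z r" "f' = fr lam z' l" "g' = fr lam z' r"
  have v: "valid lam z l" "valid lam z r" "valid lam z' l" "valid lam z' r" using Node.prems by auto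
  have w: "wf_tree l" "wf_tree r" and al: "a \<notin> addrs l" "a \<notin> addrs r" and disj: "leaves l \<inter> leaves r = {}"
    using Node.prems by auto
  have rng: "0 \<le> f" "f \<le> 1" "0 \<le> g" "g \<le> 1" "0 \<le> f'" "f' \<le> 1" "0 \<le> g'" "g' \<le> 1"
    unfolding defs using v valid_fr by auto
  have frt: "fr lam z ?t = f + g - of_bool ?b" by (simp add: defs)
  have frt01: "0 \<le> fr lam z ?t" "fr lam z ?t \<le> 1" using Node.prems valid_fr by auto
  have frt01': "0 \<le> fr lam z' ?t" "fr lam z' ?t \<le> 1" using Node.prems valid_fr by auto
  define p p' where pdefs: "p = thr ?b f g" "p' = thr ?b f' g'"
  have p: "0 \<le> p" "p \<le> 1" "0 \<le> p'" "p' \<le> 1" unfolding pdefs using rng thr_range by auto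
  have lw: "left_wins ?b f g (\<omega> a) \<longleftrightarrow> \<omega> a < p" "left_wins ?b f' g' (\<omega> a) \<longleftrightarrow> \<omega> a < p'"
    if "\<omega> \<in> space seed_space" for \<omega>
    unfolding pdefs using rng seed_bounds(1)[OF that] by (intro left_wins_thr; simp)+
  let ?d = "disc lam z z'"
  have SD: "SF (?d t b)" if "valid lam z t" "valid lam z' t" for t b using that by (rule SF_disc)
  have tri: "sdc (sel lam z \<omega> t c) (sel lam z' \<omega> t (\<not> c)) \<le> ?d t c \<omega> + 1" for t c \<omega>
  proof -
    have "sdc (sel lam z \<omega> t c) (sel lam z' \<omega> t (\<not> c))
      \<le> sdc (sel lam z \<omega> t c) (sel lam z' \<omega> t c) + sdc (sel lam z' \<omega> t c) (sel lam z' \<omega> t (\<not> c))"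
      by (intro sdc_triangle) auto
    also have "sdc (sel lam z' \<omega> t c) (sel lam z' \<omega> t (\<not> c)) \<le> 1"
      using sdc_sel[of lam z' \<omega> t] by (cases c) (auto simp: sdc_commute)
    finally show ?thesis by (simp add: disc_def)
  qed
  have Un: "sdc (sel lam z \<omega> l c \<union> sel lam z \<omega> r d) (sel lam z' \<omega> l c' \<union> sel lam z' \<omega> r d')
     \<le> sdc (sel lam z \<omega> l c) (sel lam z' \<omega> l c') + sdc (sel lam z \<omega> r d) (sel lam z' \<omega> r d')" for c d c' d' \<omega>
    by (intro sdc_Un) auto
  show ?case
  proof (cases "i \<in> leaves l")
    case True
    then have ir: "i \<notin> leaves r" using disj by auto
    then have gg: "g' = g" unfolding defs using Node.prems by (intro fr_cong) auto
    have dr: "?d r b \<omega> = 0" for b \<omega> using ir Node.prems by (intro disc_same) auto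
    have IH: "f * edisc lam z z' l True + (1 - f) * edisc lam z z' l False \<le> 2 * e * real (cnt S l i)"
       and ff: "f' = f + e"
      using Node.IH(1)[OF w(1) v(1) v(3) _ _ True] Node.prems by (auto simp: defs)
    have same: "edisc lam z z' ?t ?b \<le> edisc lam z z' l ?b"
      unfolding edisc_def using Un[of _ ?b ?b ?b ?b] dr
      by (intro integral_mono SF_integrable SD Node.prems v) (auto simp: disc_def)
    have mixed: "edisc lam z z' ?t (\<not> ?b) \<le> p * edisc lam z z' l True + (1 - p) * edisc lam z z' l False + 2 * \<bar>p - p'\<bar>"
      unfolding edisc_def
    proof (rule integral_mixed)
      fix \<omega> assume om: "\<omega> \<in> space seed_space"
      have q: "sdc (sel lam z \<omega> r True) (sel lam z' \<omega> r False) \<le> 1"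
         "sdc (sel lam z \<omega> r False) (sel lam z' \<omega> r True) \<le> 1"
        using tri[of \<omega> r True] tri[of \<omega> r False] dr by auto
      show "?d ?t (\<not> ?b) \<omega> \<le> (if \<omega> a < p then ?d l True \<omega> else ?d l False \<omega>)
          + 2 * of_bool (\<omega> a < p \<longleftrightarrow> \<not> \<omega> a < p')"
        using Un[of \<omega> True False True False] Un[of \<omega> True False False True]
          Un[of \<omega> False True True False] Un[of \<omega> False True False True] dr[of True \<omega>] dr[of False \<omega>]
          tri[of \<omega> l True] tri[of \<omega> l False] q lw[OF om]
        by (auto simp: disc_def defs)
    qed (use p al in \<open>auto intro!: SD v Node.prems indep_disc\<close>)
    have wd: "wgt ?b f g * \<bar>p - p'\<bar> \<le> e * of_bool (leaves r \<inter> S \<noteq> {})"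
    proof -
      have "wgt ?b f g * \<bar>p - p'\<bar> \<le> (f' - f) * of_bool (if ?b then g < 1 else g > 0)"
        unfolding pdefs gg by (rule wgt_thr_diff_left) (use rng ff Node.prems in auto)
      also have "\<dots> \<le> e * of_bool (leaves r \<inter> S \<noteq> {})"
      proof (cases "leaves r \<inter> S = {}")
        case True
        have z0: "\<forall>j \<in> leaves r. z j = 0" using Node.prems(7) True ir by auto
        have "fr lam z r \<le> 0" using z0
        proof (induction r) qed (auto simp: of_bool_def)
        then have "g = 0" using rng by (simp add: defs)
        moreover have "e = 0" if ?b
          using that frt01 frt01' \<open>g = 0\<close> ff gg Node.prems rng by (simp add: defs(1) defs(2) flip: defs(3) defs(4))
        ultimately show ?thesis using ff True by auto
      qed (use ff Node.prems in auto)
      finally show ?thesis .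
    qed
    \<comment> \<open>Together with the case in which the coin is not consulted, this makes the left
      child end up selected with probability exactly \<open>f\<close>.\<close>
    have wp: "wgt ?b f g * p = (if ?b then 1 - g else f)"
      unfolding pdefs using rng by (intro wgt_thr)
    have eT: "0 \<le> edisc lam z z' l b" for b by (rule edisc_nonneg)
    have "fr lam z ?t * edisc lam z z' ?t True + (1 - fr lam z ?t) * edisc lam z z' ?t False
       \<le> f * edisc lam z z' l True + (1 - f) * edisc lam z z' l False + 2 * (wgt ?b f g * \<bar>p - p'\<bar>)"
    proof (cases ?b)
      case True
      then have w: "wgt ?b f g = 1 - fr lam z ?t" using frt by (simp add: wgt_def)
      have m1: "fr lam z ?t * edisc lam z z' ?t True \<le> fr lam z ?t * edisc lam z z' l True"
        using same True frt01 by (intro mult_left_mono) auto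
      have m2: "(1 - fr lam z ?t) * edisc lam z z' ?t False
        \<le> (1 - fr lam z ?t) * (p * edisc lam z z' l True + (1 - p) * edisc lam z z' l False + 2 * \<bar>p - p'\<bar>)"
        using mixed True frt01 by (intro mult_left_mono) auto
      have m3: "(1 - fr lam z ?t) * p = 1 - g" using wp w True by simp
      have m4: "fr lam z ?t = f + g - 1" using frt True by simp
      have m4: "fr lam z ?t = f + g - 1" using frt True by (simp del: fr.simps)
      show ?thesis using mix_both[OF m1 m2 m3] unfolding w m4 by (simp add: algebra_simps)
    next
      case False
      then have w: "wgt ?b f g = fr lam z ?t" using frt by (simp add: wgt_def)
      have m1: "(1 - fr lam z ?t) * edisc lam z z' ?t False \<le> (1 - fr lam z ?t) * edisc lam z z' l False"
        using same False frt01 by (intro mult_left_mono) auto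
      have m2: "fr lam z ?t * edisc lam z z' ?t True
        \<le> fr lam z ?t * (p * edisc lam z z' l True + (1 - p) * edisc lam z z' l False + 2 * \<bar>p - p'\<bar>)"
        using mixed False frt01 by (intro mult_left_mono) auto
      have m3: "fr lam z ?t * p = f" using wp w False by simp
      have m4: "fr lam z ?t = f + g" using frt False by (simp del: fr.simps)
      show ?thesis using mix_both[OF m1 m2 m3] unfolding w m4 by (simp add: algebra_simps)
    qed
    also have "\<dots> \<le> 2 * e * real (cnt S l i) + 2 * (e * of_bool (leaves r \<inter> S \<noteq> {}))"
      using IH wd by simp
    finally show ?thesis using True ff gg by (auto simp: algebra_simps defs)
  next
    case False
    then have ir: "i \<in> leaves r" using Node.prems by auto
    have gg: "f' = f" unfolding defs using Node.prems False by (intro fr_cong) auto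
    have dr: "?d l b \<omega> = 0" for b \<omega> using False Node.prems by (intro disc_same) auto
    have IH: "g * edisc lam z z' r True + (1 - g) * edisc lam z z' r False \<le> 2 * e * real (cnt S r i)"
       and ff: "g' = g + e"
      using Node.IH(2)[OF w(2) v(2) v(4) _ _ ir] Node.prems by (auto simp: defs)
    have same: "edisc lam z z' ?t ?b \<le> edisc lam z z' r ?b"
      unfolding edisc_def using Un[of _ ?b ?b ?b ?b] dr
      by (intro integral_mono SF_integrable SD Node.prems v) (auto simp: disc_def)
    have mixed: "edisc lam z z' ?t (\<not> ?b) \<le> p * edisc lam z z' r False + (1 - p) * edisc lam z z' r True + 2 * \<bar>p - p'\<bar>"
      unfolding edisc_def
    proof (rule integral_mixed)
      fix \<omega> assume om: "\<omega> \<in> space seed_space"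
      have q: "sdc (sel lam z \<omega> l True) (sel lam z' \<omega> l False) \<le> 1"
         "sdc (sel lam z \<omega> l False) (sel lam z' \<omega> l True) \<le> 1"
        using tri[of \<omega> l True] tri[of \<omega> l False] dr by auto
      show "?d ?t (\<not> ?b) \<omega> \<le> (if \<omega> a < p then ?d r False \<omega> else ?d r True \<omega>)
          + 2 * of_bool (\<omega> a < p \<longleftrightarrow> \<not> \<omega> a < p')"
        using Un[of \<omega> True False True False] Un[of \<omega> True False False True]
          Un[of \<omega> False True True False] Un[of \<omega> False True False True] dr[of True \<omega>] dr[of False \<omega>]
          tri[of \<omega> r True] tri[of \<omega> r False] q lw[OF om]
        by (auto simp: disc_def defs)
    qed (use p al in \<open>auto intro!: SD v Node.prems indep_disc\<close>)
    have wd: "wgt ?b f g * \<bar>p - p'\<bar> \<le> e"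
      using wgt_thr_diff_right[of f g g' ?b] rng ff Node.prems(5) unfolding pdefs gg by simp
    have wp: "wgt ?b f g * p = (if ?b then 1 - g else f)"
      unfolding pdefs using rng by (intro wgt_thr)
    have "fr lam z ?t * edisc lam z z' ?t True + (1 - fr lam z ?t) * edisc lam z z' ?t False
       \<le> g * edisc lam z z' r True + (1 - g) * edisc lam z z' r False + 2 * (wgt ?b f g * \<bar>p - p'\<bar>)"
    proof (cases ?b)
      case True
      then have w: "wgt ?b f g = 1 - fr lam z ?t" using frt by (simp add: wgt_def)
      have m1: "fr lam z ?t * edisc lam z z' ?t True \<le> fr lam z ?t * edisc lam z z' r True"
        using same True frt01 by (intro mult_left_mono) auto
      have m2: "(1 - fr lam z ?t) * edisc lam z z' ?t False
        \<le> (1 - fr lam z ?t) * (p * edisc lam z z' r False + (1 - p) * edisc lam z z' r True + 2 * \<bar>p - p'\<bar>)"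
        using mixed True frt01 by (intro mult_left_mono) auto
      have m3: "(1 - fr lam z ?t) * p = 1 - g" using wp w True by simp
      have m4: "fr lam z ?t = f + g - 1" using frt True by simp
      have m4: "fr lam z ?t = f + g - 1" using frt True by (simp del: fr.simps)
      show ?thesis using mix_both[OF m1 m2 m3] unfolding w m4 by (simp add: algebra_simps)
    next
      case F: False
      then have w: "wgt ?b f g = fr lam z ?t" using frt by (simp add: wgt_def)
      have m1: "(1 - fr lam z ?t) * edisc lam z z' ?t False \<le> (1 - fr lam z ?t) * edisc lam z z' r False"
        using same F frt01 by (intro mult_left_mono) auto
      have m2: "fr lam z ?t * edisc lam z z' ?t True
        \<le> fr lam z ?t * (p * edisc lam z z' r False + (1 - p) * edisc lam z z' r True + 2 * \<bar>p - p'\<bar>)"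
        using mixed F frt01 by (intro mult_left_mono) auto
      have m3: "fr lam z ?t * p = f" using wp w F by simp
      have m4: "fr lam z ?t = f + g" using frt F by simp
      have m4: "fr lam z ?t = f + g" using frt F by (simp del: fr.simps)
      show ?thesis using mix_both[OF m1 m2 m3] unfolding w m4 by (simp add: algebra_simps)
    qed
    also have "\<dots> \<le> 2 * e * real (cnt S r i) + 2 * e"
      using IH wd by simp
    finally show ?thesis using False ir ff gg by (auto simp: algebra_simps defs)
  qed
qed auto

section \<open>Number of selected items; independence of the labelling\<close>

fun highs :: "(tree \<Rightarrow> bool) \<Rightarrow> tree \<Rightarrow> int" where
  "highs lam (Node a l r) = highs lam l + highs lam r + of_bool (lam (Node a l r))"
| "highs lam _ = 0"

text \<open>Every high merge settles one item and removes mass 1; the rest is carried.\<close>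

lemma sum_leaves_eq: "wf_tree t \<Longrightarrow> (\<Sum>i\<in>leaves t. z i) = fr lam z t + of_int (highs lam t)"
  by (induction t) (auto simp: sum.union_disjoint)

text \<open>At a node of total mass \<open>s\<close>, \<open>N\<close> of the items below it end up selected, where \<open>N\<close> is
  \<open>\<lfloor>s\<rfloor>\<close> or \<open>\<lceil>s\<rceil>\<close>. Expressed through \<open>N\<close>, the selection does not depend on the labelling.\<close>

definition near :: "int \<Rightarrow> real \<Rightarrow> bool" where
  "near N s \<longleftrightarrow> \<bar>of_int N - s\<bar> < 1"

definition selN where
  "selN lam z \<omega> t N = sel lam z \<omega> t (highs lam t < N)"

lemma near_bits:
  assumes "valid lam z t" "near N (fr lam z t + of_int (highs lam t))"
  shows "N = highs lam t + of_bool (highs lam t < N)"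
    and "fr lam z t = 0 \<Longrightarrow> N = highs lam t" and "fr lam z t = 1 \<Longrightarrow> N = highs lam t + 1"
proof -
  have r: "0 \<le> fr lam z t" "fr lam z t \<le> 1" using valid_fr assms by auto
  have 1: "of_int N < (of_int (highs lam t + 2) :: real)" "of_int (highs lam t - 1) < (of_int N :: real)"
    using assms(2) r unfolding near_def by linarith+
  then have "N < highs lam t + 2" "highs lam t - 1 < N" unfolding of_int_less_iff by auto
  then show "N = highs lam t + of_bool (highs lam t < N)" by auto
  show "N = highs lam t" if "fr lam z t = 0"
  proof -
    have "of_int N < (of_int (highs lam t + 1) :: real)" "of_int (highs lam t - 1) < (of_int N :: real)"
      using assms(2) that unfolding near_def by linarith+
    then show ?thesis unfolding of_int_less_iff by auto
  qed
  show "N = highs lam t + 1" if "fr lam z t = 1"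
  proof -
    have "of_int N < (of_int (highs lam t + 2) :: real)" "of_int (highs lam t) < (of_int N :: real)"
      using assms(2) that unfolding near_def by linarith+
    then show ?thesis unfolding of_int_less_iff by auto
  qed
qed

definition childN where
  "childN lam z \<omega> a l r N = (let b = lam (Node a l r); c = (highs lam (Node a l r) < N) in
     if b = c then (highs lam l + of_bool c, highs lam r + of_bool c)
     else if left_wins b (fr lam z l) (fr lam z r) (\<omega> a) then (highs lam l + 1, highs lam r)
     else (highs lam l, highs lam r + 1))"

lemma selN_Node:
  "selN lam z \<omega> (Node a l r) N = (case childN lam z \<omega> a l r N of (N1, N2) \<Rightarrow>
     selN lam z \<omega> l N1 \<union> selN lam z \<omega> r N2)"
  by (cases "lam (Node a l r)"; cases "highs lam (Node a l r) < N")
    (auto simp: selN_def childN_def Let_def)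

text \<open>The delicate cases are children of mass 0 or 1, which must receive exactly that count.
  The strict tests and coins in [0, 1) ensure it.\<close>

lemma childN_near:
  assumes v: "valid lam z (Node a l r)" and om: "0 \<le> \<omega> a" "\<omega> a < 1"
    and N: "near N (fr lam z (Node a l r) + of_int (highs lam (Node a l r)))"
    and c: "childN lam z \<omega> a l r N = (N1, N2)"
  shows "N1 + N2 = N" "near N1 (fr lam z l + of_int (highs lam l))"
    "near N2 (fr lam z r + of_int (highs lam r))"
proof -
  let ?t = "Node a l r"
  let ?b = "lam ?t" and ?c = "highs lam ?t < N" and ?f = "fr lam z l" and ?g = "fr lam z r"
  have r: "0 \<le> ?f" "?f \<le> 1" "0 \<le> ?g" "?g \<le> 1"
    using v valid_fr[of lam z l] valid_fr[of lam z r] by auto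
  have rt: "0 \<le> fr lam z ?t" "fr lam z ?t \<le> 1" using v valid_fr by auto
  have lw: "left_wins ?b ?f ?g (\<omega> a) \<longleftrightarrow> \<omega> a < thr ?b ?f ?g"
    using r om by (intro left_wins_thr) auto
  note nb = near_bits[OF v N]
  have frt: "fr lam z ?t = ?f + ?g - of_bool ?b" by simp
  show "N1 + N2 = N"
    using c nb(1) by (auto simp: childN_def Let_def split: if_splits)
  \<comment> \<open>Extreme masses: each of the four facts says that the coin cannot favour the
    impossible outcome.\<close>
  have f0: "\<not> left_wins ?b 0 ?g (\<omega> a)" if "?b \<Longrightarrow> ?g = 1"
    using that mult_nonneg_nonneg[OF om(1) r(3)] by (auto simp: left_wins_def)
  have g0: "left_wins ?b ?f 0 (\<omega> a)" if "?b \<longrightarrow> ?f = 1" "\<not> ?b \<Longrightarrow> ?f > 0"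
    using that om by (auto simp: left_wins_def)
  have f1: "left_wins ?b 1 ?g (\<omega> a)" if "\<not> ?b \<Longrightarrow> ?g = 0" "?b \<Longrightarrow> ?g < 1"
    using that om r by (auto simp: left_wins_def)
  have g1: "\<not> left_wins ?b ?f 1 (\<omega> a)" if "\<not> ?b \<Longrightarrow> ?f = 0"
  proof (cases ?b)
    case True
    have "0 \<le> \<omega> a * (2 - (?f + 1))" using om r by (intro mult_nonneg_nonneg) auto
    then show ?thesis using True by (simp add: left_wins_def)
  qed (use that om r in \<open>auto simp: left_wins_def\<close>)
  have "near N1 (?f + of_int (highs lam l)) \<and> near N2 (?g + of_int (highs lam r))"
  proof (cases "?b = ?c")
    case True
    then have NN: "N1 = highs lam l + of_bool ?c" "N2 = highs lam r + of_bool ?c"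
      using c by (auto simp: childN_def Let_def)
    show ?thesis
    proof (cases ?c)
      case c: True
      then have "fr lam z ?t \<noteq> 0" using nb(2) by auto
      then have "?f > 0" "?g > 0" using frt r rt(1) True c by (simp_all del: fr.simps highs.simps)
      then show ?thesis unfolding near_def NN using r c by (simp del: highs.simps)
    next
      case c: False
      then have "fr lam z ?t \<noteq> 1" using nb(3) by auto
      then have "?f < 1" "?g < 1" using frt r rt(2) True c by (simp_all del: fr.simps highs.simps)
      then show ?thesis unfolding near_def NN using r c by (simp del: highs.simps)
    qed
  next
    case False
    have pos: "?b \<Longrightarrow> fr lam z ?t \<noteq> 1" "\<not> ?b \<Longrightarrow> fr lam z ?t \<noteq> 0"
      using nb(2,3) False by auto
    show ?thesis
    proof (cases "left_wins ?b ?f ?g (\<omega> a)")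
      case lwT: True
      then have NN: "N1 = highs lam l + 1" "N2 = highs lam r"
        using c False by (auto simp: childN_def Let_def)
      have "?f > 0"
      proof (rule ccontr)
        assume "\<not> ?thesis"
        then have f: "?f = 0" using r by simp
        have "?g = 1" if ?b using that frt f r rt(1) by (simp del: fr.simps)
        from f0[OF this] show False using lwT f by simp
      qed
      moreover have "?g < 1"
      proof (rule ccontr)
        assume "\<not> ?thesis"
        then have g: "?g = 1" using r by simp
        have "?f = 0" if "\<not> ?b" using that frt g r rt(2) by (simp del: fr.simps)
        from g1[OF this] show False using lwT g by simp
      qed
      ultimately show ?thesis unfolding near_def NN using r by simp
    next
      case lwF: False
      then have NN: "N1 = highs lam l" "N2 = highs lam r + 1"
        using c False by (auto simp: childN_def Let_def)
      have "?f < 1"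
      proof (rule ccontr)
        assume "\<not> ?thesis"
        then have f: "?f = 1" using r by simp
        have "?g = 0" if "\<not> ?b" using that frt f r rt(2) by (simp del: fr.simps)
        moreover have "?g < 1" if ?b using that frt f r rt pos by (simp del: fr.simps)
        ultimately show False using f1 lwF f by simp
      qed
      moreover have "?g > 0"
      proof (rule ccontr)
        assume "\<not> ?thesis"
        then have g: "?g = 0" using r by simp
        have "?b \<longrightarrow> ?f = 1" using frt g r rt(1) by (cases ?b) (simp_all del: fr.simps)
        moreover have "?f > 0" if "\<not> ?b" using that frt g r rt pos by (simp del: fr.simps)
        ultimately show False using g0 lwF g by simp
      qed
      ultimately show ?thesis unfolding near_def NN using r by simp
    qed
  qed
  then show "near N1 (?f + of_int (highs lam l))" "near N2 (?g + of_int (highs lam r))" by auto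
qed

lemma near_int: "near N (of_int k) \<longleftrightarrow> N = k"
proof -
  have "\<bar>of_int N - (of_int k :: real)\<bar> = of_int \<bar>N - k\<bar>" by simp
  then show ?thesis unfolding near_def by (simp only: of_int_less_1_iff) auto
qed

lemma highs_unique:
  assumes "valid lam z t" "valid lam' z t" "fr lam z t + of_int (highs lam t) = fr lam' z t + of_int (highs lam' t)"
    "\<And>k. fr lam z t + of_int (highs lam t) \<noteq> of_int k"
  shows "highs lam t = highs lam' t" "fr lam z t = fr lam' z t"
proof -
  have r: "0 \<le> fr lam z t" "fr lam z t \<le> 1" "0 \<le> fr lam' z t" "fr lam' z t \<le> 1" using valid_fr assms by auto
  have n: "fr lam z t \<noteq> 0" "fr lam z t \<noteq> 1" "fr lam' z t \<noteq> 0" "fr lam' z t \<noteq> 1"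
    using assms(4)[of "highs lam t"] assms(4)[of "highs lam t + 1"]
     assms(4)[of "highs lam' t"] assms(4)[of "highs lam' t + 1"] assms(3) by auto
  then have "of_int (highs lam t - highs lam' t) < (1::real)" "of_int (highs lam' t - highs lam t) < (1::real)"
    using assms(3) r by auto
  then show *: "highs lam t = highs lam' t" unfolding of_int_less_1_iff by auto
  then show "fr lam z t = fr lam' z t" using assms(3) by simp
qed

text \<open>A child of integral mass has its count forced, and then the other count is forced as
  well. If neither mass is integral, carried masses and settled counts agree for both labellings,
  and differing labels at the node force \<open>f + g = 1\<close>.\<close>

lemma selN_label:
  assumes "wf_tree t" "valid lam z t" "valid lam' z t" "\<omega> \<in> space seed_space"
    "near N (\<Sum>i\<in>leaves t. z i)"
  shows "selN lam z \<omega> t N = selN lam' z \<omega> t N"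
  using assms
proof (induction t arbitrary: N)
  case (Node a l r)
  let ?t = "Node a l r"
  have om: "0 \<le> \<omega> a" "\<omega> a < 1" using Node.prems seed_bounds by auto
  have w: "wf_tree l" "wf_tree r" using Node.prems by auto
  have v: "valid lam z l" "valid lam z r" "valid lam' z l" "valid lam' z r" using Node.prems by auto
  obtain N1 N2 where c: "childN lam z \<omega> a l r N = (N1, N2)" by (cases "childN lam z \<omega> a l r N")
  obtain M1 M2 where d: "childN lam' z \<omega> a l r N = (M1, M2)" by (cases "childN lam' z \<omega> a l r N")
  note seq = sum_leaves_eq[OF Node.prems(1), of z] sum_leaves_eq[OF w(1), of z] sum_leaves_eq[OF w(2), of z]
  have nN: "near N (fr lam z ?t + of_int (highs lam ?t))" "near N (fr lam' z ?t + of_int (highs lam' ?t))"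
    using Node.prems(5) seq(1)[of lam] seq(1)[of lam'] by (simp_all del: fr.simps highs.simps leaves.simps)
  note cn = childN_near[OF Node.prems(2) om nN(1) c]
  note dn = childN_near[OF Node.prems(3) om nN(2) d]
  have e: "fr lam z l + of_int (highs lam l) = fr lam' z l + of_int (highs lam' l)"
    "fr lam z r + of_int (highs lam r) = fr lam' z r + of_int (highs lam' r)"
    using seq(2)[of lam] seq(2)[of lam'] seq(3)[of lam] seq(3)[of lam'] by auto
  have "N1 = M1 \<and> N2 = M2"
  proof (cases "\<exists>k. fr lam z l + of_int (highs lam l) = of_int k")
    case True
    then have "N1 = M1" using cn(2) dn(2) e by (auto simp: near_int)
    then show ?thesis using cn(1) dn(1) by auto
  next
    case F1: False
    show ?thesis
    proof (cases "\<exists>k. fr lam z r + of_int (highs lam r) = of_int k")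
      case True
      then have "N2 = M2" using cn(3) dn(3) e by (auto simp: near_int)
      then show ?thesis using cn(1) dn(1) by auto
    next
      case F2: False
      have el: "highs lam l = highs lam' l" "fr lam z l = fr lam' z l"
        using highs_unique[OF v(1,3) e(1)] F1 by auto
      have er: "highs lam r = highs lam' r" "fr lam z r = fr lam' z r"
        using highs_unique[OF v(2,4) e(2)] F2 by auto
      show ?thesis
      proof (cases "lam ?t = lam' ?t")
        case True
        then show ?thesis using c d el er by (auto simp: childN_def Let_def split: if_splits)
      next
        case False
        have "fr lam z ?t \<ge> 0" "fr lam z ?t \<le> 1" "fr lam' z ?t \<ge> 0" "fr lam' z ?t \<le> 1"
          using Node.prems(2,3) valid_fr by auto
        \<comment> \<open>At total 1 the two tests coincide, since 1 - g = f and 2 - (f + g) = f +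
          g.\<close>
        then have s1: "fr lam z l + fr lam z r = 1" using False el er by (auto split: if_splits)
        then have lw: "left_wins (lam ?t) (fr lam z l) (fr lam z r) (\<omega> a) =
           left_wins (lam' ?t) (fr lam z l) (fr lam z r) (\<omega> a)"
          by (auto simp: left_wins_def)
        have "of_int N = (of_int (highs lam l + highs lam r + 1) :: real) \<Longrightarrow> N = highs lam l + highs lam r + 1"
          by (simp only: of_int_eq_iff)
        have "near N (of_int (highs lam l + highs lam r + 1))"
          using nN(1) s1 by (simp add: algebra_simps)
        then have "N = highs lam l + highs lam r + 1" by (simp only: near_int)
        then show ?thesis using c d el er lw False
          by (cases "lam ?t") (auto simp: childN_def Let_def split: if_splits)
      qed
    qed
  qed
  moreover have "near N1 (\<Sum>i\<in>leaves l. z i)" "near N2 (\<Sum>i\<in>leaves r. z i)"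
    using cn seq(2)[of lam] seq(3)[of lam] by auto
  ultimately show ?case unfolding selN_Node c d
    using Node.IH(1)[OF w(1) v(1,3)] Node.IH(2)[OF w(2) v(2,4)] Node.prems(4) by simp
qed (auto simp: selN_def)

section \<open>The labelling determined by the masses and the rounded set\<close>

fun mfr :: "(nat \<Rightarrow> real) \<Rightarrow> tree \<Rightarrow> real" where
  "mfr z Tip = 0"
| "mfr z (Leaf i) = z i"
| "mfr z (Node a l r) = (if mfr z l + mfr z r < 1 then mfr z l + mfr z r else mfr z l + mfr z r - 1)"

text \<open>A total of exactly 1 counts as high; the program makes the same choice.\<close>

definition mlab :: "(nat \<Rightarrow> real) \<Rightarrow> tree \<Rightarrow> bool" where
  "mlab z t = (case t of Node a l r \<Rightarrow> \<not> mfr z l + mfr z r < 1 | _ \<Rightarrow> False)"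

lemma fr_mlab: "fr (mlab z) z t = mfr z t"
  by (induction t) (auto simp: mlab_def)

lemma mfr_range: "(\<And>i. i \<in> leaves t \<Longrightarrow> 0 \<le> z i \<and> z i \<le> 1) \<Longrightarrow> 0 \<le> mfr z t \<and> mfr z t \<le> 1"
  by (induction t) (auto; force)+

lemma valid_mlab: "(\<And>i. i \<in> leaves t \<Longrightarrow> 0 \<le> z i \<and> z i \<le> 1) \<Longrightarrow> valid (mlab z) z t"
proof (induction t)
  case (Node a l r)
  have "0 \<le> mfr z (Node a l r) \<and> mfr z (Node a l r) \<le> 1"
    using Node.prems by (rule mfr_range)
  then show ?case using Node unfolding fr_mlab[symmetric] by auto
qed auto

definition final :: "(tree \<Rightarrow> bool) \<Rightarrow> (nat \<Rightarrow> real) \<Rightarrow> nat \<Rightarrow> tree \<Rightarrow> (nat \<Rightarrow> real) \<Rightarrow> nat set" where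
  "final lam z a t \<omega> = sel lam z \<omega> t (\<omega> a < fr lam z t)"

abbreviation rounding :: "(nat \<Rightarrow> real) \<Rightarrow> nat \<Rightarrow> tree \<Rightarrow> (nat \<Rightarrow> real) \<Rightarrow> nat set" where
  "rounding z \<equiv> final (mlab z) z"

text \<open>The last coin turns the carried mass into a count at the root. This count depends only
  on the total mass, so the independence of counts from labels applies.\<close>

lemma final_label:
  assumes "wf_tree t" "valid lam z t" "valid lam' z t" "\<omega> \<in> space seed_space"
  shows "final lam z a t \<omega> = final lam' z a t \<omega>"
proof -
  have om: "0 \<le> \<omega> a" "\<omega> a < 1" using assms seed_bounds by auto
  have fN: "final lam z a t \<omega> = selN lam z \<omega> t (highs lam t + of_bool (\<omega> a < fr lam z t))" for lam
    by (simp add: final_def selN_def)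
  have nr: "near (highs lam t + of_bool (\<omega> a < fr lam z t)) (\<Sum>i\<in>leaves t. z i)" if "valid lam z t" for lam
    using valid_fr[OF that] om sum_leaves_eq[OF assms(1), of z lam] by (auto simp: near_def)
  have e: "fr lam z t + of_int (highs lam t) = fr lam' z t + of_int (highs lam' t)"
    using sum_leaves_eq[OF assms(1)] by metis
  have "highs lam t + of_bool (\<omega> a < fr lam z t) = highs lam' t + of_bool (\<omega> a < fr lam' z t)"
  proof (cases "\<exists>k. fr lam z t + of_int (highs lam t) = of_int k")
    case True
    then obtain k where "(\<Sum>i\<in>leaves t. z i) = of_int k" using sum_leaves_eq[OF assms(1), of z lam] by auto
    then show ?thesis using nr[OF assms(2)] nr[OF assms(3)] by (metis near_int)
  next
    case False
    then show ?thesis using highs_unique[OF assms(2,3) e] by auto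
  qed
  then show ?thesis unfolding fN using selN_label[OF assms(1-4)] nr[OF assms(2)] by metis
qed

lemma SF_final: "valid lam z t \<Longrightarrow> SF (final lam z a t)"
proof -
  assume v: "valid lam z t"
  have "SF (\<lambda>\<omega>. if \<omega> a < fr lam z t then sel lam z \<omega> t True else sel lam z \<omega> t False)"
    by (intro SF_if SF_less_const SF_sel v)
  then show ?thesis by (rule simple_function_cong[THEN iffD1, rotated]) (auto simp: final_def)
qed

text \<open>Each proper merge contributes 2e through \<open>psi_bound\<close>; the coin at the root
  adds at most 2e.\<close>

lemma final_close:
  assumes t: "wf_tree t" "a \<notin> addrs t" and v: "valid lam z t" "valid lam z' t"
    and z': "z' = z(i := z i + e)" "0 \<le> e" "i \<in> leaves t"
    and S: "\<And>j. j \<in> leaves t \<Longrightarrow> j \<noteq> i \<Longrightarrow> j \<notin> S \<Longrightarrow> z j = 0"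
  shows "(\<integral>\<omega>. sdc (final lam z a t \<omega>) (final lam z' a t \<omega>) \<partial>seed_space) \<le> e * (3 + 2 * real (cnt S t i))"
proof -
  have pb: "fr lam z t * edisc lam z z' t True + (1 - fr lam z t) * edisc lam z z' t False
     \<le> 2 * e * real (cnt S t i) \<and> fr lam z' t = fr lam z t + e"
    by (rule psi_bound[OF t(1) v z']) (blast intro: S)
  have psi: "fr lam z t * edisc lam z z' t True + (1 - fr lam z t) * edisc lam z z' t False
     \<le> 2 * e * real (cnt S t i)" and f': "fr lam z' t = fr lam z t + e"
    using pb by simp_all
  have r: "0 \<le> fr lam z t" "fr lam z t \<le> 1" "fr lam z' t \<le> 1"
    using valid_fr[OF v(1)] valid_fr[OF v(2)] by simp_all
  have "(\<integral>\<omega>. sdc (final lam z a t \<omega>) (final lam z' a t \<omega>) \<partial>seed_space)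
     \<le> fr lam z t * (\<integral>\<omega>. disc lam z z' t True \<omega> \<partial>seed_space)
       + (1 - fr lam z t) * (\<integral>\<omega>. disc lam z z' t False \<omega> \<partial>seed_space) + 2 * \<bar>fr lam z t - fr lam z' t\<bar>"
  proof (rule integral_mixed)
    fix \<omega> assume om: "\<omega> \<in> space seed_space"
    have "sdc (sel lam z \<omega> t False) (sel lam z' \<omega> t True)
      \<le> sdc (sel lam z \<omega> t False) (sel lam z' \<omega> t False) + sdc (sel lam z' \<omega> t False) (sel lam z' \<omega> t True)"
      by (intro sdc_triangle) auto
    then show "sdc (final lam z a t \<omega>) (final lam z' a t \<omega>)
       \<le> (if \<omega> a < fr lam z t then disc lam z z' t True \<omega> else disc lam z z' t False \<omega>)
        + 2 * of_bool (\<omega> a < fr lam z t \<longleftrightarrow> \<not> \<omega> a < fr lam z' t)"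
      using sdc_sel[of lam z' \<omega> t] z'(2) unfolding final_def disc_def f'
      by (cases "\<omega> a < fr lam z t"; cases "\<omega> a < fr lam z t + e")
         (simp_all add: sdc_commute[of "sel lam z' \<omega> t False" "sel lam z' \<omega> t True"])
  next
    show "SF (\<lambda>\<omega>. sdc (final lam z a t \<omega>) (final lam z' a t \<omega>))"
      by (rule SF_comp2[where k=sdc, OF SF_final[OF v(1)] SF_final[OF v(2)]])
  qed (rule SF_disc[OF v] indep_disc[OF t(2)] | use r f' z'(2) in linarith)+
  then show ?thesis using psi f' z'(2) unfolding edisc_def by (simp add: algebra_simps)
qed

section \<open>Lipschitz dependence of the rounded set on the masses\<close>

text \<open>The values of coordinate \<open>i\<close> at which some node above \<open>i\<close> has
  an integral total, the only places where labels may have to change.\<close>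

fun bad :: "(nat \<Rightarrow> real) \<Rightarrow> nat \<Rightarrow> tree \<Rightarrow> real set" where
  "bad z i (Node a l r) = bad z i l \<union> bad z i r \<union>
     {u \<in> {0..1}. i \<in> leaves (Node a l r) \<and> (\<Sum>j\<in>leaves (Node a l r). (z(i := u)) j) \<in> \<int>}"
| "bad z i _ = {}"

lemma sum_upd:
  assumes "finite A" "i \<in> A"
  shows "(\<Sum>j\<in>A. (z(i := u)) j) = u + (\<Sum>j\<in>A - {i}. z j :: real)"
  using assms by (subst sum.remove[of _ i]) auto

lemma finite_bad: "finite (bad z i t)"
proof (induction t)
  case (Node a l r)
  let ?A = "leaves (Node a l r)"
  let ?c = "\<Sum>j\<in>?A - {i}. z j"
  have "{u \<in> {0..1}. i \<in> ?A \<and> (\<Sum>j\<in>?A. (z(i := u)) j) \<in> \<int>}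
    \<subseteq> (\<lambda>k. of_int k - ?c) ` {\<lfloor>?c\<rfloor>..\<lfloor>?c + 1\<rfloor>}"
  proof safe
    fix u :: real assume u: "u \<in> {0..1}" "i \<in> ?A" "(\<Sum>j\<in>?A. (z(i := u)) j) \<in> \<int>"
    from u(2) have "(\<Sum>j\<in>?A. (z(i := u)) j) = u + ?c" by (rule sum_upd[OF finite_leaves])
    then obtain k where k: "u + ?c = of_int k" using u(3) by (metis Ints_cases)
    then have "?c \<le> of_int k" "of_int k \<le> ?c + 1" using u(1) by auto
    then have "k \<in> {\<lfloor>?c\<rfloor>..\<lfloor>?c + 1\<rfloor>}" unfolding atLeastAtMost_iff le_floor_iff floor_le_iff by linarith
    then show "u \<in> (\<lambda>k. of_int k - ?c) ` {\<lfloor>?c\<rfloor>..\<lfloor>?c + 1\<rfloor>}" using k by (auto intro!: image_eqI[of _ _ k])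
  qed
  from finite_subset[OF this] have "finite {u \<in> {0..1}. i \<in> ?A \<and> (\<Sum>j\<in>?A. (z(i := u)) j) \<in> \<int>}" by simp
  then show ?case using Node by (simp only: bad.simps finite_Un)
qed simp_all

lemma fr_upd:
  assumes "wf_tree t" "i \<in> leaves t"
  shows "fr lam (z(i := u)) t = fr lam (z(i := v)) t + (u - v)"
  using sum_leaves_eq[OF assms(1), of "z(i := u)" lam] sum_leaves_eq[OF assms(1), of "z(i := v)" lam]
    sum_upd[OF finite_leaves assms(2), of z u] sum_upd[OF finite_leaves assms(2), of z v]
  by linarith

text \<open>Above \<open>i\<close> the carried mass moves with slope 1 in the coordinate. If it left
  [0, 1], it would pass 0 or 1 strictly inside the segment, at a point of \<open>bad\<close>. So the
  labels found at \<open>m\<close> serve the closed segment, ends included.\<close>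

lemma valid_segment:
  assumes "wf_tree t" "0 \<le> p" "p < m" "m < q" "q \<le> 1" "p \<le> u" "u \<le> q"
    and z: "\<And>j. j \<in> leaves t \<Longrightarrow> 0 \<le> z j \<and> z j \<le> 1"
    and nb: "bad z i t \<inter> {p<..<q} = {}"
  shows "valid (mlab (z(i := m))) (z(i := u)) t"
  using assms(1) z nb
proof (induction t)
  case (Node a l r)
  let ?t = "Node a l r" and ?lam = "mlab (z(i := m))"
  have sub: "bad z i l \<inter> {p<..<q} = {}" "bad z i r \<inter> {p<..<q} = {}" using Node.prems(3) by auto
  have wl: "wf_tree l" "wf_tree r" using Node.prems(1) by simp_all
  have zl: "\<And>j. j \<in> leaves l \<Longrightarrow> 0 \<le> z j \<and> z j \<le> 1"
    "\<And>j. j \<in> leaves r \<Longrightarrow> 0 \<le> z j \<and> z j \<le> 1"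
    using Node.prems(2) by simp_all
  have IH: "valid (mlab (z(i := m))) (z(i := u)) l" "valid (mlab (z(i := m))) (z(i := u)) r"
    by (rule Node.IH(1)[OF wl(1) zl(1) sub(1)], assumption)
       (rule Node.IH(2)[OF wl(2) zl(2) sub(2)], assumption)
  have vm: "valid ?lam (z(i := m)) ?t"
  proof (rule valid_mlab)
    fix j assume "j \<in> leaves ?t"
    then show "0 \<le> (z(i := m)) j \<and> (z(i := m)) j \<le> 1" using Node.prems(2)[of j] assms by auto
  qed
  have "0 \<le> fr ?lam (z(i := u)) ?t \<and> fr ?lam (z(i := u)) ?t \<le> 1"
  proof (cases "i \<in> leaves ?t")
    case False
    then have "fr ?lam (z(i := u)) ?t = fr ?lam (z(i := m)) ?t" by (intro fr_cong) (metis fun_upd_other)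
    then show ?thesis using valid_fr[OF vm] by (simp del: fr.simps)
  next
    case True
    let ?F = "\<lambda>v. fr ?lam (z(i := v)) ?t"
    have Fu: "?F v = ?F m + (v - m)" for v by (rule fr_upd[OF Node.prems(1) True])
    have bd: "v \<in> bad z i ?t" if "?F v \<in> {0, 1}" "0 \<le> v" "v \<le> 1" for v
    proof -
      have "?F v \<in> \<int>" using that(1) by (metis Ints_0 Ints_1 insertE singletonD)
      then have "(\<Sum>j\<in>leaves ?t. (z(i := v)) j) \<in> \<int>"
        unfolding sum_leaves_eq[OF Node.prems(1), of "z(i := v)" ?lam] by (intro Ints_add Ints_of_int)
      then show ?thesis unfolding bad.simps using that(2,3) True
        by (intro UnI2 CollectI conjI) (simp_all only: atLeastAtMost_iff simp_thms)
    qed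
    have r: "0 \<le> ?F m" "?F m \<le> 1" using valid_fr[OF vm] by (simp_all del: fr.simps)
    show ?thesis
    proof (rule ccontr)
      assume "\<not> ?thesis"
      then consider "?F u < 0" | "?F u > 1" by linarith
      then show False
      proof cases
        case 1
        define v where "v = m - ?F m"
        have "?F v = 0" unfolding v_def Fu[of "m - ?F m"] by simp
        moreover have v: "v \<le> m" "u < v" using r(1) 1 Fu[of u] unfolding v_def by linarith+
        ultimately have "v \<in> bad z i ?t" using assms by (intro bd) auto
        moreover have "v \<in> {p<..<q}" using v assms by simp
        ultimately show False using Node.prems(3) by blast
      next
        case 2
        define v where "v = m + 1 - ?F m"
        have "?F v = 1" unfolding v_def Fu[of "m + 1 - ?F m"] by simp
        moreover have v: "m \<le> v" "v < u" using r(2) 2 Fu[of u] unfolding v_def by linarith+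
        ultimately have "v \<in> bad z i ?t" using assms by (intro bd) auto
        moreover have "v \<in> {p<..<q}" using v assms by simp
        ultimately show False using Node.prems(3) by blast
      qed
    qed
  qed
  then show ?case using IH by (simp only: valid.simps)
next
  case (Leaf j)
  then have "0 \<le> z j" "z j \<le> 1" by simp_all
  then show ?case using assms(2,5,6,7) by simp
qed simp

text \<open>Induction on the number of break points strictly inside the interval: cutting at one of
  them leaves fewer on either side.\<close>

lemma subdivide:
  fixes D :: "real \<Rightarrow> real \<Rightarrow> real"
  assumes fin: "finite B"
    and tri: "\<And>p q r. 0 \<le> p \<Longrightarrow> p \<le> q \<Longrightarrow> q \<le> r \<Longrightarrow> r \<le> 1 \<Longrightarrow> D p r \<le> D p q + D q r"
    and base: "\<And>p q. 0 \<le> p \<Longrightarrow> p < q \<Longrightarrow> q \<le> 1 \<Longrightarrow> B \<inter> {p<..<q} = {} \<Longrightarrow> D p q \<le> L * (q - p)"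
  shows "0 \<le> p \<Longrightarrow> p < q \<Longrightarrow> q \<le> 1 \<Longrightarrow> D p q \<le> L * (q - p)"
proof (induction "card (B \<inter> {p<..<q})" arbitrary: p q rule: less_induct)
  case less
  show ?case
  proof (cases "B \<inter> {p<..<q} = {}")
    case True
    then show ?thesis using base less.prems by auto
  next
    case False
    then obtain v where v: "v \<in> B" "p < v" "v < q" by auto
    have "card (B \<inter> {p<..<v}) < card (B \<inter> {p<..<q})"
      using v fin by (intro psubset_card_mono) auto
    then have 1: "D p v \<le> L * (v - p)" using less v by auto
    have "card (B \<inter> {v<..<q}) < card (B \<inter> {p<..<q})"
      using v fin by (intro psubset_card_mono) auto
    then have 2: "D v q \<le> L * (q - v)" using less v by auto
    show ?thesis using tri[of p v q] 1 2 less.prems v by (auto simp: algebra_simps)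
  qed
qed

lemma finite_final [simp]: "finite (final lam z a t \<omega>)"
  by (simp add: final_def)

lemma integral_sdc_triangle:
  assumes "SF A" "SF B" "SF C" "\<And>\<omega>. finite (A \<omega>)" "\<And>\<omega>. finite (B \<omega>)" "\<And>\<omega>. finite (C \<omega>)"
  shows "(\<integral>\<omega>. sdc (A \<omega>) (C \<omega>) \<partial>seed_space) \<le> (\<integral>\<omega>. sdc (A \<omega>) (B \<omega>) \<partial>seed_space) + (\<integral>\<omega>. sdc (B \<omega>) (C \<omega>) \<partial>seed_space)"
proof -
  have S: "SF (\<lambda>\<omega>. sdc (A \<omega>) (B \<omega>))" "SF (\<lambda>\<omega>. sdc (B \<omega>) (C \<omega>))" "SF (\<lambda>\<omega>. sdc (A \<omega>) (C \<omega>))"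
    by (intro SF_comp2[where k=sdc] assms)+
  have "(\<integral>\<omega>. sdc (A \<omega>) (C \<omega>) \<partial>seed_space) \<le> (\<integral>\<omega>. sdc (A \<omega>) (B \<omega>) + sdc (B \<omega>) (C \<omega>) \<partial>seed_space)"
    by (intro integral_mono SF_integrable S Bochner_Integration.integrable_add sdc_triangle assms)
  also have "\<dots> = (\<integral>\<omega>. sdc (A \<omega>) (B \<omega>) \<partial>seed_space) + (\<integral>\<omega>. sdc (B \<omega>) (C \<omega>) \<partial>seed_space)"
    by (intro Bochner_Integration.integral_add SF_integrable S)
  finally show ?thesis .
qed

text \<open>On a segment free of break points the labels of its midpoint are valid at both ends,
  where they may replace the proper ones by \<open>final_label\<close>. The segments are then joined
  by \<open>subdivide\<close>.\<close>

lemma rounding_single: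
  assumes t: "wf_tree t" "a \<notin> addrs t" "i \<in> leaves t"
    and z: "\<And>j. j \<in> leaves t \<Longrightarrow> 0 \<le> z j \<and> z j \<le> 1"
    and S: "\<And>j. j \<in> leaves t \<Longrightarrow> j \<noteq> i \<Longrightarrow> j \<notin> S \<Longrightarrow> z j = 0"
    and u: "0 \<le> p" "p \<le> 1" "0 \<le> q" "q \<le> 1"
  shows "(\<integral>\<omega>. sdc (rounding (z(i := p)) a t \<omega>) (rounding (z(i := q)) a t \<omega>) \<partial>seed_space)
     \<le> \<bar>p - q\<bar> * (3 + 2 * real (cnt S t i))"
proof -
  define D where "D = (\<lambda>p q. (\<integral>\<omega>. sdc (rounding (z(i := p)) a t \<omega>) (rounding (z(i := q)) a t \<omega>) \<partial>seed_space))"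
  let ?L = "3 + 2 * real (cnt S t i)"
  have val: "valid (mlab (z(i := p))) (z(i := p)) t" if "0 \<le> p" "p \<le> 1" for p
    using z that by (intro valid_mlab) auto
  have lt: "D p q \<le> ?L * (q - p)" if "0 \<le> p" "p < q" "q \<le> 1" for p q
  proof (rule subdivide[OF finite_bad _ _ that])
    fix p q r :: real assume "0 \<le> p" "p \<le> q" "q \<le> r" "r \<le> 1"
    then show "D p r \<le> D p q + D q r"
      unfolding D_def by (intro integral_sdc_triangle SF_final val) auto
  next
    fix p q :: real assume pq: "0 \<le> p" "p < q" "q \<le> 1" "bad z i t \<inter> {p<..<q} = {}"
    define m where "m = (p + q) / 2"
    let ?lam = "mlab (z(i := m))"
    have v: "valid ?lam (z(i := p)) t" "valid ?lam (z(i := q)) t"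
      using pq by (intro valid_segment[of t p m q] t z; auto simp: m_def)+
    have "D p q = (\<integral>\<omega>. sdc (final ?lam (z(i := p)) a t \<omega>) (final ?lam (z(i := q)) a t \<omega>) \<partial>seed_space)"
      unfolding D_def
      by (intro Bochner_Integration.integral_cong refl arg_cong2[of _ _ _ _ sdc]
           final_label[OF t(1) val v(1)] final_label[OF t(1) val v(2)]) (use pq in auto)
    also have "\<dots> \<le> (q - p) * ?L"
      using pq S by (intro final_close t v) auto
    finally show "D p q \<le> ?L * (q - p)" by (simp add: mult.commute)
  qed
  have sym: "D p q = D q p" unfolding D_def by (simp add: sdc_commute)
  have "D p q \<le> \<bar>p - q\<bar> * ?L"
  proof (cases p q rule: linorder_cases)
    case less
    then show ?thesis using lt[of p q] u by (simp add: mult.commute)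
  next
    case equal
    then show ?thesis by (simp add: D_def)
  next
    case greater
    then show ?thesis using lt[of q p] u sym by (simp add: mult.commute)
  qed
  then show ?thesis by (simp add: D_def)
qed

lemma rounding_cong:
  assumes "wf_tree t" "\<And>j. j \<in> leaves t \<Longrightarrow> z j = z' j" "\<And>j. j \<in> leaves t \<Longrightarrow> 0 \<le> z j \<and> z j \<le> 1"
    "\<omega> \<in> space seed_space"
  shows "rounding z a t \<omega> = rounding z' a t \<omega>"
proof -
  have val: "valid lam z t = valid lam z' t" for lam using assms(2)
  proof (induction t)
    case (Node a l r)
    then have "fr lam z (Node a l r) = fr lam z' (Node a l r)" by (intro fr_cong) auto
    then show ?case using Node by (simp del: fr.simps)
  qed auto
  have "rounding z' a t \<omega> = final (mlab z) z' a t \<omega>"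
  proof (rule final_label[OF assms(1) _ _ assms(4)])
    show "valid (mlab z') z' t" using assms by (intro valid_mlab) auto
    have "valid (mlab z) z t" using assms by (intro valid_mlab) auto
    then show "valid (mlab z) z' t" using val by simp
  qed
  also have "\<dots> = rounding z a t \<omega>"
    using sel_cong[of t z z'] fr_cong[of t z z'] assms(2) by (simp add: final_def)
  finally show ?thesis ..
qed

text \<open>Interpolate between \<open>z\<close> and \<open>z'\<close> one coordinate at a time.\<close>

lemma rounding_lipschitz:
  assumes t: "wf_tree t" "a \<notin> addrs t"
    and z: "\<And>j. j \<in> leaves t \<Longrightarrow> 0 \<le> z j \<and> z j \<le> 1" "\<And>j. j \<in> leaves t \<Longrightarrow> 0 \<le> z' j \<and> z' j \<le> 1"
    and S: "\<And>j. j \<in> leaves t \<Longrightarrow> j \<notin> S \<Longrightarrow> z j = 0 \<and> z' j = 0"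
    and L: "\<And>j. j \<in> leaves t \<Longrightarrow> z j \<noteq> z' j \<Longrightarrow> real (cnt S t j) \<le> L" and L0: "0 \<le> L"
  shows "(\<integral>\<omega>. sdc (rounding z a t \<omega>) (rounding z' a t \<omega>) \<partial>seed_space)
     \<le> (\<Sum>j\<in>leaves t. \<bar>z j - z' j\<bar>) * (3 + 2 * L)"
proof -
  define D where "D = (\<lambda>z z'. (\<integral>\<omega>. sdc (rounding z a t \<omega>) (rounding z' a t \<omega>) \<partial>seed_space))"
  define mix where "mix = (\<lambda>I j. if j \<in> I then z' j else z j)"
  have mixr: "0 \<le> mix I j \<and> mix I j \<le> 1" if "j \<in> leaves t" for I j
    using z that by (simp add: mix_def)
  have val: "valid (mlab (mix I)) (mix I) t" for I
    using mixr by (intro valid_mlab) auto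
  have "D (mix {}) (mix I) \<le> (\<Sum>j\<in>I. \<bar>z j - z' j\<bar>) * (3 + 2 * L)" if "finite I" "I \<subseteq> leaves t" for I
    using that
  proof (induction I)
    case empty
    then show ?case by (simp add: D_def)
  next
    case (insert i I)
    have "D (mix I) (mix (insert i I)) \<le> \<bar>z i - z' i\<bar> * (3 + 2 * L)"
    proof (cases "z i = z' i")
      case True
      then have "mix I = mix (insert i I)" by (auto simp: mix_def)
      then show ?thesis using L0 by (simp add: D_def)
    next
      case False
      have m: "mix I = (mix I)(i := z i)" "mix (insert i I) = (mix I)(i := z' i)"
        using insert by (auto simp: mix_def)
      have "D ((mix I)(i := z i)) ((mix I)(i := z' i)) \<le> \<bar>z i - z' i\<bar> * (3 + 2 * real (cnt S t i))"
        unfolding D_def using insert z S by (intro rounding_single t mixr) (auto simp: mix_def)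
      also have "\<dots> \<le> \<bar>z i - z' i\<bar> * (3 + 2 * L)"
        using L[of i] False insert by (intro mult_left_mono) auto
      finally show ?thesis using m by simp
    qed
    moreover have "D (mix {}) (mix (insert i I)) \<le> D (mix {}) (mix I) + D (mix I) (mix (insert i I))"
      unfolding D_def by (intro integral_sdc_triangle SF_final val) auto
    ultimately show ?case using insert by (simp add: algebra_simps)
  qed
  from this[of "leaves t"] have "D (mix {}) (mix (leaves t)) \<le> (\<Sum>j\<in>leaves t. \<bar>z j - z' j\<bar>) * (3 + 2 * L)"
    by simp
  also have "D (mix {}) (mix (leaves t)) = D z z'"
    unfolding D_def
    by (intro Bochner_Integration.integral_cong refl arg_cong2[of _ _ _ _ sdc]
        rounding_cong[OF t(1)]) (use z in \<open>auto simp: mix_def\<close>)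
  finally show ?thesis by (simp add: D_def)
qed

section \<open>Cardinality and marginals of the rounded set\<close>

text \<open>The counts of the children add up to \<open>N\<close>, and at a leaf a count near its
  mass is 0 or 1.\<close>

lemma card_selN:
  assumes "wf_tree t" "valid lam z t" "\<omega> \<in> space seed_space" "near N (\<Sum>i\<in>leaves t. z i)"
  shows "int (card (selN lam z \<omega> t N)) = N"
  using assms
proof (induction t arbitrary: N)
  case Tip
  then show ?case using near_int[of N 0] by (simp add: selN_def)
next
  case (Leaf i)
  then have "N = of_bool (0 < N)" using near_bits(1)[of lam z "Leaf i" N] by simp
  then show ?case by (auto simp: selN_def split: if_splits)
next
  case (Node a l r)
  let ?t = "Node a l r"
  have om: "0 \<le> \<omega> a" "\<omega> a < 1" using Node.prems seed_bounds by auto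
  have w: "wf_tree l" "wf_tree r" "leaves l \<inter> leaves r = {}" using Node.prems by auto
  have v: "valid lam z l" "valid lam z r" using Node.prems by auto
  obtain N1 N2 where c: "childN lam z \<omega> a l r N = (N1, N2)" by (cases "childN lam z \<omega> a l r N")
  have nN: "near N (fr lam z ?t + of_int (highs lam ?t))"
    using Node.prems(4) sum_leaves_eq[OF Node.prems(1), of z lam] by (simp del: fr.simps highs.simps leaves.simps)
  note cn = childN_near[OF Node.prems(2) om nN c]
  have "int (card (selN lam z \<omega> l N1)) = N1" "int (card (selN lam z \<omega> r N2)) = N2"
    using Node.IH(1)[OF w(1) v(1) Node.prems(3), of N1] Node.IH(2)[OF w(2) v(2) Node.prems(3), of N2] cn
      sum_leaves_eq[OF w(1), of z lam] sum_leaves_eq[OF w(2), of z lam] by auto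
  moreover have "selN lam z \<omega> l N1 \<inter> selN lam z \<omega> r N2 = {}"
    using w(3) sel_subset unfolding selN_def by blast
  ultimately show ?case unfolding selN_Node c using cn(1)
    by (simp add: card_Un_disjoint selN_def)
qed

lemma near_floor_ceiling:
  assumes "near N s"
  shows "N \<in> {\<lfloor>s\<rfloor>, \<lceil>s\<rceil>}"
proof (cases "of_int N \<le> s")
  case True
  then have "\<lfloor>s\<rfloor> = N" using assms by (intro floor_unique) (auto simp: near_def)
  then show ?thesis by simp
next
  case False
  then have "\<lceil>s\<rceil> = N" using assms by (intro ceiling_unique) (auto simp: near_def)
  then show ?thesis by simp
qed

lemma card_rounding:
  assumes t: "wf_tree t" and z: "\<And>j. j \<in> leaves t \<Longrightarrow> 0 \<le> z j \<and> z j \<le> 1" and om: "\<omega> \<in> space seed_space"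
  shows "int (card (rounding z a t \<omega>)) \<in> {\<lfloor>\<Sum>i\<in>leaves t. z i\<rfloor>, \<lceil>\<Sum>i\<in>leaves t. z i\<rceil>}"
proof -
  let ?N = "highs (mlab z) t + of_bool (\<omega> a < fr (mlab z) z t)"
  have v: "valid (mlab z) z t" using z by (rule valid_mlab)
  have nr: "near ?N (\<Sum>i\<in>leaves t. z i)"
    using valid_fr[OF v] seed_bounds[OF om, of a] sum_leaves_eq[OF t, of z "mlab z"] by (auto simp: near_def)
  have "rounding z a t \<omega> = selN (mlab z) z \<omega> t ?N"
    by (simp add: final_def selN_def)
  then show ?thesis using card_selN[OF t v om nr] near_floor_ceiling[OF nr] by simp
qed

lemma rounding_subset: "rounding z a t \<omega> \<subseteq> leaves t"
  by (simp add: final_def sel_subset)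

lemma integral_if_less:
  assumes A: "SF (A :: _ \<Rightarrow> real)" "indep_of A a" and B: "SF B" "indep_of B a"
    and p: "0 \<le> p" "p \<le> 1"
  shows "(\<integral>\<omega>. (if \<omega> a < p then A \<omega> else B \<omega>) \<partial>seed_space)
    = p * (\<integral>\<omega>. A \<omega> \<partial>seed_space) + (1 - p) * (\<integral>\<omega>. B \<omega> \<partial>seed_space)"
proof -
  let ?I = "\<lambda>\<omega>. of_bool (\<omega> a < p) :: real"
  have SI: "SF ?I" by (intro SF_comp[where g=of_bool] SF_less_const)
  have S1: "SF (\<lambda>\<omega>. ?I \<omega> * A \<omega>)" "SF (\<lambda>\<omega>. ?I \<omega> * B \<omega>)"
    by (intro SF_comp2[where k="(*)"] SI A B)+
  have "(\<integral>\<omega>. (if \<omega> a < p then A \<omega> else B \<omega>) \<partial>seed_space)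
     = (\<integral>\<omega>. ?I \<omega> * A \<omega> + (B \<omega> - ?I \<omega> * B \<omega>) \<partial>seed_space)"
    by (intro Bochner_Integration.integral_cong) auto
  also have "\<dots> = (\<integral>\<omega>. ?I \<omega> * A \<omega> \<partial>seed_space) + ((\<integral>\<omega>. B \<omega> \<partial>seed_space) - (\<integral>\<omega>. ?I \<omega> * B \<omega> \<partial>seed_space))"
    by (subst Bochner_Integration.integral_add Bochner_Integration.integral_diff;
        (intro SF_integrable SF_comp2[where k="(-)"] S1 B)?)+ simp
  finally show ?thesis
    unfolding integral_less_mult[OF A p] integral_less_mult[OF B p] by (simp add: left_diff_distrib)
qed

text \<open>The same potential as in \<open>psi_bound\<close>, now for the event that
  \<open>i\<close> is selected; it passes through every node without loss.\<close>

lemma rounding_marginal: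
  assumes t: "wf_tree t" "a \<notin> addrs t" and i: "i \<in> leaves t"
    and z: "\<And>j. j \<in> leaves t \<Longrightarrow> 0 \<le> z j \<and> z j \<le> 1"
  shows "(\<integral>\<omega>. of_bool (i \<in> rounding z a t \<omega>) \<partial>seed_space) = z i"
proof -
  define lam where "lam = mlab z"
  define X where "X = (\<lambda>t b \<omega>. of_bool (i \<in> sel lam z \<omega> t b) :: real)"
  have v: "valid lam z t" unfolding lam_def using z by (rule valid_mlab)
  have SX: "SF (X t b)" if "valid lam z t" for t b
    unfolding X_def by (intro SF_comp[where g="\<lambda>A. of_bool (i \<in> A)"] SF_sel that)
  have iX: "indep_of (X t b) a" if "a \<notin> addrs t" for t b a
    using that by (simp add: indep_of_def X_def sel_upd)
  have main: "fr lam z t * (\<integral>\<omega>. X t True \<omega> \<partial>seed_space) + (1 - fr lam z t) * (\<integral>\<omega>. X t False \<omega> \<partial>seed_space) = z i"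
    using t(1) v i
  proof (induction t)
    case (Leaf j)
    then show ?case by (simp add: X_def seed.prob_space)
  next
    case (Node a l r)
    let ?t = "Node a l r"
    let ?b = "lam ?t"
    define f g where defs: "f = fr lam z l" "g = fr lam z r"
    have v: "valid lam z l" "valid lam z r" using Node.prems by auto
    have w: "wf_tree l" "wf_tree r" and al: "a \<notin> addrs l" "a \<notin> addrs r" and disj: "leaves l \<inter> leaves r = {}"
      using Node.prems by auto
    have rng: "0 \<le> f" "f \<le> 1" "0 \<le> g" "g \<le> 1" unfolding defs using v valid_fr by auto
    have frt: "fr lam z ?t = f + g - of_bool ?b" by (simp add: defs)
    define p where "p = thr ?b f g"
    have p: "0 \<le> p" "p \<le> 1" unfolding p_def using rng thr_range by auto
    have lw: "left_wins ?b f g (\<omega> a) \<longleftrightarrow> \<omega> a < p" if "\<omega> \<in> space seed_space" for \<omega>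
      unfolding p_def using rng seed_bounds(1)[OF that] by (intro left_wins_thr; simp)
    have wp: "wgt ?b f g * p = (if ?b then 1 - g else f)"
      unfolding p_def using rng by (intro wgt_thr)
    define E where "E = (\<lambda>t b. (\<integral>\<omega>. X t b \<omega> \<partial>seed_space))"
    show ?case
    proof (cases "i \<in> leaves l")
      case True
      then have ir: "i \<notin> sel lam z \<omega> r b" for \<omega> b using disj sel_subset by blast
      have same: "E ?t ?b = E l ?b" unfolding E_def by (simp add: X_def ir)
      have mixed: "E ?t (\<not> ?b) = p * E l True + (1 - p) * E l False"
        unfolding E_def
        by (subst integral_if_less[symmetric, OF SX[OF v(1)] iX[OF al(1)] SX[OF v(1)] iX[OF al(1)] p],
            intro Bochner_Integration.integral_cong refl) (use lw ir in \<open>auto simp: X_def defs\<close>)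
      have IH: "f * E l True + (1 - f) * E l False = z i"
        using Node.IH(1)[OF w(1) v(1) True] by (simp add: defs E_def)
      have "wgt ?b f g * E ?t (\<not> ?b) = (wgt ?b f g * p) * E l True + (wgt ?b f g - wgt ?b f g * p) * E l False"
        unfolding mixed by (simp add: algebra_simps)
      then have "wgt ?b f g * E ?t (\<not> ?b) + (1 - wgt ?b f g) * E ?t ?b = z i"
        unfolding wp same IH[symmetric] by (cases ?b) (simp_all add: wgt_def algebra_simps)
      then have "fr lam z ?t * E ?t True + (1 - fr lam z ?t) * E ?t False = z i"
        unfolding frt by (cases ?b) (simp_all add: wgt_def algebra_simps)
      then show ?thesis unfolding E_def .
    next
      case False
      then have r: "i \<in> leaves r" using Node.prems by auto
      have il: "i \<notin> sel lam z \<omega> l b" for \<omega> b using False sel_subset by blast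
      have same: "E ?t ?b = E r ?b" unfolding E_def by (simp add: X_def il)
      have mixed: "E ?t (\<not> ?b) = p * E r False + (1 - p) * E r True"
        unfolding E_def
        by (subst integral_if_less[symmetric, OF SX[OF v(2)] iX[OF al(2)] SX[OF v(2)] iX[OF al(2)] p],
            intro Bochner_Integration.integral_cong refl) (use lw il in \<open>auto simp: X_def defs\<close>)
      have IH: "g * E r True + (1 - g) * E r False = z i"
        using Node.IH(2)[OF w(2) v(2) r] by (simp add: defs E_def)
      have "wgt ?b f g * E ?t (\<not> ?b) = (wgt ?b f g * p) * E r False + (wgt ?b f g - wgt ?b f g * p) * E r True"
        unfolding mixed by (simp add: algebra_simps)
      then have "wgt ?b f g * E ?t (\<not> ?b) + (1 - wgt ?b f g) * E ?t ?b = z i"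
        unfolding wp same IH[symmetric] by (cases ?b) (simp_all add: wgt_def algebra_simps)
      then have "fr lam z ?t * E ?t True + (1 - fr lam z ?t) * E ?t False = z i"
        unfolding frt by (cases ?b) (simp_all add: wgt_def algebra_simps)
      then show ?thesis unfolding E_def .
    qed
  qed simp
  have "(\<integral>\<omega>. of_bool (i \<in> rounding z a t \<omega>) \<partial>seed_space)
     = (\<integral>\<omega>. (if \<omega> a < fr lam z t then X t True \<omega> else X t False \<omega>) \<partial>seed_space)"
    by (intro Bochner_Integration.integral_cong) (auto simp: X_def final_def lam_def)
  also have "\<dots> = z i"
    using valid_fr[OF v] main t(2) by (subst integral_if_less) (auto intro: SX v iX)
  finally show ?thesis .
qed

section \<open>Reservoir sampling in passes\<close>

text \<open>Weighted reservoir sampling. The state is the mass read so far and the item held; an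
  entry consists of seed address, item and mass, and displaces the held item with probability q / (S
  + q).\<close>

definition res_step :: "(nat \<Rightarrow> real) \<Rightarrow> real \<times> nat \<Rightarrow> nat \<times> nat \<times> real \<Rightarrow> real \<times> nat" where
  "res_step \<omega> = (\<lambda>(S, X) (a, i, q). (S + q, if \<omega> a * (S + q) < q then i else X))"

definition res :: "(nat \<Rightarrow> real) \<Rightarrow> (nat \<times> nat \<times> real) list \<Rightarrow> real \<times> nat" where
  "res \<omega> es = foldl (res_step \<omega>) (0, 0) es"

definition total :: "(nat \<times> nat \<times> real) list \<Rightarrow> real" where
  "total es = (\<Sum>e\<leftarrow>es. snd (snd e))"

definition token :: "(nat \<Rightarrow> real) \<Rightarrow> (nat \<times> nat \<times> real) list \<Rightarrow> nat" where
  "token \<omega> es = snd (res \<omega> es)"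

lemma fst_res: "fst (res \<omega> es) = total es"
  by (induction es rule: rev_induct) (auto simp: res_def total_def res_step_def split: prod.splits)

lemma token_Nil [simp]: "token \<omega> [] = 0" by (simp add: token_def res_def)

lemma token_snoc: "token \<omega> (es @ [(a, i, q)]) = (if \<omega> a * (total es + q) < q then i else token \<omega> es)"
  using fst_res[of \<omega> es] by (auto simp: token_def res_def res_step_def split: prod.splits)

lemma total_snoc [simp]: "total (es @ [(a, i, q)]) = total es + q" by (simp add: total_def)

lemma total_Nil [simp]: "total [] = 0" by (simp add: total_def)

lemma total_nonneg: "\<forall>e\<in>set es. 0 \<le> snd (snd e) \<Longrightarrow> 0 \<le> total es"
  by (auto simp: total_def intro!: sum_list_nonneg)

lemma accept_iff:
  assumes "0 \<le> (S::real)" "0 \<le> q" "0 \<le> u"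
  shows "u * (S + q) < q \<longleftrightarrow> u < q / (S + q)"
proof (cases "S + q = 0")
  case True then show ?thesis using assms by auto
next
  case False
  then show ?thesis using assms by (simp add: pos_less_divide_eq)
qed

lemma token_upd: "a \<notin> fst ` set es \<Longrightarrow> token (fun_upd \<omega> a v) es = token \<omega> es"
proof (induction es rule: rev_induct)
  case (snoc e es)
  then show ?case by (cases e) (auto simp: token_snoc)
qed simp

lemma SF_token:
  assumes "\<forall>e\<in>set es. 0 \<le> snd (snd e)"
  shows "SF (\<lambda>\<omega>. token \<omega> es)"
  using assms
proof (induction es rule: rev_induct)
  case (snoc e es)
  obtain a i q where e: "e = (a, i, q)" by (cases e)
  have pos: "0 \<le> q" "0 \<le> total es" using snoc.prems e total_nonneg by auto
  have "SF (\<lambda>\<omega>. if \<omega> a < q / (total es + q) then i else token \<omega> es)"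
    using snoc by (intro SF_if SF_less_const) auto
  then show ?case unfolding e
    by (rule simple_function_cong[THEN iffD1, rotated])
      (auto simp: token_snoc accept_iff[OF pos(2) pos(1) seed_bounds(1)])
qed simp

text \<open>Multiplied by the total, so that the recursion is linear and an empty list is no
  exception.\<close>

lemma token_marginal:
  assumes "\<forall>e\<in>set es. 0 \<le> snd (snd e)" "distinct (map fst es)"
  shows "total es * (\<integral>\<omega>. of_bool (token \<omega> es = i) \<partial>seed_space)
     = (\<Sum>(a, j, q)\<leftarrow>es. if j = i then q else 0)"
  using assms
proof (induction es rule: rev_induct)
  case (snoc e es)
  obtain a j q where e: "e = (a, j, q)" by (cases e)
  have pos: "0 \<le> q" "0 \<le> total es" using snoc.prems e total_nonneg by auto
  have "(\<integral>\<omega>. of_bool (token \<omega> (es @ [e]) = i) \<partial>seed_space)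
     = (\<integral>\<omega>. (if \<omega> a < q / (total es + q) then of_bool (j = i) else of_bool (token \<omega> es = i)) \<partial>seed_space :: real)"
    unfolding e by (intro Bochner_Integration.integral_cong refl)
      (auto simp: token_snoc accept_iff[OF pos(2) pos(1) seed_bounds(1)])
  also have "\<dots> = q / (total es + q) * of_bool (j = i)
      + (1 - q / (total es + q)) * (\<integral>\<omega>. of_bool (token \<omega> es = i) \<partial>seed_space)"
    using snoc.prems e pos
    by (subst integral_if_less)
      (auto intro!: SF_comp[where g="\<lambda>x. of_bool (x = i)"] SF_token
        simp: indep_of_def token_upd divide_le_eq_1 seed.prob_space)
  also have "(total es + q) * \<dots> = q * of_bool (j = i) + total es * (\<integral>\<omega>. of_bool (token \<omega> es = i) \<partial>seed_space)"
  proof -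
    have s: "(total es + q) * (q / (total es + q)) = q" using pos by auto
    have "(T + q) * (p * b + (1 - p) * P) = ((T + q) * p) * b + (T + q - (T + q) * p) * P" for T p b P :: real
      by (simp add: algebra_simps)
    then show ?thesis by (simp only: s) simp
  qed
  also have "total es * (\<integral>\<omega>. of_bool (token \<omega> es = i) \<partial>seed_space)
     = (\<Sum>(a, j, q)\<leftarrow>es. if j = i then q else 0)" using snoc by auto
  finally show ?case unfolding e by simp
qed simp

lemma token_in:
  assumes "\<forall>e\<in>set es. 0 \<le> snd (snd e)" "0 < total es" "\<omega> \<in> space seed_space"
  shows "\<exists>a q. (a, token \<omega> es, q) \<in> set es \<and> 0 < q"
  using assms
proof (induction es rule: rev_induct)
  case (snoc e es)
  obtain a j q where e: "e = (a, j, q)" by (cases e)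
  have pos: "0 \<le> q" "0 \<le> total es" using snoc.prems e total_nonneg by auto
  have om: "0 \<le> \<omega> a" "\<omega> a < 1" using snoc.prems seed_bounds by auto
  show ?case
  proof (cases "\<omega> a * (total es + q) < q")
    case True
    moreover have "0 \<le> \<omega> a * (total es + q)" using om pos by simp
    ultimately have "0 < q" by linarith
    then show ?thesis unfolding e using True by (auto simp: token_snoc intro!: exI[of _ a] exI[of _ q])
  next
    case False
    then have "total es > 0" using om pos snoc.prems(2) e by (cases "total es = 0") auto
    then show ?thesis using snoc False e by (fastforce simp: token_snoc)
  qed
qed simp

text \<open>Two reservoirs read the same coins. The quantity total times probability of disagreement
  is unchanged by a step with equal thresholds; a step with differing thresholds adds the increase
  of the entry and the accumulated increase times the acceptance probability. Summed over a stretch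
  of entries, these probabilities behave like a logarithm of the growth.\<close>

lemma token_coupling:
  assumes "\<forall>(a, i, q, q')\<in>set ts. 0 \<le> q \<and> q \<le> q'" "distinct (map fst ts)"
    and "es = map (\<lambda>(a, i, q, q'). (a, i, q)) ts" "es' = map (\<lambda>(a, i, q, q'). (a, i, q')) ts"
  shows "total es' * (\<integral>\<omega>. of_bool (token \<omega> es \<noteq> token \<omega> es') \<partial>seed_space)
    \<le> (\<Sum>(a, i, q, q')\<leftarrow>ts. q' - q) + (\<Sum>k<length ts.
       (total (take (Suc k) es') - total (take (Suc k) es)) * (snd (snd (es ! k)) / total (take (Suc k) es)))
     \<and> total es \<le> total es'"
  using assms
proof (induction ts arbitrary: es es' rule: rev_induct)
  case (snoc t ts)
  obtain a i q q' where t: "t = (a, i, q, q')" by (cases t)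
  define fs fs' where fs: "fs = map (\<lambda>(a, i, q, q'). (a, i, q)) ts" "fs' = map (\<lambda>(a, i, q, q'). (a, i, q')) ts"
  have es: "es = fs @ [(a, i, q)]" "es' = fs' @ [(a, i, q')]" using snoc.prems(3,4) t fs by auto
  have nn: "\<forall>e\<in>set fs. 0 \<le> snd (snd e)" "\<forall>e\<in>set fs'. 0 \<le> snd (snd e)"
    using snoc.prems(1) by (auto simp: fs; force)+
  have q: "0 \<le> q" "q \<le> q'" using snoc.prems(1) t by auto
  have a: "a \<notin> fst ` set fs" "a \<notin> fst ` set fs'" using snoc.prems(2) t by (auto simp: fs image_iff)
  define H where "H = (\<lambda>es es'. \<Sum>k<length es.
    (total (take (Suc k) es') - total (take (Suc k) es)) * (snd (snd (es ! k)) / total (take (Suc k) es)))"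
  define P where "P = (\<integral>\<omega>. of_bool (token \<omega> fs \<noteq> token \<omega> fs') \<partial>seed_space :: real)"
  let ?R = "\<Sum>(a, i, q, q')\<leftarrow>ts. q' - q"
  have len: "length fs = length ts" "length fs' = length ts" by (simp_all add: fs)
  have IH: "total fs' * P \<le> ?R + H fs fs'" "total fs \<le> total fs'"
    using snoc.IH[OF _ _ fs] snoc.prems(1,2) len by (auto simp: H_def P_def)
  have T: "0 \<le> total fs" "0 \<le> total fs'" using nn total_nonneg by auto
  define p p' where p: "p = q / (total fs + q)" "p' = q' / (total fs' + q')"
  have pr: "0 \<le> p" "p \<le> 1" "0 \<le> p'" "p' \<le> 1" using q T unfolding p by (auto simp: divide_le_eq_1)
  have acc: "\<omega> a * (total fs + q) < q \<longleftrightarrow> \<omega> a < p" "\<omega> a * (total fs' + q') < q' \<longleftrightarrow> \<omega> a < p'"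
    if "\<omega> \<in> space seed_space" for \<omega>
    using accept_iff[OF T(1) q(1) seed_bounds(1)[OF that]] accept_iff[OF T(2) _ seed_bounds(1)[OF that]] q
    unfolding p by auto
  let ?Y = "\<lambda>\<omega>. of_bool (token \<omega> fs \<noteq> token \<omega> fs') :: real"
  have SY: "SF ?Y" using nn
    by (intro SF_comp2[where k="\<lambda>x y. of_bool (x \<noteq> y)"] SF_token) auto
  have iY: "indep_of ?Y a" unfolding indep_of_def token_upd[OF a(1)] token_upd[OF a(2)] by simp
  have "(\<integral>\<omega>. of_bool (token \<omega> es \<noteq> token \<omega> es') \<partial>seed_space)
    \<le> (\<integral>\<omega>. (if \<omega> a < p' then 0 else ?Y \<omega>) + (of_bool (\<omega> a < max p p') - of_bool (\<omega> a < min p p')) \<partial>seed_space)"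
  proof (intro integral_mono SF_integrable)
    have "SF (\<lambda>\<omega>. token \<omega> es)" "SF (\<lambda>\<omega>. token \<omega> es')"
      using nn q unfolding es by (auto intro!: SF_token)
    then show "SF (\<lambda>\<omega>. of_bool (token \<omega> es \<noteq> token \<omega> es') :: real)"
      by (rule SF_comp2[where k="\<lambda>x y. of_bool (x \<noteq> y)"])
    show "SF (\<lambda>\<omega>. (if \<omega> a < p' then 0 else ?Y \<omega>) + (of_bool (\<omega> a < max p p') - of_bool (\<omega> a < min p p')))"
      by (intro SF_comp2[where k="(+)"] SF_comp2[where k="(-)"] SF_if SF_less_const SF_comp[where g=of_bool] SY simple_function_const)
    fix \<omega> assume om: "\<omega> \<in> space seed_space"
    show "of_bool (token \<omega> es \<noteq> token \<omega> es') \<le> (if \<omega> a < p' then 0 else ?Y \<omega>)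
       + (of_bool (\<omega> a < max p p') - of_bool (\<omega> a < min p p'))"
      unfolding es token_snoc acc[OF om] by (auto simp: max_def min_def)
  qed
  also have "\<dots> = (1 - p') * P + \<bar>p - p'\<bar>"
  proof -
    have I: "(\<integral>\<omega>. of_bool (\<omega> a < c) \<partial>seed_space) = c" if "0 \<le> c" "c \<le> 1" for c
      using integral_less_mult[of "\<lambda>_. 1" a c] that by (simp add: indep_of_def seed.prob_space)
    have SI: "SF (\<lambda>\<omega>. of_bool (\<omega> a < c) :: real)" for c :: real
      by (intro SF_comp[where g=of_bool] SF_less_const)
    have "(\<integral>\<omega>. (if \<omega> a < p' then 0 else ?Y \<omega>) \<partial>seed_space) = p' * (\<integral>\<omega>. 0 \<partial>seed_space) + (1 - p') * (\<integral>\<omega>. ?Y \<omega> \<partial>seed_space)"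
      by (rule integral_if_less[OF simple_function_const _ SY iY pr(3,4)]) (simp add: indep_of_def)
    moreover have "(\<integral>\<omega>. (of_bool (\<omega> a < max p p') - of_bool (\<omega> a < min p p')) \<partial>seed_space) = max p p' - min p p'"
      using pr by (subst Bochner_Integration.integral_diff)
        (auto intro!: SF_integrable SI simp: I simp del: less_max_iff_disj min_less_iff_conj)
    moreover have "max p p' - min p p' = \<bar>p - p'\<bar>" by (simp add: max_def min_def)
    moreover have S1: "SF (\<lambda>\<omega>. if \<omega> a < p' then 0 else ?Y \<omega>)"
      by (intro SF_if SF_less_const SY simple_function_const)
    moreover have S2: "SF (\<lambda>\<omega>. of_bool (\<omega> a < max p p') - of_bool (\<omega> a < min p p') :: real)"
      by (rule SF_comp2[where k="(-)", OF SI SI])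
    ultimately show ?thesis unfolding P_def
      using Bochner_Integration.integral_add[OF SF_integrable[OF S1] SF_integrable[OF S2]] by simp
  qed
  finally have "total es' * (\<integral>\<omega>. of_bool (token \<omega> es \<noteq> token \<omega> es') \<partial>seed_space)
     \<le> (total fs' + q') * ((1 - p') * P + \<bar>p - p'\<bar>)"
    using T q unfolding es by (intro mult_mono) auto
  \<comment> \<open>Acceptance in the second run removes an old disagreement, unless the two coins
    differ; the factor 1 - p' turns the new total back into the old one.\<close>
  also have "\<dots> = total fs' * P + (total fs' + q') * \<bar>p - p'\<bar>"
  proof -
    have s: "(total fs' + q') * p' = q'" using T q unfolding p by auto
    have "(T + q) * ((1 - p) * P + d) = (T + q - (T + q) * p) * P + (T + q) * d" for T q p P d :: real
      by (simp add: algebra_simps)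
    then show ?thesis by (simp only: s) simp
  qed
  \<comment> \<open>Both thresholds times their own totals are the entries, so total' * (p - p') =
    (total' - total) * p - (q' - q).\<close>
  also have "(total fs' + q') * \<bar>p - p'\<bar> \<le> (q' - q) + (total es' - total es) * p"
  proof (cases "total fs' + q' = 0")
    case True
    then show ?thesis using T q IH(2) unfolding p es by auto
  next
    case False
    have p's: "(total fs' + q') * p' = q'" using False unfolding p by simp
    have ps: "(total fs + q) * p = q" using T q unfolding p by auto
    have "(total fs' + q') * \<bar>p - p'\<bar> = \<bar>(total fs' + q') * (p - p')\<bar>"
      using T q by (simp add: abs_mult)
    also have "(total fs' + q') * (p - p') = (total fs' + q') * p - q'"
      using p's by (simp add: right_diff_distrib)
    also have "(total fs' + q') * p - q' = (total es' - total es) * p - (q' - q)"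
      using ps unfolding es by (simp add: algebra_simps)
    also have "\<bar>\<dots>\<bar> \<le> (total es' - total es) * p + (q' - q)"
      using pr IH(2) q unfolding es by (intro order.trans[OF abs_triangle_ineq4]) auto
    finally show ?thesis by simp
  qed
  also have "total fs' * P \<le> ?R + H fs fs'" by (rule IH)
  finally have "total es' * (\<integral>\<omega>. of_bool (token \<omega> es \<noteq> token \<omega> es') \<partial>seed_space)
    \<le> ?R + H fs fs' + ((q' - q) + (total es' - total es) * p)" by simp
  moreover have "H es es' = H fs fs' + (total es' - total es) * p"
    unfolding H_def p es using len by (simp add: nth_append)
  ultimately show ?case using t IH(2) q len unfolding H_def es
    by simp
qed simp

section \<open>The tower function and the schedule of passes\<close>

fun tow :: "nat \<Rightarrow> nat" where
  "tow 0 = 1"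
| "tow (Suc g) = 2 ^ tow g"

lemma tow_ge: "g < tow g"
proof (induction g)
  case (Suc g)
  have "Suc g < Suc (tow g)" using Suc by simp
  also have "\<dots> \<le> 2 ^ tow g" by (simp add: Suc_le_eq)
  finally show ?case by simp
qed simp

lemma tow_mono: "g \<le> h \<Longrightarrow> tow g \<le> tow h"
proof (induction h)
  case (Suc h)
  have "tow h \<le> 2 ^ tow h" by (simp add: less_imp_le)
  then show ?case using Suc by (cases "g = Suc h") (auto intro: order_trans)
qed simp

lemma le_tow_of_iterated_log: "(log 2 ^^ j) r \<le> 1 \<Longrightarrow> r \<le> real (tow j)"
proof (induction j arbitrary: r)
  case (Suc j)
  show ?case
  proof (cases "r > 0")
    case True
    have "(log 2 ^^ j) (log 2 r) \<le> 1" using Suc.prems by (simp add: funpow_swap1)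
    then have "log 2 r \<le> real (tow j)" by (rule Suc.IH)
    then have "r \<le> 2 powr real (tow j)" using True by (simp add: log_le_iff)
    then show ?thesis by (simp add: powr_realpow)
  next
    case False
    then show ?thesis by (meson not_less of_nat_0_le_iff order_trans)
  qed
qed simp

lemma iterated_log_le: "r \<le> real (tow j) \<Longrightarrow> \<exists>i. (log 2 ^^ i) r \<le> 1"
proof (induction j arbitrary: r)
  case 0
  then show ?case by (intro exI[of _ 0]) simp
next
  case (Suc j)
  show ?case
  proof (cases "r > 1")
    case True
    have "log 2 r \<le> log 2 (2 ^ tow j)" using Suc.prems True by (subst log_le_cancel_iff) auto
    then have "log 2 r \<le> real (tow j)" by (simp add: log_nat_power)
    from Suc.IH[OF this] obtain i where "(log 2 ^^ i) (log 2 r) \<le> 1" by blast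
    then show ?thesis by (intro exI[of _ "Suc i"]) (simp add: funpow_swap1)
  next
    case False
    then show ?thesis by (intro exI[of _ 0]) simp
  qed
qed

lemma le_tow_log_star: "n \<le> tow (log_star n)"
proof -
  have "\<exists>i. (log 2 ^^ i) (real n) \<le> 1"
    using tow_ge[of n] by (intro iterated_log_le[of _ n]) simp
  then have "(log 2 ^^ log_star n) (real n) \<le> 1"
    unfolding log_star_def by (rule LeastI_ex)
  then have "real n \<le> real (tow (log_star n))" by (rule le_tow_of_iterated_log)
  then show ?thesis by simp
qed

lemma log_star_pos: "2 \<le> n \<Longrightarrow> 1 \<le> log_star n"
  using le_tow_log_star[of n] by (cases "log_star n") auto

text \<open>
  The passes run downwards; those numbered \<open>g\<close> or higher add up to a fraction \<open>1 / dd n g\<close> of the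
  mass. The rate of growth is chosen such that \<open>(\<Sum>g. ln (dd n (g + 1)) / dd n g)\<close> stays bounded.
\<close>

fun dd :: "nat \<Rightarrow> nat \<Rightarrow> nat" where
  "dd n 0 = 1"
| "dd n (Suc g) = min n (4 ^ tow g)"

definition npass :: "nat \<Rightarrow> nat" where
  "npass n = (LEAST g. n \<le> dd n g)"

text \<open>Differences of the reciprocals, so that the weights telescope; the highest pass keeps
  all of its 1 / n.\<close>

definition wt :: "nat \<Rightarrow> nat \<Rightarrow> real" where
  "wt n g = 1 / real (dd n g) - (if g = npass n then 0 else 1 / real (dd n (Suc g)))"

lemma dd_log_star: "n \<le> dd n (Suc (log_star n))"
proof -
  have "n \<le> tow (log_star n)" by (rule le_tow_log_star)
  also have "\<dots> < 2 ^ tow (log_star n)" by (rule less_exp)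
  also have "\<dots> \<le> 4 ^ tow (log_star n)" by (rule power_mono) auto
  finally show ?thesis by simp
qed

lemma npass_le: "npass n \<le> Suc (log_star n)"
  unfolding npass_def by (rule Least_le) (rule dd_log_star)

lemma dd_npass: "n \<ge> 1 \<Longrightarrow> dd n (npass n) = n"
proof -
  assume n: "n \<ge> 1"
  have "n \<le> dd n (npass n)" unfolding npass_def by (rule LeastI) (rule dd_log_star)
  moreover have "dd n g \<le> n" for g using n by (cases g) auto
  ultimately show ?thesis by (simp add: le_antisym)
qed

lemma dd_less: "g < npass n \<Longrightarrow> dd n g < n"
  using not_less_Least[of g "\<lambda>g. n \<le> dd n g"] by (simp add: npass_def)

lemma dd_pos: "n \<ge> 1 \<Longrightarrow> 1 \<le> dd n g"
  by (cases g) auto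

lemma dd_mono_Suc: "n \<ge> 1 \<Longrightarrow> dd n g \<le> dd n (Suc g)"
proof (cases g)
  case (Suc h)
  have "(4::nat) ^ tow h \<le> 4 ^ tow (Suc h)" using tow_mono[of h "Suc h"] by (intro power_increasing) auto
  then show ?thesis unfolding Suc dd.simps by (meson min.mono order_refl)
qed simp

lemma wt_nonneg: "n \<ge> 1 \<Longrightarrow> 0 \<le> wt n g"
  using dd_mono_Suc[of n g] dd_pos[of n g] by (auto simp: wt_def frac_le)

lemma ln4: "ln (4::real) \<le> 2"
proof -
  have "ln (4::real) = 2 * ln 2" using ln_realpow[of "2::real" 2] by simp
  then show ?thesis using ln_le_minus_one[of "2::real"] by simp
qed

text \<open>For g > 0, \<open>dd n (Suc g)\<close> is at most 4 ^ tow g, with logarithm at most 2 *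
  tow g = 2 * 2 ^ tow (g - 1), while \<open>dd n g\<close> is 4 ^ tow (g - 1). The ratio is 2 *
  (1/2) ^ tow (g - 1), at most 2 * (1/2) ^ g. Base 4 in the schedule against base 2 in the tower
  yields the decay.\<close>

lemma sum_pass_cost:
  assumes n: "n \<ge> 1"
  shows "(\<Sum>g<npass n. 1 / real (dd n g) * ln (real (dd n (Suc g)) / real (dd n g))) \<le> 4"
proof -
  have "1 / real (dd n g) * ln (real (dd n (Suc g)) / real (dd n g)) \<le> 2 * (1/2) ^ g" if "g < npass n" for g
  proof -
    have p: "1 \<le> real (dd n g)" "1 \<le> real (dd n (Suc g))" using dd_pos[OF n] by (simp_all del: dd.simps)
    have "ln (real (dd n (Suc g)) / real (dd n g)) \<le> ln (real (dd n (Suc g)))"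
      using p by (intro ln_mono) (auto simp: divide_le_eq simp del: dd.simps)
    also have "\<dots> \<le> ln (4 ^ tow g)"
      using p(2) by (intro ln_mono) (auto simp: min_def split: if_splits)
    also have "\<dots> = real (tow g) * ln 4" by (simp add: ln_realpow)
    also have "\<dots> \<le> 2 * real (tow g)" using ln4 by (simp add: mult.commute mult_left_mono)
    finally have *: "ln (real (dd n (Suc g)) / real (dd n g)) \<le> 2 * real (tow g)" .
    show ?thesis
    proof (cases g)
      case 0
      then show ?thesis using * by simp
    next
      case (Suc h)
      have d: "dd n g = 4 ^ tow h" using dd_less[OF that] Suc by (auto simp: min_def split: if_splits)
      have "1 / real (dd n g) * ln (real (dd n (Suc g)) / real (dd n g)) \<le> 1 / real (dd n g) * (2 * real (tow g))"
        using * by (intro mult_left_mono) auto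
      also have "\<dots> = 2 * (2 ^ tow h / 4 ^ tow h)" unfolding d by (simp add: Suc)
      also have "2 ^ tow h / 4 ^ tow h = (1/2 :: real) ^ tow h"
        by (simp add: power_divide[symmetric])
      also have "(1/2 :: real) ^ tow h \<le> (1/2) ^ g"
        using tow_ge[of h] Suc by (intro power_decreasing) auto
      finally show ?thesis by simp
    qed
  qed
  then have "(\<Sum>g<npass n. 1 / real (dd n g) * ln (real (dd n (Suc g)) / real (dd n g)))
     \<le> (\<Sum>g<npass n. 2 * (1/2) ^ g)" by (intro sum_mono) auto
  also have "\<dots> = 2 * (\<Sum>g<npass n. (1/2) ^ g)" by (simp add: sum_distrib_left)
  also have "(\<Sum>g<npass n. (1/2) ^ g) = 2 - 2 * (1/2 :: real) ^ npass n"
    by (simp add: sum_gp_strict)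
  also have "2 * (2 - 2 * (1/2 :: real) ^ npass n) \<le> 4" by simp
  finally show ?thesis .
qed

section \<open>Coupling error over all passes\<close>

text \<open>Meant for the highest pass, which starts from an empty reservoir, where the growth
  factor is infinite.\<close>

lemma sum_ratio_le_length:
  assumes "\<forall>e\<in>set es. 0 \<le> snd (snd e)" "0 \<le> S"
  shows "(\<Sum>k<length es. snd (snd (es ! k)) / (S + total (take (Suc k) es))) \<le> length es"
proof -
  have "(\<Sum>k<length es. snd (snd (es ! k)) / (S + total (take (Suc k) es))) \<le> (\<Sum>k<length es. 1)"
  proof (intro sum_mono)
    fix k assume "k \<in> {..<length es}"
    then have k: "k < length es" by simp
    have "take (Suc k) es = take k es @ [es ! k]" using k by (simp add: take_Suc_conv_app_nth)
    then have "total (take (Suc k) es) = total (take k es) + snd (snd (es ! k))"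
      by (simp add: total_def)
    moreover have "0 \<le> total (take k es)" using assms by (intro total_nonneg) (auto dest: in_set_takeD)
    moreover have "0 \<le> snd (snd (es ! k))" using assms k by auto
    ultimately show "snd (snd (es ! k)) / (S + total (take (Suc k) es)) \<le> 1"
      using assms by (auto simp: divide_le_eq_1)
  qed
  then show ?thesis by simp
qed

text \<open>Each ratio is 1 - 1/x for the growth factor x of its step, hence at most ln x, and the
  logarithms telescope.\<close>

lemma sum_ratio_le_ln:
  assumes "\<forall>e\<in>set es. 0 \<le> snd (snd e)" "0 < S"
  shows "(\<Sum>k<length es. snd (snd (es ! k)) / (S + total (take (Suc k) es))) \<le> ln ((S + total es) / S)"
  using assms
proof (induction es rule: rev_induct)
  case (snoc e es)
  obtain a i q where e: "e = (a, i, q)" by (cases e)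
  have T: "0 \<le> total es" "0 \<le> q" using snoc.prems e total_nonneg by auto
  have "(\<Sum>k<length (es @ [e]). snd (snd ((es @ [e]) ! k)) / (S + total (take (Suc k) (es @ [e]))))
    = (\<Sum>k<length es. snd (snd (es ! k)) / (S + total (take (Suc k) es))) + q / (S + total (es @ [e]))"
    using e by (simp add: nth_append)
  also have "\<dots> \<le> ln ((S + total es) / S) + q / (S + total es + q)"
    using snoc e by (simp add: add.assoc)
  also have "q / (S + total es + q) \<le> ln ((S + total es + q) / (S + total es))"
  proof -
    have "ln ((S + total es) / (S + total es + q)) \<le> (S + total es) / (S + total es + q) - 1"
      using T snoc.prems by (intro ln_le_minus_one) (auto intro!: divide_pos_pos)
    also have "\<dots> = - (q / (S + total es + q))" using T snoc.prems by (simp add: field_simps)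
    finally show ?thesis using T snoc.prems by (simp add: ln_div)
  qed
  also have "ln ((S + total es) / S) + ln ((S + total es + q) / (S + total es)) = ln ((S + total (es @ [e])) / S)"
    using T snoc.prems e by (simp add: ln_div add.assoc)
  finally show ?case by simp
qed simp

text \<open>The residue 2 modulo 8 is reserved for drawings. The address does not mention the cell,
  so the cells share their coins; only expectations are ever added over cells, for which this is
  harmless.\<close>

definition saddr :: "nat \<Rightarrow> nat \<Rightarrow> nat \<Rightarrow> nat" where
  "saddr n g i = 8 * (g * (n + 1) + i) + 2"

lemma saddr_inj:
  assumes "i \<in> {1..n}" "j \<in> {1..n}" "saddr n g i = saddr n h j"
  shows "g = h \<and> i = j"
proof -
  have e: "g * (n + 1) + i = h * (n + 1) + j" using assms(3) by (simp add: saddr_def)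
  have "(g * (n + 1) + i) div (n + 1) = g" "(h * (n + 1) + j) div (n + 1) = h"
    using assms by (simp_all add: div_mult_self3 del: mult_Suc_right)
  then have "g = h" using e by metis
  then show ?thesis using e by simp
qed

definition pass :: "nat \<Rightarrow> (nat \<Rightarrow> real) \<Rightarrow> nat \<Rightarrow> (nat \<times> nat \<times> real) list" where
  "pass n v g = map (\<lambda>i. (saddr n g i, i, wt n g * v i)) [1..<Suc n]"

definition entries :: "nat \<Rightarrow> (nat \<Rightarrow> real) \<Rightarrow> (nat \<times> nat \<times> real) list" where
  "entries n v = concat (map (pass n v) (rev [0..<Suc (npass n)]))"

definition vtot :: "nat \<Rightarrow> (nat \<Rightarrow> real) \<Rightarrow> real" where
  "vtot n v = (\<Sum>i=1..n. v i)"

lemma vtot_upd: "i \<in> {1..n} \<Longrightarrow> vtot n (v(i := u)) = vtot n v + (u - v i)"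
  using sum_upd[of "{1..n}" i v u] sum.remove[of "{1..n}" i v] by (simp add: vtot_def)

lemma sum_list_upt: "(\<Sum>i\<leftarrow>[1..<Suc n]. f i) = (\<Sum>i=1..n. (f i :: real))"
  by (simp add: interv_sum_list_conv_sum_set_nat atLeastLessThanSuc_atLeastAtMost del: upt_Suc sum.op_ivl_Suc)

lemma total_append [simp]: "total (es @ fs) = total es + total fs"
  by (simp add: total_def)

lemma total_pass: "total (pass n v g) = wt n g * vtot n v"
proof -
  have "total (pass n v g) = (\<Sum>i\<leftarrow>[1..<Suc n]. wt n g * v i)"
    by (simp add: total_def pass_def o_def del: upt_Suc)
  then show ?thesis unfolding sum_list_upt by (simp add: vtot_def sum_distrib_left)
qed

lemma entries_nonneg:
  assumes "n \<ge> 1" "\<And>i. i \<in> {1..n} \<Longrightarrow> 0 \<le> v i"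
  shows "\<forall>e\<in>set (pass n v g). 0 \<le> snd (snd e)" "\<forall>e\<in>set (entries n v). 0 \<le> snd (snd e)"
  using assms wt_nonneg by (auto simp: entries_def pass_def simp del: upt_Suc)

lemma distinct_entries: "distinct (map fst (entries n v))"
proof (cases "n = 0")
  case True
  then have "entries n v = []" unfolding entries_def pass_def concat_eq_Nil_conv by auto
  then show ?thesis by simp
next
  case False
  let ?F = "\<lambda>g. map (saddr n g) [1..<Suc n]"
  have 1: "map fst (entries n v) = concat (map ?F (rev [0..<Suc (npass n)]))"
    by (simp add: entries_def pass_def map_concat o_def del: upt_Suc)
  have set1: "set [1..<Suc n] = {1..n}" by auto
  have disj: "g = h" if "set (?F g) \<inter> set (?F h) \<noteq> {}" for g h
  proof -
    from that obtain a where "a \<in> saddr n g ` {1..n}" "a \<in> saddr n h ` {1..n}"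
      unfolding set_map set1 by blast
    then obtain i j where "i \<in> {1..n}" "j \<in> {1..n}" "saddr n g i = saddr n h j"
      by (metis imageE)
    then show ?thesis using saddr_inj by blast
  qed
  have ne: "set (?F g) \<noteq> {}" for g using False by auto
  have i: "inj_on ?F A" for A
    by (rule inj_onI) (metis disj ne inf.idem)
  have d: "distinct (?F g)" for g
    unfolding distinct_map set1 by (intro conjI distinct_upt inj_onI) (metis saddr_inj)
  show ?thesis unfolding 1
  proof (rule distinct_concat)
    show "distinct (map ?F (rev [0..<Suc (npass n)]))"
      unfolding distinct_map using i by simp
  next
    fix ys assume "ys \<in> set (map ?F (rev [0..<Suc (npass n)]))"
    then obtain g where "ys = ?F g" unfolding set_map[of ?F] by blast
    then show "distinct ys" using d by simp
  next
    fix ys zs assume a: "ys \<in> set (map ?F (rev [0..<Suc (npass n)]))" "zs \<in> set (map ?F (rev [0..<Suc (npass n)]))" "ys \<noteq> zs"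
    from a(1) obtain g where g: "ys = ?F g" unfolding set_map[of ?F] by blast
    from a(2) obtain h where h: "zs = ?F h" unfolding set_map[of ?F] by blast
    show "set ys \<inter> set zs = {}" using disj[of g h] a(3) unfolding g h by blast
  qed
qed

definition passes :: "nat \<Rightarrow> (nat \<Rightarrow> real) \<Rightarrow> nat \<Rightarrow> (nat \<times> nat \<times> real) list" where
  "passes n v g = concat (map (pass n v) (rev [g..<Suc (npass n)]))"

lemma passes_step: "g \<le> npass n \<Longrightarrow> passes n v g = passes n v (Suc g) @ pass n v g"
  by (simp add: passes_def upt_conv_Cons del: upt_Suc)

lemma passes_end: "passes n v (Suc (npass n)) = []" by (simp add: passes_def)

lemma total_passes: "g \<le> npass n \<Longrightarrow> total (passes n v g) = vtot n v / real (dd n g)"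
proof (induction rule: inc_induct)
  case base
  show ?case by (simp add: passes_step passes_end total_pass wt_def)
next
  case (step g)
  then show ?case by (simp add: passes_step total_pass wt_def algebra_simps add_divide_distrib diff_divide_distrib del: dd.simps)
qed

lemma total_entries: "total (entries n v) = vtot n v"
  using total_passes[of 0 n v] by (simp add: passes_def entries_def)

definition shifted_ratios :: "(nat \<times> nat \<times> real) list \<Rightarrow> (nat \<times> nat \<times> real) list \<Rightarrow> real" where
  "shifted_ratios es es' = (\<Sum>k<length es.
     (total (take (Suc k) es') - total (take (Suc k) es)) * (snd (snd (es ! k)) / total (take (Suc k) es)))"

lemma shifted_ratios_snoc:
  assumes "length es = length es'"
  shows "shifted_ratios (es @ [e]) (es' @ [e']) = shifted_ratios es es'
    + (total (es' @ [e']) - total (es @ [e])) * (snd (snd e) / total (es @ [e]))"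
  using assms by (simp add: shifted_ratios_def nth_append)

text \<open>Within a block of entries the accumulated increase is replaced by its bound
  \<open>d\<close>, which leaves a pure sum of ratios.\<close>

lemma shifted_ratios_append:
  assumes "length es = length es'" "length fs = length fs'"
    and "\<forall>e\<in>set fs. 0 \<le> snd (snd e)" "0 \<le> total es"
    and d: "\<And>k. k < length fs \<Longrightarrow> total es' + total (take (Suc k) fs') - (total es + total (take (Suc k) fs)) \<le> d"
  shows "shifted_ratios (es @ fs) (es' @ fs') \<le> shifted_ratios es es'
   + d * (\<Sum>k<length fs. snd (snd (fs ! k)) / (total es + total (take (Suc k) fs)))"
  using assms(2,3,5)
proof (induction fs fs' rule: rev_induct2)
  case (4 e fs e' fs')
  have len: "length fs = length fs'" using 4(2) by simp
  have "shifted_ratios (es @ fs @ [e]) (es' @ fs' @ [e']) = shifted_ratios (es @ fs) (es' @ fs')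
    + (total (es' @ fs' @ [e']) - total (es @ fs @ [e])) * (snd (snd e) / (total es + total (fs @ [e])))"
    using shifted_ratios_snoc[of "es @ fs" "es' @ fs'" e e'] assms(1) len by simp
  also have "(total (es' @ fs' @ [e']) - total (es @ fs @ [e])) * (snd (snd e) / (total es + total (fs @ [e])))
     \<le> d * (snd (snd e) / (total es + total (fs @ [e])))"
  proof (rule mult_right_mono)
    show "total (es' @ fs' @ [e']) - total (es @ fs @ [e]) \<le> d"
      using 4(4)[of "length fs"] len by simp
    have "0 \<le> total (fs @ [e])" by (rule total_nonneg) (use 4(3) in simp)
    then show "0 \<le> snd (snd e) / (total es + total (fs @ [e]))"
      using 4(3) assms(4) by (intro divide_nonneg_nonneg add_nonneg_nonneg) auto
  qed
  also have "shifted_ratios (es @ fs) (es' @ fs') \<le> shifted_ratios es es'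
     + d * (\<Sum>k<length fs. snd (snd (fs ! k)) / (total es + total (take (Suc k) fs)))"
  proof (rule 4(1)[OF len])
    show "\<forall>e\<in>set fs. 0 \<le> snd (snd e)" using 4(3) by auto
    fix k assume "k < length fs"
    then show "total es' + total (take (Suc k) fs') - (total es + total (take (Suc k) fs)) \<le> d"
      using 4(4)[of k] len by simp
  qed
  finally show ?case by (simp add: nth_append distrib_left)
qed simp_all

lemma total_take_pass:
  "k \<le> n \<Longrightarrow> total (take k (pass n v g)) = wt n g * (\<Sum>i=1..k. v i)"
proof -
  assume k: "k \<le> n"
  have "take k (pass n v g) = map (\<lambda>i. (saddr n g i, i, wt n g * v i)) [1..<Suc k]"
    using k by (simp add: pass_def take_map take_upt del: upt_Suc)
  then have "total (take k (pass n v g)) = (\<Sum>i\<leftarrow>[1..<Suc k]. wt n g * v i)"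
    by (simp add: total_def o_def del: upt_Suc)
  then show ?thesis unfolding sum_list_upt by (simp add: sum_distrib_left)
qed

lemma length_pass [simp]: "length (pass n v g) = n" by (simp add: pass_def)

lemma length_passes: "length (passes n v g) = length (passes n w g)"
  by (simp add: passes_def length_concat o_def)

text \<open>Later passes have a larger start mass, so their ratios are weighted by the smaller change
  that has been accumulated before them.\<close>

lemma shifted_ratios_passes:
  assumes n: "n \<ge> 1" and v: "\<And>i. i \<in> {1..n} \<Longrightarrow> 0 \<le> v i" and i: "i \<in> {1..n}" and e: "0 \<le> e"
    and v': "v' = v(i := v i + e)" and g: "g \<le> npass n"
  shows "shifted_ratios (passes n v g) (passes n v' g) \<le>
     e * (1 + (\<Sum>h=g..<npass n. 1 / real (dd n h) * ln (real (dd n (Suc h)) / real (dd n h))))"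
  using g
proof (induction rule: inc_induct)
  case base
  note nn = entries_nonneg(1)[of n v, OF n v]
  have sumd: "(\<Sum>j=1..k. v' j) - (\<Sum>j=1..k. v j) \<le> e" for k
    using e unfolding v' sum_subtractf[symmetric] by (simp add: if_distrib[of "\<lambda>x. x - _"] sum.delta cong: if_cong)
  have "shifted_ratios ([] @ pass n v (npass n)) ([] @ pass n v' (npass n)) \<le> shifted_ratios [] []
    + wt n (npass n) * e * (\<Sum>k<length (pass n v (npass n)). snd (snd (pass n v (npass n) ! k)) / (total [] + total (take (Suc k) (pass n v (npass n)))))"
  proof (rule shifted_ratios_append)
    fix k assume "k < length (pass n v (npass n))"
    then show "total [] + total (take (Suc k) (pass n v' (npass n))) - (total [] + total (take (Suc k) (pass n v (npass n))))
      \<le> wt n (npass n) * e"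
      using mult_left_mono[OF sumd[of "Suc k"] wt_nonneg[OF n, of "npass n"]]
      by (simp add: total_take_pass right_diff_distrib del: sum.cl_ivl_Suc)
  qed (use nn in auto)
  \<comment> \<open>The highest pass has weight 1 / n, and each of its \<open>n\<close> ratios is at
    most 1.\<close>
  also have "\<dots> \<le> wt n (npass n) * e * n"
    using sum_ratio_le_length[OF nn, of 0 "npass n"] e wt_nonneg[OF n, of "npass n"]
    by (auto simp: shifted_ratios_def intro!: mult_left_mono)
  also have "\<dots> = e" using n by (simp add: wt_def dd_npass)
  finally show ?case by (simp add: passes_step passes_end)
next
  case (step g)
  note nn = entries_nonneg(1)[of n v, OF n v]
  have sumd: "(\<Sum>j=1..k. v' j) - (\<Sum>j=1..k. v j) \<le> e" for k
    using e unfolding v' sum_subtractf[symmetric] by (simp add: if_distrib[of "\<lambda>x. x - _"] sum.delta cong: if_cong)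
  have V: "vtot n v' = vtot n v + e" unfolding v' using vtot_upd[OF i] by simp
  have V0: "0 \<le> vtot n v" unfolding vtot_def using v by (intro sum_nonneg) auto
  have sg: "Suc g \<le> npass n" "g \<le> npass n" using step by auto
  let ?T = "passes n v (Suc g)" and ?T' = "passes n v' (Suc g)"
  have p: "1 \<le> real (dd n g)" "1 \<le> real (dd n (Suc g))" using dd_pos[OF n] by (simp_all del: dd.simps)
  have T: "total ?T = vtot n v / real (dd n (Suc g))" "total ?T' = (vtot n v + e) / real (dd n (Suc g))"
    using total_passes[OF sg(1)] V by (simp_all del: dd.simps)
  have wg: "wt n g = 1 / real (dd n g) - 1 / real (dd n (Suc g))" using step by (simp add: wt_def)
  have "shifted_ratios (?T @ pass n v g) (?T' @ pass n v' g) \<le> shifted_ratios ?T ?T'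
    + e / real (dd n g) * (\<Sum>k<length (pass n v g). snd (snd (pass n v g ! k)) / (total ?T + total (take (Suc k) (pass n v g))))"
  proof (rule shifted_ratios_append)
    show "length ?T = length ?T'" by (rule length_passes)
    show "0 \<le> total ?T" unfolding T using V0 by simp
    fix k assume "k < length (pass n v g)"
    then have "total ?T' + total (take (Suc k) (pass n v' g)) - (total ?T + total (take (Suc k) (pass n v g)))
      = e / real (dd n (Suc g)) + wt n g * ((\<Sum>j=1..Suc k. v' j) - (\<Sum>j=1..Suc k. v j))"
      unfolding T by (simp add: total_take_pass right_diff_distrib add_divide_distrib del: sum.cl_ivl_Suc dd.simps)
    also have "\<dots> \<le> e / real (dd n (Suc g)) + wt n g * e"
      by (intro add_left_mono mult_left_mono sumd wt_nonneg n)
    also have "\<dots> = e / real (dd n g)" unfolding wg by (simp add: algebra_simps del: dd.simps)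
    finally show "total ?T' + total (take (Suc k) (pass n v' g)) - (total ?T + total (take (Suc k) (pass n v g))) \<le> e / real (dd n g)" .
  qed (use nn in auto)
  then have a1: "shifted_ratios (passes n v g) (passes n v' g) \<le> shifted_ratios ?T ?T'
    + e / real (dd n g) * (\<Sum>k<length (pass n v g). snd (snd (pass n v g ! k)) / (total ?T + total (take (Suc k) (pass n v g))))"
    by (simp only: passes_step[OF sg(2)])
  have a2: "(\<Sum>k<length (pass n v g). snd (snd (pass n v g ! k)) / (total ?T + total (take (Suc k) (pass n v g))))
     \<le> ln (real (dd n (Suc g)) / real (dd n g))"
  proof (cases "vtot n v = 0")
    case True
    then have "\<forall>j\<in>{1..n}. v j = 0" unfolding vtot_def using v by (subst (asm) sum_nonneg_eq_0_iff) auto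
    then have "snd (snd (pass n v g ! k)) = 0" if "k < n" for k
      using that by (simp add: pass_def del: upt_Suc)
    then have "(\<Sum>k<length (pass n v g). snd (snd (pass n v g ! k)) / (total ?T + total (take (Suc k) (pass n v g)))) = 0"
      by (intro sum.neutral) auto
    then show ?thesis using p dd_mono_Suc[OF n, of g] by (simp del: dd.simps)
  next
    case False
    then have Vp: "vtot n v > 0" using V0 by simp
    then have "total ?T > 0" unfolding T using p by simp
    from sum_ratio_le_ln[OF nn this, of g]
    have "(\<Sum>k<length (pass n v g). snd (snd (pass n v g ! k)) / (total ?T + total (take (Suc k) (pass n v g))))
      \<le> ln ((total ?T + total (pass n v g)) / total ?T)" .
    also have "total ?T + total (pass n v g) = vtot n v / real (dd n g)"
      unfolding T total_pass wg by (simp add: algebra_simps del: dd.simps)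
    also have "(vtot n v / real (dd n g)) / total ?T = real (dd n (Suc g)) / real (dd n g)"
      unfolding T using Vp p by (simp add: field_simps del: dd.simps)
    finally show ?thesis .
  qed
  let ?L = "ln (real (dd n (Suc g)) / real (dd n g))"
  have a3: "shifted_ratios ?T ?T' \<le> e * (1 + (\<Sum>h=Suc g..<npass n. 1 / real (dd n h) * ln (real (dd n (Suc h)) / real (dd n h))))"
    by (rule step.IH)
  have "shifted_ratios (passes n v g) (passes n v' g) \<le>
      e * (1 + (\<Sum>h=Suc g..<npass n. 1 / real (dd n h) * ln (real (dd n (Suc h)) / real (dd n h)))) + e / real (dd n g) * ?L"
    using a1 a3 mult_left_mono[OF a2, of "e / real (dd n g)"] e p(1) by simp
  also have "\<dots> = e * (1 + (1 / real (dd n g) * ?L + (\<Sum>h=Suc g..<npass n. 1 / real (dd n h) * ln (real (dd n (Suc h)) / real (dd n h)))))"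
    by (simp add: algebra_simps del: dd.simps)
  finally show ?case using step by (simp only: sum.atLeast_Suc_lessThan[of g "npass n"])
qed

text \<open>The factor 6 collects 1 for the increase itself, 1 for the highest pass and 4 from
  \<open>sum_pass_cost\<close>.\<close>

lemma token_coupling_entries:
  assumes n: "n \<ge> 1" and v: "\<And>i. i \<in> {1..n} \<Longrightarrow> 0 \<le> v i" and i: "i \<in> {1..n}" and e: "0 \<le> e"
    and v': "v' = v(i := v i + e)"
  shows "vtot n v' * (\<integral>\<omega>. of_bool (token \<omega> (entries n v) \<noteq> token \<omega> (entries n v')) \<partial>seed_space) \<le> 6 * e"
proof -
  define ts where "ts = concat (map (\<lambda>g. map (\<lambda>i. (saddr n g i, i, wt n g * v i, wt n g * v' i)) [1..<Suc n]) (rev [0..<Suc (npass n)]))"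
  have es: "entries n v = map (\<lambda>(a, i, q, q'). (a, i, q)) ts" "entries n v' = map (\<lambda>(a, i, q, q'). (a, i, q')) ts"
    by (simp_all add: ts_def entries_def pass_def[abs_def] map_concat o_def del: upt_Suc)
  have "map fst ts = map fst (entries n v)" unfolding es by (simp add: o_def split_def)
  then have d: "distinct (map fst ts)" using distinct_entries by metis
  have mono: "wt n g * v j \<le> wt n g * v' j" if "j \<in> {1..n}" for g j
    using e unfolding v' by (intro mult_left_mono wt_nonneg n) auto
  have "\<forall>(a, i, q, q')\<in>set ts. 0 \<le> q \<and> q \<le> q'"
    using v mono wt_nonneg[OF n] by (auto simp: ts_def simp del: upt_Suc)
  from token_coupling[OF this d es]
  have "total (entries n v') * (\<integral>\<omega>. of_bool (token \<omega> (entries n v) \<noteq> token \<omega> (entries n v')) \<partial>seed_space)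
    \<le> (\<Sum>(a, i, q, q')\<leftarrow>ts. q' - q) + shifted_ratios (entries n v) (entries n v')"
    unfolding shifted_ratios_def es by simp
  also have "(\<Sum>(a, i, q, q')\<leftarrow>ts. q' - q) = total (entries n v') - total (entries n v)"
    unfolding es total_def by (induction ts) auto
  also have "\<dots> = e" unfolding total_entries v' using vtot_upd[OF i] by simp
  also have "shifted_ratios (entries n v) (entries n v') \<le> e * (1 + 4)"
  proof -
    have "shifted_ratios (passes n v 0) (passes n v' 0) \<le>
       e * (1 + (\<Sum>h=0..<npass n. 1 / real (dd n h) * ln (real (dd n (Suc h)) / real (dd n h))))"
      by (rule shifted_ratios_passes[OF n v i e v']) simp_all
    also have "\<dots> \<le> e * (1 + 4)"
      using sum_pass_cost[OF n] e by (intro mult_left_mono add_left_mono) (simp_all only: atLeast0LessThan)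
    finally show ?thesis by (simp add: passes_def entries_def)
  qed
  finally show ?thesis by (simp add: total_entries)
qed

text \<open>The \<open>l\<^sub>1\<close> distance of \<open>S\<close> times the \<open>X\<close>-th and \<open>S'\<close> times the \<open>X'\<close>-th unit vector.\<close>

definition tdist :: "real \<times> nat \<Rightarrow> real \<times> nat \<Rightarrow> real" where
  "tdist p q = (if snd p = snd q then \<bar>fst p - fst q\<bar> else fst p + fst q)"

definition tk :: "nat \<Rightarrow> (nat \<Rightarrow> real) \<Rightarrow> (nat \<Rightarrow> real) \<Rightarrow> real \<times> nat" where
  "tk n v \<omega> = res \<omega> (entries n v)"

lemma fst_tk [simp]: "fst (tk n v \<omega>) = vtot n v" by (simp add: tk_def fst_res total_entries)

lemma snd_tk: "snd (tk n v \<omega>) = token \<omega> (entries n v)" by (simp add: tk_def token_def)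

lemma SF_tk:
  assumes "n \<ge> 1" "\<And>i. i \<in> {1..n} \<Longrightarrow> 0 \<le> v i"
  shows "SF (tk n v)"
proof -
  have "tk n v = (\<lambda>\<omega>. (vtot n v, token \<omega> (entries n v)))"
    by (rule ext) (metis fst_tk snd_tk prod.collapse)
  then show ?thesis using SF_token[OF entries_nonneg(2)[of n v, OF assms]] by simp
qed

lemma tdist_triangle: "0 \<le> fst p \<Longrightarrow> 0 \<le> fst q \<Longrightarrow> 0 \<le> fst r \<Longrightarrow> tdist p r \<le> tdist p q + tdist q r"
  by (auto simp: tdist_def)

lemma vtot_nonneg: "(\<And>i. i \<in> {1..n} \<Longrightarrow> 0 \<le> v i) \<Longrightarrow> 0 \<le> vtot n v"
  unfolding vtot_def by (intro sum_nonneg) auto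

text \<open>Equal tokens pay the change of mass, different ones at most twice the larger mass times
  the probability bounded before: 13 = 1 + 2 * 6.\<close>

lemma tk_single:
  assumes n: "n \<ge> 1" and v: "\<And>i. i \<in> {1..n} \<Longrightarrow> 0 \<le> v i" and i: "i \<in> {1..n}" and pq: "0 \<le> p" "0 \<le> q"
  shows "(\<integral>\<omega>. tdist (tk n (v(i := p)) \<omega>) (tk n (v(i := q)) \<omega>) \<partial>seed_space) \<le> 13 * \<bar>p - q\<bar>"
proof -
  define D where "D p q = (\<integral>\<omega>. tdist (tk n (v(i := p)) \<omega>) (tk n (v(i := q)) \<omega>) \<partial>seed_space)" for p q
  have le: "D p q \<le> 13 * (q - p)" if "0 \<le> p" "p \<le> q" for p q
  proof -
    let ?v = "v(i := p)" and ?v' = "v(i := q)"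
    have nn: "0 \<le> ?v j" "0 \<le> ?v' j" if "j \<in> {1..n}" for j using v that \<open>0 \<le> p\<close> \<open>p \<le> q\<close> by auto
    have V: "vtot n ?v' = vtot n ?v + (q - p)" using vtot_upd[OF i, of v] by simp
    have V0: "0 \<le> vtot n ?v" using nn by (intro vtot_nonneg)
    let ?N = "\<lambda>\<omega>. of_bool (token \<omega> (entries n ?v) \<noteq> token \<omega> (entries n ?v')) :: real"
    have SN: "SF ?N"
      by (intro SF_comp2[where k="\<lambda>x y. of_bool (x \<noteq> y)"] SF_token entries_nonneg n nn)
    have "D p q \<le> (\<integral>\<omega>. (q - p) + 2 * vtot n ?v' * ?N \<omega> \<partial>seed_space)"
      unfolding D_def
    proof (intro integral_mono SF_integrable)
      show "SF (\<lambda>\<omega>. tdist (tk n ?v \<omega>) (tk n ?v' \<omega>))"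
        by (intro SF_comp2[where k=tdist] SF_tk n nn)
      show "SF (\<lambda>\<omega>. (q - p) + 2 * vtot n ?v' * ?N \<omega>)"
        by (rule SF_comp[OF SN, where g="\<lambda>x. (q - p) + 2 * vtot n ?v' * x"])
      show "tdist (tk n ?v \<omega>) (tk n ?v' \<omega>) \<le> (q - p) + 2 * vtot n ?v' * ?N \<omega>" for \<omega>
        using V V0 that by (auto simp: tdist_def snd_tk)
    qed
    also have "\<dots> = (q - p) + 2 * (vtot n ?v' * (\<integral>\<omega>. ?N \<omega> \<partial>seed_space))"
      by (subst Bochner_Integration.integral_add)
        (auto intro!: SF_integrable SF_comp[OF SN, where g="\<lambda>x. 2 * vtot n ?v' * x"] SN simp: seed.prob_space)
    also have "vtot n ?v' * (\<integral>\<omega>. ?N \<omega> \<partial>seed_space) \<le> 6 * (q - p)"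
      by (rule token_coupling_entries[OF n _ i]) (use that nn in auto)
    finally show ?thesis by simp
  qed
  have sym: "D p q = D q p" for p q unfolding D_def
    by (intro Bochner_Integration.integral_cong) (auto simp: tdist_def)
  show ?thesis using le[of p q] le[of q p] sym[of p q] pq unfolding D_def[symmetric]
    by (cases "p \<le> q") auto
qed

lemma tk_lipschitz:
  assumes n: "n \<ge> 1" and v: "\<And>i. i \<in> {1..n} \<Longrightarrow> 0 \<le> v i" and v': "\<And>i. i \<in> {1..n} \<Longrightarrow> 0 \<le> v' i"
  shows "(\<integral>\<omega>. tdist (tk n v \<omega>) (tk n v' \<omega>) \<partial>seed_space) \<le> 13 * (\<Sum>i=1..n. \<bar>v i - v' i\<bar>)"
proof -
  define D where "D v w = (\<integral>\<omega>. tdist (tk n v \<omega>) (tk n w \<omega>) \<partial>seed_space)" for v w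
  define mix where "mix I j = (if j \<in> I then v' j else v j)" for I j
  have nn: "0 \<le> mix I j" if "j \<in> {1..n}" for I j using v v' that by (simp add: mix_def)
  have tri: "D v1 v3 \<le> D v1 v2 + D v2 v3"
    if "\<And>j. j \<in> {1..n} \<Longrightarrow> 0 \<le> v1 j" "\<And>j. j \<in> {1..n} \<Longrightarrow> 0 \<le> v2 j" "\<And>j. j \<in> {1..n} \<Longrightarrow> 0 \<le> v3 j" for v1 v2 v3
  proof -
    have S: "SF (\<lambda>\<omega>. tdist (tk n v1 \<omega>) (tk n v2 \<omega>))" "SF (\<lambda>\<omega>. tdist (tk n v2 \<omega>) (tk n v3 \<omega>))"
      "SF (\<lambda>\<omega>. tdist (tk n v1 \<omega>) (tk n v3 \<omega>))"
      by (rule SF_comp2[where k=tdist]; rule SF_tk[OF n]; blast intro: that)+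
    have "D v1 v3 \<le> (\<integral>\<omega>. tdist (tk n v1 \<omega>) (tk n v2 \<omega>) + tdist (tk n v2 \<omega>) (tk n v3 \<omega>) \<partial>seed_space)"
      unfolding D_def
    proof (intro integral_mono Bochner_Integration.integrable_add SF_integrable S tdist_triangle)
      show "0 \<le> fst (tk n v1 \<omega>)" "0 \<le> fst (tk n v2 \<omega>)" "0 \<le> fst (tk n v3 \<omega>)" for \<omega>
        unfolding fst_tk by (rule vtot_nonneg, rule that, assumption)+
    qed
    also have "\<dots> = D v1 v2 + D v2 v3" unfolding D_def
      by (intro Bochner_Integration.integral_add SF_integrable S)
    finally show ?thesis .
  qed
  have "D (mix {}) (mix I) \<le> 13 * (\<Sum>j\<in>I. \<bar>v j - v' j\<bar>)" if "finite I" "I \<subseteq> {1..n}" for I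
    using that
  proof (induction I)
    case empty
    then show ?case by (simp add: D_def tdist_def)
  next
    case (insert i I)
    have m: "mix I = (mix I)(i := v i)" "mix (insert i I) = (mix I)(i := v' i)"
      using insert by (auto simp: mix_def)
    have "D ((mix I)(i := v i)) ((mix I)(i := v' i)) \<le> 13 * \<bar>v i - v' i\<bar>"
      unfolding D_def using insert v v' by (intro tk_single n nn) auto
    then have "D (mix I) (mix (insert i I)) \<le> 13 * \<bar>v i - v' i\<bar>" using m by simp
    moreover have "D (mix {}) (mix (insert i I)) \<le> D (mix {}) (mix I) + D (mix I) (mix (insert i I))"
      by (intro tri nn)
    ultimately show ?case using insert by simp
  qed
  from this[of "{1..n}"] have "D (mix {}) (mix {1..n}) \<le> 13 * (\<Sum>i=1..n. \<bar>v i - v' i\<bar>)" by simp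
  moreover have "entries n (mix {}) = entries n v" "entries n (mix {1..n}) = entries n v'"
    by (auto simp: entries_def pass_def mix_def simp del: upt_Suc intro!: arg_cong[of _ _ concat])
  ultimately show ?thesis by (simp add: D_def tk_def)
qed

lemma tk_marginal:
  assumes n: "n \<ge> 1" and v: "\<And>i. i \<in> {1..n} \<Longrightarrow> 0 \<le> v i" and i: "i \<in> {1..n}"
  shows "vtot n v * (\<integral>\<omega>. of_bool (snd (tk n v \<omega>) = i) \<partial>seed_space) = v i"
proof -
  have "vtot n v * (\<integral>\<omega>. of_bool (snd (tk n v \<omega>) = i) \<partial>seed_space)
    = (\<Sum>(a, j, q)\<leftarrow>entries n v. if j = i then q else 0)"
    using token_marginal[where i=i, OF entries_nonneg(2)[of n v, OF n v] distinct_entries] by (simp add: snd_tk total_entries)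
  also have "\<dots> = total (entries n (\<lambda>j. if j = i then v j else 0))"
    unfolding total_def entries_def pass_def[abs_def]
    by (simp add: map_concat o_def if_distrib[of "\<lambda>x. wt n _ * x"] cong: if_cong del: upt_Suc)
  also have "\<dots> = v i" unfolding total_entries vtot_def using i by simp
  finally show ?thesis .
qed

lemma tk_in:
  assumes n: "n \<ge> 1" and v: "\<And>i. i \<in> {1..n} \<Longrightarrow> 0 \<le> v i" and V: "0 < vtot n v" and om: "\<omega> \<in> space seed_space"
  shows "snd (tk n v \<omega>) \<in> {1..n}" "0 < v (snd (tk n v \<omega>))"
proof -
  obtain a q where "(a, token \<omega> (entries n v), q) \<in> set (entries n v)" "0 < q"
    using token_in[OF entries_nonneg(2)[of n v, OF n v] _ om] V by (auto simp: total_entries)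
  then have "\<exists>g. token \<omega> (entries n v) \<in> {1..n} \<and> q = wt n g * v (token \<omega> (entries n v))"
    by (auto simp: entries_def pass_def simp del: upt_Suc)
  then obtain g where "token \<omega> (entries n v) \<in> {1..n}" "0 < wt n g * v (token \<omega> (entries n v))"
    using \<open>0 < q\<close> by auto
  then show "snd (tk n v \<omega>) \<in> {1..n}" "0 < v (snd (tk n v \<omega>))"
    using wt_nonneg[OF n, of g] by (auto simp: snd_tk zero_less_mult_iff)
qed

lemma tk_cong_addrs:
  assumes "\<And>g i. i \<in> {1..n} \<Longrightarrow> \<omega> (saddr n g i) = \<omega>' (saddr n g i)"
  shows "tk n v \<omega> = tk n v \<omega>'"
proof -
  have "foldl (res_step \<omega>) s es = foldl (res_step \<omega>') s es" if "\<forall>e\<in>set es. \<omega> (fst e) = \<omega>' (fst e)" for s es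
    using that by (induction es arbitrary: s) (auto simp: res_step_def split_def)
  then show ?thesis unfolding tk_def res_def using assms
    by (auto simp: entries_def pass_def simp del: upt_Suc)
qed

section \<open>Cells of mass one half\<close>

definition lmass :: "real \<Rightarrow> (nat \<Rightarrow> nat) \<Rightarrow> (nat \<Rightarrow> real) \<Rightarrow> nat \<Rightarrow> nat \<Rightarrow> real" where
  "lmass \<rho> h x b j = (if h j = b \<and> x j < \<rho> / 2 then x j else 0)"

definition pre :: "real \<Rightarrow> (nat \<Rightarrow> nat) \<Rightarrow> (nat \<Rightarrow> real) \<Rightarrow> nat \<Rightarrow> nat \<Rightarrow> real" where
  "pre \<rho> h x b i = (\<Sum>j\<in>{1..<i}. lmass \<rho> h x b j)"

text \<open>A boundary point belongs to the cell on its left, and 0 to cell 0. Thus a new cell is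
  opened only when a filling strictly exceeds 1/2.\<close>

definition cix :: "real \<Rightarrow> nat" where
  "cix p = nat (\<lceil>2 * p\<rceil> - 1)"

definition offs :: "real \<Rightarrow> real" where
  "offs p = p - real (cix p) / 2"

abbreviation cstride :: "nat \<Rightarrow> nat" where
  "cstride n \<equiv> 4 * (n + 1)"

text \<open>Light items of bucket \<open>b\<close> share the cells \<open>b * cstride n + c\<close> with \<open>c < 2 * (n + 1)\<close>; each heavy
  item has a cell of its own.\<close>

definition cel :: "nat \<Rightarrow> real \<Rightarrow> (nat \<Rightarrow> nat) \<Rightarrow> (nat \<Rightarrow> real) \<Rightarrow> nat \<Rightarrow> nat" where
  "cel n \<rho> h x i = h i * cstride n + (if x i < \<rho> / 2 then cix (pre \<rho> h x (h i) i) else 2 * (n + 1) + i)"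

text \<open>The piece of an item in its first cell. Light items have mass below
  \<open>\<rho> / 2\<close>, hence below 1/2, and reach at most into the next cell.\<close>

definition pc1 :: "real \<Rightarrow> (nat \<Rightarrow> nat) \<Rightarrow> (nat \<Rightarrow> real) \<Rightarrow> nat \<Rightarrow> real" where
  "pc1 \<rho> h x i = (if x i < \<rho> / 2 then min (x i) (1/2 - offs (pre \<rho> h x (h i) i)) else x i)"

definition vv :: "nat \<Rightarrow> real \<Rightarrow> (nat \<Rightarrow> nat) \<Rightarrow> (nat \<Rightarrow> real) \<Rightarrow> nat \<Rightarrow> nat \<Rightarrow> real" where
  "vv n \<rho> h x \<kappa> i = (if \<kappa> = cel n \<rho> h x i then pc1 \<rho> h x i
     else if \<kappa> = Suc (cel n \<rho> h x i) then x i - pc1 \<rho> h x i else 0)"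

text \<open>The length of the part of [0, p] that lies in cell \<open>c\<close>.\<close>

definition clamp :: "nat \<Rightarrow> real \<Rightarrow> real" where
  "clamp c p = max 0 (min (1/2) (p - real c / 2))"

lemma clamp_le: "clamp c p \<le> 1/2" unfolding clamp_def by (intro max.boundedI min.cobounded1) simp

definition frac_vec :: "nat \<Rightarrow> (nat \<Rightarrow> real) \<Rightarrow> bool" where
  "frac_vec n x \<longleftrightarrow> (\<forall>i\<in>{1..n}. 0 \<le> x i \<and> x i \<le> 1)"

lemma offs_range:
  assumes "0 \<le> p"
  shows "0 \<le> offs p" "offs p \<le> 1/2"
proof -
  have "real (cix p) \<le> 2 * p \<and> 2 * p \<le> real (cix p) + 1"
  proof (cases "p = 0")
    case False
    then have "0 < \<lceil>2 * p\<rceil>" using assms by simp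
    then have "real (cix p) = of_int \<lceil>2 * p\<rceil> - 1" by (simp add: cix_def)
    then show ?thesis by linarith
  qed (simp add: cix_def)
  then show "0 \<le> offs p" "offs p \<le> 1/2" by (auto simp: offs_def)
qed

lemma pre_Suc: "1 \<le> i \<Longrightarrow> pre \<rho> h x b (Suc i) = pre \<rho> h x b i + lmass \<rho> h x b i"
  by (simp add: pre_def)

lemma pre_1 [simp]: "pre \<rho> h x b (Suc 0) = 0" by (simp add: pre_def)

section \<open>One drawn item per cell\<close>

definition zcell :: "nat \<Rightarrow> real \<Rightarrow> (nat \<Rightarrow> nat) \<Rightarrow> (nat \<Rightarrow> real) \<Rightarrow> (nat \<Rightarrow> real) \<Rightarrow> nat \<Rightarrow> nat \<Rightarrow> real" where
  "zcell n \<rho> h x \<omega> \<kappa> i = (if snd (tk n (vv n \<rho> h x \<kappa>) \<omega>) = i then vtot n (vv n \<rho> h x \<kappa>) else 0)"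

definition zv :: "nat \<Rightarrow> real \<Rightarrow> (nat \<Rightarrow> nat) \<Rightarrow> (nat \<Rightarrow> real) \<Rightarrow> (nat \<Rightarrow> real) \<Rightarrow> nat \<Rightarrow> real" where
  "zv n \<rho> h x \<omega> i = zcell n \<rho> h x \<omega> (cel n \<rho> h x i) i + zcell n \<rho> h x \<omega> (Suc (cel n \<rho> h x i)) i"

definition cells :: "nat \<Rightarrow> real \<Rightarrow> (nat \<Rightarrow> nat) \<Rightarrow> (nat \<Rightarrow> real) \<Rightarrow> nat set" where
  "cells n \<rho> h x = cel n \<rho> h x ` {1..n} \<union> Suc ` cel n \<rho> h x ` {1..n}"

definition bmass :: "nat \<Rightarrow> (nat \<Rightarrow> nat) \<Rightarrow> (nat \<Rightarrow> real) \<Rightarrow> nat \<Rightarrow> real" where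
  "bmass n h x b = (\<Sum>j\<in>{j\<in>{1..n}. h j = b}. x j)"

lemma finite_cells [simp]: "finite (cells n \<rho> h x)" by (simp add: cells_def)

context
  fixes n :: nat and \<rho> :: real and h :: "nat \<Rightarrow> nat" and x :: "nat \<Rightarrow> real"
  assumes x: "frac_vec n x" and \<rho>: "1/2 \<le> \<rho>" "\<rho> \<le> 1"
begin

lemma x_range: "i \<in> {1..n} \<Longrightarrow> 0 \<le> x i" "i \<in> {1..n} \<Longrightarrow> x i \<le> 1"
  using x by (auto simp: frac_vec_def)

lemma lmass_nonneg: "j \<in> {1..n} \<Longrightarrow> 0 \<le> lmass \<rho> h x b j"
  using x_range by (simp add: lmass_def)

lemma pre_nonneg: "i \<le> Suc n \<Longrightarrow> 0 \<le> pre \<rho> h x b i"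
  unfolding pre_def by (intro sum_nonneg lmass_nonneg) auto

lemma pre_mono:
  assumes "i \<le> j" "j \<le> Suc n"
  shows "pre \<rho> h x b i \<le> pre \<rho> h x b j"
  unfolding pre_def using assms by (intro sum_mono2) (auto intro!: lmass_nonneg)

lemma pre_le: "i \<le> Suc n \<Longrightarrow> pre \<rho> h x b i \<le> real n"
proof -
  assume i: "i \<le> Suc n"
  have "pre \<rho> h x b i \<le> (\<Sum>j\<in>{1..<i}. 1)"
    unfolding pre_def using i x_range by (intro sum_mono) (auto simp: lmass_def)
  also have "\<dots> \<le> real n" using i by simp
  finally show ?thesis .
qed

lemma cix_le: "i \<in> {1..n} \<Longrightarrow> cix (pre \<rho> h x b i) < 2 * n"
proof -
  assume i: "i \<in> {1..n}"
  have "\<lceil>2 * pre \<rho> h x b i\<rceil> \<le> 2 * int n"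
    using pre_le[of i b] i by (simp add: ceiling_le_iff)
  then show ?thesis using i unfolding cix_def by auto
qed

lemma pc1_range: "i \<in> {1..n} \<Longrightarrow> 0 \<le> pc1 \<rho> h x i" "i \<in> {1..n} \<Longrightarrow> pc1 \<rho> h x i \<le> x i"
  using x_range offs_range[OF pre_nonneg, of i "h i"] by (auto simp: pc1_def)

lemma vv_nonneg: "i \<in> {1..n} \<Longrightarrow> 0 \<le> vv n \<rho> h x \<kappa> i"
  using pc1_range by (simp add: vv_def)

lemma vv_sum:
  assumes "finite C" "cel n \<rho> h x i \<in> C" "Suc (cel n \<rho> h x i) \<in> C"
  shows "(\<Sum>\<kappa>\<in>C. vv n \<rho> h x \<kappa> i) = x i"
proof -
  have "(\<Sum>\<kappa>\<in>C. vv n \<rho> h x \<kappa> i) = (\<Sum>\<kappa>\<in>{cel n \<rho> h x i, Suc (cel n \<rho> h x i)}. vv n \<rho> h x \<kappa> i)"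
    using assms by (intro sum.mono_neutral_right) (auto simp: vv_def)
  then show ?thesis by (simp add: vv_def)
qed

lemma cel_block:
  assumes "i \<in> {1..n}"
  shows "cel n \<rho> h x i div cstride n = h i" "Suc (cel n \<rho> h x i) div cstride n = h i"
    "cel n \<rho> h x i mod cstride n = (if x i < \<rho> / 2 then cix (pre \<rho> h x (h i) i) else 2 * (n + 1) + i)"
    "Suc (cel n \<rho> h x i) mod cstride n = Suc (if x i < \<rho> / 2 then cix (pre \<rho> h x (h i) i) else 2 * (n + 1) + i)"
proof -
  let ?c = "if x i < \<rho> / 2 then cix (pre \<rho> h x (h i) i) else 2 * (n + 1) + i"
  have c: "Suc ?c < cstride n" using cix_le[OF assms, of "h i"] assms by auto
  have d: "(h i * cstride n + r) div cstride n = h i" "(h i * cstride n + r) mod cstride n = r"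
    if "r < cstride n" for r
    using that by simp_all
  have e: "cel n \<rho> h x i = h i * cstride n + ?c" "Suc (cel n \<rho> h x i) = h i * cstride n + Suc ?c"
    by (simp_all add: cel_def)
  show "cel n \<rho> h x i div cstride n = h i" "cel n \<rho> h x i mod cstride n = ?c"
    unfolding e(1) by (rule d[OF Suc_lessD[OF c]])+
  show "Suc (cel n \<rho> h x i) div cstride n = h i" "Suc (cel n \<rho> h x i) mod cstride n = Suc ?c"
    unfolding e(2) by (rule d[OF c])+
qed

lemma vv_other_block:
  assumes "i \<in> {1..n}" "\<kappa> div cstride n \<noteq> h i"
  shows "vv n \<rho> h x \<kappa> i = 0"
  using cel_block[OF assms(1)] assms(2) by (auto simp: vv_def)

text \<open>A light item occupies the interval between two consecutive prefix sums, and its share is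
  the length of the intersection with the cell. In this form shares telescope over the items, and a
  shift of the interval can be analysed.\<close>

lemma vv_clamp:
  assumes i: "i \<in> {1..n}" and c: "\<kappa> mod cstride n = c" "c < 2 * (n + 1)" and b: "\<kappa> div cstride n = b"
  shows "vv n \<rho> h x \<kappa> i = clamp c (pre \<rho> h x b (Suc i)) - clamp c (pre \<rho> h x b i)"
proof (cases "h i = b \<and> x i < \<rho> / 2")
  case False
  then have "pre \<rho> h x b (Suc i) = pre \<rho> h x b i" using i by (subst pre_Suc) (auto simp: lmass_def)
  moreover have "vv n \<rho> h x \<kappa> i = 0"
    using False cel_block[OF i] c b by (auto simp: vv_def)
  ultimately show ?thesis by simp
next
  case True
  define P c0 where "P = pre \<rho> h x b i" and "c0 = cix P"
  have P0: "0 \<le> P" unfolding P_def using i by (intro pre_nonneg) auto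
  define e where "e = offs P"
  have e: "0 \<le> e" "e \<le> 1/2" "P = real c0 / 2 + e" using offs_range[OF P0] by (auto simp: e_def c0_def offs_def)
  have x2: "0 \<le> x i" "x i \<le> 1/2" using x_range[OF i] True \<rho> by auto
  have P': "pre \<rho> h x b (Suc i) = P + x i" using i True by (subst pre_Suc) (auto simp: lmass_def P_def)
  have cel: "cel n \<rho> h x i mod cstride n = c0" "Suc (cel n \<rho> h x i) mod cstride n = Suc c0"
    "cel n \<rho> h x i div cstride n = b" "Suc (cel n \<rho> h x i) div cstride n = b"
    using cel_block[OF i] True by (auto simp: c0_def P_def)
  have eq: "\<kappa> = k \<longleftrightarrow> c = k mod cstride n" if "k div cstride n = b" for k
    using b c(1) that by (metis div_mult_mod_eq)
  have k: "\<kappa> = cel n \<rho> h x i \<longleftrightarrow> c = c0" "\<kappa> = Suc (cel n \<rho> h x i) \<longleftrightarrow> c = Suc c0"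
    using eq[OF cel(3)] eq[OF cel(4)] cel by auto
  have p1: "pc1 \<rho> h x i = min (x i) (1/2 - e)" using True by (simp add: pc1_def e_def P_def)
  have cl: "clamp c P = max 0 (min (1/2) (e + (real c0 - real c) / 2))"
    "clamp c (P + x i) = max 0 (min (1/2) (e + x i + (real c0 - real c) / 2))"
  proof -
    have "P - real c / 2 = e + (real c0 - real c) / 2" "P + x i - real c / 2 = e + x i + (real c0 - real c) / 2"
      by (simp_all add: e(3) diff_divide_distrib)
    then show "clamp c P = max 0 (min (1/2) (e + (real c0 - real c) / 2))"
      "clamp c (P + x i) = max 0 (min (1/2) (e + x i + (real c0 - real c) / 2))"
      unfolding clamp_def by simp_all
  qed
  consider "c = c0" | "c = Suc c0" | "c < c0" | "Suc c0 < c" by linarith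
  then have "vv n \<rho> h x \<kappa> i = clamp c (P + x i) - clamp c P"
  proof cases
    case 1
    then show ?thesis using e x2 unfolding cl by (simp add: vv_def k p1)
  next
    case 2
    then show ?thesis using e x2 unfolding cl by (simp add: vv_def k p1)
  next
    case 3
    then have "real c + 1 \<le> real c0" by linarith
    then have "1/2 \<le> (real c0 - real c) / 2" by simp
    then have "1/2 \<le> e + (real c0 - real c) / 2" "1/2 \<le> e + x i + (real c0 - real c) / 2"
      using e x2 by linarith+
    then show ?thesis using 3 unfolding cl by (simp add: vv_def k)
  next
    case 4
    then have "real c0 + 2 \<le> real c" by linarith
    then have "(real c0 - real c) / 2 \<le> -1" by simp
    then have "e + (real c0 - real c) / 2 \<le> 0" "e + x i + (real c0 - real c) / 2 \<le> 0"
      using e x2 by linarith+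
    then show ?thesis using 4 unfolding cl by (simp add: vv_def k)
  qed
  then show ?thesis by (simp add: P' P_def)
qed

lemma vv_heavy_cell:
  assumes i: "i \<in> {1..n}" and c: "2 * (n + 1) \<le> \<kappa> mod cstride n"
  shows "vv n \<rho> h x \<kappa> i = (if \<kappa> = h i * cstride n + 2 * (n + 1) + i \<and> \<rho> / 2 \<le> x i then x i else 0)"
proof (cases "x i < \<rho> / 2")
  case True
  then have "\<kappa> \<noteq> cel n \<rho> h x i" "\<kappa> \<noteq> Suc (cel n \<rho> h x i)"
    using cel_block[OF i] c cix_le[OF i, of "h i"] by auto
  then show ?thesis using True by (simp add: vv_def)
next
  case False
  then show ?thesis by (auto simp: vv_def cel_def pc1_def)
qed

lemma vtot_light_cell:
  assumes "\<kappa> mod cstride n < 2 * (n + 1)"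
  shows "vtot n (vv n \<rho> h x \<kappa>) = clamp (\<kappa> mod cstride n) (pre \<rho> h x (\<kappa> div cstride n) (Suc n))"
proof -
  have "vtot n (vv n \<rho> h x \<kappa>) = (\<Sum>i=1..n. clamp (\<kappa> mod cstride n) (pre \<rho> h x (\<kappa> div cstride n) (Suc i)) - clamp (\<kappa> mod cstride n) (pre \<rho> h x (\<kappa> div cstride n) i))"
    unfolding vtot_def using assms by (intro sum.cong refl vv_clamp) auto
  also have "\<dots> = clamp (\<kappa> mod cstride n) (pre \<rho> h x (\<kappa> div cstride n) (Suc n)) - clamp (\<kappa> mod cstride n) (pre \<rho> h x (\<kappa> div cstride n) 1)"
    by (rule sum_Suc_diff) simp
  finally show ?thesis by (simp add: clamp_def)
qed

lemma vtot_vv_nonneg: "0 \<le> vtot n (vv n \<rho> h x \<kappa>)"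
  by (intro vtot_nonneg vv_nonneg)

lemma zcell_nonneg: "0 \<le> zcell n \<rho> h x \<omega> \<kappa> i" using vtot_vv_nonneg by (simp add: zcell_def)

lemma zcell_pos:
  assumes "\<omega> \<in> space seed_space" "zcell n \<rho> h x \<omega> \<kappa> i \<noteq> 0" "1 \<le> n"
  shows "i \<in> {1..n}" "0 < vv n \<rho> h x \<kappa> i" "i = snd (tk n (vv n \<rho> h x \<kappa>) \<omega>)" "0 < vtot n (vv n \<rho> h x \<kappa>)"
proof -
  show i: "i = snd (tk n (vv n \<rho> h x \<kappa>) \<omega>)" and p: "0 < vtot n (vv n \<rho> h x \<kappa>)"
    using assms(2) vtot_vv_nonneg[of \<kappa>] by (auto simp: zcell_def split: if_splits)
  show "i \<in> {1..n}" "0 < vv n \<rho> h x \<kappa> i"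
    using tk_in[of n "vv n \<rho> h x \<kappa>", OF assms(3) vv_nonneg p assms(1)] i by auto
qed

lemma zcell_cells:
  assumes "\<omega> \<in> space seed_space" "zcell n \<rho> h x \<omega> \<kappa> i \<noteq> 0" "1 \<le> n"
  shows "\<kappa> \<in> {cel n \<rho> h x i, Suc (cel n \<rho> h x i)}"
  using zcell_pos(2)[OF assms] by (auto simp: vv_def split: if_splits)

lemma zv_eq_sum:
  assumes "\<omega> \<in> space seed_space" "1 \<le> n" "finite C" "cel n \<rho> h x i \<in> C" "Suc (cel n \<rho> h x i) \<in> C"
  shows "zv n \<rho> h x \<omega> i = (\<Sum>\<kappa>\<in>C. zcell n \<rho> h x \<omega> \<kappa> i)"
proof -
  have "(\<Sum>\<kappa>\<in>C. zcell n \<rho> h x \<omega> \<kappa> i) = (\<Sum>\<kappa>\<in>{cel n \<rho> h x i, Suc (cel n \<rho> h x i)}. zcell n \<rho> h x \<omega> \<kappa> i)"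
    using assms zcell_cells[OF assms(1) _ assms(2)] by (intro sum.mono_neutral_right) auto
  then show ?thesis by (simp add: zv_def)
qed

lemma zv_nonneg: "0 \<le> zv n \<rho> h x \<omega> i" using zcell_nonneg by (simp add: zv_def)

text \<open>Origin of the cell length 1/2: a light item may win both of its cells. A heavy item is
  alone in its cell and keeps its own mass.\<close>

lemma zv_le_1:
  assumes om: "\<omega> \<in> space seed_space" and i: "i \<in> {1..n}"
  shows "zv n \<rho> h x \<omega> i \<le> 1"
proof (cases "x i < \<rho> / 2")
  case True
  have half: "zcell n \<rho> h x \<omega> \<kappa> i \<le> 1/2" if "\<kappa> mod cstride n < 2 * (n + 1)" for \<kappa>
    using vtot_light_cell[OF that] clamp_le by (simp add: zcell_def del: mult_Suc_right)
  have m: "cel n \<rho> h x i mod cstride n < 2 * (n + 1)" "Suc (cel n \<rho> h x i) mod cstride n < 2 * (n + 1)"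
    unfolding cel_block(3,4)[OF i] using cix_le[OF i, of "h i"] True by simp_all
  show ?thesis using half[OF m(1)] half[OF m(2)] by (simp add: zv_def)
next
  case False
  have n: "1 \<le> n" using i by auto
  have "vv n \<rho> h x (Suc (cel n \<rho> h x i)) i = 0" using False by (simp add: vv_def pc1_def)
  then have 1: "zcell n \<rho> h x \<omega> (Suc (cel n \<rho> h x i)) i = 0"
    using zcell_pos(2)[OF om _ n, of "Suc (cel n \<rho> h x i)" i] by (cases "zcell n \<rho> h x \<omega> (Suc (cel n \<rho> h x i)) i = 0") auto
  have hc: "2 * (n + 1) \<le> cel n \<rho> h x i mod cstride n" using cel_block[OF i] False by auto
  have "vtot n (vv n \<rho> h x (cel n \<rho> h x i)) = (\<Sum>j=1..n. if j = i then x i else 0)"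
    unfolding vtot_def
  proof (intro sum.cong refl)
    fix j assume j: "j \<in> {1..n}"
    have "cel n \<rho> h x i = h j * cstride n + 2 * (n + 1) + j \<longleftrightarrow> i = j" if "\<rho> / 2 \<le> x j"
    proof -
      have cj: "cel n \<rho> h x j = h j * cstride n + 2 * (n + 1) + j" using that by (simp add: cel_def)
      have "2 * (n + 1) + i = 2 * (n + 1) + j" if eq: "cel n \<rho> h x i = cel n \<rho> h x j"
      proof -
        have "cel n \<rho> h x i mod cstride n = cel n \<rho> h x j mod cstride n" using eq by (rule arg_cong)
        then show ?thesis unfolding cel_block(3)[OF i] cel_block(3)[OF j] using False \<open>\<rho> / 2 \<le> x j\<close> by simp
      qed
      then show ?thesis unfolding cj[symmetric] by auto
    qed
    then show "vv n \<rho> h x (cel n \<rho> h x i) j = (if j = i then x i else 0)"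
      unfolding vv_heavy_cell[OF j hc] using False by (cases "j = i") auto
  qed
  also have "\<dots> = x i" using i by simp
  finally have "zcell n \<rho> h x \<omega> (cel n \<rho> h x i) i \<le> x i" using x_range[OF i] by (simp add: zcell_def)
  then show ?thesis using 1 x_range[OF i] by (simp add: zv_def)
qed

lemma sum_vtot_cells: "finite C \<Longrightarrow> (cells n \<rho> h x) \<subseteq> C \<Longrightarrow> (\<Sum>\<kappa>\<in>C. vtot n (vv n \<rho> h x \<kappa>)) = vtot n x"
proof -
  assume C: "finite C" "(cells n \<rho> h x) \<subseteq> C"
  have "(\<Sum>\<kappa>\<in>C. vtot n (vv n \<rho> h x \<kappa>)) = (\<Sum>i=1..n. \<Sum>\<kappa>\<in>C. vv n \<rho> h x \<kappa> i)"
    unfolding vtot_def by (rule sum.swap)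
  also have "\<dots> = vtot n x" unfolding vtot_def
    by (rule sum.cong[OF refl], rule vv_sum[OF C(1)]) (use C(2) in \<open>auto simp: cells_def\<close>)
  finally show ?thesis .
qed

lemma sum_zcell:
  assumes "\<omega> \<in> space seed_space" "1 \<le> n"
  shows "(\<Sum>i=1..n. zcell n \<rho> h x \<omega> \<kappa> i) = vtot n (vv n \<rho> h x \<kappa>)"
proof (cases "vtot n (vv n \<rho> h x \<kappa>) = 0")
  case True
  then show ?thesis by (simp add: zcell_def)
next
  case False
  then have "0 < vtot n (vv n \<rho> h x \<kappa>)" using vtot_vv_nonneg[of \<kappa>] by simp
  from tk_in(1)[of n "vv n \<rho> h x \<kappa>", OF assms(2) vv_nonneg this assms(1)]
  show ?thesis by (simp add: zcell_def)
qed

lemma sum_zv: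
  assumes "\<omega> \<in> space seed_space" "1 \<le> n"
  shows "(\<Sum>i=1..n. zv n \<rho> h x \<omega> i) = (\<Sum>i=1..n. x i)"
proof -
  have "(\<Sum>i=1..n. zv n \<rho> h x \<omega> i) = (\<Sum>i=1..n. \<Sum>\<kappa>\<in>(cells n \<rho> h x). zcell n \<rho> h x \<omega> \<kappa> i)"
    by (intro sum.cong refl zv_eq_sum assms finite_cells) (auto simp: cells_def)
  also have "\<dots> = (\<Sum>\<kappa>\<in>(cells n \<rho> h x). vtot n (vv n \<rho> h x \<kappa>))"
    by (subst sum.swap) (simp only: sum_zcell[OF assms])
  finally show ?thesis using sum_vtot_cells[OF finite_cells order_refl] by (simp add: vtot_def)
qed

lemma SF_zv:
  assumes "1 \<le> n"
  shows "SF (\<lambda>\<omega>. zv n \<rho> h x \<omega> i)"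
proof -
  have S: "SF (tk n (vv n \<rho> h x \<kappa>))" for \<kappa> by (intro SF_tk assms vv_nonneg)
  have "SF (\<lambda>\<omega>. zcell n \<rho> h x \<omega> \<kappa> i)" for \<kappa>
    unfolding zcell_def by (rule SF_comp[OF S, where g="\<lambda>p. if snd p = i then vtot n (vv n \<rho> h x \<kappa>) else 0"])
  then show ?thesis unfolding zv_def by (intro SF_comp2[where k="(+)"])
qed

lemma zv_marginal:
  assumes "1 \<le> n" "i \<in> {1..n}"
  shows "(\<integral>\<omega>. zv n \<rho> h x \<omega> i \<partial>seed_space) = x i"
proof -
  have S: "SF (tk n (vv n \<rho> h x \<kappa>))" for \<kappa> by (intro SF_tk assms vv_nonneg)
  have S1: "SF (\<lambda>\<omega>. of_bool (snd (tk n (vv n \<rho> h x \<kappa>) \<omega>) = i) :: real)" for \<kappa>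
    by (rule SF_comp[OF S, where g="\<lambda>p. of_bool (snd p = i)"])
  have z: "zcell n \<rho> h x \<omega> \<kappa> i = vtot n (vv n \<rho> h x \<kappa>) * of_bool (snd (tk n (vv n \<rho> h x \<kappa>) \<omega>) = i)" for \<omega> \<kappa>
    by (simp add: zcell_def)
  have 1: "(\<integral>\<omega>. zcell n \<rho> h x \<omega> \<kappa> i \<partial>seed_space) = vv n \<rho> h x \<kappa> i" for \<kappa>
    unfolding z using tk_marginal[of n "vv n \<rho> h x \<kappa>" i, OF assms(1) vv_nonneg assms(2)] by simp
  have I: "integrable seed_space (\<lambda>\<omega>. zcell n \<rho> h x \<omega> \<kappa> i)" for \<kappa>
    unfolding z by (intro SF_integrable SF_comp[OF S1, where g="\<lambda>y. vtot n (vv n \<rho> h x \<kappa>) * y"])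
  show ?thesis unfolding zv_def using 1 I by (simp add: vv_def)
qed

lemma zv_cong_addrs:
  assumes "\<And>g i. i \<in> {1..n} \<Longrightarrow> \<omega> (saddr n g i) = \<omega>' (saddr n g i)"
  shows "zv n \<rho> h x \<omega> = zv n \<rho> h x \<omega>'"
  unfolding zv_def zcell_def using tk_cong_addrs[of n \<omega> \<omega>', OF assms] by simp

lemma light_le_bmass: "pre \<rho> h x b (Suc n) + (\<Sum>j\<in>{j\<in>{1..n}. h j = b \<and> \<not> x j < \<rho> / 2}. x j) = bmass n h x b"
proof -
  have "pre \<rho> h x b (Suc n) = (\<Sum>j\<in>{j\<in>{1..n}. h j = b \<and> x j < \<rho> / 2}. x j)"
    unfolding pre_def lmass_def by (subst sum.inter_filter[symmetric]) (auto intro!: sum.cong)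
  then show ?thesis unfolding bmass_def
    by (simp, subst sum.union_disjoint[symmetric]) (auto intro!: sum.cong)
qed

text \<open>A heavy item has mass at least \<open>\<rho> / 2\<close>, hence 1/4, so 4 times the
  heavy mass bounds their number. A light survivor is the token of a nonempty cell, and light mass L
  fills at most 2L + 1 cells.\<close>

lemma count_nonzero:
  assumes om: "\<omega> \<in> space seed_space" and n: "1 \<le> n"
  shows "real (card {j\<in>{1..n}. h j = b \<and> zv n \<rho> h x \<omega> j \<noteq> 0}) \<le> 4 * bmass n h x b + 1"
proof -
  let ?H = "{j\<in>{1..n}. h j = b \<and> \<not> x j < \<rho> / 2}"
  let ?L = "pre \<rho> h x b (Suc n)"
  have L0: "0 \<le> ?L" by (intro pre_nonneg) simp
  let ?T = "(\<lambda>c. snd (tk n (vv n \<rho> h x (b * cstride n + c)) \<omega>)) ` {..<nat \<lceil>2 * ?L\<rceil>}"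
  have sub: "{j\<in>{1..n}. h j = b \<and> zv n \<rho> h x \<omega> j \<noteq> 0} \<subseteq> ?H \<union> ?T"
  proof
    fix j assume "j \<in> {j\<in>{1..n}. h j = b \<and> zv n \<rho> h x \<omega> j \<noteq> 0}"
    then have j: "j \<in> {1..n}" "h j = b" "zv n \<rho> h x \<omega> j \<noteq> 0" by auto
    show "j \<in> ?H \<union> ?T"
    proof (cases "x j < \<rho> / 2")
      case True
      obtain \<kappa> where \<kappa>: "\<kappa> \<in> {cel n \<rho> h x j, Suc (cel n \<rho> h x j)}" "zcell n \<rho> h x \<omega> \<kappa> j \<noteq> 0"
        using j(3) unfolding zv_def by (cases "zcell n \<rho> h x \<omega> (cel n \<rho> h x j) j = 0") auto
      have m: "\<kappa> mod cstride n < 2 * (n + 1)" "\<kappa> div cstride n = b"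
        using \<kappa>(1) cel_block[OF j(1)] True j(2) cix_le[OF j(1), of "h j"] by auto
      note p = zcell_pos[OF om \<kappa>(2) n]
      have "0 < clamp (\<kappa> mod cstride n) ?L" using p(4) vtot_light_cell[OF m(1)] m(2) by simp
      then have "real (\<kappa> mod cstride n) < 2 * ?L" by (simp add: clamp_def max_def split: if_splits)
      then have "\<kappa> mod cstride n < nat \<lceil>2 * ?L\<rceil>" by linarith
      moreover have "\<kappa> = b * cstride n + \<kappa> mod cstride n" using m(2) by (metis div_mult_mod_eq)
      ultimately show ?thesis using p(3) by (metis (mono_tags, lifting) UnI2 image_eqI lessThan_iff)
    qed (use j in auto)
  qed
  have fin: "finite ?H" by simp
  have "real (card ?H) * (1/4) \<le> (\<Sum>j\<in>?H. x j)"
  proof -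
    have "(\<Sum>j\<in>?H. 1/4) \<le> (\<Sum>j\<in>?H. x j)" using \<rho> by (intro sum_mono) auto
    then show ?thesis by simp
  qed
  then have H: "real (card ?H) \<le> 4 * (bmass n h x b - ?L)" using light_le_bmass[of b] by simp
  have "card ?T \<le> nat \<lceil>2 * ?L\<rceil>" using card_image_le[of "{..<nat \<lceil>2 * ?L\<rceil>}"] by simp
  then have T: "real (card ?T) \<le> 2 * ?L + 1" using L0 by linarith
  have "card {j\<in>{1..n}. h j = b \<and> zv n \<rho> h x \<omega> j \<noteq> 0} \<le> card (?H \<union> ?T)"
    using fin by (intro card_mono[OF _ sub]) auto
  also have "\<dots> \<le> card ?H + card ?T" by (rule card_Un_le)
  finally have "real (card {j\<in>{1..n}. h j = b \<and> zv n \<rho> h x \<omega> j \<noteq> 0}) \<le> real (card ?H) + real (card ?T)" by simp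
  then show ?thesis using H T L0 by simp
qed

end

section \<open>Change of the cells when one coordinate grows\<close>

text \<open>The part of the interval from \<open>p\<close> to \<open>p + e\<close> beyond
  \<open>l\<close>. Moving a point by \<open>e\<close> changes its clamp by a difference of two such
  ramps, one for each end of the cell.\<close>

definition ramp :: "real \<Rightarrow> real \<Rightarrow> real \<Rightarrow> real" where
  "ramp l e p = max 0 (p + e - l) - max 0 (p - l)"

lemma ramp_mono: "0 \<le> e \<Longrightarrow> p \<le> q \<Longrightarrow> ramp l e p \<le> ramp l e q" by (simp add: ramp_def)

lemma ramp_range: "0 \<le> e \<Longrightarrow> 0 \<le> ramp l e p \<and> ramp l e p \<le> e" by (simp add: ramp_def max_def)

lemma clamp_shift: "0 \<le> e \<Longrightarrow> clamp c (p + e) - clamp c p = ramp (real c / 2) e p - ramp (real c / 2 + 1/2) e p"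
  by (simp add: clamp_def ramp_def max_def min_def)

lemma clamp_lipschitz: "0 \<le> e \<Longrightarrow> \<bar>clamp c (p + e) - clamp c p\<bar> \<le> e"
  by (simp add: clamp_def max_def min_def)

text \<open>A total variation: both ramps increase along the prefix sums and have values between 0
  and \<open>e\<close>, so each contributes at most \<open>e\<close>, however many items there
  are.\<close>

lemma abs_shift_sum:
  assumes e: "0 \<le> e" and mono: "\<And>j. j \<in> {a..n} \<Longrightarrow> p j \<le> p (Suc j)" and a: "a \<le> Suc n"
  shows "(\<Sum>j=a..n. \<bar>(clamp c (p (Suc j) + e) - clamp c (p (Suc j))) - (clamp c (p j + e) - clamp c (p j))\<bar>) \<le> 2 * e"
proof -
  let ?A = "\<lambda>j. ramp (real c / 2) e (p j)" and ?B = "\<lambda>j. ramp (real c / 2 + 1/2) e (p j)"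
  have "(\<Sum>j=a..n. \<bar>(clamp c (p (Suc j) + e) - clamp c (p (Suc j))) - (clamp c (p j + e) - clamp c (p j))\<bar>)
     \<le> (\<Sum>j=a..n. (?A (Suc j) - ?A j) + (?B (Suc j) - ?B j))"
  proof (rule sum_mono)
    fix j assume "j \<in> {a..n}"
    then have "?A j \<le> ?A (Suc j)" "?B j \<le> ?B (Suc j)" using ramp_mono[OF e mono] by auto
    then show "\<bar>(clamp c (p (Suc j) + e) - clamp c (p (Suc j))) - (clamp c (p j + e) - clamp c (p j))\<bar>
      \<le> (?A (Suc j) - ?A j) + (?B (Suc j) - ?B j)"
      unfolding clamp_shift[OF e] by linarith
  qed
  also have "\<dots> = (?A (Suc n) - ?A a) + (?B (Suc n) - ?B a)"
    unfolding sum.distrib using sum_Suc_diff[OF a, of ?A] sum_Suc_diff[OF a, of ?B] by simp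
  also have "\<dots> \<le> 2 * e"
    using ramp_range[OF e, of "real c / 2"] ramp_range[OF e, of "real c / 2 + 1/2"]
    by (smt (verit))
  finally show ?thesis .
qed

lemma cells_mem: "j \<in> {1..n} \<Longrightarrow> cel n \<rho> h w j \<in> cells n \<rho> h w" "j \<in> {1..n} \<Longrightarrow> Suc (cel n \<rho> h w j) \<in> cells n \<rho> h w"
  by (simp_all add: cells_def)

definition vdist :: "nat \<Rightarrow> real \<Rightarrow> (nat \<Rightarrow> nat) \<Rightarrow> (nat \<Rightarrow> real) \<Rightarrow> (nat \<Rightarrow> real) \<Rightarrow> real" where
  "vdist n \<rho> h x y = (\<Sum>\<kappa>\<in>cells n \<rho> h x \<union> cells n \<rho> h y. \<Sum>j=1..n. \<bar>vv n \<rho> h x \<kappa> j - vv n \<rho> h y \<kappa> j\<bar>)"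

context
  fixes n :: nat and \<rho> :: real and h :: "nat \<Rightarrow> nat" and x y :: "nat \<Rightarrow> real" and i :: nat and e :: real
  assumes x: "frac_vec n x" and y: "frac_vec n y" and \<rho>: "1/2 \<le> \<rho>" "\<rho> \<le> 1"
    and i: "i \<in> {1..n}" and yx: "y = x(i := x i + e)" and e: "0 \<le> e"
begin

lemma n_pos: "1 \<le> n" using i by auto

lemma pre_other: "b \<noteq> h i \<Longrightarrow> pre \<rho> h y b j = pre \<rho> h x b j"
  unfolding pre_def by (intro sum.cong) (auto simp: lmass_def yx)

lemma vv_same_other:
  assumes j: "j \<in> {1..n}" and k: "\<kappa> div cstride n \<noteq> h i"
  shows "vv n \<rho> h x \<kappa> j = vv n \<rho> h y \<kappa> j"
proof (cases "h j = h i")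
  case True
  then show ?thesis using vv_other_block[OF x \<rho> j] vv_other_block[OF y \<rho> j] k by simp
next
  case False
  then have "j \<noteq> i" by auto
  then have "x j = y j" "cel n \<rho> h x j = cel n \<rho> h y j" "pc1 \<rho> h x j = pc1 \<rho> h y j"
    using pre_other[OF False] by (simp_all add: yx cel_def pc1_def)
  then show ?thesis by (simp add: vv_def)
qed

lemma vdist_block:
  "vdist n \<rho> h x y = (\<Sum>\<kappa>\<in>{\<kappa>\<in>cells n \<rho> h x \<union> cells n \<rho> h y. \<kappa> div cstride n = h i}.
     \<Sum>j=1..n. \<bar>vv n \<rho> h x \<kappa> j - vv n \<rho> h y \<kappa> j\<bar>)"
  unfolding vdist_def
proof (rule sum.mono_neutral_right)
  show "\<forall>\<kappa>\<in>cells n \<rho> h x \<union> cells n \<rho> h y - {\<kappa>\<in>cells n \<rho> h x \<union> cells n \<rho> h y. \<kappa> div cstride n = h i}.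
     (\<Sum>j=1..n. \<bar>vv n \<rho> h x \<kappa> j - vv n \<rho> h y \<kappa> j\<bar>) = 0"
  proof
    fix \<kappa> assume "\<kappa> \<in> cells n \<rho> h x \<union> cells n \<rho> h y - {\<kappa>\<in>cells n \<rho> h x \<union> cells n \<rho> h y. \<kappa> div cstride n = h i}"
    then have k: "\<kappa> div cstride n \<noteq> h i" by blast
    show "(\<Sum>j=1..n. \<bar>vv n \<rho> h x \<kappa> j - vv n \<rho> h y \<kappa> j\<bar>) = 0"
      using vv_same_other[OF _ k] by (intro sum.neutral) simp
  qed
qed auto

lemma bmass_xy: "bmass n h y (h i) = bmass n h x (h i) + e"
proof -
  let ?A = "{j \<in> {1..n}. h j = h i}"
  have "sum y ?A = y i + sum y (?A - {i})" using i by (intro sum.remove) auto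
  also have "sum y (?A - {i}) = sum x (?A - {i})" by (intro sum.cong) (auto simp: yx)
  also have "y i = x i + e" by (simp add: yx)
  also have "x i + e + sum x (?A - {i}) = sum x ?A + e" using i by (subst sum.remove[of ?A i x]) auto
  finally show ?thesis unfolding bmass_def .
qed

text \<open>For the case that item \<open>i\<close> changes between light and heavy. No cell of the
  bucket need stay similar, so both bucket masses are paid; the small probability of this case makes
  up for it.\<close>

lemma vdist_crude: "vdist n \<rho> h x y \<le> 2 * bmass n h y (h i)"
proof -
  let ?C = "cells n \<rho> h x \<union> cells n \<rho> h y"
  let ?D = "{\<kappa>\<in>?C. \<kappa> div cstride n = h i}"
  have fin: "finite ?C" by (simp add: finite_cells)
  have one: "(\<Sum>\<kappa>\<in>?D. \<Sum>j=1..n. vv n \<rho> h w \<kappa> j) \<le> bmass n h w (h i)"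
    if w: "frac_vec n w" and sub: "cells n \<rho> h w \<subseteq> ?C" for w
  proof -
    have "(\<Sum>\<kappa>\<in>?D. \<Sum>j=1..n. vv n \<rho> h w \<kappa> j) = (\<Sum>j=1..n. \<Sum>\<kappa>\<in>?D. vv n \<rho> h w \<kappa> j)" by (rule sum.swap)
    also have "\<dots> \<le> (\<Sum>j=1..n. if h j = h i then w j else 0)"
    proof (rule sum_mono)
      fix j assume j: "j \<in> {1..n}"
      show "(\<Sum>\<kappa>\<in>?D. vv n \<rho> h w \<kappa> j) \<le> (if h j = h i then w j else 0)"
      proof (cases "h j = h i")
        case True
        have "(\<Sum>\<kappa>\<in>?D. vv n \<rho> h w \<kappa> j) \<le> (\<Sum>\<kappa>\<in>?C. vv n \<rho> h w \<kappa> j)"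
          by (intro sum_mono2[OF fin] vv_nonneg[OF w \<rho> j]) auto
        also have "\<dots> = w j" using cells_mem[OF j] sub by (intro vv_sum[OF w \<rho> fin]) blast+
        finally show ?thesis using True by simp
      next
        case False
        then have "vv n \<rho> h w \<kappa> j = 0" if "\<kappa> \<in> ?D" for \<kappa>
          using vv_other_block[OF w \<rho> j, of \<kappa>] that by simp
        then show ?thesis using False by simp
      qed
    qed
    also have "\<dots> = bmass n h w (h i)" unfolding bmass_def by (subst sum.inter_filter) auto
    finally show ?thesis .
  qed
  have "vdist n \<rho> h x y \<le> (\<Sum>\<kappa>\<in>?D. \<Sum>j=1..n. vv n \<rho> h x \<kappa> j + vv n \<rho> h y \<kappa> j)"
    unfolding vdist_block
  proof (intro sum_mono)
    fix \<kappa> j assume "j \<in> {1..n}"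
    then show "\<bar>vv n \<rho> h x \<kappa> j - vv n \<rho> h y \<kappa> j\<bar> \<le> vv n \<rho> h x \<kappa> j + vv n \<rho> h y \<kappa> j"
      using vv_nonneg[OF x \<rho>, of j h \<kappa>] vv_nonneg[OF y \<rho>, of j h \<kappa>] by linarith
  qed
  also have "\<dots> = (\<Sum>\<kappa>\<in>?D. \<Sum>j=1..n. vv n \<rho> h x \<kappa> j) + (\<Sum>\<kappa>\<in>?D. \<Sum>j=1..n. vv n \<rho> h y \<kappa> j)"
    by (simp only: sum.distrib)
  also have "\<dots> \<le> bmass n h x (h i) + bmass n h y (h i)"
    by (intro add_mono one x y) auto
  finally show ?thesis using bmass_xy e by simp
qed

lemma bmass_y_nonneg: "0 \<le> bmass n h y b"
  unfolding bmass_def using y by (intro sum_nonneg) (auto simp: frac_vec_def)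

lemma vdist_heavy:
  assumes hv: "\<rho> / 2 \<le> x i"
  shows "vdist n \<rho> h x y \<le> e"
proof -
  let ?C = "cells n \<rho> h x \<union> cells n \<rho> h y"
  have lm: "lmass \<rho> h y b j = lmass \<rho> h x b j" for b j using hv e by (auto simp: lmass_def yx)
  then have pr: "pre \<rho> h y b j = pre \<rho> h x b j" for b j by (simp add: pre_def)
  have same: "vv n \<rho> h x \<kappa> j = vv n \<rho> h y \<kappa> j" if "j \<noteq> i" for \<kappa> j
  proof -
    have yj: "y j = x j" using that by (simp add: yx)
    have "cel n \<rho> h y j = cel n \<rho> h x j" "pc1 \<rho> h y j = pc1 \<rho> h x j"
      unfolding cel_def pc1_def pr yj by (rule refl)+
    then show ?thesis unfolding vv_def yj by simp
  qed
  have ci: "cel n \<rho> h y i = cel n \<rho> h x i" using hv e by (simp add: cel_def yx)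
  have vi: "\<bar>vv n \<rho> h x \<kappa> i - vv n \<rho> h y \<kappa> i\<bar> = (if \<kappa> = cel n \<rho> h x i then e else 0)" for \<kappa>
    using hv e unfolding vv_def ci by (simp add: pc1_def yx)
  have inner: "(\<Sum>j=1..n. \<bar>vv n \<rho> h x \<kappa> j - vv n \<rho> h y \<kappa> j\<bar>) = (if \<kappa> = cel n \<rho> h x i then e else 0)" for \<kappa>
  proof -
    have "(\<Sum>j=1..n. \<bar>vv n \<rho> h x \<kappa> j - vv n \<rho> h y \<kappa> j\<bar>) = (\<Sum>j=1..n. if j = i then (if \<kappa> = cel n \<rho> h x i then e else 0) else 0)"
      by (intro sum.cong refl) (simp add: same vi)
    then show ?thesis using i by simp
  qed
  have "vdist n \<rho> h x y = (\<Sum>\<kappa>\<in>?C. if \<kappa> = cel n \<rho> h x i then e else 0)"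
    unfolding vdist_def inner ..
  also have "\<dots> \<le> e" using e by (simp add: finite_cells sum.delta)
  finally show ?thesis .
qed

text \<open>Every nonempty cell of the bucket may change, but each by at most 3e: \<open>e\<close>
  for item \<open>i\<close> and 2e for all shifted items together. There are at most 2L + 1 such
  cells.\<close>

lemma vdist_light:
  assumes lt: "y i < \<rho> / 2"
  shows "vdist n \<rho> h x y \<le> 3 * e * (2 * bmass n h y (h i) + 1)"
proof -
  let ?C = "cells n \<rho> h x \<union> cells n \<rho> h y"
  let ?b = "h i" and ?M = "cstride n"
  let ?L = "pre \<rho> h y ?b (Suc n)"
  let ?W = "\<lambda>\<kappa>. \<Sum>j=1..n. \<bar>vv n \<rho> h x \<kappa> j - vv n \<rho> h y \<kappa> j\<bar>"
  have ltx: "x i < \<rho> / 2" using lt e by (simp add: yx)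
  have lm: "lmass \<rho> h y ?b j = lmass \<rho> h x ?b j + (if j = i then e else 0)" for j
    using lt ltx by (auto simp: lmass_def yx)
  have pr: "pre \<rho> h y ?b j = pre \<rho> h x ?b j + (if i < j then e else 0)" for j
  proof -
    have "pre \<rho> h y ?b j = pre \<rho> h x ?b j + (\<Sum>k\<in>{1..<j}. if k = i then e else 0)"
      by (simp add: pre_def lm sum.distrib)
    then show ?thesis using i by (simp add: sum.delta)
  qed
  have heavy0: "?W \<kappa> = 0" if k: "2 * (n + 1) \<le> \<kappa> mod ?M" for \<kappa>
  proof (intro sum.neutral ballI)
    fix j assume j: "j \<in> {1..n}"
    show "\<bar>vv n \<rho> h x \<kappa> j - vv n \<rho> h y \<kappa> j\<bar> = 0"
      using vv_heavy_cell[OF x \<rho> j k, of h] vv_heavy_cell[OF y \<rho> j k, of h] lt ltx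
      by (cases "j = i") (simp_all add: yx del: mult_Suc_right)
  qed
  have light: "?W \<kappa> \<le> 3 * e" if c: "\<kappa> mod ?M = c" "c < 2 * (n + 1)" and b: "\<kappa> div ?M = ?b" for \<kappa> c
  proof -
    let ?p = "\<lambda>j. pre \<rho> h x ?b j"
    let ?t = "\<lambda>j. \<bar>vv n \<rho> h x \<kappa> j - vv n \<rho> h y \<kappa> j\<bar>"
    have t: "?t j = \<bar>(clamp c (?p (Suc j)) - clamp c (?p j)) - (clamp c (pre \<rho> h y ?b (Suc j)) - clamp c (pre \<rho> h y ?b j))\<bar>"
      if "j \<in> {1..n}" for j
      using vv_clamp[OF x \<rho> that c b] vv_clamp[OF y \<rho> that c b] by simp
    \<comment> \<open>Items before \<open>i\<close> keep their place, item \<open>i\<close> grows,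
      and all later items move by \<open>e\<close>.\<close>
    have "?W \<kappa> = sum ?t {1..i} + sum ?t {Suc i..n}"
      using i by (subst sum.union_disjoint[symmetric]) (auto intro!: sum.cong)
    also have "sum ?t {1..i} = ?t i"
    proof -
      have "?t j = 0" if "j \<in> {1..i} - {i}" for j
        using that i by (subst t) (auto simp: pr)
      then show ?thesis using i by (subst sum.remove[of _ i]) auto
    qed
    also have "?t i \<le> e"
    proof -
      have "?t i = \<bar>clamp c (?p (Suc i) + e) - clamp c (?p (Suc i))\<bar>"
        by (subst t[OF i]) (simp add: pr)
      then show ?thesis using clamp_lipschitz[OF e] by simp
    qed
    also have "sum ?t {Suc i..n} \<le> 2 * e"
    proof -
      have "sum ?t {Suc i..n} = (\<Sum>j=Suc i..n. \<bar>(clamp c (?p (Suc j) + e) - clamp c (?p (Suc j))) - (clamp c (?p j + e) - clamp c (?p j))\<bar>)"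
        using i by (intro sum.cong refl) (subst t, auto simp: pr)
      also have "\<dots> \<le> 2 * e"
        using i by (intro abs_shift_sum e pre_mono[OF x \<rho>]) auto
      finally show ?thesis .
    qed
    finally show ?thesis by simp
  qed
  have zero: "?W \<kappa> = 0" if c: "\<kappa> mod ?M = c" "c < 2 * (n + 1)" and b: "\<kappa> div ?M = ?b" and L: "2 * ?L \<le> real c" for \<kappa> c
  proof -
    have z: "clamp c (pre \<rho> h w ?b j) = 0" if "w = x \<or> w = y" "j \<le> Suc n" for w j
    proof -
      have "pre \<rho> h w ?b j \<le> pre \<rho> h y ?b j" using that(1) e by (auto simp: pr)
      also have "\<dots> \<le> ?L" using that by (intro pre_mono[OF y \<rho>]) auto
      finally show ?thesis using L by (simp add: clamp_def)
    qed
    show ?thesis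
    proof (intro sum.neutral ballI)
      fix j assume j: "j \<in> {1..n}"
      show "\<bar>vv n \<rho> h x \<kappa> j - vv n \<rho> h y \<kappa> j\<bar> = 0"
        using vv_clamp[OF x \<rho> j c b] vv_clamp[OF y \<rho> j c b] z[of x] z[of y] j by simp
    qed
  qed
  have L0: "0 \<le> ?L" by (intro pre_nonneg[OF y \<rho>]) simp
  have LB: "?L \<le> bmass n h y ?b"
  proof -
    have "0 \<le> (\<Sum>j\<in>{j\<in>{1..n}. h j = ?b \<and> \<not> y j < \<rho> / 2}. y j)"
      using y by (intro sum_nonneg) (auto simp: frac_vec_def)
    then show ?thesis using light_le_bmass[OF y \<rho>, of h ?b] by simp
  qed
  let ?D = "{\<kappa>\<in>?C. \<kappa> div ?M = ?b}"
  let ?I = "(\<lambda>c. ?b * ?M + c) ` {..<nat \<lceil>2 * ?L\<rceil>}"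
  have "vdist n \<rho> h x y = sum ?W ?D" by (rule vdist_block)
  also have "\<dots> \<le> (\<Sum>\<kappa>\<in>?D. if \<kappa> \<in> ?I then 3 * e else 0)"
  proof (rule sum_mono)
    fix \<kappa> assume k: "\<kappa> \<in> ?D"
    show "?W \<kappa> \<le> (if \<kappa> \<in> ?I then 3 * e else 0)"
    proof (cases "\<kappa> mod ?M < 2 * (n + 1)")
      case False
      then show ?thesis using heavy0[of \<kappa>] e by (simp del: mult_Suc_right)
    next
      case True
      show ?thesis
      proof (cases "2 * ?L \<le> real (\<kappa> mod ?M)")
        case L: True
        then show ?thesis using zero[OF refl True _ L] k e by auto
      next
        case False
        then have "\<kappa> mod ?M < nat \<lceil>2 * ?L\<rceil>" by linarith
        moreover have "\<kappa> = ?b * ?M + \<kappa> mod ?M" using k by (metis (mono_tags, lifting) div_mult_mod_eq mem_Collect_eq)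
        ultimately have "\<kappa> \<in> ?I" by blast
        then show ?thesis using light[OF refl True] k by (simp del: mult_Suc_right)
      qed
    qed
  qed
  also have "\<dots> \<le> (\<Sum>\<kappa>\<in>?I. 3 * e)"
  proof -
    have "finite ?D" by (simp add: finite_cells)
    then have "(\<Sum>\<kappa>\<in>?D. if \<kappa> \<in> ?I then 3 * e else 0) = (\<Sum>\<kappa>\<in>?D \<inter> ?I. 3 * e)"
      by (subst sum.inter_restrict) auto
    also have "\<dots> \<le> (\<Sum>\<kappa>\<in>?I. 3 * e)" using e by (intro sum_mono2) auto
    finally show ?thesis .
  qed
  also have "\<dots> = real (card ?I) * (3 * e)" by simp
  also have "\<dots> \<le> (2 * ?L + 1) * (3 * e)"
  proof (intro mult_right_mono)
    have "card ?I \<le> nat \<lceil>2 * ?L\<rceil>" using card_image_le[of "{..<nat \<lceil>2 * ?L\<rceil>}"] by simp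
    then show "real (card ?I) \<le> 2 * ?L + 1" using L0 by linarith
  qed (use e in simp)
  also have "\<dots> \<le> (2 * bmass n h y ?b + 1) * (3 * e)"
    using LB e by (intro mult_right_mono) auto
  finally show ?thesis by (simp add: mult.commute)
qed

lemma zv_other:
  assumes "j \<in> {1..n}" "h j \<noteq> h i"
  shows "zv n \<rho> h x \<omega> j = zv n \<rho> h y \<omega> j"
proof -
  have c: "cel n \<rho> h x j = cel n \<rho> h y j"
    using pre_other[OF assms(2)] assms(2) by (auto simp: cel_def yx)
  have b: "cel n \<rho> h x j div cstride n \<noteq> h i" "Suc (cel n \<rho> h x j) div cstride n \<noteq> h i"
    using cel_block[OF x \<rho> assms(1)] assms(2) by simp_all
  have "tk n (vv n \<rho> h x \<kappa>) \<omega> = tk n (vv n \<rho> h y \<kappa>) \<omega>" "vtot n (vv n \<rho> h x \<kappa>) = vtot n (vv n \<rho> h y \<kappa>)"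
    if "\<kappa> div cstride n \<noteq> h i" for \<kappa>
  proof -
    have "pass n (vv n \<rho> h x \<kappa>) g = pass n (vv n \<rho> h y \<kappa>) g" for g
      using vv_same_other[OF _ that] by (auto simp: pass_def simp del: upt_Suc)
    then show "tk n (vv n \<rho> h x \<kappa>) \<omega> = tk n (vv n \<rho> h y \<kappa>) \<omega>"
      by (simp add: tk_def entries_def del: upt_Suc cong: map_cong)
    show "vtot n (vv n \<rho> h x \<kappa>) = vtot n (vv n \<rho> h y \<kappa>)"
      unfolding vtot_def using vv_same_other[OF _ that] by (intro sum.cong) auto
  qed
  then show ?thesis using b unfolding zv_def zcell_def c by simp
qed

text \<open>For every cell the change of the surviving vector is at most the distance of the two
  tokens; by linearity the cells may be treated one by one.\<close>

lemma zv_dist: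
  "(\<integral>\<omega>. (\<Sum>j=1..n. \<bar>zv n \<rho> h x \<omega> j - zv n \<rho> h y \<omega> j\<bar>) \<partial>seed_space) \<le> 13 * vdist n \<rho> h x y"
proof -
  let ?C = "cells n \<rho> h x \<union> cells n \<rho> h y"
  let ?T = "\<lambda>\<kappa> \<omega>. tdist (tk n (vv n \<rho> h x \<kappa>) \<omega>) (tk n (vv n \<rho> h y \<kappa>) \<omega>)"
  have ST: "SF (?T \<kappa>)" for \<kappa>
    by (intro SF_comp2[where k=tdist] SF_tk n_pos vv_nonneg[OF x \<rho>] vv_nonneg[OF y \<rho>])
  have fin: "finite ?C" by (simp add: finite_cells)
  have "(\<integral>\<omega>. (\<Sum>j=1..n. \<bar>zv n \<rho> h x \<omega> j - zv n \<rho> h y \<omega> j\<bar>) \<partial>seed_space)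
     \<le> (\<integral>\<omega>. (\<Sum>\<kappa>\<in>?C. ?T \<kappa> \<omega>) \<partial>seed_space)"
  proof (rule integral_mono)
    show "integrable seed_space (\<lambda>\<omega>. \<Sum>j=1..n. \<bar>zv n \<rho> h x \<omega> j - zv n \<rho> h y \<omega> j\<bar>)"
      by (intro Bochner_Integration.integrable_sum SF_integrable
          SF_comp2[where k="\<lambda>p q. \<bar>p - q\<bar>"] SF_zv[OF x \<rho>] SF_zv[OF y \<rho>] n_pos)
    show "integrable seed_space (\<lambda>\<omega>. \<Sum>\<kappa>\<in>?C. ?T \<kappa> \<omega>)"
      by (intro Bochner_Integration.integrable_sum SF_integrable ST)
    fix \<omega> assume om: "\<omega> \<in> space seed_space"
    have "(\<Sum>j=1..n. \<bar>zv n \<rho> h x \<omega> j - zv n \<rho> h y \<omega> j\<bar>)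
      \<le> (\<Sum>j=1..n. \<Sum>\<kappa>\<in>?C. \<bar>zcell n \<rho> h x \<omega> \<kappa> j - zcell n \<rho> h y \<omega> \<kappa> j\<bar>)"
    proof (rule sum_mono)
      fix j assume j: "j \<in> {1..n}"
      have "zv n \<rho> h x \<omega> j = (\<Sum>\<kappa>\<in>?C. zcell n \<rho> h x \<omega> \<kappa> j)"
        by (rule zv_eq_sum[OF x \<rho> om n_pos fin]) (use j in \<open>auto simp: cells_def\<close>)
      moreover have "zv n \<rho> h y \<omega> j = (\<Sum>\<kappa>\<in>?C. zcell n \<rho> h y \<omega> \<kappa> j)"
        by (rule zv_eq_sum[OF y \<rho> om n_pos fin]) (use j in \<open>auto simp: cells_def\<close>)
      ultimately show "\<bar>zv n \<rho> h x \<omega> j - zv n \<rho> h y \<omega> j\<bar> \<le> (\<Sum>\<kappa>\<in>?C. \<bar>zcell n \<rho> h x \<omega> \<kappa> j - zcell n \<rho> h y \<omega> \<kappa> j\<bar>)"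
        by (simp add: sum_abs flip: sum_subtractf)
    qed
    also have "\<dots> = (\<Sum>\<kappa>\<in>?C. \<Sum>j=1..n. \<bar>zcell n \<rho> h x \<omega> \<kappa> j - zcell n \<rho> h y \<omega> \<kappa> j\<bar>)" by (rule sum.swap)
    also have "\<dots> \<le> (\<Sum>\<kappa>\<in>?C. ?T \<kappa> \<omega>)"
    proof (rule sum_mono)
      fix \<kappa>
      let ?X = "snd (tk n (vv n \<rho> h x \<kappa>) \<omega>)" and ?Y = "snd (tk n (vv n \<rho> h y \<kappa>) \<omega>)"
      let ?S = "vtot n (vv n \<rho> h x \<kappa>)" and ?R = "vtot n (vv n \<rho> h y \<kappa>)"
      have S: "0 \<le> ?S" "0 \<le> ?R" using vtot_vv_nonneg[OF x \<rho>] vtot_vv_nonneg[OF y \<rho>] by auto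
      have s: "(\<Sum>j=1..n. if j = a then c else 0) \<le> c" if "0 \<le> c" for c :: real and a
        using that by (simp add: sum.delta)
      show "(\<Sum>j=1..n. \<bar>zcell n \<rho> h x \<omega> \<kappa> j - zcell n \<rho> h y \<omega> \<kappa> j\<bar>) \<le> ?T \<kappa> \<omega>"
      proof (cases "?X = ?Y")
        case True
        have "(\<Sum>j=1..n. \<bar>zcell n \<rho> h x \<omega> \<kappa> j - zcell n \<rho> h y \<omega> \<kappa> j\<bar>) = (\<Sum>j=1..n. if j = ?X then \<bar>?S - ?R\<bar> else 0)"
          using True by (intro sum.cong) (auto simp: zcell_def)
        also have "\<dots> \<le> \<bar>?S - ?R\<bar>" by (rule s) simp
        finally show ?thesis using True by (simp add: tdist_def)
      next
        case False
        have "(\<Sum>j=1..n. \<bar>zcell n \<rho> h x \<omega> \<kappa> j - zcell n \<rho> h y \<omega> \<kappa> j\<bar>) \<le>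
            (\<Sum>j=1..n. (if j = ?X then ?S else 0) + (if j = ?Y then ?R else 0))"
          using S by (intro sum_mono) (auto simp: zcell_def)
        also have "\<dots> \<le> ?S + ?R" unfolding sum.distrib by (intro add_mono s S)
        finally show ?thesis using False by (simp add: tdist_def)
      qed
    qed
    finally show "(\<Sum>j=1..n. \<bar>zv n \<rho> h x \<omega> j - zv n \<rho> h y \<omega> j\<bar>) \<le> (\<Sum>\<kappa>\<in>?C. ?T \<kappa> \<omega>)" .
  qed
  also have "\<dots> = (\<Sum>\<kappa>\<in>?C. \<integral>\<omega>. ?T \<kappa> \<omega> \<partial>seed_space)"
    by (intro Bochner_Integration.integral_sum SF_integrable ST)
  also have "\<dots> \<le> (\<Sum>\<kappa>\<in>?C. 13 * (\<Sum>j=1..n. \<bar>vv n \<rho> h x \<kappa> j - vv n \<rho> h y \<kappa> j\<bar>))"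
    by (intro sum_mono tk_lipschitz n_pos vv_nonneg[OF x \<rho>] vv_nonneg[OF y \<rho>])
  also have "\<dots> = 13 * vdist n \<rho> h x y" by (simp add: vdist_def sum_distrib_left)
  finally show ?thesis .
qed

end

section \<open>The tree of buckets\<close>

text \<open>Residues modulo 8 keep the stages apart: 1 for hash values, 2 for drawings, 3 and 4 for
  the coins of caterpillars and binary tree. Address 0 determines \<open>\<rho>\<close>, and address
  5 is the coin at the root.\<close>

definition paddr :: "nat \<Rightarrow> nat" where "paddr i = 8 * i + 3"
definition taddr :: "nat \<Rightarrow> nat" where "taddr v = 8 * v + 4"
definition haddr :: "nat \<Rightarrow> nat" where "haddr i = 8 * i + 1"

definition btl :: "(nat \<Rightarrow> nat) \<Rightarrow> nat \<Rightarrow> nat list \<Rightarrow> tree" where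
  "btl h b is = foldl (\<lambda>t i. if h i = b then Node (paddr i) t (Leaf i) else t) Tip is"

text \<open>Heap order: the children of \<open>v\<close> are 2v and 2v + 1. With root 1 and depth
  \<open>d\<close>, bucket b is found at 2^d + b. The numbers supply both seed addresses and array
  positions.\<close>

fun ht :: "(nat \<Rightarrow> tree) \<Rightarrow> nat \<Rightarrow> nat \<Rightarrow> tree" where
  "ht B 0 v = B v"
| "ht B (Suc d) v = Node (taddr v) (ht B d (2 * v)) (ht B d (2 * v + 1))"

definition bucket_tree :: "nat \<Rightarrow> (nat \<Rightarrow> nat) \<Rightarrow> nat \<Rightarrow> tree" where
  "bucket_tree n h d = ht (\<lambda>v. btl h (v - 2 ^ d) [1..<Suc n]) d 1"

lemma btl_snoc: "btl h b (is @ [i]) = (if h i = b then Node (paddr i) (btl h b is) (Leaf i) else btl h b is)"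
  by (simp add: btl_def)

lemma btl_Nil [simp]: "btl h b [] = Tip" by (simp add: btl_def)

lemma leaves_btl: "leaves (btl h b is) = {i \<in> set is. h i = b}"
  by (induction "is" rule: rev_induct) (auto simp: btl_snoc)

lemma addrs_btl: "addrs (btl h b is) = paddr ` {i \<in> set is. h i = b}"
  by (induction "is" rule: rev_induct) (auto simp: btl_snoc)

lemma wf_btl: "distinct is \<Longrightarrow> wf_tree (btl h b is)"
  by (induction "is" rule: rev_induct) (auto simp: btl_snoc addrs_btl leaves_btl paddr_def)

text \<open>An item pays once when it joins as a right child, and afterwards only for later leaves
  of the bucket that lie in \<open>S\<close>.\<close>

lemma cnt_btl: "distinct is \<Longrightarrow> cnt S (btl h b is) i \<le> 1 + card {j \<in> set is. h j = b \<and> j \<in> S}"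
proof (induction "is" rule: rev_induct)
  case (snoc j js)
  let ?A = "\<lambda>js. {j \<in> set js. h j = b \<and> j \<in> S}"
  have IH: "cnt S (btl h b js) i \<le> 1 + card (?A js)" using snoc by simp
  have sub: "?A js \<subseteq> ?A (js @ [j])" by auto
  have le: "card (?A js) \<le> card (?A (js @ [j]))" by (rule card_mono[OF _ sub]) simp
  show ?case
  proof (cases "h j = b")
    case False
    then have "btl h b (js @ [j]) = btl h b js" by (simp add: btl_snoc)
    with IH have "cnt S (btl h b (js @ [j])) i \<le> 1 + card (?A js)" by simp
    then show ?thesis using le by linarith
  next
    case True
    show ?thesis
    proof (cases "i \<in> leaves (btl h b js) \<and> j \<in> S")
      case c: True
      have "j \<notin> ?A js" using snoc.prems by auto
      moreover have "?A (js @ [j]) = insert j (?A js)" using c True by auto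
      ultimately have "card (?A (js @ [j])) = Suc (card (?A js))" by simp
      then show ?thesis using IH True c by (simp add: btl_snoc)
    next
      case c: False
      then show ?thesis using IH le True by (auto simp: btl_snoc)
    qed
  qed
qed simp

text \<open>The descendants of \<open>v\<close> in heap order: deleting final binary digits of
  \<open>u\<close> leaves \<open>v\<close>.\<close>

definition below :: "nat \<Rightarrow> nat set" where
  "below v = {u. \<exists>k. u div 2 ^ k = v}"

lemma below_children_disjoint:
  assumes "1 \<le> v"
  shows "below (2 * v) \<inter> below (2 * v + 1) = {}"
proof -
  have False if a: "u div 2 ^ k = 2 * v" and b: "u div 2 ^ l = 2 * v + 1" for u k l :: nat
  proof (cases k l rule: linorder_cases)
    case less
    then obtain m where l: "l = k + Suc m" using less_imp_Suc_add by auto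
    have "u div 2 ^ l = u div 2 ^ k div 2 ^ Suc m" unfolding l power_add div_mult2_eq ..
    then have "2 * v + 1 = (2 * v) div 2 ^ Suc m" unfolding a b .
    then show False using div_le_dividend[of "2 * v" "2 ^ Suc m"] by linarith
  next
    case equal
    then show False using a b by simp
  next
    case greater
    then obtain m where k: "k = l + Suc m" using less_imp_Suc_add by auto
    have "u div 2 ^ k = u div 2 ^ l div 2 ^ Suc m" unfolding k power_add div_mult2_eq ..
    then have "2 * v = (2 * v + 1) div 2 ^ Suc m" unfolding a b .
    also have "\<dots> = (2 * v + 1) div 2 div 2 ^ m" by (simp only: power_Suc div_mult2_eq)
    also have "\<dots> \<le> v" using div_le_dividend[of "(2 * v + 1) div 2" "2 ^ m"] by simp
    finally show False using assms by simp
  qed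
  then show ?thesis by (auto simp: below_def)
qed

lemma below_child: "below (2 * v) \<subseteq> below v" "below (2 * v + 1) \<subseteq> below v"
proof -
  have "u div 2 ^ Suc k = v" if "u div 2 ^ k = 2 * v \<or> u div 2 ^ k = 2 * v + 1" for u k
  proof -
    have "u div 2 ^ Suc k = u div 2 ^ k div 2" by (metis div_mult2_eq power_Suc2)
    then show ?thesis using that by auto
  qed
  then show "below (2 * v) \<subseteq> below v" "below (2 * v + 1) \<subseteq> below v" unfolding below_def by blast+
qed

lemma below_self: "v \<in> below v" unfolding below_def by (auto intro: exI[of _ 0])

lemma below_ge: "u \<in> below v \<Longrightarrow> v \<le> u" unfolding below_def by auto

lemma ht_props:
  assumes "1 \<le> v"
    and B: "\<And>u. wf_tree (B u)"
    and dis: "\<And>u w. u \<noteq> w \<Longrightarrow> leaves (B u) \<inter> leaves (B w) = {} \<and> addrs (B u) \<inter> addrs (B w) = {}"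
    and ta: "\<And>u w. taddr w \<notin> addrs (B u)"
  shows "wf_tree (ht B d v) \<and> leaves (ht B d v) \<subseteq> (\<Union>u\<in>below v. leaves (B u))
    \<and> addrs (ht B d v) \<subseteq> (\<Union>u\<in>below v. addrs (B u)) \<union> taddr ` below v"
  using assms(1)
proof (induction d arbitrary: v)
  case 0
  have "leaves (B v) \<subseteq> (\<Union>u\<in>below v. leaves (B u))" "addrs (B v) \<subseteq> (\<Union>u\<in>below v. addrs (B u)) \<union> taddr ` below v"
    using below_self[of v] by blast+
  then show ?case using B[of v] by (simp only: ht.simps simp_thms)
next
  case (Suc d)
  let ?l = "ht B d (2 * v)" and ?r = "ht B d (2 * v + 1)"
  have "1 \<le> 2 * v" "1 \<le> 2 * v + 1" using Suc.prems by simp_all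
  note L = Suc.IH[OF this(1), THEN conjunct1] Suc.IH[OF this(1), THEN conjunct2, THEN conjunct1]
      Suc.IH[OF this(1), THEN conjunct2, THEN conjunct2]
    and R = Suc.IH[OF this(2), THEN conjunct1] Suc.IH[OF this(2), THEN conjunct2, THEN conjunct1]
      Suc.IH[OF this(2), THEN conjunct2, THEN conjunct2]
  note bd = below_children_disjoint[OF Suc.prems]
  have ne: "u \<noteq> w" if "u \<in> below (2 * v)" "w \<in> below (2 * v + 1)" for u w using bd that by blast
  have tinj: "taddr u = taddr w \<longleftrightarrow> u = w" for u w by (simp add: taddr_def)
  have dl: "leaves ?l \<inter> leaves ?r = {}"
  proof (rule ccontr)
    assume "\<not> ?thesis"
    then obtain i where i: "i \<in> leaves ?l" "i \<in> leaves ?r" by blast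
    obtain u where u: "u \<in> below (2 * v)" "i \<in> leaves (B u)" using L(2) i(1) by blast
    obtain w where w: "w \<in> below (2 * v + 1)" "i \<in> leaves (B w)" using R(2) i(2) by blast
    show False using dis[OF ne[OF u(1) w(1)]] u(2) w(2) by blast
  qed
  have da: "addrs ?l \<inter> addrs ?r = {}"
  proof (rule ccontr)
    assume "\<not> ?thesis"
    then obtain i where i: "i \<in> addrs ?l" "i \<in> addrs ?r" by blast
    then obtain u where u: "u \<in> below (2 * v)" "i \<in> addrs (B u) \<or> i = taddr u" using L(3) by blast
    obtain w where w: "w \<in> below (2 * v + 1)" "i \<in> addrs (B w) \<or> i = taddr w" using R(3) i by blast
    note d = dis[OF ne[OF u(1) w(1)]]
    from u(2) show False
    proof
      assume iu: "i \<in> addrs (B u)"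
      from w(2) show False
      proof
        assume "i \<in> addrs (B w)" then show False using iu d by blast
      next
        assume "i = taddr w" then show False using iu ta[of w u] by simp
      qed
    next
      assume iu: "i = taddr u"
      from w(2) show False
      proof
        assume "i \<in> addrs (B w)" then show False using iu ta[of u w] by simp
      next
        assume "i = taddr w" then show False using iu tinj[of u w] ne[OF u(1) w(1)] by simp
      qed
    qed
  qed
  have tv: "taddr v \<notin> addrs ?l" "taddr v \<notin> addrs ?r"
  proof -
    have "v \<notin> below (2 * v)" "v \<notin> below (2 * v + 1)" using below_ge[of v "2 * v"] below_ge[of v "2 * v + 1"] Suc.prems by auto
    then have 1: "taddr v \<notin> taddr ` below (2 * v)" "taddr v \<notin> taddr ` below (2 * v + 1)"
      by (auto simp: tinj)
    have 2: "taddr v \<notin> (\<Union>u\<in>W. addrs (B u))" for W using ta by simp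
    show "taddr v \<notin> addrs ?l" using L(3) 1(1) 2[of "below (2 * v)"] by blast
    show "taddr v \<notin> addrs ?r" using R(3) 1(2) 2[of "below (2 * v + 1)"] by blast
  qed
  have U: "(\<Union>u\<in>below (2 * v). F u) \<subseteq> (\<Union>u\<in>below v. F u)" "(\<Union>u\<in>below (2 * v + 1). F u) \<subseteq> (\<Union>u\<in>below v. F u)"
    for F :: "nat \<Rightarrow> nat set"
    by (rule UN_mono[OF below_child(1) order_refl], rule UN_mono[OF below_child(2) order_refl])
  have I: "taddr ` below (2 * v) \<subseteq> taddr ` below v" "taddr ` below (2 * v + 1) \<subseteq> taddr ` below v"
    by (rule image_mono[OF below_child(1)], rule image_mono[OF below_child(2)])
  have "wf_tree (ht B (Suc d) v)" unfolding ht.simps wf_tree.simps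
    by (intro conjI L(1) R(1) dl da tv)
  moreover have "leaves (ht B (Suc d) v) \<subseteq> (\<Union>u\<in>below v. leaves (B u))"
    unfolding ht.simps leaves.simps
    by (rule Un_least[OF order.trans[OF L(2) U(1)] order.trans[OF R(2) U(2)]])
  moreover have "addrs (ht B (Suc d) v) \<subseteq> (\<Union>u\<in>below v. addrs (B u)) \<union> taddr ` below v"
    unfolding ht.simps addrs.simps
    by (rule insert_subsetI[OF UnI2[OF imageI[OF below_self]]
        Un_least[OF order.trans[OF L(3) Un_mono[OF U(1) I(1)]] order.trans[OF R(3) Un_mono[OF U(2) I(2)]]]])
  ultimately show ?case by (intro conjI)
qed

lemma leaves_ht: "leaves (ht B d v) = (\<Union>u\<in>{v * 2 ^ d..<(v + 1) * 2 ^ d}. leaves (B u))"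
proof (induction d arbitrary: v)
  case (Suc d)
  have "{v * 2 ^ Suc d..<(v + 1) * 2 ^ Suc d} = {2 * v * 2 ^ d..<(2 * v + 1) * 2 ^ d} \<union> {(2 * v + 1) * 2 ^ d..<(2 * v + 1 + 1) * 2 ^ d}"
    by (subst ivl_disj_un_two(3)) (auto simp: algebra_simps)
  then show ?case using Suc by (simp add: UN_Un)
qed auto

lemma cnt_ht:
  assumes "\<And>u. cnt S (B u) i \<le> c u"  "\<And>u w. i \<in> leaves (B u) \<Longrightarrow> i \<in> leaves (B w) \<Longrightarrow> u = w"
    "\<And>u. i \<in> leaves (B u) \<Longrightarrow> c u \<le> m"
  shows "i \<in> leaves (ht B d v) \<Longrightarrow> cnt S (ht B d v) i \<le> d + m"
proof (induction d arbitrary: v)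
  case 0
  then show ?case using assms(1)[of v] assms(3)[of v] by simp
next
  case (Suc d)
  show ?case
  proof (cases "i \<in> leaves (ht B d (2 * v))")
    case True
    then show ?thesis using Suc.IH[OF True] by simp
  next
    case False
    then have "i \<in> leaves (ht B d (2 * v + 1))" using Suc.prems by simp
    then show ?thesis using Suc.IH[of "2 * v + 1"] False by simp
  qed
qed

lemma bucket_tree_props:
  assumes h: "\<And>i. i \<in> {1..n} \<Longrightarrow> h i < 2 ^ d"
  shows "wf_tree (bucket_tree n h d)" "leaves (bucket_tree n h d) = {1..n}" "5 \<notin> addrs (bucket_tree n h d)"
    "addrs (bucket_tree n h d) \<subseteq> range paddr \<union> range taddr"
    "i \<in> {1..n} \<Longrightarrow> cnt S (bucket_tree n h d) i \<le> d + (1 + card {j \<in> {1..n}. h j = h i \<and> j \<in> S})"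
proof -
  let ?B = "\<lambda>v. btl h (v - 2 ^ d) [1..<Suc n]"
  \<comment> \<open>Truncated subtraction would send every number below 2 ^ d to bucket 0 and spoil
    disjointness. The bottom of the tree never meets such numbers, so they may be set to
    \<open>Tip\<close>.\<close>
  let ?B' = "\<lambda>v. if v < 2 ^ d then Tip else ?B v"
  have eq: "ht ?B e v = ht ?B' e v" if "2 ^ d \<le> v * 2 ^ e" for e v
    using that
  proof (induction e arbitrary: v)
    case (Suc e)
    have "2 ^ d \<le> 2 * v * 2 ^ e" using Suc.prems by (simp add: algebra_simps)
    moreover have "2 * v * 2 ^ e \<le> (2 * v + 1) * 2 ^ e" by simp
    ultimately have "2 ^ d \<le> (2 * v) * 2 ^ e" "2 ^ d \<le> (2 * v + 1) * 2 ^ e" by linarith+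
    then show ?case using Suc.IH by simp
  qed simp
  have T: "bucket_tree n h d = ht ?B' d 1" unfolding bucket_tree_def by (rule eq) simp
  have set1: "set [1..<Suc n] = {1..n}" by auto
  have lB: "leaves (?B' u) = (if u < 2 ^ d then {} else {i \<in> {1..n}. h i = u - 2 ^ d})" for u
    by (cases "u < 2 ^ d") (simp_all only: if_True if_False leaves.simps leaves_btl set1)
  have aB: "addrs (?B' u) = (if u < 2 ^ d then {} else paddr ` {i \<in> {1..n}. h i = u - 2 ^ d})" for u
    by (cases "u < 2 ^ d") (simp_all only: if_True if_False addrs.simps addrs_btl set1)
  have dis: "leaves (?B' u) \<inter> leaves (?B' w) = {} \<and> addrs (?B' u) \<inter> addrs (?B' w) = {}" if "u \<noteq> w" for u w
    unfolding lB aB using that by (auto simp: paddr_def)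
  have ta: "taddr w \<notin> addrs (?B' u)" for u w unfolding aB by (auto simp: taddr_def paddr_def) presburger
  have wB: "wf_tree (?B' u)" for u by (simp add: wf_btl del: upt_Suc)
  have P: "wf_tree (ht ?B' d 1) \<and> leaves (ht ?B' d 1) \<subseteq> (\<Union>u\<in>below 1. leaves (?B' u))
    \<and> addrs (ht ?B' d 1) \<subseteq> (\<Union>u\<in>below 1. addrs (?B' u)) \<union> taddr ` below 1"
    by (rule ht_props[OF _ wB dis ta]) simp
  show "wf_tree (bucket_tree n h d)" using P T by simp
  have "\<exists>u\<in>{2 ^ d..<2 ^ d + 2 ^ d}. h i = u - 2 ^ d" if "i \<in> {1..n}" for i
    using h[OF that] by (intro bexI[of _ "h i + 2 ^ d"]) auto
  then show lv: "leaves (bucket_tree n h d) = {1..n}"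
    unfolding T leaves_ht lB by (auto split: if_splits)
  have "addrs (bucket_tree n h d) \<subseteq> (\<Union>u\<in>below 1. addrs (?B' u)) \<union> taddr ` below 1" using P T by simp
  moreover have "addrs (?B' u) \<subseteq> range paddr" for u unfolding aB by auto
  ultimately show ad: "addrs (bucket_tree n h d) \<subseteq> range paddr \<union> range taddr" by blast
  have "5 \<noteq> paddr i" "5 \<noteq> taddr i" for i unfolding paddr_def taddr_def by presburger+
  then show "5 \<notin> addrs (bucket_tree n h d)" using ad by blast
  assume i: "i \<in> {1..n}"
  show "cnt S (bucket_tree n h d) i \<le> d + (1 + card {j \<in> {1..n}. h j = h i \<and> j \<in> S})"
    unfolding T
  proof (rule cnt_ht)
    show "cnt S (?B' u) i \<le> 1 + card {j \<in> {1..n}. h j = u - 2 ^ d \<and> j \<in> S}" for u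
      using cnt_btl[of "[1..<Suc n]" S h "u - 2 ^ d" i] unfolding set1 by (cases "u < 2 ^ d") (simp_all del: upt_Suc)
    show "u = w" if "i \<in> leaves (?B' u)" "i \<in> leaves (?B' w)" for u w
      using dis[of u w] that by auto
    show "1 + card {j \<in> {1..n}. h j = u - 2 ^ d \<and> j \<in> S} \<le> 1 + card {j \<in> {1..n}. h j = h i \<and> j \<in> S}"
      if "i \<in> leaves (?B' u)" for u using that unfolding lB by (auto split: if_splits)
    show "i \<in> leaves (ht ?B' d 1)" using lv i T by simp
  qed
qed

section \<open>The algorithm and its stretch\<close>

lemma SF_pred:
  assumes "{\<omega> \<in> space seed_space. P \<omega>} \<in> sets seed_space"
  shows "SF P"
proof -
  have m': "{\<omega> \<in> space seed_space. \<not> P \<omega>} \<in> sets seed_space"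
    using sets.compl_sets[OF assms] by (auto simp: set_diff_eq intro: back_subst[where P="\<lambda>x. x \<in> sets seed_space"])
  have "P -` {b} \<inter> space seed_space \<in> sets seed_space" for b
    using assms m' by (cases b) (simp_all add: vimage_def Collect_conj_eq Int_commute)
  then show ?thesis unfolding simple_function_def by (auto intro: finite_subset[of _ UNIV])
qed

text \<open>Composes random stages: the finite-valued outcome of one stage selects the function for
  the next.\<close>

lemma SF_bind:
  assumes "SF d" "\<And>v. v \<in> d ` space seed_space \<Longrightarrow> SF (f v)"
  shows "SF (\<lambda>\<omega>. f (d \<omega>) \<omega>)"
  unfolding simple_function_def
proof safe
  have "(\<lambda>\<omega>. f (d \<omega>) \<omega>) ` space seed_space \<subseteq> (\<Union>v\<in>d ` space seed_space. f v ` space seed_space)" by auto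
  moreover have "finite \<dots>"
    by (rule finite_UN_I[OF simple_functionD(1)[OF assms(1)]], rule simple_functionD(1)[OF assms(2)])
  ultimately show "finite ((\<lambda>\<omega>. f (d \<omega>) \<omega>) ` space seed_space)" by (rule finite_subset)
  fix \<omega>0
  let ?c = "f (d \<omega>0) \<omega>0"
  have "(\<lambda>\<omega>. f (d \<omega>) \<omega>) -` {?c} \<inter> space seed_space
     = (\<Union>v\<in>d ` space seed_space. (d -` {v} \<inter> space seed_space) \<inter> (f v -` {?c} \<inter> space seed_space))" by auto
  also have "\<dots> \<in> sets seed_space"
    by (rule sets.finite_UN[OF simple_functionD(1)[OF assms(1)]], rule sets.Int,
      rule simple_functionD(2)[OF assms(1)], rule simple_functionD(2)[OF assms(2)])
  finally show "(\<lambda>\<omega>. f (d \<omega>) \<omega>) -` {?c} \<inter> space seed_space \<in> sets seed_space" .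
qed

lemma prob_coord:
  assumes "B \<in> sets borel"
  shows "seed.prob {\<omega> \<in> space seed_space. \<omega> a \<in> B} = measure lborel (B \<inter> {0..<1})"
proof -
  interpret P: product_prob_space "\<lambda>_::nat. restrict_space lborel {0..<1::real}" UNIV
    by (intro product_prob_spaceI prob_space_unit)
  have 0: "B \<inter> {0..<1} \<in> sets (restrict_space lborel {0..<1::real})"
    using assms by (auto simp: sets_restrict_space_iff)
  have "emeasure seed_space {\<omega> \<in> space seed_space. \<omega> a \<in> B \<inter> {0..<1}}
      = emeasure (restrict_space lborel {0..<1::real}) (B \<inter> {0..<1})"
    unfolding seed_space_def using P.emeasure_PiM_Collect_single[OF UNIV_I 0] .
  also have "\<dots> = emeasure lborel (B \<inter> {0..<1})"
    using assms by (subst emeasure_restrict_space) auto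
  also have "{\<omega> \<in> space seed_space. \<omega> a \<in> B \<inter> {0..<1}} = {\<omega> \<in> space seed_space. \<omega> a \<in> B}"
    by (auto simp: seed_bounds)
  finally show ?thesis by (simp add: measure_def)
qed

lemma SF_coord:
  assumes "B \<in> sets borel"
  shows "SF (\<lambda>\<omega>. \<omega> a \<in> B)"
proof (rule SF_pred)
  show "{\<omega> \<in> space seed_space. \<omega> a \<in> B} \<in> sets seed_space"
    using measurable_sets[OF seed_component_measurable assms, of a] by (simp add: vimage_def Int_def conj_commute)
qed

lemma integral_coord_interval:
  assumes "B \<in> sets borel" "B \<subseteq> {p..q}" "p \<le> q"
  shows "(\<integral>\<omega>. of_bool (\<omega> a \<in> B) \<partial>seed_space) \<le> q - p"
proof -
  have "(\<integral>\<omega>. of_bool (\<omega> a \<in> B) \<partial>seed_space) = (\<integral>\<omega>. indicator {\<omega> \<in> space seed_space. \<omega> a \<in> B} \<omega> \<partial>seed_space :: real)"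
    by (intro Bochner_Integration.integral_cong) (auto simp: indicator_def)
  also have "\<dots> = seed.prob {\<omega> \<in> space seed_space. \<omega> a \<in> B}"
    by (simp add: Int_absorb2)
  also have "\<dots> = measure lborel (B \<inter> {0..<1})" by (rule prob_coord[OF assms(1)])
  also have "\<dots> \<le> measure lborel {p..q}"
    using assms by (intro measure_mono_fmeasurable) (auto simp: fmeasurable_def)
  finally show ?thesis using assms(3) by simp
qed

definition rho :: "(nat \<Rightarrow> real) \<Rightarrow> real" where
  "rho \<omega> = (1 + \<omega> 0) / 2"

definition lev :: "real \<Rightarrow> real \<Rightarrow> nat" where
  "lev r s = (LEAST d. s \<le> 2 ^ d * r)"

text \<open>The leading \<open>d\<close> bits of a random real, so one seed cell serves every level.
  The value 0 outside the indices keeps the range of the function finite.\<close>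

definition hsh :: "nat \<Rightarrow> nat \<Rightarrow> (nat \<Rightarrow> real) \<Rightarrow> nat \<Rightarrow> nat" where
  "hsh n d \<omega> i = (if i \<in> {1..n} then nat \<lfloor>2 ^ d * \<omega> (haddr i)\<rfloor> else 0)"

definition zr :: "nat \<Rightarrow> real \<Rightarrow> (nat \<Rightarrow> nat) \<Rightarrow> (nat \<Rightarrow> real) \<Rightarrow> (nat \<Rightarrow> real) \<Rightarrow> nat \<Rightarrow> real" where
  "zr n \<rho> h x \<omega> i = (if i \<in> {1..n} then zv n \<rho> h x \<omega> i else 0)"

definition Aset :: "nat \<Rightarrow> nat \<Rightarrow> (nat \<Rightarrow> nat) \<Rightarrow> (nat \<Rightarrow> real) \<Rightarrow> (nat \<Rightarrow> real) \<Rightarrow> nat set" where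
  "Aset n d h z \<omega> = rounding z 5 (bucket_tree n h d) \<omega>"

text \<open>The algorithm with \<open>\<rho>\<close> and the level frozen, as needed after
  conditioning on address 0.\<close>

definition Asub :: "nat \<Rightarrow> real \<Rightarrow> nat \<Rightarrow> (nat \<Rightarrow> real) \<Rightarrow> (nat \<Rightarrow> real) \<Rightarrow> nat set" where
  "Asub n \<rho> d \<omega> x = Aset n d (hsh n d \<omega>) (zr n \<rho> (hsh n d \<omega>) x \<omega>) \<omega>"

definition Alg :: "nat \<Rightarrow> (nat \<Rightarrow> real) \<Rightarrow> (nat \<Rightarrow> real) \<Rightarrow> nat set" where
  "Alg n \<omega> x = Asub n (rho \<omega>) (lev (rho \<omega>) (vtot n x)) \<omega> x"

lemma rho_range: "\<omega> \<in> space seed_space \<Longrightarrow> 1/2 \<le> rho \<omega>" "\<omega> \<in> space seed_space \<Longrightarrow> rho \<omega> \<le> 1"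
  using seed_bounds[of \<omega> 0] by (simp_all add: rho_def)

lemma hsh_less: "\<omega> \<in> space seed_space \<Longrightarrow> hsh n d \<omega> i < 2 ^ d"
proof -
  assume om: "\<omega> \<in> space seed_space"
  have "2 ^ d * \<omega> (haddr i) < 2 ^ d * 1" "0 \<le> 2 ^ d * \<omega> (haddr i)"
    using seed_bounds[OF om, of "haddr i"] by (auto intro!: mult_strict_left_mono)
  then have "\<lfloor>2 ^ d * \<omega> (haddr i)\<rfloor> < 2 ^ d" "0 \<le> \<lfloor>2 ^ d * \<omega> (haddr i)\<rfloor>"
    by (simp_all add: floor_less_iff)
  then show ?thesis by (simp add: hsh_def nat_less_iff)
qed

lemma lev_props:
  assumes r: "1/2 \<le> r" and D: "s \<le> 2 ^ D / 2"
  shows "s \<le> 2 ^ lev r s * r" "lev r s \<le> D" "d < lev r s \<Longrightarrow> 2 ^ d * r < s"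
proof -
  have "2 ^ D * (1/2) \<le> 2 ^ D * r" using r by (intro mult_left_mono) auto
  then have *: "s \<le> 2 ^ D * r" using D by linarith
  then show "s \<le> 2 ^ lev r s * r" unfolding lev_def by (rule LeastI)
  show "lev r s \<le> D" unfolding lev_def using * by (rule Least_le)
  show "2 ^ d * r < s" if "d < lev r s" using not_less_Least[OF that[unfolded lev_def]] by simp
qed

lemma mod8: "haddr i mod 8 = 1" "saddr n g i mod 8 = 2" "paddr i mod 8 = 3" "taddr i mod 8 = 4"
  unfolding haddr_def saddr_def paddr_def taddr_def by presburger+

text \<open>The addresses of the hash values; \<open>H1\<close> collects those of the
  drawings.\<close>

definition "H0 = {a::nat. a mod 8 = 1}"
definition "H1 = {a::nat. a mod 8 = 2}"

lemma hsh_comb: "hsh n d (comb {0} \<omega>0 \<omega>) = hsh n d \<omega>" "hsh n d (comb H0 \<omega> \<omega>') = hsh n d \<omega>"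
  by (auto simp: hsh_def comb_def H0_def mod8 haddr_def fun_eq_iff)

lemma zr_cong:
  assumes "frac_vec n x" "1/2 \<le> \<rho>" "\<rho> \<le> 1" "\<And>g i. \<omega> (saddr n g i) = \<omega>' (saddr n g i)"
  shows "zr n \<rho> h x \<omega> = zr n \<rho> h x \<omega>'"
  using zv_cong_addrs[OF assms(1-3), of \<omega> \<omega>' h] assms(4) by (auto simp: zr_def fun_eq_iff)

lemma zr_comb:
  assumes "frac_vec n x" "1/2 \<le> \<rho>" "\<rho> \<le> 1"
  shows "zr n \<rho> h x (comb {0} \<omega>0 \<omega>) = zr n \<rho> h x \<omega>" "zr n \<rho> h x (comb H0 \<omega>0 \<omega>) = zr n \<rho> h x \<omega>"
    "zr n \<rho> h x (comb H1 \<omega> \<omega>') = zr n \<rho> h x \<omega>"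
proof -
  show "zr n \<rho> h x (comb {0} \<omega>0 \<omega>) = zr n \<rho> h x \<omega>"
    by (rule zr_cong[OF assms]) (simp add: comb_def saddr_def)
  show "zr n \<rho> h x (comb H0 \<omega>0 \<omega>) = zr n \<rho> h x \<omega>" "zr n \<rho> h x (comb H1 \<omega> \<omega>') = zr n \<rho> h x \<omega>"
    by (rule zr_cong[OF assms], simp add: comb_def H0_def H1_def mod8)+
qed

lemma Aset_comb:
  assumes h: "\<And>i. i \<in> {1..n} \<Longrightarrow> h i < 2 ^ d"
  shows "Aset n d h z (comb {0} \<omega>0 \<omega>) = Aset n d h z \<omega>" "Aset n d h z (comb H0 \<omega>0 \<omega>) = Aset n d h z \<omega>"
    "Aset n d h z (comb H1 \<omega>0 \<omega>) = Aset n d h z \<omega>"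
proof -
  have c: "Aset n d h z \<omega>' = Aset n d h z \<omega>" if a: "\<And>a. a mod 8 \<in> {3, 4, 5} \<Longrightarrow> \<omega>' a = \<omega> a" for \<omega> \<omega>'
  proof -
    have "sel lam z \<omega>' (bucket_tree n h d) b = sel lam z \<omega> (bucket_tree n h d) b" for lam b
    proof (rule sel_cong_addrs)
      fix a' assume "a' \<in> addrs (bucket_tree n h d)"
      then have "a' \<in> range paddr \<union> range taddr" using bucket_tree_props(4)[of n h d, OF h] by blast
      then have "a' mod 8 \<in> {3, 4, 5}" using mod8 by auto
      then show "\<omega>' a' = \<omega> a'" by (rule a)
    qed
    moreover have "\<omega>' 5 = \<omega> 5" by (rule a) simp
    ultimately show ?thesis by (simp add: Aset_def final_def)
  qed
  show "Aset n d h z (comb {0} \<omega>0 \<omega>) = Aset n d h z \<omega>" "Aset n d h z (comb H0 \<omega>0 \<omega>) = Aset n d h z \<omega>"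
    "Aset n d h z (comb H1 \<omega>0 \<omega>) = Aset n d h z \<omega>"
    by (rule c; auto simp: comb_def H0_def H1_def)+
qed

lemma zr_range:
  assumes "frac_vec n x" "1/2 \<le> \<rho>" "\<rho> \<le> 1" "\<omega> \<in> space seed_space"
  shows "0 \<le> zr n \<rho> h x \<omega> i" "zr n \<rho> h x \<omega> i \<le> 1"
  using zv_nonneg[OF assms(1-3)] zv_le_1[OF assms(1-3) assms(4)] by (simp_all add: zr_def)

lemma SF_zr:
  assumes "frac_vec n x" "1/2 \<le> \<rho>" "\<rho> \<le> 1" "1 \<le> n"
  shows "SF (zr n \<rho> h x)"
proof -
  have "SF (\<lambda>\<omega>. (\<lambda>i. if i \<in> {1..n} then zv n \<rho> h x \<omega> i else 0))"
    by (intro SF_finite_fun SF_zv assms) simp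
  then show ?thesis by (simp add: zr_def[abs_def])
qed

lemma SF_hsh: "SF (hsh n d)"
proof -
  have "SF (\<lambda>\<omega>. nat \<lfloor>2 ^ d * \<omega> (haddr i)\<rfloor>)" if "i \<in> {1..n}" for i
  proof (rule SF_finite_range)
    have "(\<lambda>\<omega>. \<lfloor>2 ^ d * \<omega> (haddr i)\<rfloor>) \<in> measurable seed_space (count_space UNIV)"
      using seed_component_measurable by measurable
    then show "(\<lambda>\<omega>. nat \<lfloor>2 ^ d * \<omega> (haddr i)\<rfloor>) \<in> measurable seed_space (count_space UNIV)"
      by (rule measurable_compose) simp
    have "(\<lambda>\<omega>. nat \<lfloor>2 ^ d * \<omega> (haddr i)\<rfloor>) ` space seed_space \<subseteq> {..<2 ^ d}"
      using hsh_less[of _ n d i] that by (auto simp: hsh_def)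
    then show "finite ((\<lambda>\<omega>. nat \<lfloor>2 ^ d * \<omega> (haddr i)\<rfloor>) ` space seed_space)"
      by (rule finite_subset) simp
  qed
  then have "SF (\<lambda>\<omega>. (\<lambda>i. if i \<in> {1..n} then nat \<lfloor>2 ^ d * \<omega> (haddr i)\<rfloor> else 0))"
    by (intro SF_finite_fun) simp_all
  then show ?thesis by (simp add: hsh_def[abs_def])
qed

lemma SF_Aset:
  assumes "\<And>i. i \<in> {1..n} \<Longrightarrow> h i < 2 ^ d" "\<And>i. i \<in> {1..n} \<Longrightarrow> 0 \<le> z i \<and> z i \<le> 1"
  shows "SF (Aset n d h z)"
proof -
  have "valid (mlab z) z (bucket_tree n h d)"
    using assms(2) bucket_tree_props(2)[of n h d, OF assms(1)] by (intro valid_mlab) simp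
  then show ?thesis unfolding Aset_def[abs_def] by (rule SF_final)
qed

lemma SF_Asub:
  assumes "frac_vec n x" "1/2 \<le> \<rho>" "\<rho> \<le> 1" "1 \<le> n"
  shows "SF (\<lambda>\<omega>. Asub n \<rho> d \<omega> x)"
  unfolding Asub_def
proof (rule SF_bind[OF SF_hsh, where f="\<lambda>h \<omega>. Aset n d h (zr n \<rho> h x \<omega>) \<omega>"])
  fix h assume "h \<in> hsh n d ` space seed_space"
  then have h: "h i < 2 ^ d" for i using hsh_less by auto
  show "SF (\<lambda>\<omega>. Aset n d h (zr n \<rho> h x \<omega>) \<omega>)"
  proof (rule SF_bind[OF SF_zr[OF assms], where f="\<lambda>z \<omega>. Aset n d h z \<omega>"])
    fix z assume "z \<in> zr n \<rho> h x ` space seed_space"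
    then show "SF (Aset n d h z)" using zr_range[OF assms(1-3)] h by (intro SF_Aset) auto
  qed
qed

lemma Aset_zr_comb:
  assumes x: "frac_vec n x" and \<rho>: "1/2 \<le> \<rho>" "\<rho> \<le> 1" and h: "\<And>i. i \<in> {1..n} \<Longrightarrow> h i < 2 ^ d"
  shows "Aset n d h (zr n \<rho> h x (comb H1 \<omega> \<omega>')) (comb H1 \<omega> \<omega>') = Aset n d h (zr n \<rho> h x \<omega>) \<omega>'"
  unfolding zr_comb(3)[OF x \<rho>] by (rule Aset_comb(3)[OF h])

lemma Asub_comb:
  assumes x: "frac_vec n x" and \<rho>: "1/2 \<le> \<rho>" "\<rho> \<le> 1" and om: "\<omega> \<in> space seed_space"
  shows "Asub n \<rho> d (comb {0} \<omega>0 \<omega>) x = Asub n \<rho> d \<omega> x"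
    "Asub n \<rho> d (comb H0 \<omega> \<omega>') x = Aset n d (hsh n d \<omega>) (zr n \<rho> (hsh n d \<omega>) x \<omega>') \<omega>'"
  unfolding Asub_def hsh_comb zr_comb[OF x \<rho>]
  by (rule Aset_comb(1) Aset_comb(2), rule hsh_less[OF om])+

section \<open>Stretch for fixed hash values\<close>

context
  fixes n :: nat and \<rho> :: real
  assumes n: "1 \<le> n" and \<rho>: "1/2 \<le> \<rho>" "\<rho> \<le> 1"
begin

text \<open>\<open>13 * vdist\<close> bounds the expected movement of the surviving vector, all of
  it inside one bucket. A leaf there lies below at most \<open>d\<close> tree merges, its own
  caterpillar merge, and one per item surviving for \<open>x\<close> or \<open>y\<close>; the latter
  number at most 8Z + 2. Inserted into 3 + 2L this gives the last factor.\<close>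

lemma stretch_fixed_hash:
  assumes h: "\<And>i. i \<in> {1..n} \<Longrightarrow> h i < 2 ^ d"
    and x: "frac_vec n x" and y: "frac_vec n y"
    and i: "i \<in> {1..n}" and yx: "y = x(i := x i + e)" and e: "0 \<le> e"
  shows "(\<integral>\<omega>. sdc (Aset n d h (zr n \<rho> h x \<omega>) \<omega>) (Aset n d h (zr n \<rho> h y \<omega>) \<omega>) \<partial>seed_space)
    \<le> 13 * vdist n \<rho> h x y * (2 * real d + 9 + 16 * bmass n h y (h i))"
proof -
  let ?Z = "bmass n h y (h i)"
  let ?F = "\<lambda>\<omega>. sdc (Aset n d h (zr n \<rho> h x \<omega>) \<omega>) (Aset n d h (zr n \<rho> h y \<omega>) \<omega>)"
  let ?B = "2 * real d + 9 + 16 * ?Z"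
  have SA: "SF (\<lambda>\<omega>. Aset n d h (zr n \<rho> h w \<omega>) \<omega>)" if "frac_vec n w" for w
  proof (rule SF_bind[OF SF_zr[OF that \<rho> n], where f="\<lambda>z \<omega>. Aset n d h z \<omega>"])
    fix z assume "z \<in> zr n \<rho> h w ` space seed_space"
    then show "SF (Aset n d h z)" using zr_range[OF that \<rho>] h by (intro SF_Aset) auto
  qed
  have SZ: "SF (\<lambda>\<omega>. zr n \<rho> h w \<omega> j)" if "frac_vec n w" for w j
    by (rule SF_comp[OF SF_zr[OF that \<rho> n], where g="\<lambda>z. z j"])
  have Zx: "bmass n h x (h i) \<le> ?Z" using bmass_xy[OF x y \<rho> i yx e] e by simp
  have Z0: "0 \<le> ?Z" by (rule bmass_y_nonneg[OF x y \<rho> i yx e])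
  have "(\<integral>\<omega>. ?F \<omega> \<partial>seed_space) \<le> (\<integral>\<omega>. (\<Sum>j=1..n. \<bar>zr n \<rho> h x \<omega> j - zr n \<rho> h y \<omega> j\<bar>) * ?B \<partial>seed_space)"
  proof (rule integral_split_le[where H=H1])
    show "SF ?F" by (intro SF_comp2[where k=sdc] SA x y)
    show "SF (\<lambda>\<omega>. (\<Sum>j=1..n. \<bar>zr n \<rho> h x \<omega> j - zr n \<rho> h y \<omega> j\<bar>) * ?B)"
      by (rule SF_comp2[OF SF_zr[OF x \<rho> n] SF_zr[OF y \<rho> n], where k="\<lambda>z z'. (\<Sum>j=1..n. \<bar>z j - z' j\<bar>) * ?B"])
    fix \<omega> assume om: "\<omega> \<in> space seed_space"
    let ?z = "zr n \<rho> h x \<omega>" and ?z' = "zr n \<rho> h y \<omega>"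
    let ?t = "bucket_tree n h d"
    let ?S = "{j. ?z j \<noteq> 0 \<or> ?z' j \<noteq> 0}"
    note bt = bucket_tree_props[of n h d, OF h]
    have "(\<integral>\<omega>'. ?F (comb H1 \<omega> \<omega>') \<partial>seed_space)
       = (\<integral>\<omega>'. sdc (rounding ?z 5 ?t \<omega>') (rounding ?z' 5 ?t \<omega>') \<partial>seed_space)"
    proof -
      have a: "Aset n d h (zr n \<rho> h v (comb H1 \<omega> \<omega>')) (comb H1 \<omega> \<omega>') = Aset n d h (zr n \<rho> h v \<omega>) \<omega>'"
        if "frac_vec n v" for v \<omega>'
        by (rule Aset_zr_comb[OF that \<rho>]) (rule h)
      show ?thesis unfolding a[OF x] a[OF y] by (simp only: Aset_def)
    qed
    also have "\<dots> \<le> (\<Sum>j\<in>leaves ?t. \<bar>?z j - ?z' j\<bar>) * (3 + 2 * (real d + 3 + 8 * ?Z))"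
    proof (rule rounding_lipschitz)
      show "wf_tree ?t" "5 \<notin> addrs ?t" by (rule bt, assumption)+
      show "0 \<le> ?z j \<and> ?z j \<le> 1" "0 \<le> ?z' j \<and> ?z' j \<le> 1" for j
        using zr_range[OF x \<rho> om] zr_range[OF y \<rho> om] by simp_all
      show "?z j = 0 \<and> ?z' j = 0" if "j \<notin> ?S" for j using that by simp
      show "0 \<le> real d + 3 + 8 * ?Z" using Z0 by simp
      fix j assume j: "j \<in> leaves ?t" "?z j \<noteq> ?z' j"
      then have j1: "j \<in> {1..n}" using bt(2) by simp
      have hj: "h j = h i"
      proof (rule ccontr)
        assume "h j \<noteq> h i"
        then show False using zv_other[OF x y \<rho> i yx e j1, of h \<omega>] j(2) j1 by (simp add: zr_def)
      qed
      let ?N = "\<lambda>w. {j \<in> {1..n}. h j = h i \<and> zv n \<rho> h w \<omega> j \<noteq> 0}"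
      have "card {k \<in> {1..n}. h k = h j \<and> k \<in> ?S} \<le> card (?N x \<union> ?N y)"
        unfolding hj by (intro card_mono) (auto simp: zr_def)
      also have "\<dots> \<le> card (?N x) + card (?N y)" by (rule card_Un_le)
      finally have "real (card {k \<in> {1..n}. h k = h j \<and> k \<in> ?S}) \<le> real (card (?N x)) + real (card (?N y))" by linarith
      also have "\<dots> \<le> (4 * bmass n h x (h i) + 1) + (4 * ?Z + 1)"
        by (intro add_mono count_nonzero[OF x \<rho> om n] count_nonzero[OF y \<rho> om n])
      finally have "real (card {k \<in> {1..n}. h k = h j \<and> k \<in> ?S}) \<le> 8 * ?Z + 2" using Zx by simp
      moreover have "cnt ?S ?t j \<le> d + (1 + card {k \<in> {1..n}. h k = h j \<and> k \<in> ?S})" by (rule bt(5)[OF _ j1])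
      ultimately show "real (cnt ?S ?t j) \<le> real d + 3 + 8 * ?Z" by linarith
    qed
    also have "leaves ?t = {1..n}" by (rule bt(2))
    finally show "(\<integral>\<omega>'. ?F (comb H1 \<omega> \<omega>') \<partial>seed_space) \<le> (\<Sum>j=1..n. \<bar>?z j - ?z' j\<bar>) * ?B"
      by (simp add: algebra_simps)
  qed
  also have "\<dots> = (\<integral>\<omega>. (\<Sum>j=1..n. \<bar>zv n \<rho> h x \<omega> j - zv n \<rho> h y \<omega> j\<bar>) \<partial>seed_space) * ?B"
    by (simp add: zr_def)
  also have "\<dots> \<le> (13 * vdist n \<rho> h x y) * ?B"
    using Z0 by (intro mult_right_mono zv_dist[OF x y \<rho> i yx e]) auto
  finally show ?thesis .
qed

end

section \<open>Averaging over the hash values\<close>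

lemma hash_prob:
  assumes j: "j \<in> {1..n}" and b: "b < 2 ^ d" and Y: "SF (Y :: _ \<Rightarrow> real)" "indep_of Y (haddr j)"
  shows "(\<integral>\<omega>. of_bool (hsh n d \<omega> j = b) * Y \<omega> \<partial>seed_space) = (\<integral>\<omega>. Y \<omega> \<partial>seed_space) / 2 ^ d"
proof -
  let ?a = "haddr j"
  let ?p = "real b / 2 ^ d" and ?q = "real (Suc b) / 2 ^ d"
  have q1: "?q \<le> 1"
  proof -
    have "real (Suc b) \<le> real (2 ^ d)" using b by (simp only: of_nat_le_iff Suc_le_eq)
    then show ?thesis by simp
  qed
  have p0: "0 \<le> ?p" "?p \<le> ?q" by (simp_all add: divide_right_mono)
  have ev: "of_bool (hsh n d \<omega> j = b) = (of_bool (\<omega> ?a < ?q) - of_bool (\<omega> ?a < ?p) :: real)"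
    if "\<omega> \<in> space seed_space" for \<omega>
  proof -
    have u: "0 \<le> 2 ^ d * \<omega> ?a" using seed_bounds[OF that] by simp
    have "hsh n d \<omega> j = b \<longleftrightarrow> \<lfloor>2 ^ d * \<omega> ?a\<rfloor> = int b" using j u by (auto simp: hsh_def)
    also have "\<dots> \<longleftrightarrow> real b \<le> 2 ^ d * \<omega> ?a \<and> 2 ^ d * \<omega> ?a < real b + 1" by (simp add: floor_eq_iff)
    also have "\<dots> \<longleftrightarrow> \<not> \<omega> ?a < ?p \<and> \<omega> ?a < ?q" by (auto simp: field_simps)
    finally show ?thesis using p0 by auto
  qed
  have S: "SF (\<lambda>\<omega>. of_bool (\<omega> ?a < c) * Y \<omega>)" for c :: real
    by (intro SF_comp2[where k="(*)"] SF_comp[where g=of_bool] SF_less_const Y)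
  have "(\<integral>\<omega>. of_bool (hsh n d \<omega> j = b) * Y \<omega> \<partial>seed_space)
     = (\<integral>\<omega>. of_bool (\<omega> ?a < ?q) * Y \<omega> - of_bool (\<omega> ?a < ?p) * Y \<omega> \<partial>seed_space)"
    by (intro Bochner_Integration.integral_cong refl) (simp add: ev left_diff_distrib)
  also have "\<dots> = (\<integral>\<omega>. of_bool (\<omega> ?a < ?q) * Y \<omega> \<partial>seed_space) - (\<integral>\<omega>. of_bool (\<omega> ?a < ?p) * Y \<omega> \<partial>seed_space)"
    by (intro Bochner_Integration.integral_diff SF_integrable S)
  also have "\<dots> = ?q * (\<integral>\<omega>. Y \<omega> \<partial>seed_space) - ?p * (\<integral>\<omega>. Y \<omega> \<partial>seed_space)"
    using p0 order_trans[OF p0(2) q1] q1 by (simp only: integral_less_mult[OF Y])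
  also have "\<dots> = (\<integral>\<omega>. Y \<omega> \<partial>seed_space) / 2 ^ d"
    by (simp add: diff_divide_distrib[symmetric] left_diff_distrib[symmetric])
  finally show ?thesis .
qed

lemma hsh_upd: "a \<noteq> haddr i \<Longrightarrow> hsh n d (fun_upd \<omega> a v) i = hsh n d \<omega> i"
  by (simp add: hsh_def)

lemma haddr_inj: "haddr i = haddr j \<longleftrightarrow> i = j" by (simp add: haddr_def)

lemma SF_hsh_eq: "SF (\<lambda>\<omega>. of_bool (hsh n d \<omega> i = hsh n d \<omega> j) :: real)"
  by (rule SF_comp[OF SF_hsh, where g="\<lambda>h. of_bool (h i = h j)"])

text \<open>Summation over the value \<open>b\<close> of item \<open>i\<close>; once this is named,
  the coin of \<open>j\<close> occurs in no other factor.\<close>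

lemma hash_collision:
  assumes ij: "j \<in> {1..n}" "i \<noteq> j" and Y: "SF (Y :: _ \<Rightarrow> real)" "indep_of Y (haddr j)"
  shows "(\<integral>\<omega>. of_bool (hsh n d \<omega> j = hsh n d \<omega> i) * Y \<omega> \<partial>seed_space) = (\<integral>\<omega>. Y \<omega> \<partial>seed_space) / 2 ^ d"
proof -
  let ?Yb = "\<lambda>b \<omega>. of_bool (hsh n d \<omega> i = b) * Y \<omega>"
  have Sb: "SF (\<lambda>\<omega>. of_bool (hsh n d \<omega> l = b) :: real)" for l b
    by (rule SF_comp[OF SF_hsh, where g="\<lambda>h. of_bool (h l = b)"])
  have SY: "SF (?Yb b)" for b by (rule SF_comp2[OF Sb Y(1), where k="(*)"])
  have iY: "indep_of (?Yb b) (haddr j)" for b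
    using Y(2) ij(2) by (simp add: indep_of_def hsh_upd haddr_inj)
  have S2: "SF (\<lambda>\<omega>. of_bool (hsh n d \<omega> j = b) * ?Yb b \<omega>)" for b
    by (rule SF_comp2[OF Sb SY, where k="(*)"])
  have dec: "of_bool (hsh n d \<omega> i \<in> {..<2 ^ d} \<and> P (hsh n d \<omega> i)) * Y \<omega> =
      (\<Sum>b<2 ^ d. of_bool (P b) * (of_bool (hsh n d \<omega> i = b) * Y \<omega>))" for P \<omega>
  proof -
    have "(\<Sum>b<2 ^ d. of_bool (P b) * (of_bool (hsh n d \<omega> i = b) * Y \<omega>))
       = (\<Sum>b<2 ^ d. if b = hsh n d \<omega> i then of_bool (P (hsh n d \<omega> i)) * Y \<omega> else 0)"
      by (intro sum.cong refl) auto
    then show ?thesis by simp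
  qed
  have "(\<integral>\<omega>. of_bool (hsh n d \<omega> j = hsh n d \<omega> i) * Y \<omega> \<partial>seed_space)
      = (\<integral>\<omega>. (\<Sum>b<2 ^ d. of_bool (hsh n d \<omega> j = b) * ?Yb b \<omega>) \<partial>seed_space)"
    using hsh_less by (intro Bochner_Integration.integral_cong refl) (simp flip: dec)
  also have "\<dots> = (\<Sum>b<2 ^ d. \<integral>\<omega>. of_bool (hsh n d \<omega> j = b) * ?Yb b \<omega> \<partial>seed_space)"
    by (intro Bochner_Integration.integral_sum SF_integrable S2)
  also have "\<dots> = (\<Sum>b<2 ^ d. (\<integral>\<omega>. ?Yb b \<omega> \<partial>seed_space) / 2 ^ d)"
    by (intro sum.cong refl hash_prob ij SY iY) simp
  also have "\<dots> = (\<Sum>b<2 ^ d. \<integral>\<omega>. ?Yb b \<omega> \<partial>seed_space) / 2 ^ d"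
    by (simp add: sum_divide_distrib)
  also have "(\<Sum>b<2 ^ d. \<integral>\<omega>. ?Yb b \<omega> \<partial>seed_space) = (\<integral>\<omega>. (\<Sum>b<2 ^ d. ?Yb b \<omega>) \<partial>seed_space)"
    by (intro Bochner_Integration.integral_sum[symmetric] SF_integrable SY)
  also have "\<dots> = (\<integral>\<omega>. Y \<omega> \<partial>seed_space)"
    using hsh_less dec[of _ "\<lambda>_. True"] by (intro Bochner_Integration.integral_cong refl) simp
  finally show ?thesis .
qed

text \<open>A square is required because disturbed mass and depth are both of order 1 + Z. With the
  mass of the other items at most 2^d, the first moment is at most 1 and pairwise independence
  bounds the second by 2, so (2 + Z)^2 has expectation at most 4 + 4 + 2.\<close>

lemma hash_moment:
  assumes i: "i \<in> {1..n}" and y: "frac_vec n y" and s: "vtot n y \<le> 2 ^ d"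
  shows "(\<integral>\<omega>. (1 + bmass n (hsh n d \<omega>) y (hsh n d \<omega> i))\<^sup>2 \<partial>seed_space) \<le> 10"
proof -
  let ?A = "{1..n} - {i}"
  let ?I = "\<lambda>j \<omega>. of_bool (hsh n d \<omega> j = hsh n d \<omega> i) :: real"
  define Z where "Z \<omega> = (\<Sum>j\<in>?A. y j * ?I j \<omega>)" for \<omega>
  define t where "t = (\<Sum>j\<in>?A. y j) / 2 ^ d"
  have yr: "0 \<le> y j" "y j \<le> 1" if "j \<in> {1..n}" for j using y that by (auto simp: frac_vec_def)
  have t: "0 \<le> t" "t \<le> 1"
  proof -
    show "0 \<le> t" unfolding t_def using yr by (intro divide_nonneg_nonneg sum_nonneg) auto
    have "(\<Sum>j\<in>?A. y j) \<le> vtot n y" unfolding vtot_def using yr by (intro sum_mono2) auto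
    then show "t \<le> 1" unfolding t_def using s by simp
  qed
  have b: "bmass n (hsh n d \<omega>) y (hsh n d \<omega> i) = y i + Z \<omega>" for \<omega>
  proof -
    have "bmass n (hsh n d \<omega>) y (hsh n d \<omega> i) = (\<Sum>j=1..n. y j * ?I j \<omega>)"
      unfolding bmass_def sum.inter_filter[of "{1..n}", OF finite_atLeastAtMost] by (intro sum.cong refl) simp
    also have "\<dots> = y i * ?I i \<omega> + Z \<omega>" unfolding Z_def using i by (intro sum.remove) auto
    finally show ?thesis by simp
  qed
  have Z0: "0 \<le> Z \<omega>" for \<omega> unfolding Z_def using yr by (intro sum_nonneg mult_nonneg_nonneg) auto
  have SI: "SF (?I j)" for j by (rule SF_hsh_eq)
  have II: "integrable seed_space (\<lambda>\<omega>. c * ?I j \<omega>)" for c j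
    by (rule SF_integrable, rule SF_comp[OF SI, where g="\<lambda>v. c * v"])
  have IIJ: "integrable seed_space (\<lambda>\<omega>. c * (?I j \<omega> * ?I l \<omega>))" for c j l
    by (rule SF_integrable, rule SF_comp2[OF SI SI, where k="\<lambda>u v. c * (u * v)"])
  have E1: "(\<integral>\<omega>. ?I j \<omega> \<partial>seed_space) = 1 / 2 ^ d" if "j \<in> ?A" for j
    using hash_collision[of j n i "\<lambda>_. 1" d] that by (auto simp: indep_of_def seed.prob_space)
  have E2: "(\<integral>\<omega>. ?I j \<omega> * ?I l \<omega> \<partial>seed_space) \<le> (if j = l then 1 / 2 ^ d else 1 / 2 ^ d / 2 ^ d)"
    if "j \<in> ?A" "l \<in> ?A" for j l
  proof (cases "j = l")
    case True
    have I2: "?I j \<omega> * ?I j \<omega> = ?I j \<omega>" for \<omega> by simp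
    show ?thesis unfolding True[symmetric] I2 E1[OF that(1)] by simp
  next
    case False
    have "(\<integral>\<omega>. ?I j \<omega> * ?I l \<omega> \<partial>seed_space) = (\<integral>\<omega>. ?I l \<omega> \<partial>seed_space) / 2 ^ d"
    proof (rule hash_collision)
      show "indep_of (?I l) (haddr j)" using False that by (auto simp: indep_of_def hsh_upd haddr_inj)
    qed (use that in \<open>auto intro: SI\<close>)
    then show ?thesis using E1[OF that(2)] False by simp
  qed
  have EZ: "(\<integral>\<omega>. Z \<omega> \<partial>seed_space) = t"
  proof -
    have "(\<integral>\<omega>. Z \<omega> \<partial>seed_space) = (\<Sum>j\<in>?A. \<integral>\<omega>. y j * ?I j \<omega> \<partial>seed_space)"
      unfolding Z_def by (intro Bochner_Integration.integral_sum II)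
    also have "\<dots> = (\<Sum>j\<in>?A. y j * (1 / 2 ^ d))"
      using E1 by (intro sum.cong refl) simp
    finally show ?thesis by (simp add: t_def sum_divide_distrib)
  qed
  have Zsq: "(Z \<omega>)\<^sup>2 = (\<Sum>j\<in>?A. \<Sum>l\<in>?A. y j * y l * (?I j \<omega> * ?I l \<omega>))" for \<omega>
    unfolding Z_def power2_eq_square sum_product by (intro sum.cong refl) (simp only: ac_simps)
  have EZ2: "(\<integral>\<omega>. (Z \<omega>)\<^sup>2 \<partial>seed_space) \<le> 2"
  proof -
    have "(\<integral>\<omega>. (Z \<omega>)\<^sup>2 \<partial>seed_space) = (\<Sum>j\<in>?A. \<integral>\<omega>. (\<Sum>l\<in>?A. y j * y l * (?I j \<omega> * ?I l \<omega>)) \<partial>seed_space)"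
      unfolding Zsq by (intro Bochner_Integration.integral_sum Bochner_Integration.integrable_sum IIJ)
    also have "\<dots> = (\<Sum>j\<in>?A. \<Sum>l\<in>?A. \<integral>\<omega>. y j * y l * (?I j \<omega> * ?I l \<omega>) \<partial>seed_space)"
      by (intro sum.cong refl Bochner_Integration.integral_sum IIJ)
    also have "\<dots> \<le> (\<Sum>j\<in>?A. \<Sum>l\<in>?A. (if j = l then y j / 2 ^ d else 0) + y j * y l / 2 ^ d / 2 ^ d)"
    proof (intro sum_mono)
      fix j l assume jl: "j \<in> ?A" "l \<in> ?A"
      then have yy: "0 \<le> y j" "0 \<le> y l" "y l \<le> 1" using yr by auto
      have "(\<integral>\<omega>. y j * y l * (?I j \<omega> * ?I l \<omega>) \<partial>seed_space) = y j * y l * (\<integral>\<omega>. ?I j \<omega> * ?I l \<omega> \<partial>seed_space)"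
        by simp
      also have "\<dots> \<le> y j * y l * (if j = l then 1 / 2 ^ d else 1 / 2 ^ d / 2 ^ d)"
        using E2[OF jl] yy by (intro mult_left_mono) auto
      also have "\<dots> \<le> (if j = l then y j / 2 ^ d else 0) + y j * y l / 2 ^ d / 2 ^ d"
      proof -
        have "y j * y l \<le> y j * 1" using yy by (intro mult_left_mono) auto
        then have "y j * y l / 2 ^ d \<le> y j / 2 ^ d" by (simp add: divide_right_mono)
        then show ?thesis using yy by (auto intro: order_trans)
      qed
      finally show "(\<integral>\<omega>. y j * y l * (?I j \<omega> * ?I l \<omega>) \<partial>seed_space)
        \<le> (if j = l then y j / 2 ^ d else 0) + y j * y l / 2 ^ d / 2 ^ d" .
    qed
    also have "\<dots> = t + t * t"
    proof -
      have "(\<Sum>j\<in>?A. \<Sum>l\<in>?A. if j = l then y j / 2 ^ d else 0) = t"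
        unfolding t_def sum_divide_distrib by (intro sum.cong refl) simp
      moreover have "(\<Sum>j\<in>?A. \<Sum>l\<in>?A. y j * y l / 2 ^ d / 2 ^ d) = t * t"
        unfolding t_def by (simp add: sum_product sum_divide_distrib)
      ultimately show ?thesis by (simp add: sum.distrib)
    qed
    also have "\<dots> \<le> 2" using t mult_mono[of t 1 t 1] by simp
    finally show ?thesis .
  qed
  have SZ: "SF Z"
    unfolding Z_def by (rule SF_comp[OF SF_hsh, where g="\<lambda>h. \<Sum>j\<in>?A. y j * of_bool (h j = h i)"])
  have "(\<integral>\<omega>. (1 + bmass n (hsh n d \<omega>) y (hsh n d \<omega> i))\<^sup>2 \<partial>seed_space) \<le> (\<integral>\<omega>. (4 + 4 * Z \<omega>) + (Z \<omega>)\<^sup>2 \<partial>seed_space)"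
  proof (intro integral_mono SF_integrable)
    show "SF (\<lambda>\<omega>. (1 + bmass n (hsh n d \<omega>) y (hsh n d \<omega> i))\<^sup>2)"
      by (rule SF_comp[OF SF_hsh, where g="\<lambda>h. (1 + bmass n h y (h i))\<^sup>2"])
    show "SF (\<lambda>\<omega>. (4 + 4 * Z \<omega>) + (Z \<omega>)\<^sup>2)"
      by (rule SF_comp[OF SZ, where g="\<lambda>z. (4 + 4 * z) + z\<^sup>2"])
    fix \<omega>
    have "(1 + (y i + Z \<omega>))\<^sup>2 \<le> (2 + Z \<omega>)\<^sup>2"
      using yr[OF i] Z0[of \<omega>] by (intro power_mono) auto
    then show "(1 + bmass n (hsh n d \<omega>) y (hsh n d \<omega> i))\<^sup>2 \<le> (4 + 4 * Z \<omega>) + (Z \<omega>)\<^sup>2"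
      unfolding b by (simp add: power2_eq_square algebra_simps)
  qed
  also have "\<dots> = (4 + 4 * t) + (\<integral>\<omega>. (Z \<omega>)\<^sup>2 \<partial>seed_space)"
  proof -
    have S1: "SF (\<lambda>\<omega>. 4 + 4 * Z \<omega>)" "SF (\<lambda>\<omega>. 4 * Z \<omega>)" "SF (\<lambda>\<omega>. (Z \<omega>)\<^sup>2)"
      by (rule SF_comp[OF SZ, where g="\<lambda>z. 4 + 4 * z"] SF_comp[OF SZ, where g="\<lambda>z. 4 * z"]
          SF_comp[OF SZ, where g="\<lambda>z. z\<^sup>2"])+
    have "(\<integral>\<omega>. 4 + 4 * Z \<omega> \<partial>seed_space) = 4 + 4 * t"
      using Bochner_Integration.integral_add[OF SF_integrable[OF simple_function_const[of seed_space "4::real"]] SF_integrable[OF S1(2)]]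
      by (simp add: EZ seed.prob_space)
    then show ?thesis
      using Bochner_Integration.integral_add[OF SF_integrable[OF S1(1)] SF_integrable[OF S1(3)]] by simp
  qed
  also have "\<dots> \<le> 10" using EZ2 t by simp
  finally show ?thesis .
qed

text \<open>130 is 13 from the drawings times 10 from \<open>hash_moment\<close>. If item
  \<open>i\<close> stays light or stays heavy, \<open>vdist\<close> is at most 6e (1 + Z); otherwise
  only the crude bound 2Z is available.\<close>

lemma stretch_fixed_level:
  assumes n: "1 \<le> n" and \<rho>: "1/2 \<le> \<rho>" "\<rho> \<le> 1"
    and x: "frac_vec n x" and y: "frac_vec n y"
    and i: "i \<in> {1..n}" and yx: "y = x(i := x i + e)" and e: "0 \<le> e"
    and s: "vtot n y \<le> 2 ^ d"
  shows "(\<integral>\<omega>. sdc (Asub n \<rho> d \<omega> x) (Asub n \<rho> d \<omega> y) \<partial>seed_space)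
     \<le> (if x i < \<rho> / 2 \<longleftrightarrow> y i < \<rho> / 2 then 6 * e else 2) * (130 * (2 * real d + 16))"
proof -
  let ?W = "if x i < \<rho> / 2 \<longleftrightarrow> y i < \<rho> / 2 then 6 * e else 2"
  let ?Z = "\<lambda>\<omega>. bmass n (hsh n d \<omega>) y (hsh n d \<omega> i)"
  let ?F = "\<lambda>\<omega>. sdc (Asub n \<rho> d \<omega> x) (Asub n \<rho> d \<omega> y)"
  let ?c = "13 * ?W * (2 * real d + 16)"
  have W0: "0 \<le> ?W" using e by simp
  have "(\<integral>\<omega>. ?F \<omega> \<partial>seed_space) \<le> (\<integral>\<omega>. ?c * (1 + ?Z \<omega>)\<^sup>2 \<partial>seed_space)"
  proof (rule integral_split_le[where H=H0])
    show "SF ?F" by (intro SF_comp2[where k=sdc] SF_Asub x y \<rho> n)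
    show "SF (\<lambda>\<omega>. ?c * (1 + ?Z \<omega>)\<^sup>2)"
      by (rule SF_comp[OF SF_hsh, where g="\<lambda>h. ?c * (1 + bmass n h y (h i))\<^sup>2"])
    fix \<omega> assume om: "\<omega> \<in> space seed_space"
    let ?h = "hsh n d \<omega>"
    have h: "?h i < 2 ^ d" for i by (rule hsh_less[OF om])
    have Z0: "0 \<le> ?Z \<omega>" by (rule bmass_y_nonneg[OF x y \<rho> i yx e])
    have V: "vdist n \<rho> ?h x y \<le> ?W * (1 + ?Z \<omega>)"
    proof (cases "x i < \<rho> / 2 \<longleftrightarrow> y i < \<rho> / 2")
      case False
      then show ?thesis using vdist_crude[OF x y \<rho> i yx e, of ?h] by simp
    next
      case True
      show ?thesis
      proof (cases "y i < \<rho> / 2")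
        case lt: True
        have "3 * e * (2 * ?Z \<omega> + 1) \<le> 6 * e * (1 + ?Z \<omega>)"
          using e by (simp add: algebra_simps)
        then show ?thesis using vdist_light[OF x y \<rho> i yx e lt, of ?h] True by simp
      next
        case hv: False
        have "e \<le> 6 * e * (1 + ?Z \<omega>)" using e Z0 mult_nonneg_nonneg[OF e Z0] by (simp add: algebra_simps)
        then show ?thesis using vdist_heavy[OF x y \<rho> i yx e, of ?h] True hv by simp
      qed
    qed
    have "(\<integral>\<omega>'. ?F (comb H0 \<omega> \<omega>') \<partial>seed_space)
      = (\<integral>\<omega>. sdc (Aset n d ?h (zr n \<rho> ?h x \<omega>) \<omega>) (Aset n d ?h (zr n \<rho> ?h y \<omega>) \<omega>) \<partial>seed_space)"
      unfolding Asub_comb(2)[OF x \<rho> om] Asub_comb(2)[OF y \<rho> om] ..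
    also have "\<dots> \<le> 13 * vdist n \<rho> ?h x y * (2 * real d + 9 + 16 * ?Z \<omega>)"
      by (rule stretch_fixed_hash[OF n \<rho> h x y i yx e])
    also have "\<dots> \<le> 13 * (?W * (1 + ?Z \<omega>)) * ((2 * real d + 16) * (1 + ?Z \<omega>))"
    proof (rule mult_mono)
      show "13 * vdist n \<rho> ?h x y \<le> 13 * (?W * (1 + ?Z \<omega>))" using V by simp
      show "2 * real d + 9 + 16 * ?Z \<omega> \<le> (2 * real d + 16) * (1 + ?Z \<omega>)"
        using Z0 mult_nonneg_nonneg[of "real d" "?Z \<omega>"] by (simp add: algebra_simps)
      show "0 \<le> 13 * (?W * (1 + ?Z \<omega>))" using W0 Z0 by simp
      show "0 \<le> 2 * real d + 9 + 16 * ?Z \<omega>" using Z0 by simp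
    qed
    also have "\<dots> = ?c * (1 + ?Z \<omega>)\<^sup>2" by (simp add: power2_eq_square)
    finally show "(\<integral>\<omega>'. ?F (comb H0 \<omega> \<omega>') \<partial>seed_space) \<le> ?c * (1 + ?Z \<omega>)\<^sup>2" .
  qed
  also have "\<dots> = ?c * (\<integral>\<omega>. (1 + ?Z \<omega>)\<^sup>2 \<partial>seed_space)" by simp
  also have "\<dots> \<le> ?c * 10" using W0 by (intro mult_left_mono hash_moment i y s) simp
  also have "\<dots> = ?W * (130 * (2 * real d + 16))" by (simp only: mult.assoc mult.commute mult.left_commute)
  finally show ?thesis .
qed

section \<open>Measurability and marginals of the algorithm\<close>

text \<open>For a function known only to coincide with some simple function on each fibre of
  \<open>d\<close>; the representatives are chosen and then composed by
  \<open>SF_bind\<close>.\<close>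

lemma SF_fiber:
  assumes d: "SF d"
    and F: "\<And>\<omega>0. \<omega>0 \<in> space seed_space \<Longrightarrow> \<exists>g. SF g \<and> (\<forall>\<omega>\<in>space seed_space. d \<omega> = d \<omega>0 \<longrightarrow> F \<omega> = g \<omega>)"
  shows "SF F"
proof -
  define f where "f v = (SOME g. SF g \<and> (\<forall>\<omega>\<in>space seed_space. d \<omega> = v \<longrightarrow> F \<omega> = g \<omega>))" for v
  have f: "SF (f v) \<and> (\<forall>\<omega>\<in>space seed_space. d \<omega> = v \<longrightarrow> F \<omega> = f v \<omega>)" if v: "v \<in> d ` space seed_space" for v
  proof -
    obtain \<omega>0 where "\<omega>0 \<in> space seed_space" "v = d \<omega>0" using v by (rule imageE)
    then show ?thesis unfolding f_def using F[of \<omega>0] by (intro someI_ex[of "\<lambda>g. SF g \<and> (\<forall>\<omega>\<in>space seed_space. d \<omega> = v \<longrightarrow> F \<omega> = g \<omega>)"]) simp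
  qed
  have "SF (\<lambda>\<omega>. f (d \<omega>) \<omega>)" by (rule SF_bind[OF d]) (use f in blast)
  moreover have "F \<omega> = f (d \<omega>) \<omega>" if "\<omega> \<in> space seed_space" for \<omega>
    using f[of "d \<omega>"] that by blast
  ultimately show ?thesis by (simp cong: simple_function_cong)
qed

text \<open>\<open>\<rho>\<close> enters every stage only through the comparison that decides
  whether an item is light.\<close>

lemma Asub_light_cong:
  assumes "\<And>i. x i < \<rho> / 2 \<longleftrightarrow> x i < \<rho>' / 2"
  shows "Asub n \<rho> d \<omega> x = Asub n \<rho>' d \<omega> x"
  unfolding Asub_def zr_def[abs_def] zv_def zcell_def vv_def cel_def pc1_def pre_def lmass_def
  by (simp only: assms)

lemma rho_ge_iff: "c \<le> rho \<omega> \<longleftrightarrow> \<omega> 0 \<in> {2 * c - 1..}"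
  by (auto simp: rho_def)

definition supp_vec :: "nat \<Rightarrow> (nat \<Rightarrow> real) \<Rightarrow> bool" where
  "supp_vec n x \<longleftrightarrow> frac_vec n x \<and> (\<forall>i. i \<notin> {1..n} \<longrightarrow> x i = 0)"

lemma SF_rho_ge: "SF (\<lambda>\<omega>. c \<le> rho \<omega>)"
  unfolding rho_ge_iff by (rule SF_coord) simp

lemma lev_ex: "1/2 \<le> r \<Longrightarrow> \<exists>D. s \<le> 2 ^ D / (2::real) \<and> s \<le> 2 ^ D * r"
proof -
  assume r: "1/2 \<le> r"
  obtain D :: nat where D: "2 * s < 2 ^ D" using real_arch_pow[of 2 "2 * s"] by auto
  have "2 ^ D * (1/2) \<le> 2 ^ D * r" using r by (intro mult_left_mono) auto
  then show ?thesis using D by (intro exI[of _ D]) linarith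
qed

lemma SF_lev: "SF (\<lambda>\<omega>. lev (rho \<omega>) s)"
proof -
  obtain D :: nat where D: "s \<le> 2 ^ D / 2" using lev_ex[of "1/2" s] by auto
  define q where "q \<omega> = (\<lambda>d. if d \<in> {..D} then s / 2 ^ d \<le> rho \<omega> else True)" for \<omega>
  have q: "SF q" unfolding q_def by (rule SF_finite_fun) (auto intro: SF_rho_ge)
  have "lev (rho \<omega>) s = (LEAST d. q \<omega> d)" if om: "\<omega> \<in> space seed_space" for \<omega>
  proof -
    have i: "s / 2 ^ d \<le> rho \<omega> \<longleftrightarrow> s \<le> 2 ^ d * rho \<omega>" for d by (simp add: field_simps)
    note lp = lev_props[OF rho_range(1)[OF om] D]
    show ?thesis
    proof (rule sym, rule Least_equality)
      show "q \<omega> (lev (rho \<omega>) s)" using lp(1,2) by (simp add: q_def i)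
      fix d assume qd: "q \<omega> d"
      show "lev (rho \<omega>) s \<le> d"
      proof (rule ccontr)
        assume "\<not> lev (rho \<omega>) s \<le> d"
        then have "d < lev (rho \<omega>) s" by simp
        then show False using lp(2) lp(3)[of d] qd by (simp add: q_def i)
      qed
    qed
  qed
  then show ?thesis
    using SF_comp[OF q, where g="\<lambda>f. LEAST d. f d"] by (simp cong: simple_function_cong)
qed

text \<open>\<open>\<rho>\<close> takes uncountably many values, but the output depends on it only
  through the level and the set of light items, and these vary in a finite set.\<close>

lemma SF_Alg:
  assumes x: "supp_vec n x" and n: "1 \<le> n"
  shows "SF (\<lambda>\<omega>. Alg n \<omega> x)"
proof -
  have fx: "frac_vec n x" and x0: "\<And>i. i \<notin> {1..n} \<Longrightarrow> x i = 0" using x by (auto simp: supp_vec_def)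
  define L where "L \<omega> = (\<lambda>i. if i \<in> {1..n} then \<not> x i < rho \<omega> / 2 else False)" for \<omega>
  have SL: "SF L" unfolding L_def
  proof (rule SF_finite_fun)
    fix i show "SF (\<lambda>\<omega>. \<not> x i < rho \<omega> / 2)"
    proof -
      have "\<not> x i < rho \<omega> / 2 \<longleftrightarrow> \<omega> 0 \<in> {..4 * x i - 1}" for \<omega> by (auto simp: rho_def)
      then show ?thesis using SF_coord[of "{..4 * x i - 1}" 0] by (simp del: atMost_iff)
    qed
  qed simp
  have SD: "SF (\<lambda>\<omega>. (L \<omega>, lev (rho \<omega>) (vtot n x)))" by (rule SF_comp2[OF SL SF_lev, where k=Pair])
  show ?thesis
  proof (rule SF_fiber[OF SD])
    fix \<omega>0 assume om0: "\<omega>0 \<in> space seed_space"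
    let ?g = "\<lambda>\<omega>. Asub n (rho \<omega>0) (lev (rho \<omega>0) (vtot n x)) \<omega> x"
    have "Alg n \<omega> x = ?g \<omega>" if om: "\<omega> \<in> space seed_space"
      and e: "(L \<omega>, lev (rho \<omega>) (vtot n x)) = (L \<omega>0, lev (rho \<omega>0) (vtot n x))" for \<omega>
    proof -
      have "x i < rho \<omega> / 2 \<longleftrightarrow> x i < rho \<omega>0 / 2" for i
      proof (cases "i \<in> {1..n}")
        case True
        have "L \<omega> i = L \<omega>0 i" using e by simp
        then show ?thesis using True by (simp add: L_def)
      next
        case False
        then show ?thesis using x0[OF False] rho_range[OF om] rho_range[OF om0] by simp
      qed
      then show ?thesis using e unfolding Alg_def by (simp add: Asub_light_cong[of x "rho \<omega>" "rho \<omega>0"])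
    qed
    moreover have "SF ?g" by (rule SF_Asub[OF fx rho_range[OF om0] n])
    ultimately show "\<exists>g. SF g \<and> (\<forall>\<omega>\<in>space seed_space. (L \<omega>, lev (rho \<omega>) (vtot n x)) = (L \<omega>0, lev (rho \<omega>0) (vtot n x)) \<longrightarrow> Alg n \<omega> x = g \<omega>)"
      by blast
  qed
qed

lemma Alg_comb0:
  assumes "frac_vec n x" "\<omega> \<in> space seed_space" "\<omega>' \<in> space seed_space"
  shows "Alg n (comb {0} \<omega> \<omega>') x = Asub n (rho \<omega>) (lev (rho \<omega>) (vtot n x)) \<omega>' x"
proof -
  have "rho (comb {0} \<omega> \<omega>') = rho \<omega>" by (simp add: rho_def comb_def)
  then show ?thesis unfolding Alg_def using Asub_comb(1)[OF assms(1) rho_range[OF assms(2)] assms(3)] by simp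
qed

lemma Asub_subset: "\<omega> \<in> space seed_space \<Longrightarrow> Asub n \<rho> d \<omega> x \<subseteq> {1..n}"
  unfolding Asub_def Aset_def
  using rounding_subset bucket_tree_props(2)[of n "hsh n d \<omega>" d, OF hsh_less] by blast

lemma finite_Asub: "finite (Asub n \<rho> d \<omega> x)"
  unfolding Asub_def Aset_def by (rule finite_final)

lemma card_Asub:
  assumes x: "frac_vec n x" and \<rho>: "1/2 \<le> \<rho>" "\<rho> \<le> 1" and om: "\<omega> \<in> space seed_space" and n: "1 \<le> n"
  shows "int (card (Asub n \<rho> d \<omega> x)) \<in> {\<lfloor>vtot n x\<rfloor>, \<lceil>vtot n x\<rceil>}"
proof -
  let ?h = "hsh n d \<omega>"
  have h: "?h i < 2 ^ d" for i by (rule hsh_less[OF om])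
  note bt = bucket_tree_props[of n ?h d, OF h]
  have "(\<Sum>i\<in>leaves (bucket_tree n ?h d). zr n \<rho> ?h x \<omega> i) = (\<Sum>i=1..n. zv n \<rho> ?h x \<omega> i)"
    unfolding bt(2) by (intro sum.cong refl) (simp add: zr_def)
  also have "\<dots> = vtot n x" using sum_zv[OF x \<rho> om n] by (simp add: vtot_def)
  finally show ?thesis
    unfolding Asub_def Aset_def
    using card_rounding[OF bt(1) _ om, of "zr n \<rho> ?h x \<omega>" 5] zr_range[OF x \<rho> om] by simp
qed

text \<open>For given drawings the tree selects \<open>i\<close> with the probability found in the
  surviving vector, and the drawings preserve the expectation of each coordinate.\<close>

lemma Asub_marginal:
  assumes x: "frac_vec n x" and \<rho>: "1/2 \<le> \<rho>" "\<rho> \<le> 1" and i: "i \<in> {1..n}" and n: "1 \<le> n"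
  shows "(\<integral>\<omega>. of_bool (i \<in> Asub n \<rho> d \<omega> x) \<partial>seed_space) = x i"
proof -
  have S: "SF (\<lambda>\<omega>. of_bool (i \<in> Asub n \<rho> d \<omega> x) :: real)"
    by (rule SF_comp[OF SF_Asub[OF x \<rho> n], where g="\<lambda>A. of_bool (i \<in> A)"])
  have inner: "(\<integral>\<omega>'. of_bool (i \<in> Asub n \<rho> d (comb H0 \<omega> \<omega>') x) \<partial>seed_space) = x i"
    if om: "\<omega> \<in> space seed_space" for \<omega>
  proof -
    let ?h = "hsh n d \<omega>"
    have h: "?h j < 2 ^ d" for j by (rule hsh_less[OF om])
    note bt = bucket_tree_props[of n ?h d, OF h]
    let ?f = "\<lambda>\<omega>. of_bool (i \<in> Aset n d ?h (zr n \<rho> ?h x \<omega>) \<omega>) :: real"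
    have Sf: "SF ?f"
      using SF_comb[OF S om, of H0] unfolding Asub_comb(2)[OF x \<rho> om] .
    have in2: "(\<integral>\<omega>'. ?f (comb H1 \<omega>1 \<omega>') \<partial>seed_space) = zv n \<rho> ?h x \<omega>1 i" if om1: "\<omega>1 \<in> space seed_space" for \<omega>1
    proof -
      have a: "Aset n d ?h (zr n \<rho> ?h x (comb H1 \<omega>1 \<omega>')) (comb H1 \<omega>1 \<omega>') = rounding (zr n \<rho> ?h x \<omega>1) 5 (bucket_tree n ?h d) \<omega>'"
        for \<omega>' unfolding Aset_def[symmetric] by (rule Aset_zr_comb[OF x \<rho>]) (rule h)
      have "(\<integral>\<omega>'. of_bool (i \<in> rounding (zr n \<rho> ?h x \<omega>1) 5 (bucket_tree n ?h d) \<omega>') \<partial>seed_space) = zr n \<rho> ?h x \<omega>1 i"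
        using bt(1-3) i zr_range[OF x \<rho> om1] by (intro rounding_marginal) simp_all
      then show ?thesis unfolding a using i by (simp add: zr_def)
    qed
    have "(\<integral>\<omega>'. of_bool (i \<in> Asub n \<rho> d (comb H0 \<omega> \<omega>') x) \<partial>seed_space :: real) = (\<integral>\<omega>'. ?f \<omega>' \<partial>seed_space)"
      unfolding Asub_comb(2)[OF x \<rho> om] ..
    also have "\<dots> = (\<integral>\<omega>1. (\<integral>\<omega>'. ?f (comb H1 \<omega>1 \<omega>') \<partial>seed_space) \<partial>seed_space)" by (rule integral_split[OF Sf])
    also have "\<dots> = (\<integral>\<omega>1. zv n \<rho> ?h x \<omega>1 i \<partial>seed_space)"
      by (intro Bochner_Integration.integral_cong refl in2)
    also have "\<dots> = x i" by (rule zv_marginal[OF x \<rho> n i])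
    finally show ?thesis .
  qed
  have "(\<integral>\<omega>. of_bool (i \<in> Asub n \<rho> d \<omega> x) \<partial>seed_space :: real)
     = (\<integral>\<omega>. (\<integral>\<omega>'. of_bool (i \<in> Asub n \<rho> d (comb H0 \<omega> \<omega>') x) \<partial>seed_space) \<partial>seed_space)"
    by (rule integral_split[OF S])
  also have "\<dots> = (\<integral>\<omega>. x i \<partial>seed_space)"
    by (intro Bochner_Integration.integral_cong refl inner)
  finally show ?thesis by (simp add: seed.prob_space)
qed

lemma Alg_marginal:
  assumes x: "supp_vec n x" and i: "i \<in> {1..n}" and n: "1 \<le> n"
  shows "(\<integral>\<omega>. of_bool (i \<in> Alg n \<omega> x) \<partial>seed_space) = x i"
proof -
  have fx: "frac_vec n x" using x by (simp add: supp_vec_def)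
  have S: "SF (\<lambda>\<omega>. of_bool (i \<in> Alg n \<omega> x) :: real)"
    by (rule SF_comp[OF SF_Alg[OF x n], where g="\<lambda>A. of_bool (i \<in> A)"])
  have "(\<integral>\<omega>'. of_bool (i \<in> Alg n (comb {0} \<omega> \<omega>') x) \<partial>seed_space) = x i" if om: "\<omega> \<in> space seed_space" for \<omega>
  proof -
    have "(\<integral>\<omega>'. of_bool (i \<in> Alg n (comb {0} \<omega> \<omega>') x) \<partial>seed_space :: real)
      = (\<integral>\<omega>'. of_bool (i \<in> Asub n (rho \<omega>) (lev (rho \<omega>) (vtot n x)) \<omega>' x) \<partial>seed_space)"
      using Alg_comb0[OF fx om] by (intro Bochner_Integration.integral_cong refl) simp
    then show ?thesis using Asub_marginal[OF fx rho_range[OF om] i n] by simp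
  qed
  note inner = this
  have "(\<integral>\<omega>. of_bool (i \<in> Alg n \<omega> x) \<partial>seed_space :: real)
     = (\<integral>\<omega>. (\<integral>\<omega>'. of_bool (i \<in> Alg n (comb {0} \<omega> \<omega>') x) \<partial>seed_space) \<partial>seed_space)"
    by (rule integral_split[OF S])
  also have "\<dots> = (\<integral>\<omega>. x i \<partial>seed_space)"
    by (intro Bochner_Integration.integral_cong refl inner)
  finally show ?thesis by (simp add: seed.prob_space)
qed

lemma Delta_supp: "x \<in> Delta n k \<Longrightarrow> supp_vec n x"
  by (simp add: Delta_def supp_vec_def frac_vec_def)

lemma l1_vtot: "x \<in> Delta n k \<Longrightarrow> l1_norm n x = vtot n x"
  unfolding l1_norm_def vtot_def by (intro sum.cong refl) (simp add: Delta_def)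

lemma Alg_correlated:
  assumes n: "1 \<le> n"
  shows "correlated_sampling seed_space n k (Alg n)"
  unfolding correlated_sampling_def
proof (intro conjI ballI prob_space_seed_space)
  fix x assume xD: "x \<in> Delta n k"
  have x: "supp_vec n x" by (rule Delta_supp[OF xD])
  then have fx: "frac_vec n x" by (simp add: supp_vec_def)
  have S: "SF (\<lambda>\<omega>. i \<in> Alg n \<omega> x)" for i
    by (rule SF_comp[OF SF_Alg[OF x n], where g="\<lambda>A. i \<in> A"])
  have m: "{\<omega> \<in> space seed_space. i \<in> Alg n \<omega> x} \<in> sets seed_space" for i
    using simple_functionD(2)[OF S[of i], of "{True}"] by (simp add: vimage_def Int_def conj_commute)
  {
    fix \<omega> assume om: "\<omega> \<in> space seed_space"
    show "Alg n \<omega> x \<subseteq> {1..n}" unfolding Alg_def by (rule Asub_subset[OF om])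
    show "int (card (Alg n \<omega> x)) \<in> {\<lfloor>l1_norm n x\<rfloor>, \<lceil>l1_norm n x\<rceil>}"
      unfolding Alg_def l1_vtot[OF xD] by (rule card_Asub[OF fx rho_range[OF om] om n])
  next
    fix i assume i: "i \<in> {1..n}"
    show "{\<omega> \<in> space seed_space. i \<in> Alg n \<omega> x} \<in> sets seed_space" by (rule m)
    have "seed.prob {\<omega> \<in> space seed_space. i \<in> Alg n \<omega> x}
        = (\<integral>\<omega>. indicator {\<omega> \<in> space seed_space. i \<in> Alg n \<omega> x} \<omega> \<partial>seed_space)"
      by (simp add: Int_absorb2)
    also have "\<dots> = (\<integral>\<omega>. of_bool (i \<in> Alg n \<omega> x) \<partial>seed_space)"
      by (intro Bochner_Integration.integral_cong) (auto simp: indicator_def)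
    also have "\<dots> = x i" by (rule Alg_marginal[OF x i n])
    finally show "measure seed_space {\<omega> \<in> space seed_space. i \<in> Alg n \<omega> x} = x i" .
  }
qed

section \<open>Averaging over the random scale and total stretch\<close>

text \<open>For each level d up to D, the level changes there with probability at most 2e / 2^d and
  then costs at most 2 * 2^d + 4, together at most 12e. The cut between light and heavy falls
  between the two values with probability at most 4e and costs c = 260 (2D + 16); all other outcomes
  cost 3ec. Hence 1820 = 7 * 260.\<close>

lemma stretch_single:
  assumes n: "1 \<le> n" and x: "supp_vec n x" and y: "supp_vec n y"
    and i: "i \<in> {1..n}" and yx: "y = x(i := x i + e)" and e: "0 \<le> e" and D: "vtot n y \<le> 2 ^ D / 2"
  shows "(\<integral>\<omega>. sdc (Alg n \<omega> x) (Alg n \<omega> y) \<partial>seed_space)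
     \<le> e * (12 * (real D + 1) + 1820 * (2 * real D + 16))"
proof -
  have fx: "frac_vec n x" and fy: "frac_vec n y" using x y by (simp_all add: supp_vec_def)
  let ?s = "vtot n x" and ?s' = "vtot n y"
  have s': "?s' = ?s + e" unfolding yx using vtot_upd[OF i, of x "x i + e"] by simp
  have e1: "e \<le> 1"
  proof -
    have "0 \<le> x i" "y i \<le> 1" using fx fy i by (auto simp: frac_vec_def)
    then show ?thesis by (simp add: yx)
  qed
  have s0: "0 \<le> ?s" using fx unfolding vtot_def by (intro sum_nonneg) (simp add: frac_vec_def)
  \<comment> \<open>The event that 2 ^ d * \<rho> lies between the two total masses, solved for
    \<open>\<omega> 0\<close>.\<close>
  define B where "B d = {2 * ?s / 2 ^ d - 1..2 * ?s' / 2 ^ d - 1}" for d :: nat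
  \<comment> \<open>The event that \<open>\<rho> / 2\<close> lies between \<open>x i\<close> and
    \<open>y i\<close>, solved for \<open>\<omega> 0\<close>.\<close>
  define J where "J = {4 * x i - 1..4 * y i - 1}"
  define c where "c = 260 * (2 * real D + 16)"
  define T where "T d \<omega> = of_bool (\<omega> 0 \<in> B d) * (2 * 2 ^ d + 4 :: real)" for d :: nat and \<omega> :: "nat \<Rightarrow> real"
  define TJ where "TJ \<omega> = of_bool (\<omega> 0 \<in> J) * c" for \<omega> :: "nat \<Rightarrow> real"
  define G where "G \<omega> = (\<Sum>d\<le>D. T d \<omega>) + (TJ \<omega> + 3 * e * c)" for \<omega>
  have c0: "0 \<le> c" by (simp add: c_def)
  have T0: "0 \<le> T d \<omega>" for d \<omega> by (simp add: T_def)
  have J0: "0 \<le> TJ \<omega>" for \<omega> using c0 by (simp add: TJ_def)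
  have ST: "SF (T d)" for d unfolding T_def
    by (rule SF_comp[OF SF_coord, where g="\<lambda>b. of_bool b * (2 * 2 ^ d + 4)"]) (simp add: B_def)
  have SJ: "SF TJ" unfolding TJ_def
    by (rule SF_comp[OF SF_coord, where g="\<lambda>b. of_bool b * c"]) (simp add: J_def)
  have SJc: "SF (\<lambda>\<omega>. TJ \<omega> + 3 * e * c)" by (rule SF_comp[OF SJ, where g="\<lambda>v. v + 3 * e * c"])
  have SS: "SF (\<lambda>\<omega>. \<Sum>d\<le>D. T d \<omega>)"
  proof -
    have "SF (\<lambda>\<omega>. \<Sum>d\<in>A. T d \<omega>)" if "finite A" for A
      using that by induction (simp_all add: SF_comp2[OF ST, where k="(+)"])
    then show ?thesis by simp
  qed
  have SG: "SF G" unfolding G_def by (rule SF_comp2[OF SS SJc, where k="(+)"])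
  have "(\<integral>\<omega>. sdc (Alg n \<omega> x) (Alg n \<omega> y) \<partial>seed_space) \<le> (\<integral>\<omega>. G \<omega> \<partial>seed_space)"
  proof (rule integral_split_le[where H="{0}", OF _ SG])
    show "SF (\<lambda>\<omega>. sdc (Alg n \<omega> x) (Alg n \<omega> y))" by (intro SF_comp2[where k=sdc] SF_Alg x y n)
    fix \<omega> assume om: "\<omega> \<in> space seed_space"
    note rr = rho_range[OF om]
    let ?r = "rho \<omega>"
    let ?d = "lev ?r ?s" and ?d' = "lev ?r ?s'"
    have Ds: "?s \<le> 2 ^ D / 2" using D s' e by simp
    note lp = lev_props[OF rr(1) Ds] and lp' = lev_props[OF rr(1) D]
    have r0: "\<omega> 0 = 2 * ?r - 1" by (simp add: rho_def field_simps)
    have "(\<integral>\<omega>'. sdc (Alg n (comb {0} \<omega> \<omega>') x) (Alg n (comb {0} \<omega> \<omega>') y) \<partial>seed_space)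
       = (\<integral>\<omega>'. sdc (Asub n ?r ?d \<omega>' x) (Asub n ?r ?d' \<omega>' y) \<partial>seed_space)"
      by (intro Bochner_Integration.integral_cong refl) (simp add: Alg_comb0[OF fx om] Alg_comb0[OF fy om])
    also have "\<dots> \<le> G \<omega>"
    proof (cases "?d = ?d'")
      case False
      have dd: "?d < ?d'"
      proof (rule ccontr)
        assume "\<not> ?d < ?d'"
        then have "?d' < ?d" using False by simp
        then show False using lp(3)[of ?d'] lp'(1) s' e by simp
      qed
      have inB: "\<omega> 0 \<in> B ?d" unfolding B_def r0
        using lp(1) lp'(3)[OF dd] by (simp add: field_simps)
      have sl: "?s \<le> 2 ^ ?d"
      proof -
        have "2 ^ ?d * ?r \<le> 2 ^ ?d * 1" using rr by (intro mult_left_mono) auto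
        then show ?thesis using lp(1) by linarith
      qed
      \<comment> \<open>Different levels mean unrelated trees, so both outputs are paid in full;
        their size is of the order of the number of buckets.\<close>
      have "sdc (Asub n ?r ?d \<omega>' x) (Asub n ?r ?d' \<omega>' y) \<le> 2 * 2 ^ ?d + 4"
        if om': "\<omega>' \<in> space seed_space" for \<omega>'
      proof -
        have cb: "real (card (Asub n ?r d \<omega>' v)) \<le> vtot n v + 1" if "frac_vec n v" for v d
        proof -
          have "int (card (Asub n ?r d \<omega>' v)) \<le> \<lceil>vtot n v\<rceil>"
            using card_Asub[OF that rr om' n, of d] by (auto intro: order_trans[OF floor_le_ceiling])
          then have "real_of_int (int (card (Asub n ?r d \<omega>' v))) \<le> real_of_int \<lceil>vtot n v\<rceil>"
            by (simp only: of_int_le_iff)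
          also have "\<dots> \<le> vtot n v + 1" by (rule of_int_ceiling_le_add_one)
          finally show ?thesis by simp
        qed
        have "sdc (Asub n ?r ?d \<omega>' x) (Asub n ?r ?d' \<omega>' y) \<le> (?s + 1) + (?s' + 1)"
          by (rule order_trans[OF sdc_le_card[OF finite_Asub finite_Asub] add_mono[OF cb[OF fx] cb[OF fy]]])
        then show ?thesis using sl s' e1 by simp
      qed
      then have "(\<integral>\<omega>'. sdc (Asub n ?r ?d \<omega>' x) (Asub n ?r ?d' \<omega>' y) \<partial>seed_space)
          \<le> (\<integral>\<omega>'. 2 * 2 ^ ?d + 4 \<partial>seed_space)"
        by (intro integral_mono SF_integrable SF_comp2[where k=sdc] SF_Asub fx fy rr n simple_function_const)
      also have "\<dots> = T ?d \<omega>" using inB by (simp add: T_def seed.prob_space)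
      also have "\<dots> \<le> (\<Sum>d\<le>D. T d \<omega>)"
        using lp(2) T0 by (intro member_le_sum) auto
      also have "\<dots> \<le> G \<omega>" using J0[of \<omega>] c0 e unfolding G_def by simp
      finally show ?thesis .
    next
      case True
      let ?W = "if x i < ?r / 2 \<longleftrightarrow> y i < ?r / 2 then 6 * e else 2"
      have sl: "?s' \<le> 2 ^ ?d"
      proof -
        have "2 ^ ?d' * ?r \<le> 2 ^ ?d' * 1" using rr by (intro mult_left_mono) auto
        then show ?thesis using lp'(1) unfolding True by linarith
      qed
      have W0: "0 \<le> ?W" using e by simp
      have "(\<integral>\<omega>'. sdc (Asub n ?r ?d \<omega>' x) (Asub n ?r ?d' \<omega>' y) \<partial>seed_space) \<le> ?W * (130 * (2 * real ?d + 16))"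
        unfolding True[symmetric] by (rule stretch_fixed_level[OF n rr fx fy i yx e sl])
      also have "\<dots> \<le> ?W * (130 * (2 * real D + 16))"
        using lp(2) by (intro mult_left_mono[OF _ W0]) simp
      also have "\<dots> \<le> TJ \<omega> + 3 * e * c"
      proof (cases "x i < ?r / 2 \<longleftrightarrow> y i < ?r / 2")
        case True
        then have W: "?W = 6 * e" by simp
        have eq: "6 * e * (130 * (2 * real D + 16)) = 3 * e * c" by (simp add: c_def)
        show ?thesis unfolding W eq using J0[of \<omega>] by simp
      next
        case False
        then have "\<omega> 0 \<in> J" using e unfolding J_def r0 by (simp add: yx) linarith
        then have "TJ \<omega> = c" by (simp add: TJ_def)
        moreover have "?W * (130 * (2 * real D + 16)) = c" using False by (simp add: c_def)
        ultimately show ?thesis using c0 e by simp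
      qed
      also have "\<dots> \<le> G \<omega>" unfolding G_def using T0 by (simp add: sum_nonneg)
      finally show ?thesis .
    qed
    finally show "(\<integral>\<omega>'. sdc (Alg n (comb {0} \<omega> \<omega>') x) (Alg n (comb {0} \<omega> \<omega>') y) \<partial>seed_space) \<le> G \<omega>" .
  qed
  also have "\<dots> = (\<Sum>d\<le>D. \<integral>\<omega>. T d \<omega> \<partial>seed_space) + ((\<integral>\<omega>. TJ \<omega> \<partial>seed_space) + 3 * e * c)"
  proof -
    have a: "(\<integral>\<omega>. TJ \<omega> + 3 * e * c \<partial>seed_space) = (\<integral>\<omega>. TJ \<omega> \<partial>seed_space) + 3 * e * c"
      using Bochner_Integration.integral_add[OF SF_integrable[OF SJ] SF_integrable[OF simple_function_const[of seed_space "3 * e * c"]]]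
      by (simp add: seed.prob_space)
    have b: "(\<integral>\<omega>. (\<Sum>d\<le>D. T d \<omega>) \<partial>seed_space) = (\<Sum>d\<le>D. \<integral>\<omega>. T d \<omega> \<partial>seed_space)"
      by (intro Bochner_Integration.integral_sum SF_integrable ST)
    have "(\<integral>\<omega>. G \<omega> \<partial>seed_space) = (\<integral>\<omega>. (\<Sum>d\<le>D. T d \<omega>) \<partial>seed_space) + (\<integral>\<omega>. TJ \<omega> + 3 * e * c \<partial>seed_space)"
      unfolding G_def by (rule Bochner_Integration.integral_add[OF SF_integrable[OF SS] SF_integrable[OF SJc]])
    then show ?thesis unfolding a b .
  qed
  also have "\<dots> \<le> (\<Sum>d\<le>D. 12 * e) + (4 * e * c + 3 * e * c)"
  proof (intro add_mono sum_mono order_refl)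
    fix d :: nat
    have "(\<integral>\<omega>. of_bool (\<omega> 0 \<in> B d) \<partial>seed_space) \<le> (2 * ?s' / 2 ^ d - 1) - (2 * ?s / 2 ^ d - 1)"
      by (rule integral_coord_interval) (use e in \<open>simp_all add: B_def s' divide_right_mono\<close>)
    also have "\<dots> = 2 * e / 2 ^ d" by (simp add: s' field_simps)
    finally have "(\<integral>\<omega>. of_bool (\<omega> 0 \<in> B d) \<partial>seed_space) * (2 * 2 ^ d + 4) \<le> (2 * e / 2 ^ d) * (2 * 2 ^ d + 4)"
      by (rule mult_right_mono) simp
    then have "(\<integral>\<omega>. T d \<omega> \<partial>seed_space) \<le> (2 * e / 2 ^ d) * (2 * 2 ^ d + 4)"
      unfolding T_def by simp
    also have "\<dots> = 4 * e + 8 * e / 2 ^ d" by (simp add: field_simps)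
    also have "\<dots> \<le> 4 * e + 8 * e / 1" using e by (intro add_left_mono divide_left_mono) auto
    finally show "(\<integral>\<omega>. T d \<omega> \<partial>seed_space) \<le> 12 * e" by simp
  next
    have "(\<integral>\<omega>. of_bool (\<omega> 0 \<in> J) \<partial>seed_space) \<le> (4 * y i - 1) - (4 * x i - 1)"
      by (rule integral_coord_interval) (use e in \<open>simp_all add: J_def yx\<close>)
    also have "\<dots> = 4 * e" by (simp add: yx)
    finally show "(\<integral>\<omega>. TJ \<omega> \<partial>seed_space) \<le> 4 * e * c"
      unfolding TJ_def using c0 by (simp add: mult_right_mono)
  qed
  also have "\<dots> = e * (12 * (real D + 1) + 1820 * (2 * real D + 16))"
    by (simp add: c_def algebra_simps)
  finally show ?thesis .
qed

lemma Delta_mono: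
  assumes "y \<in> Delta n k" "supp_vec n x" "\<And>i. x i \<le> y i"
  shows "x \<in> Delta n k"
proof -
  have "l1_norm n x \<le> l1_norm n y"
    unfolding l1_norm_def using assms by (intro sum_mono) (simp add: supp_vec_def frac_vec_def abs_of_nonneg order_trans[OF _ assms(3)])
  then show ?thesis using assms by (auto simp: Delta_def supp_vec_def frac_vec_def)
qed

text \<open>The coordinates are raised one at a time. All intermediate vectors lie between
  \<open>x\<close> and \<open>y\<close>, so they belong to the polytope and the level bound
  \<open>D\<close> holds throughout.\<close>

lemma stretch_mono:
  assumes n: "1 \<le> n" and x: "x \<in> Delta n k" and y: "y \<in> Delta n k" and le: "\<And>i. x i \<le> y i" and D: "real k \<le> 2 ^ D / 2"
  shows "(\<integral>\<omega>. sdc (Alg n \<omega> x) (Alg n \<omega> y) \<partial>seed_space)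
     \<le> (\<Sum>i=1..n. y i - x i) * (12 * (real D + 1) + 1820 * (2 * real D + 16))"
proof -
  let ?c = "12 * (real D + 1) + 1820 * (2 * real D + 16)"
  define m where "m S = (\<lambda>j. if j \<in> S then y j else x j)" for S
  have mD: "m S \<in> Delta n k" for S
  proof (rule Delta_mono[OF y])
    show "supp_vec n (m S)" using Delta_supp[OF x] Delta_supp[OF y] by (simp add: m_def supp_vec_def frac_vec_def)
    show "m S i \<le> y i" for i using le by (simp add: m_def)
  qed
  have fin: "finite (Alg n \<omega> v)" for \<omega> v unfolding Alg_def by (rule finite_Asub)
  have "(\<integral>\<omega>. sdc (Alg n \<omega> x) (Alg n \<omega> (m S)) \<partial>seed_space) \<le> (\<Sum>i\<in>S. y i - x i) * ?c"
    if "finite S" "S \<subseteq> {1..n}" for S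
    using that
  proof (induction S)
    case empty
    then show ?case by (simp add: m_def)
  next
    case (insert i S)
    have i: "i \<in> {1..n}" using insert.prems by simp
    have eq: "m (insert i S) = (m S)(i := m S i + (y i - x i))"
      using insert.hyps(2) by (auto simp: m_def fun_eq_iff)
    have "vtot n (m (insert i S)) \<le> real k"
      using mD[of "insert i S"] l1_vtot[OF mD[of "insert i S"]] by (simp add: Delta_def)
    then have s: "vtot n (m (insert i S)) \<le> 2 ^ D / 2" using D by linarith
    have "(\<integral>\<omega>. sdc (Alg n \<omega> x) (Alg n \<omega> (m (insert i S))) \<partial>seed_space)
      \<le> (\<integral>\<omega>. sdc (Alg n \<omega> x) (Alg n \<omega> (m S)) \<partial>seed_space)
       + (\<integral>\<omega>. sdc (Alg n \<omega> (m S)) (Alg n \<omega> (m (insert i S))) \<partial>seed_space)"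
      by (intro integral_sdc_triangle SF_Alg n fin Delta_supp[OF mD] Delta_supp[OF x])
    also have "\<dots> \<le> (\<Sum>i\<in>S. y i - x i) * ?c + (y i - x i) * ?c"
    proof (rule add_mono)
      show "(\<integral>\<omega>. sdc (Alg n \<omega> x) (Alg n \<omega> (m S)) \<partial>seed_space) \<le> (\<Sum>i\<in>S. y i - x i) * ?c"
        using insert by simp
      show "(\<integral>\<omega>. sdc (Alg n \<omega> (m S)) (Alg n \<omega> (m (insert i S))) \<partial>seed_space) \<le> (y i - x i) * ?c"
        using le[of i] by (intro stretch_single[OF n Delta_supp[OF mD] Delta_supp[OF mD] i eq _ s]) simp
    qed
    also have "\<dots> = (\<Sum>i\<in>insert i S. y i - x i) * ?c" using insert.hyps by (simp add: algebra_simps)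
    finally show ?case .
  qed
  from this[of "{1..n}"] have *: "(\<integral>\<omega>. sdc (Alg n \<omega> x) (Alg n \<omega> (m {1..n})) \<partial>seed_space) \<le> (\<Sum>i=1..n. y i - x i) * ?c"
    by simp
  have "m {1..n} = y" using x y by (auto simp: m_def fun_eq_iff Delta_def)
  then show ?thesis using * by simp
qed

text \<open>The path leads through the coordinatewise minimum, which stays in the polytope and has
  length equal to the distance. With D at most 3L and L at least 1 the constant is 12 * 4 + 1820 *
  22 = 40088.\<close>

lemma Alg_stretch:
  assumes n: "1 \<le> n" and k: "1 \<le> k"
  shows "has_stretch seed_space n k (Alg n) (40088 * max 1 (log 2 (real k)))"
  unfolding has_stretch_def
proof (intro ballI)
  fix x y assume x: "x \<in> Delta n k" and y: "y \<in> Delta n k"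
  let ?L = "max 1 (log 2 (real k))"
  define D where "D = nat \<lceil>log 2 (real k)\<rceil> + 1"
  have kp: "0 < real k" using k by simp
  have D: "real k \<le> 2 ^ D / 2"
  proof -
    have "real k = 2 powr (log 2 (real k))" using kp by simp
    also have "\<dots> \<le> 2 powr (real (nat \<lceil>log 2 (real k)\<rceil>))" by (intro powr_mono) (simp_all add: real_nat_ceiling_ge)
    also have "\<dots> = 2 ^ D / 2" by (simp add: D_def powr_realpow)
    finally show ?thesis .
  qed
  have Dle: "real D \<le> 3 * ?L"
  proof -
    have "0 \<le> log 2 (real k)" using k by simp
    then have "real D \<le> log 2 (real k) + 2" unfolding D_def by simp linarith
    then show ?thesis by linarith
  qed
  let ?c = "12 * (real D + 1) + 1820 * (2 * real D + 16)"
  have c: "0 \<le> ?c" "?c \<le> 40088 * ?L" using Dle by simp_all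
  define m where "m = (\<lambda>i. min (x i) (y i))"
  have mD: "m \<in> Delta n k"
    by (rule Delta_mono[OF x]) (use Delta_supp[OF x] Delta_supp[OF y] in \<open>auto simp: m_def supp_vec_def frac_vec_def\<close>)
  have fin: "finite (Alg n \<omega> v)" for \<omega> v unfolding Alg_def by (rule finite_Asub)
  have "(\<integral>\<omega>. sdc (Alg n \<omega> x) (Alg n \<omega> y) \<partial>seed_space)
     \<le> (\<integral>\<omega>. sdc (Alg n \<omega> x) (Alg n \<omega> m) \<partial>seed_space) + (\<integral>\<omega>. sdc (Alg n \<omega> m) (Alg n \<omega> y) \<partial>seed_space)"
    by (intro integral_sdc_triangle SF_Alg n fin Delta_supp[OF mD] Delta_supp[OF x] Delta_supp[OF y])
  also have "\<dots> \<le> (\<Sum>i=1..n. x i - m i) * ?c + (\<Sum>i=1..n. y i - m i) * ?c"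
  proof -
    have "(\<integral>\<omega>. sdc (Alg n \<omega> x) (Alg n \<omega> m) \<partial>seed_space) = (\<integral>\<omega>. sdc (Alg n \<omega> m) (Alg n \<omega> x) \<partial>seed_space)"
      by (simp only: sdc_commute)
    moreover have "(\<integral>\<omega>. sdc (Alg n \<omega> m) (Alg n \<omega> x) \<partial>seed_space) \<le> (\<Sum>i=1..n. x i - m i) * ?c"
      by (rule stretch_mono[OF n mD x _ D]) (simp add: m_def)
    moreover have "(\<integral>\<omega>. sdc (Alg n \<omega> m) (Alg n \<omega> y) \<partial>seed_space) \<le> (\<Sum>i=1..n. y i - m i) * ?c"
      by (rule stretch_mono[OF n mD y _ D]) (simp add: m_def)
    ultimately show ?thesis by linarith
  qed
  also have "\<dots> = l1_norm n (\<lambda>i. x i - y i) * ?c"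
    unfolding l1_norm_def distrib_right[symmetric] sum.distrib[symmetric]
    by (intro arg_cong[where f="\<lambda>v. v * ?c"] sum.cong refl) (simp add: m_def min_def)
  also have "\<dots> \<le> l1_norm n (\<lambda>i. x i - y i) * (40088 * ?L)"
    using c by (intro mult_left_mono) (simp_all add: l1_norm_def sum_nonneg)
  finally show "(\<integral>\<omega>. real (card (sym_diff (Alg n \<omega> x) (Alg n \<omega> y))) \<partial>seed_space)
    \<le> 40088 * ?L * l1_norm n (\<lambda>i. x i - y i)"
    by (simp add: sdc_def mult.commute)
qed

section \<open>Running programs\<close>

text \<open>Total correctness with a bound on the number of steps.\<close>

definition run :: "nat \<Rightarrow> (nat \<Rightarrow> real) \<Rightarrow> program \<Rightarrow> state \<Rightarrow> nat \<Rightarrow> (state \<Rightarrow> bool) \<Rightarrow> bool" where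
  "run w \<omega> P s T Q \<longleftrightarrow> (\<exists>t s'. exec w \<omega> P s t s' \<and> t \<le> T \<and> Q s')"

lemma run_mono: "run w \<omega> P s T Q \<Longrightarrow> T \<le> T' \<Longrightarrow> (\<And>s'. Q s' \<Longrightarrow> Q' s') \<Longrightarrow> run w \<omega> P s T' Q'"
  unfolding run_def by (meson order_trans)

lemma run_Seq:
  assumes "run w \<omega> P s T Q" "\<And>s'. Q s' \<Longrightarrow> run w \<omega> P' s' T' Q'"
  shows "run w \<omega> (Seq P P') s (T + T') Q'"
proof -
  obtain t s1 where 1: "exec w \<omega> P s t s1" "t \<le> T" "Q s1" using assms(1) by (auto simp: run_def)
  obtain t' s2 where 2: "exec w \<omega> P' s1 t' s2" "t' \<le> T'" "Q' s2" using assms(2)[OF 1(3)] by (auto simp: run_def)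
  show ?thesis unfolding run_def using exec.Seq[OF 1(1) 2(1)] 1(2) 2(2,3) by (intro exI[of _ "t + t'"] exI[of _ s2]) simp
qed

text \<open>The invariant is indexed by an iteration counter, so that termination and running time
  come with it.\<close>

lemma run_While:
  assumes "I m s" "m \<le> m'"
    and step: "\<And>j s. I j s \<Longrightarrow> j < m' \<Longrightarrow> holds b s \<and> run w \<omega> P s T (I (Suc j))"
    and stop: "\<And>s. I m' s \<Longrightarrow> \<not> holds b s"
  shows "run w \<omega> (While b P) s ((m' - m) * (T + 1) + 1) (I m')"
  using assms(2,1)
proof (induction "m' - m" arbitrary: m s)
  case 0
  then have "I m' s" by simp
  then show ?case unfolding run_def using exec.WhileFalse[OF stop] by (intro exI[of _ 1] exI[of _ s]) simp
next
  case (Suc l)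
  then have lt: "m < m'" by simp
  from step[OF Suc.prems(2) lt] obtain t s1 where 1: "holds b s" "exec w \<omega> P s t s1" "t \<le> T" "I (Suc m) s1"
    by (auto simp: run_def)
  have "l = m' - Suc m" "Suc m \<le> m'" using Suc.hyps(2) lt by simp_all
  from Suc.hyps(1)[OF this 1(4)] obtain t' s2 where
    2: "exec w \<omega> (While b P) s1 t' s2" "t' \<le> (m' - Suc m) * (T + 1) + 1" "I m' s2" by (auto simp: run_def)
  have "m' - m = Suc (m' - Suc m)" using lt by simp
  then have "t + t' + 1 \<le> (m' - m) * (T + 1) + 1" using 1(3) 2(2) by simp
  then show ?case unfolding run_def using exec.WhileTrue[OF 1(1,2) 2(1)] 2(3) by blast
qed

fun loopfree :: "program \<Rightarrow> bool" where
  "loopfree (While _ _) = False"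
| "loopfree (Seq P Q) = (loopfree P \<and> loopfree Q)"
| "loopfree (Cond _ P Q) = (loopfree P \<and> loopfree Q)"
| "loopfree _ = True"

text \<open>An evaluator by which the simplifier can execute loop-free code symbolically; the value
  at a loop is a dummy.\<close>

fun ev :: "nat \<Rightarrow> (nat \<Rightarrow> real) \<Rightarrow> program \<Rightarrow> state \<Rightarrow> state" where
  "ev w \<omega> Skip s = s"
| "ev w \<omega> (Instr i) s = step w \<omega> i s"
| "ev w \<omega> (Seq P Q) s = ev w \<omega> Q (ev w \<omega> P s)"
| "ev w \<omega> (Cond b P Q) s = (if holds b s then ev w \<omega> P s else ev w \<omega> Q s)"
| "ev w \<omega> (While b P) s = s"

text \<open>Counts both branches of a conditional and is therefore an upper bound on the steps of
  loop-free code that needs no knowledge of the state.\<close>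

fun sz :: "program \<Rightarrow> nat" where
  "sz (Instr i) = 1"
| "sz (Seq P Q) = sz P + sz Q"
| "sz (Cond b P Q) = sz P + sz Q + 1"
| "sz _ = 0"

lemma run_loopfree: "loopfree P \<Longrightarrow> Q (ev w \<omega> P s) \<Longrightarrow> run w \<omega> P s (sz P) Q"
proof -
  have "\<exists>t. exec w \<omega> P s t (ev w \<omega> P s) \<and> t \<le> sz P" if "loopfree P" for P s
    using that
  proof (induction P arbitrary: s)
    case Skip show ?case using exec.Skip[of w \<omega> s] by (intro exI[of _ 0]) simp
  next
    case (Instr i) show ?case using exec.Instr[of w \<omega> i s] by (intro exI[of _ 1]) simp
  next
    case (Seq P Q)
    from Seq obtain t t' where "exec w \<omega> P s t (ev w \<omega> P s)" "t \<le> sz P"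
      "exec w \<omega> Q (ev w \<omega> P s) t' (ev w \<omega> Q (ev w \<omega> P s))" "t' \<le> sz Q" by (simp, blast)
    then show ?case using exec.Seq by (intro exI[of _ "t + t'"]) fastforce
  next
    case (Cond b P Q)
    from Cond obtain t t' where "exec w \<omega> P s t (ev w \<omega> P s)" "t \<le> sz P"
      "exec w \<omega> Q s t' (ev w \<omega> Q s)" "t' \<le> sz Q" by (simp, blast)
    then show ?case
      using exec.CondTrue[of b s w \<omega> P t _ Q] exec.CondFalse[of b s w \<omega> Q t' _ P]
      by (cases "holds b s") (auto intro: exI[of _ "t + 1"] exI[of _ "t' + 1"])
  qed simp
  then show "loopfree P \<Longrightarrow> Q (ev w \<omega> P s) \<Longrightarrow> run w \<omega> P s (sz P) Q" unfolding run_def by blast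
qed

fun blk :: "instr list \<Rightarrow> program" where
  "blk [] = Skip"
| "blk (i # is) = Seq (Instr i) (blk is)"

fun sq :: "program list \<Rightarrow> program" where
  "sq [] = Skip"
| "sq (P # Ps) = Seq P (sq Ps)"

text \<open>Word and real memory beyond the input is divided into interleaved arrays, numbered by \<open>f < 8\<close>.\<close>

definition fb :: "nat \<Rightarrow> nat \<Rightarrow> nat" where "fb n f = 8 * (n + 1) + f"

definition ad :: "nat \<Rightarrow> nat \<Rightarrow> nat \<Rightarrow> nat" where "ad n f i = 8 * i + fb n f"

definition arr :: "nat \<Rightarrow> (nat \<Rightarrow> 'a) \<Rightarrow> nat \<Rightarrow> nat \<Rightarrow> 'a" where "arr n m f i = m (ad n f i)"

lemma ad_inj: "f < 8 \<Longrightarrow> f' < 8 \<Longrightarrow> ad n f i = ad n f' j \<longleftrightarrow> f = f' \<and> i = j"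
  unfolding ad_def fb_def by presburger

lemma arr_upd: "f < 8 \<Longrightarrow> f' < 8 \<Longrightarrow> arr n (fun_upd m (ad n f i) v) f' = (if f = f' then (arr n m f)(i := v) else arr n m f')"
  by (auto simp: arr_def fun_eq_iff ad_inj)

lemma arr_upd_low: "a < 8 * (n + 1) \<Longrightarrow> arr n (fun_upd m a v) f = arr n m f"
  by (auto simp: arr_def ad_def fb_def fun_eq_iff)

lemma upd_low: "a < 8 * (n + 1) \<Longrightarrow> fun_upd m (ad n f i) v a = m a"
  by (auto simp: ad_def fb_def)

abbreviation addr :: "nat \<Rightarrow> nat \<Rightarrow> program \<Rightarrow> program" where
  "addr f i P \<equiv> sq [Instr (WOp WMul 30 i 6), Instr (WOp WAdd 30 30 (20 + f)), P]"

definition "ldw f i r = addr f i (Instr (WLoad r 30))"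
definition "ldr f i r = addr f i (Instr (RLoad r 30))"
definition "stw f i r = addr f i (Instr (WStore 30 r))"
definition "str f i r = addr f i (Instr (RStore 30 r))"

lemma mem_simps [simp]:
  "loopfree (ldw f i r)" "loopfree (ldr f i r)" "loopfree (stw f i r)" "loopfree (str f i r)"
  "sz (ldw f i r) = 3" "sz (ldr f i r) = 3" "sz (stw f i r) = 3" "sz (str f i r) = 3"
  by (simp_all add: ldw_def ldr_def stw_def str_def)

section \<open>Standing assumptions and word arithmetic\<close>

text \<open>A word must hold the largest addresses. Cells are numbered below 20 (n + 1)^2 and arrays
  are interleaved eightfold, so 1000 (n + 1)^2 leaves room. The zero vector is excluded, as the
  program treats it apart.\<close>

locale ram =
  fixes n w :: nat and \<omega> :: "nat \<Rightarrow> real" and x :: "nat \<Rightarrow> real"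
  assumes n: "1 \<le> n" and big: "1000 * ((n + 1) * (n + 1)) < 2 ^ w"
    and om: "\<omega> \<in> space seed_space" and x: "supp_vec n x" and nz: "nonzeros n x \<noteq> {}"
begin

definition "is = sorted_list_of_set (nonzeros n x)"
abbreviation "N \<equiv> nnz n x"

definition cregs :: "(nat \<Rightarrow> nat) \<Rightarrow> bool" where
  "cregs W \<longleftrightarrow> W 0 = n \<and> W 2 = N \<and> W 3 = 0 \<and> W 4 = 1 \<and> W 5 = 2 \<and> W 6 = 8 \<and> W 10 = n + 1 \<and> W 11 = 4 * (n + 1) \<and>
     W 12 = 2 * (n + 1) \<and> W 20 = fb n 0 \<and> W 21 = fb n 1 \<and> W 22 = fb n 2 \<and> W 23 = fb n 3 \<and> W 24 = fb n 4 \<and>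
     W 25 = fb n 5 \<and> W 32 = 3 \<and> W 33 = 4"

definition cregsr :: "(nat \<Rightarrow> real) \<Rightarrow> bool" where
  "cregsr R \<longleftrightarrow> R 0 = 0 \<and> R 1 = 1 \<and> R 2 = 1/2"

abbreviation "okreg r \<equiv> r \<notin> {0,2,3,4,5,6,10,11,12,20,21,22,23,24,25,32,33}"

lemma cregs_upd [simp]: "okreg r \<Longrightarrow> cregs (fun_upd W r v) = cregs W"
  by (simp add: cregs_def)

lemma cregsr_upd [simp]: "r \<notin> {0,1,2} \<Longrightarrow> cregsr (fun_upd R r v) = cregsr R"
  by (simp add: cregsr_def)

lemma cregsD:
  assumes "cregs W"
  shows "W 0 = n" "W 2 = N" "W 3 = 0" "W 4 = 1" "W 5 = 2" "W 6 = 8" "W 10 = n + 1" "W 11 = 4 * (n + 1)"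
    "W 12 = 2 * (n + 1)" "W 20 = fb n 0" "W 21 = fb n 1" "W 22 = fb n 2" "W 23 = fb n 3" "W 24 = fb n 4"
    "W 25 = fb n 5" "W 32 = 3" "W 33 = 4"
  using assms by (simp_all add: cregs_def)

lemma cregsrD: assumes "cregsr R" shows "R 0 = 0" "R (Suc 0) = 1" "R 1 = 1" "R 2 = 1/2"
  using assms by (simp_all add: cregsr_def)

definition inp :: "(nat \<Rightarrow> nat) \<Rightarrow> bool" where "inp m \<longleftrightarrow> (\<forall>j<N. m j = is ! j)"
definition rinp :: "(nat \<Rightarrow> real) \<Rightarrow> bool" where "rinp m \<longleftrightarrow> (\<forall>j<N. m j = x (is ! j))"

lemma finite_nonzeros [simp]: "finite (nonzeros n x)" by (simp add: nonzeros_def)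

lemma N_le: "N \<le> n"
  unfolding nnz_def nonzeros_def by (rule order_trans[OF card_mono[of "{1..n}"]]) auto

lemma N_pos: "1 \<le> N" using nz by (simp add: nnz_def Suc_le_eq card_gt_0_iff)

lemma is_props: "length is = N" "set is = nonzeros n x" "sorted is" "distinct is"
  by (simp_all add: is_def nnz_def)

lemma is_nth: "j < N \<Longrightarrow> is ! j \<in> nonzeros n x" using is_props(1,2) nth_mem by metis

lemma is_range: "j < N \<Longrightarrow> is ! j \<in> {1..n}" using is_nth by (auto simp: nonzeros_def)

lemma inp_upd [simp]: "inp (fun_upd m (ad n f i) v) = inp m"
  using N_le by (auto simp: inp_def ad_def fb_def)

lemma rinp_upd [simp]: "rinp (fun_upd m (ad n f i) v) = rinp m"
  using N_le by (auto simp: rinp_def ad_def fb_def)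

lemma bigs: "1000 * n + 1000 < 2 ^ w" "i < 64 * ((n + 1) * (n + 1)) \<Longrightarrow> f < 8 \<Longrightarrow> ad n f i < 2 ^ w"
   "i < 64 * ((n + 1) * (n + 1)) \<Longrightarrow> 8 * i + 100 < 2 ^ w"
proof -
  let ?M = "(n + 1) * (n + 1)"
  have M: "n + 1 \<le> ?M" by simp
  show "1000 * n + 1000 < 2 ^ w" using big M by linarith
  have M2: "2 * (n + 1) \<le> ?M" using n by (intro mult_right_mono) auto
  have M4: "4 \<le> ?M" using n by (intro order_trans[OF _ M2]) simp
  assume i: "i < 64 * ?M"
  have "8 * i + 8 * (n + 1) + 8 < 1000 * ?M" using i M2 M4 by linarith
  then show "ad n f i < 2 ^ w" if "f < 8" using big that unfolding ad_def fb_def by linarith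
  show "8 * i + 100 < 2 ^ w" using i big M4 by linarith
qed

lemma addr_val:
  assumes "ad n f i < 2 ^ w"
  shows "(i * 8 mod 2 ^ w + fb n f) mod 2 ^ w = ad n f i"
  using assms by (simp add: ad_def mod_add_left_eq mult.commute)

lemma ev_mem:
  assumes "wreg s 6 = 8" "wreg s (20 + f) = fb n f" "i \<noteq> 30" "f < 8" "ad n f (wreg s i) < 2 ^ w"
  shows "ev w \<omega> (ldw f i r) s = s\<lparr>wreg := (wreg s)(30 := ad n f (wreg s i), r := arr n (wmem s) f (wreg s i))\<rparr>"
    "ev w \<omega> (ldr f i q) s = s\<lparr>wreg := (wreg s)(30 := ad n f (wreg s i)), rreg := (rreg s)(q := arr n (rmem s) f (wreg s i))\<rparr>"
    "r \<noteq> 30 \<Longrightarrow> ev w \<omega> (stw f i r) s = s\<lparr>wreg := (wreg s)(30 := ad n f (wreg s i)), wmem := (wmem s)(ad n f (wreg s i) := wreg s r)\<rparr>"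
    "ev w \<omega> (str f i q) s = s\<lparr>wreg := (wreg s)(30 := ad n f (wreg s i)), rmem := (rmem s)(ad n f (wreg s i) := rreg s q)\<rparr>"
  using assms by (simp_all add: ldw_def ldr_def stw_def str_def addr_val arr_def)

lemma wsub_1: "1 \<le> a \<Longrightarrow> a < 2 ^ w \<Longrightarrow> (a + 2 ^ w - Suc 0) mod 2 ^ w = a - 1"
proof -
  assume a: "1 \<le> a" "a < 2 ^ w"
  have "a + 2 ^ w - Suc 0 = (a - 1) + 2 ^ w" using a by simp
  then have "(a + 2 ^ w - Suc 0) mod 2 ^ w = (a - 1) mod 2 ^ w" by (simp only: mod_add_self2)
  then show ?thesis using a by (simp only: mod_less)
qed

end

lemma sum_nth: "distinct xs \<Longrightarrow> (\<Sum>j<length xs. f (xs ! j)) = (\<Sum>i\<in>set xs. (f i :: real))"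
  by (simp add: sum_list_distinct_conv_sum_set[symmetric] sum_list_sum_nth atLeast0LessThan)

section \<open>The program\<close>

text \<open>
  Word registers: 0 is \<open>n\<close>, 2 the number of nonzero coordinates, 3 to 6, 32, 33 the constants 0, 1, 2, 8,
  3, 4, 10 to 12 the numbers \<open>n + 1\<close>, \<open>4 * (n + 1)\<close>, \<open>2 * (n + 1)\<close>, 20 to 25 the array bases \<open>fb n 0\<close> to
  \<open>fb n 5\<close>, 8 the number of buckets, 9 the divisor that turns a random word into a bucket, 13 the loop
  counter, 14 the current item, 15 the pass, 17 the length of the output, 30 an address, 31 the
  carried item. Real registers: 0 to 2 the constants 0, 1, 1/2, 4 the threshold \<open>\<rho> / 2\<close>, 5 the mass \<open>s\<close>,
  7 the weight of the pass, 11 a random number, 15 the carried mass. Word arrays: 0 carried item of a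
  tree node, 1 item drawn in a cell, 2 cell and 3 node of the \<open>j\<close>-th item, 4 last cell of a bucket. Real
  arrays: 0 carried mass, 1 mass of a cell, 2 and 3 the two pieces of the \<open>j\<close>-th item, 4 filling of the
  last cell, 5 the numbers \<open>1 / dd n g\<close>.
\<close>

definition "p0 = blk [WConst 4 1, WConst 5 2, WConst 6 8, WConst 32 3, WConst 33 4, WOp WAdd 10 0 4, WOp WMul 11 10 33,
  WOp WMul 12 10 5, WOp WMul 20 10 6, WOp WAdd 21 20 4, WOp WAdd 22 21 4, WOp WAdd 23 22 4, WOp WAdd 24 23 4,
  WOp WAdd 25 24 4, ROfWord 1 4, ROfWord 2 5, ROp RDiv 2 1 2]"

definition "b1 = blk [RLoad 10 13, ROp RAdd 5 5 10, WOp WAdd 13 13 4]"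
definition "p1 = While (WLess 13 2) b1"

definition "b2 = blk [WOp WAdd 8 8 8, ROp RAdd 9 9 9]"
text \<open>Comparison with successive doublings finds the level without logarithm or rounding. The
  largest word divided by 2 ^ d, plus 1, is 2 ^ (w - d) up to overflow, and division by it leaves
  the leading \<open>d\<close> bits of a random word.\<close>

definition "p2 = sq [blk [RandReal 3 3, ROp RAdd 3 3 1, ROp RMul 3 3 2, ROp RMul 4 3 2, WOp WAdd 8 4 3, ROp RAdd 9 3 0],
  While (RLess 9 5) b2,
  blk [WNot 9 3, WOp WDiv 9 9 8, WOp WAdd 9 9 4]]"

definition "st5 = sq [blk [ROfWord 10 27, ROp RDiv 10 1 10], str 5 15 10]"
text \<open>Word register 26 holds \<open>tow g\<close> and 27 holds \<open>dd n g\<close>; shifting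
  1 by twice the former gives the next power of 4. A shift beyond the word length yields 0, which is
  read as a value above \<open>n\<close>.\<close>

definition "b3a = sq [blk [WOp WAdd 28 26 26, WOp WShl 28 4 28],
  Cond (WEq 28 3) (Instr (WOp WAdd 27 0 3)) (Cond (WLess 28 0) (Instr (WOp WAdd 27 28 3)) (Instr (WOp WAdd 27 0 3))),
  blk [WOp WShl 26 4 26, WOp WAdd 15 15 4]]"
definition "b3 = Seq b3a st5"
definition "p3 = sq [blk [WOp WAdd 26 4 3, WOp WAdd 27 4 3], st5, While (WLess 27 0) b3, Instr (WOp WAdd 15 15 4)]"

section \<open>Correctness of the level and of the schedule\<close>

context ram
begin

abbreviation "r \<equiv> rho \<omega>"
abbreviation "d \<equiv> lev r (vtot n x)"
abbreviation "h \<equiv> hsh n d \<omega>"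

lemma fx: "frac_vec n x" and x_outside: "i \<notin> {1..n} \<Longrightarrow> x i = 0"
  using x by (auto simp: supp_vec_def)

lemmas rr = rho_range[OF om]

lemma vtot_nth: "vtot n x = (\<Sum>j<N. x (is ! j))"
proof -
  have "vtot n x = (\<Sum>i\<in>nonzeros n x. x i)"
    unfolding vtot_def by (intro sum.mono_neutral_right) (auto simp: nonzeros_def)
  also have "\<dots> = (\<Sum>j<N. x (is ! j))"
    using sum_nth[OF is_props(4), of x] by (simp add: is_props(1,2))
  finally show ?thesis .
qed

lemma lev_d: "vtot n x \<le> 2 ^ d * r" "i < d \<Longrightarrow> 2 ^ i * r < vtot n x"
proof -
  obtain D :: nat where D: "vtot n x \<le> 2 ^ D / 2" using lev_ex[of "1/2" "vtot n x"] by auto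
  show "vtot n x \<le> 2 ^ d * r" "i < d \<Longrightarrow> 2 ^ i * r < vtot n x" using lev_props[OF rr(1) D] by blast+
qed

text \<open>Half of the buckets already failed to suffice: 2^(d - 1) * \<rho> is less than the mass,
  which is at most \<open>N\<close>, and \<open>\<rho>\<close> is at least 1/2. So a walk over all
  buckets costs O(nnz).\<close>

lemma K_le: "2 ^ d \<le> 4 * N"
proof (cases d)
  case 0
  then show ?thesis using N_pos by simp
next
  case (Suc d')
  have "x (is ! j) \<le> 1" if "j < N" for j using is_range[OF that] fx by (simp add: frac_vec_def)
  then have "vtot n x \<le> real N" unfolding vtot_nth using sum_mono[of "{..<N}" "\<lambda>j. x (is ! j)" "\<lambda>_. 1"] by simp
  moreover have "2 ^ d' * r < vtot n x" by (rule lev_d(2)) (simp only: Suc)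
  moreover have "2 ^ d' * (1 / 2) \<le> 2 ^ d' * r" using rr by (intro mult_left_mono) auto
  ultimately have "2 ^ d' \<le> 2 * real N" by linarith
  then have "real (2 ^ d) \<le> real (4 * N)" unfolding Suc by simp
  then show ?thesis by (simp only: of_nat_le_iff)
qed

lemma K_le_n: "2 ^ d \<le> 4 * n" using K_le N_le by linarith

lemma h_less: "h i < 2 ^ d" by (rule hsh_less[OF om])

definition C :: "state \<Rightarrow> bool" where "C s \<longleftrightarrow> cregs (wreg s) \<and> cregsr (rreg s) \<and> inp (wmem s) \<and> rinp (rmem s)"

text \<open>Memory outside the input starts at 0, so no array has to be cleared. Arrays are used
  from the highest number downwards, and \<open>F\<close> bounds those still untouched.\<close>

definition "zero_arrs F m \<longleftrightarrow> (\<forall>f<F. arr n m f = (\<lambda>_. 0))"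

lemma zero_arrs_upd: "F \<le> f \<Longrightarrow> f < 8 \<Longrightarrow> zero_arrs F (fun_upd m (ad n f i) v) = zero_arrs F m"
  by (auto simp: zero_arrs_def arr_upd)

lemma zero_arrs_input: "zero_arrs F (\<lambda>j. if j < N then f j else 0)"
  using N_le by (auto simp: zero_arrs_def arr_def ad_def fb_def fun_eq_iff)

lemma w_pos: "0 < w" using big by (cases w) auto

definition "Q0 s \<longleftrightarrow> C s \<and> zero_arrs 8 (wmem s) \<and> zero_arrs 8 (rmem s) \<and>
  wreg s 13 = 0 \<and> wreg s 15 = 0 \<and> wreg s 17 = 0 \<and> rreg s 5 = 0 \<and> rreg s 6 = 0"

lemma run_p0: "run w \<omega> p0 (input_state n k x) 17 Q0"
proof -
  note b = bigs(1)
  have "run w \<omega> p0 (input_state n k x) (sz p0) Q0"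
  proof (rule run_loopfree)
    show "loopfree p0" by (simp add: p0_def)
    have "8 < (2::nat) ^ w" "4 < (2::nat) ^ w" "3 < (2::nat) ^ w" "2 < (2::nat) ^ w" "1 < (2::nat) ^ w"
      "Suc n < 2 ^ w" "4 * Suc n < 2 ^ w" "2 * Suc n < 2 ^ w" "8 * Suc n + 5 < 2 ^ w" "0 < w"
      using b n by (simp_all, cases w, auto)
    then show "Q0 (ev w \<omega> p0 (input_state n k x))"
      by (simp add: zero_arrs_input p0_def input_state_def Let_def Q0_def C_def cregs_def cregsr_def inp_def rinp_def fb_def is_def[symmetric])
  qed
  then show ?thesis by (rule run_mono) (simp_all add: p0_def)
qed

definition "Q1 s \<longleftrightarrow> C s \<and> zero_arrs 8 (wmem s) \<and> zero_arrs 8 (rmem s) \<and>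
  wreg s 15 = 0 \<and> wreg s 17 = 0 \<and> rreg s 5 = vtot n x \<and> rreg s 6 = 0"

lemma run_p1:
  assumes "Q0 s"
  shows "run w \<omega> p1 s (4 * N + 1) Q1"
proof -
  define I where "I j s \<longleftrightarrow> C s \<and> zero_arrs 8 (wmem s) \<and> zero_arrs 8 (rmem s) \<and> wreg s 15 = 0 \<and> wreg s 17 = 0 \<and> rreg s 6 = 0
    \<and> wreg s 13 = j \<and> rreg s 5 = (\<Sum>j<j. x (is ! j))" for j s
  have "run w \<omega> p1 s ((N - 0) * (sz b1 + 1) + 1) (I N)"
    unfolding p1_def
  proof (rule run_While)
    show "I 0 s" using assms by (simp add: I_def Q0_def)
    show "\<not> holds (WLess 13 2) s" if "I N s" for s using that by (simp add: I_def C_def cregs_def)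
    fix j s assume I: "I j s" and j: "j < N"
    have "j + 1 < 2 ^ w" using j N_le bigs(1) by linarith
    then have "I (Suc j) (ev w \<omega> b1 s)"
      using I j by (simp add: I_def b1_def C_def cregsD rinp_def)
    moreover have "loopfree b1" by (simp add: b1_def)
    ultimately show "holds (WLess 13 2) s \<and> run w \<omega> b1 s (sz b1) (I (Suc j))"
      using I j by (intro conjI run_loopfree) (simp_all add: I_def C_def cregs_def)
  qed simp
  then show ?thesis
    by (rule run_mono) (simp_all add: b1_def I_def Q1_def vtot_nth)
qed

text \<open>For \<open>d = 0\<close> the divisor wraps around to 0; since division by 0 yields 0,
  every item then falls into bucket 0, as it should.\<close>

definition hdiv :: nat where "hdiv = ((2 ^ w - 1) div 2 ^ d + 1) mod 2 ^ w"

definition "Q2 s \<longleftrightarrow> C s \<and> zero_arrs 8 (wmem s) \<and> zero_arrs 8 (rmem s) \<and>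
  wreg s 15 = 0 \<and> wreg s 17 = 0 \<and> rreg s 6 = 0 \<and> wreg s 8 = 2 ^ d \<and> wreg s 9 = hdiv \<and> rreg s 4 = r / 2"

lemma run_p2:
  assumes "Q1 s"
  shows "run w \<omega> p2 s (3 * 2 ^ d + 10) Q2"
proof -
  define I where "I i s \<longleftrightarrow> C s \<and> zero_arrs 8 (wmem s) \<and> zero_arrs 8 (rmem s) \<and> wreg s 15 = 0 \<and> wreg s 17 = 0 \<and> rreg s 6 = 0
    \<and> rreg s 4 = r / 2 \<and> rreg s 5 = vtot n x \<and> wreg s 8 = 2 ^ i \<and> rreg s 9 = 2 ^ i * r" for i s
  define i1 where "i1 = blk [RandReal 3 3, ROp RAdd 3 3 1, ROp RMul 3 3 2, ROp RMul 4 3 2, WOp WAdd 8 4 3, ROp RAdd 9 3 0]"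
  define i3 where "i3 = blk [WNot 9 3, WOp WDiv 9 9 8, WOp WAdd 9 9 4]"
  have w1: "1 < (2::nat) ^ w" using bigs(1) by linarith
  have "run w \<omega> i1 s (sz i1) (I 0)"
  proof (rule run_loopfree)
    show "I 0 (ev w \<omega> i1 s)"
      using assms w1 w_pos by (simp add: I_def Q1_def i1_def C_def cregsD cregsrD rho_def algebra_simps)
  qed (simp add: i1_def)
  moreover have "run w \<omega> (While (RLess 9 5) b2) s ((d - 0) * (sz b2 + 1) + 1) (I d)" if "I 0 s" for s
  proof (rule run_While)
    show "I 0 s" by (rule that)
    show "\<not> holds (RLess 9 5) s" if "I d s" for s using that lev_d(1) by (simp add: I_def)
    fix i s assume I: "I i s" and i: "i < d"
    have "(2::nat) ^ Suc i \<le> 2 ^ d" using i by (intro power_increasing) auto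
    then have "2 ^ i + 2 ^ i < (2::nat) ^ w" using K_le_n bigs(1) by simp
    then have "I (Suc i) (ev w \<omega> b2 s)"
      using I by (simp add: I_def b2_def C_def)
    moreover have "loopfree b2" by (simp add: b2_def)
    ultimately show "holds (RLess 9 5) s \<and> run w \<omega> b2 s (sz b2) (I (Suc i))"
      using I lev_d(2)[OF i] by (intro conjI run_loopfree) (simp_all add: I_def)
  qed simp
  moreover have "run w \<omega> i3 s (sz i3) Q2" if "I d s" for s
  proof (rule run_loopfree)
    show "Q2 (ev w \<omega> i3 s)"
      using that by (simp add: I_def Q2_def i3_def C_def cregsD hdiv_def)
  qed (simp add: i3_def)
  moreover have "run w \<omega> Skip s 0 Q2" if "Q2 s" for s using run_loopfree[of Skip Q2 w \<omega> s] that by simp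
  ultimately have "run w \<omega> p2 s (sz i1 + (((d - 0) * (sz b2 + 1) + 1) + (sz i3 + 0))) Q2"
    unfolding p2_def sq.simps i1_def[symmetric] i3_def[symmetric] by (intro run_Seq)
  then show ?thesis
  proof (rule run_mono)
    have "d < 2 ^ d" by (rule less_exp)
    then show "sz i1 + (((d - 0) * (sz b2 + 1) + 1) + (sz i3 + 0)) \<le> 3 * 2 ^ d + 10"
      by (simp add: i1_def i3_def b2_def) (use \<open>d < 2 ^ d\<close> in linarith)
  qed simp
qed

lemma small: "i \<le> 8 * (n + 1) \<Longrightarrow> f < 8 \<Longrightarrow> ad n f i < 2 ^ w"
proof (rule bigs(2))
  assume "i \<le> 8 * (n + 1)"
  then have "i < 64 * (n + 1)" by simp
  also have "\<dots> \<le> 64 * ((n + 1) * (n + 1))" by (intro mult_le_mono2) simp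
  finally show "i < 64 * ((n + 1) * (n + 1))" .
qed

definition "SCH m \<longleftrightarrow> (\<forall>g\<le>npass n. arr n m 5 g = 1 / real (dd n g))"

definition "Q3 s \<longleftrightarrow> C s \<and> zero_arrs 8 (wmem s) \<and> zero_arrs 5 (rmem s) \<and> SCH (rmem s) \<and>
  wreg s 15 = Suc (npass n) \<and> wreg s 17 = 0 \<and> rreg s 6 = 0 \<and> wreg s 8 = 2 ^ d \<and> wreg s 9 = hdiv \<and> rreg s 4 = r / 2"

text \<open>While the schedule has not reached \<open>n\<close>, the exponents used in the shifts
  are small enough for a word.\<close>

lemma tow_less: "dd n g < n \<Longrightarrow> tow g \<le> n"
proof (cases g)
  case 0 then show ?thesis using n by simp
next
  case (Suc g')
  assume "dd n g < n"
  then have "(4::nat) ^ tow g' < n" by (simp add: Suc)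
  moreover have "(2::nat) ^ tow g' \<le> 4 ^ tow g'" by (rule power_mono) auto
  ultimately show ?thesis by (simp add: Suc)
qed

lemma npass_less: "npass n \<le> n + 1"
proof -
  have "n \<le> 4 ^ tow n"
  proof -
    have "n < 4 ^ n" by (rule less_le_trans[OF less_exp]) (rule power_mono, auto)
    also have "\<dots> \<le> 4 ^ tow n" using tow_ge[of n] by (intro power_increasing) auto
    finally show ?thesis by simp
  qed
  then have "n \<le> dd n (Suc n)" by simp
  then show ?thesis unfolding npass_def by (metis Least_le Suc_eq_plus1)
qed

text \<open>If the power is a multiple of 2 ^ w, its word is 0 and its true value exceeds
  \<open>n\<close>; otherwise the word is exact.\<close>

lemma next_dd:
  assumes "dd n g < n"
  defines "v \<equiv> 2 ^ (2 * tow g) mod 2 ^ w"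
  shows "(if v = 0 then n else if v < n then v else n) = dd n (Suc g)"
proof -
  have p: "(4::nat) ^ tow g = 2 ^ (2 * tow g)" by (simp add: power_mult)
  have nw: "n < 2 ^ w" using bigs(1) by linarith
  show ?thesis
  proof (cases "2 * tow g < w")
    case True
    then have "(2::nat) ^ (2 * tow g) < 2 ^ w" by (intro power_strict_increasing) auto
    then have "v = 4 ^ tow g" by (simp add: v_def p)
    then show ?thesis by simp
  next
    case False
    then have "(2::nat) ^ w dvd 2 ^ (2 * tow g)" by (intro le_imp_power_dvd) simp
    then have "v = 0" by (simp add: v_def)
    have "(2::nat) ^ w \<le> 2 ^ (2 * tow g)" using False by (intro power_increasing) auto
    then have "n \<le> 4 ^ tow g" using nw unfolding p by linarith
    then show ?thesis using \<open>v = 0\<close> by (simp add: min_absorb1)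
  qed
qed

lemma run_p3:
  assumes "Q2 s"
  shows "run w \<omega> p3 s (30 * npass n + 20) Q3"
proof -
  define I where "I g s \<longleftrightarrow> C s \<and> zero_arrs 8 (wmem s) \<and> zero_arrs 5 (rmem s) \<and> wreg s 17 = 0 \<and> rreg s 6 = 0
    \<and> wreg s 8 = 2 ^ d \<and> wreg s 9 = hdiv \<and> rreg s 4 = r / 2
    \<and> wreg s 15 = g \<and> wreg s 27 = dd n g \<and> (dd n g < n \<longrightarrow> wreg s 26 = tow g)
    \<and> (\<forall>g'\<le>g. arr n (rmem s) 5 g' = 1 / real (dd n g'))" for g s
  \<comment> \<open>As \<open>I\<close>, but before the reciprocal for \<open>g\<close> has been
    stored.\<close>
  define J where "J g s \<longleftrightarrow> C s \<and> zero_arrs 8 (wmem s) \<and> zero_arrs 5 (rmem s) \<and> wreg s 17 = 0 \<and> rreg s 6 = 0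
    \<and> wreg s 8 = 2 ^ d \<and> wreg s 9 = hdiv \<and> rreg s 4 = r / 2
    \<and> wreg s 15 = g \<and> wreg s 27 = dd n g \<and> (dd n g < n \<longrightarrow> wreg s 26 = tow g)
    \<and> (\<forall>g'<g. arr n (rmem s) 5 g' = 1 / real (dd n g'))" for g s
  have adg: "ad n 5 g < 2 ^ w" if "g \<le> npass n" for g
  proof -
    have "n + 1 \<le> (n + 1) * (n + 1)" by simp
    then have "g < 64 * ((n + 1) * (n + 1))" using that npass_less by linarith
    then show ?thesis by (rule bigs(2)) simp
  qed
  have st: "I g (ev w \<omega> st5 s)" if J: "J g s" and g: "g \<le> npass n" for g s
  proof -
    have c: "cregs (wreg s)" "cregsr (rreg s)" using J by (simp_all add: J_def C_def)
    show ?thesis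
      using J adg[OF g] unfolding I_def st5_def J_def C_def
      by (simp add: cregsD[OF c(1)] cregsrD[OF c(2)] ev_mem arr_upd zero_arrs_upd le_less del: dd.simps)
  qed
  define i1 where "i1 = blk [WOp WAdd 26 4 3, WOp WAdd 27 4 3]"
  define i4 where "i4 = Instr (WOp WAdd 15 15 4)"
  have w1: "1 < (2::nat) ^ w" using bigs(1) by linarith
  have "run w \<omega> i1 s (sz i1) (J 0)"
  proof (rule run_loopfree)
    show "J 0 (ev w \<omega> i1 s)"
      using assms w1 w_pos by (simp add: J_def Q2_def i1_def C_def cregsD zero_arrs_def)
  qed (simp add: i1_def)
  moreover have "run w \<omega> st5 s (sz st5) (I 0)" if "J 0 s" for s
    using st[OF that] by (intro run_loopfree) (simp_all add: st5_def)
  moreover have "run w \<omega> (While (WLess 27 0) b3) s ((npass n - 0) * (sz b3 + 1) + 1) (I (npass n))" if "I 0 s" for s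
  proof (rule run_While)
    show "I 0 s" by (rule that)
    show "\<not> holds (WLess 27 0) s" if "I (npass n) s" for s
      using that dd_npass[OF n] by (simp add: I_def C_def cregsD)
    fix g s assume I: "I g s" and g: "g < npass n"
    have lt: "dd n g < n" by (rule dd_less[OF g])
    have c: "cregs (wreg s)" "cregsr (rreg s)" using I by (simp_all add: I_def C_def)
    have e: "wreg s 26 = tow g" using I lt by (simp add: I_def)
    have tn: "2 * tow g < 2 ^ w" "n < 2 ^ w" "Suc g < 2 ^ w" using tow_less[OF lt] bigs(1) g npass_less by linarith+
    define v :: nat where "v = 2 ^ (tow g + tow g) mod 2 ^ w"
    note nd = next_dd[OF lt, unfolded mult_2, folded v_def]
    have tn': "tow g + tow g < 2 ^ w" using tn by simp
    have v: "v < 2 ^ w" by (simp add: v_def)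
    have nt: "2 ^ tow g mod 2 ^ w = tow (Suc g)" if "dd n (Suc g) < n"
      using le_less_trans[OF tow_less[OF that] tn(2)] by (simp only: tow.simps(2) mod_less)
    have "J (Suc g) (ev w \<omega> b3a s)"
    proof (cases "v = 0")
      case True
      then have "dd n (Suc g) = n" using nd by simp
      then show ?thesis using I tn tn' True unfolding I_def J_def C_def b3a_def
        by (simp add: cregsD[OF c(1)] e v_def[symmetric] less_Suc_eq_le del: dd.simps tow.simps)
    next
      case False
      show ?thesis
      proof (cases "v < n")
        case True
        then have "dd n (Suc g) = v" using nd False by simp
        then show ?thesis using I tn tn' True False nt v unfolding I_def J_def C_def b3a_def
          by (simp add: cregsD[OF c(1)] e v_def[symmetric] less_Suc_eq_le del: dd.simps tow.simps)
      next
        case False2: False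
        then have "dd n (Suc g) = n" using nd False by simp
        then show ?thesis using I tn tn' False False2 unfolding I_def J_def C_def b3a_def
          by (simp add: cregsD[OF c(1)] e v_def[symmetric] less_Suc_eq_le del: dd.simps tow.simps)
      qed
    qed
    then have "I (Suc g) (ev w \<omega> b3 s)"
      using st[of "Suc g" "ev w \<omega> b3a s"] g by (simp only: b3_def ev.simps Suc_le_eq)
    moreover have "loopfree b3" by (simp add: b3_def b3a_def st5_def)
    ultimately show "holds (WLess 27 0) s \<and> run w \<omega> b3 s (sz b3) (I (Suc g))"
      using I lt c by (intro conjI run_loopfree) (simp_all add: I_def cregsD)
  qed simp
  moreover have "run w \<omega> i4 s (sz i4) Q3" if "I (npass n) s" for s
  proof (rule run_loopfree)
    have "Suc (npass n) < 2 ^ w" using npass_less bigs(1) by linarith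
    then show "Q3 (ev w \<omega> i4 s)"
      using that by (simp add: I_def Q3_def i4_def C_def cregsD SCH_def)
  qed (simp add: i4_def)
  moreover have "run w \<omega> Skip s 0 Q3" if "Q3 s" for s using run_loopfree[of Skip Q3 w \<omega> s] that by simp
  ultimately have "run w \<omega> p3 s (sz i1 + (sz st5 + (((npass n - 0) * (sz b3 + 1) + 1) + (sz i4 + 0)))) Q3"
    unfolding p3_def sq.simps i1_def[symmetric] i4_def[symmetric] by (intro run_Seq)
  then show ?thesis
    by (rule run_mono) (simp_all add: i1_def i4_def st5_def b3_def b3a_def)
qed

end

section \<open>Placing the items into cells\<close>

text \<open>Replaces the ceiling, which the machine cannot compute: index and filling of the last
  cell are carried along, and one comparison with 1/2 detects the overflow.\<close>

lemma cix_step: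
  assumes p: "0 \<le> p" and v: "0 < v" "v \<le> 1/2"
  shows "\<not> 1/2 < offs p + v \<Longrightarrow> cix (p + v) = cix p \<and> offs (p + v) = offs p + v"
    "1/2 < offs p + v \<Longrightarrow> cix (p + v) = Suc (cix p) \<and> offs (p + v) = v - (1/2 - offs p)"
proof -
  have o: "0 \<le> offs p" "offs p \<le> 1/2" by (rule offs_range[OF p])+
  have e: "p + v = real (cix p) / 2 + (offs p + v)" by (simp add: offs_def)
  have c: "cix (p + v) = c" if "real c / 2 < p + v" "p + v \<le> (real c + 1) / 2" for c
  proof -
    have "\<lceil>2 * (p + v)\<rceil> = int c + 1" using that by (intro ceiling_unique) auto
    then show ?thesis by (simp add: cix_def)
  qed
  show "\<not> 1/2 < offs p + v \<Longrightarrow> cix (p + v) = cix p \<and> offs (p + v) = offs p + v"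
  proof -
    assume "\<not> 1/2 < offs p + v"
    then have "cix (p + v) = cix p" unfolding e using o v by (intro c[unfolded e]) (simp_all add: field_simps)
    then show ?thesis by (simp add: offs_def)
  qed
  show "1/2 < offs p + v \<Longrightarrow> cix (p + v) = Suc (cix p) \<and> offs (p + v) = v - (1/2 - offs p)"
  proof -
    assume a: "1/2 < offs p + v"
    have "cix (p + v) = Suc (cix p)" 
    proof (rule c)
      show "real (Suc (cix p)) / 2 < p + v" unfolding e using a by simp
      show "p + v \<le> (real (Suc (cix p)) + 1) / 2" unfolding e using o v by simp
    qed
    then show ?thesis by (simp add: offs_def add_divide_distrib)
  qed
qed

text \<open>\<open>lt4a\<close> splits a light item at the end of the last cell, \<open>lt4b\<close>
  is for one that still fits, and \<open>hv4\<close> gives a heavy item a cell of its own.\<close>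

definition "lt4a = sq [Instr (ROp RSub 13 2 11), str 2 13 13, Instr (ROp RSub 14 10 13), str 3 13 14, str 4 18 14,
  Instr (WOp WAdd 28 28 4), stw 4 18 28]"
definition "lt4b = sq [str 2 13 10, str 4 18 12]"
definition "lt4 = sq [ldw 4 18 28, ldr 4 18 11, Instr (WOp WAdd 19 19 28), stw 2 13 19, Instr (ROp RAdd 12 11 10),
  Cond (RLess 2 12) lt4a lt4b]"
definition "hv4 = sq [blk [WOp WAdd 19 19 12, WOp WAdd 19 19 14], stw 2 13 19, str 2 13 10]"
definition "b4 = sq [blk [WLoad 14 13, RLoad 10 13, WOp WMul 18 14 6, WOp WAdd 18 18 4, RandWord 18 18, WOp WDiv 18 18 9,
  WOp WAdd 19 18 8], stw 3 13 19, Instr (WOp WMul 19 18 11), Cond (RLess 10 4) lt4 hv4, Instr (WOp WAdd 13 13 4)]"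
definition "p4 = sq [Instr (WOp WAdd 13 3 3), While (WLess 13 2) b4]"

context ram
begin

text \<open>The prefix sums as the program meets them, over nonzero coordinates only; the others
  have no mass.\<close>

definition "pre_nth j b = (\<Sum>l<j. lmass r h x b (is ! l))"

lemma pre_nth_eq: "j < N \<Longrightarrow> pre r h x b (is ! j) = pre_nth j b"
proof -
  assume j: "j < N"
  have "pre r h x b (is ! j) = (\<Sum>i\<in>set (take j is). lmass r h x b i)"
    unfolding pre_def
  proof (rule sum.mono_neutral_right)
    show "set (take j is) \<subseteq> {1..<is ! j}"
    proof
      fix i assume "i \<in> set (take j is)"
      then obtain l where l: "l < j" "i = is ! l" using j is_props(1) by (auto simp: in_set_conv_nth)
      have "is ! l \<le> is ! j" using l j is_props by (intro sorted_nth_mono) auto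
      moreover have "is ! l \<noteq> is ! j" using l j is_props by (simp add: nth_eq_iff_index_eq)
      ultimately show "i \<in> {1..<is ! j}" using is_range[of l] l j by auto
    qed
    show "\<forall>i\<in>{1..<is ! j} - set (take j is). lmass r h x b i = 0"
    proof
      fix i assume i: "i \<in> {1..<is ! j} - set (take j is)"
      have "x i = 0"
      proof (rule ccontr)
        assume "x i \<noteq> 0"
        then have "i \<in> set is" using i is_range[OF j] by (auto simp: is_props(2) nonzeros_def)
        then obtain l where l: "l < N" "i = is ! l" using is_props(1) by (auto simp: in_set_conv_nth)
        have "\<not> l < j" using i l is_props(1) j by (auto simp: in_set_conv_nth)
        then have "is ! j \<le> is ! l" using l is_props by (intro sorted_nth_mono) auto
        then show False using i l by auto
      qed
      then show "lmass r h x b i = 0" by (simp add: lmass_def)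
    qed
  qed simp
  also have "\<dots> = pre_nth j b"
    using sum_nth[of "take j is" "lmass r h x b"] j is_props by (simp add: pre_nth_def)
  finally show ?thesis .
qed

lemma pre_nth_Suc: "pre_nth (Suc j) b = pre_nth j b + lmass r h x b (is ! j)"
  by (simp add: pre_nth_def)

lemma pre_nth_nonneg: "j \<le> N \<Longrightarrow> 0 \<le> pre_nth j b"
  unfolding pre_nth_def using lmass_nonneg[OF fx rr] is_range by (intro sum_nonneg) simp

lemma x_pos: "j < N \<Longrightarrow> 0 < x (is ! j)"
  using is_nth[of j] is_range[of j] fx by (auto simp: nonzeros_def frac_vec_def less_le)

text \<open>Truncating a random real to \<open>w\<close> bits and then to the leading
  \<open>d\<close> of them is the same as truncating to \<open>d\<close> bits at once. The case d =
  0 rests on the wrapped divisor.\<close>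

lemma hash_val:
  assumes i: "i \<in> {1..n}"
  shows "nat \<lfloor>2 ^ w * \<omega> (Suc (8 * i))\<rfloor> div hdiv = h i"
proof (cases "d = 0")
  case True
  then have "hdiv = 0" using w_pos by (simp add: hdiv_def)
  moreover have "h i = 0" using h_less[of i] True by simp
  ultimately show ?thesis by simp
next
  case False
  let ?u = "\<omega> (Suc (8 * i))"
  have "(2::nat) ^ d < 2 ^ w" using K_le_n bigs(1) by linarith
  then have dw: "d < w" by (rule power_less_imp_less_exp[rotated]) simp
  have pw: "(2::nat) ^ w = 2 ^ (w - d) * 2 ^ d" using dw by (simp add: power_add[symmetric])
  have "hdiv = 2 ^ (w - d)"
  proof -
    have "(2::nat) ^ w - 1 = (2 ^ (w - d) - 1) * 2 ^ d + (2 ^ d - 1)"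
      unfolding pw by (simp add: diff_mult_distrib)
    then have "((2::nat) ^ w - 1) div 2 ^ d = ((2 ^ (w - d) - 1) * 2 ^ d + (2 ^ d - 1)) div 2 ^ d" by (rule arg_cong)
    also have "\<dots> = 2 ^ (w - d) - 1" by (subst div_mult_self3) simp_all
    finally have "hdiv = 2 ^ (w - d) mod 2 ^ w" by (simp add: hdiv_def)
    moreover have "(2::nat) ^ (w - d) < 2 ^ w" using False dw by (intro power_strict_increasing) auto
    ultimately show ?thesis by simp
  qed
  moreover have "nat \<lfloor>2 ^ w * ?u\<rfloor> div 2 ^ (w - d) = nat \<lfloor>2 ^ d * ?u\<rfloor>"
  proof -
    have "0 \<le> 2 ^ w * ?u" using seed_bounds[OF om] by simp
    then have "nat \<lfloor>2 ^ w * ?u\<rfloor> div 2 ^ (w - d) = nat (\<lfloor>2 ^ w * ?u\<rfloor> div 2 ^ (w - d))"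
      by (simp add: nat_div_distrib nat_power_eq)
    also have "\<lfloor>2 ^ w * ?u\<rfloor> div 2 ^ (w - d) = \<lfloor>(2 ^ w * ?u) / real_of_int (2 ^ (w - d))\<rfloor>"
      by (rule floor_divide_real_eq_div[symmetric]) simp
    also have "(2 ^ w * ?u) / real_of_int (2 ^ (w - d)) = 2 ^ d * ?u"
    proof -
      have "(2::real) ^ w = 2 ^ (w - d) * 2 ^ d" using dw by (simp add: power_add[symmetric])
      then show ?thesis by simp
    qed
    finally show ?thesis .
  qed
  ultimately show ?thesis using i by (simp add: hsh_def haddr_def)
qed

abbreviation "ce i \<equiv> cel n r h x i"

lemma cel_less:
  assumes "i \<in> {1..n}"
  shows "Suc (ce i) < 20 * ((n + 1) * (n + 1))" "h i * (4 * (n + 1)) \<le> 16 * ((n + 1) * (n + 1))"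
proof -
  let ?M = "(n + 1) * (n + 1)"
  have M: "4 * (n + 1) \<le> 4 * ?M" by (intro mult_le_mono2) simp
  have "h i * (4 * (n + 1)) \<le> (4 * (n + 1)) * (4 * (n + 1))"
    using h_less[of i] K_le_n by (intro mult_right_mono) auto
  also have "\<dots> = 16 * ?M" by (simp add: algebra_simps)
  finally show *: "h i * (4 * (n + 1)) \<le> 16 * ?M" .
  have "ce i < 16 * ?M + 4 * (n + 1) - 1"
    using * cix_le[OF fx rr assms, of h "h i"] assms unfolding cel_def by (auto split: if_splits)
  then show "Suc (ce i) < 20 * ?M" using M by linarith
qed

lemma SCH_upd: "f < 5 \<Longrightarrow> SCH (fun_upd m (ad n f i) v) = SCH m"
  by (simp add: SCH_def arr_upd)

definition items :: "nat \<Rightarrow> state \<Rightarrow> bool" where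
  "items j s \<longleftrightarrow> (\<forall>l<j. arr n (wmem s) 2 l = ce (is ! l) \<and> arr n (wmem s) 3 l = 2 ^ d + h (is ! l)
     \<and> arr n (rmem s) 2 l = pc1 r h x (is ! l) \<and> arr n (rmem s) 3 l = x (is ! l) - pc1 r h x (is ! l))"

definition "Q4 s \<longleftrightarrow> C s \<and> zero_arrs 2 (wmem s) \<and> zero_arrs 2 (rmem s) \<and> SCH (rmem s) \<and>
  wreg s 15 = Suc (npass n) \<and> wreg s 17 = 0 \<and> rreg s 6 = 0 \<and> wreg s 8 = 2 ^ d \<and> items N s"

lemma run_p4:
  assumes "Q3 s"
  shows "run w \<omega> p4 s (60 * N + 2) Q4"
proof -
  \<comment> \<open>The second pieces from \<open>j\<close> on are required to be 0, because an item
    that is not split leaves this entry unwritten.\<close>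
  define I where "I j s \<longleftrightarrow> C s \<and> zero_arrs 2 (wmem s) \<and> zero_arrs 2 (rmem s) \<and> SCH (rmem s) \<and>
    wreg s 15 = Suc (npass n) \<and> wreg s 17 = 0 \<and> rreg s 6 = 0 \<and> wreg s 8 = 2 ^ d \<and> wreg s 9 = hdiv \<and> rreg s 4 = r / 2 \<and>
    wreg s 13 = j \<and> items j s \<and> (\<forall>l\<ge>j. arr n (rmem s) 3 l = 0) \<and>
    (\<forall>b. arr n (wmem s) 4 b = cix (pre_nth j b) \<and> arr n (rmem s) 4 b = offs (pre_nth j b))" for j s
  define i1 where "i1 = Instr (WOp WAdd 13 3 3)"
  have "run w \<omega> i1 s (sz i1) (I 0)"
  proof (rule run_loopfree)
    have z: "zero_arrs 2 (wmem s)" "zero_arrs 2 (rmem s)" using assms by (auto simp: Q3_def zero_arrs_def)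
    have z4: "arr n (wmem s) 4 b = 0" "arr n (rmem s) 4 b = 0" "arr n (rmem s) 3 b = 0" for b
      using assms by (simp_all add: Q3_def zero_arrs_def)
    have c: "cix 0 = 0" "offs 0 = 0" by (simp_all add: cix_def offs_def)
    show "I 0 (ev w \<omega> i1 s)"
      using assms z z4 c by (simp add: I_def i1_def Q3_def C_def cregsD items_def pre_nth_def)
  qed (simp add: i1_def)
  moreover have "run w \<omega> (While (WLess 13 2) b4) s ((N - 0) * (sz b4 + 1) + 1) (I N)" if "I 0 s" for s
  proof (rule run_While)
    show "I 0 s" by (rule that)
    show "\<not> holds (WLess 13 2) s" if "I N s" for s using that by (simp add: I_def C_def cregs_def)
    fix j s assume I: "I j s" and j: "j < N"
    let ?i = "is ! j"
    have i: "?i \<in> {1..n}" by (rule is_range[OF j])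
    have c: "cregs (wreg s)" "cregsr (rreg s)" using I by (simp_all add: I_def C_def)
    have s1: "wmem s j = ?i" "rmem s j = x ?i" using I j by (simp_all add: I_def C_def inp_def rinp_def)
    have s2: "wreg s 13 = j" "wreg s 8 = 2 ^ d" "wreg s 9 = hdiv" "rreg s 4 = r / 2" using I by (simp_all add: I_def)
    have s3: "arr n (wmem s) 4 b = cix (pre_nth j b)" "arr n (rmem s) 4 b = offs (pre_nth j b)" for b
      using I by (simp_all add: I_def)
    have s4: "arr n (rmem s) 3 j = 0" using I by (simp add: I_def)
    have hb: "h ?i < 2 ^ d" by (rule h_less)
    have a1: "ad n f j < 2 ^ w" if "f < 8" for f
      using j N_le by (intro small that) simp
    have a2: "ad n f (h ?i) < 2 ^ w" if "f < 8" for f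
      using hb K_le_n by (intro small that) simp
    define cs where "cs = 4 * (n + 1)"
    define ho where "ho = 2 * (n + 1)"
    note cr = cregsD[OF c(1), folded cs_def ho_def] cregsrD[OF c(2)]
    have hv: "nat \<lfloor>2 ^ w * \<omega> (Suc (?i * 8))\<rfloor> div hdiv = h ?i" using hash_val[OF i] by (simp only: mult.commute)
    have bnd: "h ?i * cs + ho + ?i < 2 ^ w"
    proof -
      have "4 * (n + 1) \<le> 4 * ((n + 1) * (n + 1))" by (intro mult_le_mono2) simp
      moreover have "ho + ?i \<le> 4 * (n + 1)" using i unfolding ho_def by simp
      ultimately show ?thesis
        using cel_less(2)[OF i] big unfolding cs_def by linarith
    qed
    have m: "(?i * 8) mod 2 ^ w = ?i * 8" "Suc (?i * 8) mod 2 ^ w = Suc (?i * 8)" "(h ?i + 2 ^ d) mod 2 ^ w = h ?i + 2 ^ d"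
      "Suc j mod 2 ^ w = Suc j" "(h ?i * cs) mod 2 ^ w = h ?i * cs" "(h ?i * cs + ho) mod 2 ^ w = h ?i * cs + ho"
      "(h ?i * cs + ho + ?i) mod 2 ^ w = h ?i * cs + ho + ?i"
    proof -
      have 1: "?i \<le> n" using i by simp
      have "?i * 8 < 2 ^ w" "Suc (?i * 8) < 2 ^ w" "h ?i + 2 ^ d < 2 ^ w" "Suc j < 2 ^ w"
        using 1 j N_le hb K_le_n bigs(1) by linarith+
      moreover have "h ?i * cs < 2 ^ w" "h ?i * cs + ho < 2 ^ w" using bnd by linarith+
      ultimately show "(?i * 8) mod 2 ^ w = ?i * 8" "Suc (?i * 8) mod 2 ^ w = Suc (?i * 8)" "(h ?i + 2 ^ d) mod 2 ^ w = h ?i + 2 ^ d"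
        "Suc j mod 2 ^ w = Suc j" "(h ?i * cs) mod 2 ^ w = h ?i * cs" "(h ?i * cs + ho) mod 2 ^ w = h ?i * cs + ho"
        "(h ?i * cs + ho + ?i) mod 2 ^ w = h ?i * cs + ho + ?i" using bnd by (simp_all only: mod_less)
    qed
    note eva = cr s1 s2 ev_mem arr_upd hv m a1 a2
    note inv = I_def C_def items_def cr s1 s2 s3 s4 arr_upd zero_arrs_upd SCH_upd All_less_Suc
    have st: "holds (WLess 13 2) s" using s2 c j by (simp add: cregsD)
    have "I (Suc j) (ev w \<omega> b4 s)"
    proof (cases "x ?i < r / 2")
      case False
      have l0: "pre_nth (Suc j) b = pre_nth j b" for b using False by (simp add: pre_nth_Suc lmass_def)
      have ceq: "ce ?i = h ?i * cs + ho + ?i" using False by (simp add: cel_def cs_def ho_def)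
      have p: "pc1 r h x ?i = x ?i" using False by (simp add: pc1_def)
      show ?thesis
        using False unfolding b4_def hv4_def
          by (simp add: eva del: mod_less) (use I in \<open>simp add: inv l0 ceq p\<close>)
    next
      case True
      note light = this
      have v: "0 < x ?i" "x ?i \<le> 1/2" using x_pos[OF j] True rr by auto
      define P where "P = pre_nth j (h ?i)"
      have P0: "0 \<le> P" unfolding P_def using pre_nth_nonneg j by simp
      note cs = cix_step[OF P0 v]
      have preq: "pre r h x (h ?i) ?i = P" unfolding P_def by (rule pre_nth_eq[OF j])
      have l1: "pre_nth (Suc j) b = (if b = h ?i then P + x ?i else pre_nth j b)" for b
        using True by (simp add: pre_nth_Suc lmass_def P_def)
      have cP: "cix P < 2 * n" unfolding preq[symmetric] by (rule cix_le[OF fx rr i])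
      have ceq: "ce ?i = h ?i * cs + cix P" using True preq by (simp add: cel_def cs_def)
      have p: "pc1 r h x ?i = min (x ?i) (1/2 - offs P)" using True preq by (simp add: pc1_def)
      have "h ?i * cs + cix P < 2 ^ w" "Suc (cix P) < 2 ^ w" using bnd cP bigs(1) by (simp_all add: ho_def)
      then have b2: "(h ?i * cs + cix P) mod 2 ^ w = h ?i * cs + cix P" "Suc (cix P) mod 2 ^ w = Suc (cix P)"
        by (simp_all only: mod_less)
      have s3P: "arr n (wmem s) 4 (h ?i) = cix P" "arr n (rmem s) 4 (h ?i) = offs P" using s3 by (simp_all add: P_def)
      show ?thesis
      proof (cases "1/2 < offs P + x ?i")
        case True
        then have p': "pc1 r h x ?i = 1/2 - offs P" using p by simp
        note cs' = cs(2)[OF True, THEN conjunct1] cs(2)[OF True, THEN conjunct2]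
        show ?thesis
          using light True unfolding b4_def lt4_def lt4a_def
          by (simp add: eva s3P b2 del: mod_less) (use I in \<open>simp add: inv s3P l1 ceq p' cs' P_def[symmetric]\<close>)
      next
        case False
        then have p': "pc1 r h x ?i = x ?i" using p by simp
        note cs' = cs(1)[OF False, THEN conjunct1] cs(1)[OF False, THEN conjunct2]
        show ?thesis
          using light False unfolding b4_def lt4_def lt4b_def
          by (simp add: eva s3P b2 del: mod_less) (use I in \<open>simp add: inv s3P l1 ceq p' cs' P_def[symmetric]\<close>)
      qed
    qed
    moreover have "loopfree b4" by (simp add: b4_def lt4_def hv4_def lt4a_def lt4b_def)
    ultimately show "holds (WLess 13 2) s \<and> run w \<omega> b4 s (sz b4) (I (Suc j))"
      using st by (intro conjI run_loopfree)
  qed simp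
  moreover have "run w \<omega> Skip s 0 Q4" if "I N s" for s
    using run_loopfree[of Skip Q4 w \<omega> s] that by (simp add: I_def Q4_def)
  ultimately have "run w \<omega> p4 s (sz i1 + (((N - 0) * (sz b4 + 1) + 1) + 0)) Q4"
    unfolding p4_def sq.simps i1_def[symmetric] by (intro run_Seq)
  then show ?thesis
    by (rule run_mono) (simp_all add: i1_def b4_def lt4_def hv4_def lt4a_def lt4b_def)
qed

end

section \<open>Running the passes\<close>

text \<open>One reservoir step for the cell in word register 19. The random number in real register
  11 is read before, as both cells of an item use it.\<close>

definition "addc = sq [ldr 1 19 13, Instr (ROp RAdd 13 13 12), str 1 19 13, Instr (ROp RMul 14 11 13),
  Cond (RLess 14 12) (stw 1 19 14) Skip]"
definition "b5 = sq [blk [WLoad 14 13, WOp WAdd 18 16 14, WOp WMul 18 18 6, WOp WAdd 18 18 5, RandReal 11 18],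
  ldw 2 13 19, ldr 2 13 12, Instr (ROp RMul 12 7 12), addc,
  Instr (WOp WAdd 19 19 4), ldr 3 13 12, Instr (ROp RMul 12 7 12), addc, Instr (WOp WAdd 13 13 4)]"
definition "o5 = sq [Instr (WOp WSub 15 15 4), ldr 5 15 10,
  blk [ROp RSub 7 10 6, ROp RAdd 6 10 0, WOp WMul 16 15 10, WOp WAdd 13 3 3]]"
definition "p5 = While (WLess 3 15) (Seq o5 (While (WLess 13 2) b5))"

text \<open>The acceptance test is strict, so an entry of mass 0 never displaces the held item. This
  permits reading only the nonzero coordinates.\<close>

lemma foldl_res_filter:
  assumes "\<omega> \<in> space seed_space" "0 \<le> fst p" "\<And>i. i \<in> set xs \<Longrightarrow> 0 \<le> q i" "\<And>i. i \<in> set xs \<Longrightarrow> \<not> P i \<Longrightarrow> q i = 0"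
  shows "foldl (res_step \<omega>) p (map (\<lambda>i. (f i, i, q i)) (filter P xs)) = foldl (res_step \<omega>) p (map (\<lambda>i. (f i, i, q i)) xs)"
  using assms(2-4)
proof (induction xs arbitrary: p)
  case (Cons i xs)
  have step: "0 \<le> fst (res_step \<omega> p (f i, i, q i))" using Cons.prems(1) Cons.prems(2)[of i] by (cases p) (simp add: res_step_def)
  have IH: "foldl (res_step \<omega>) p' (map (\<lambda>i. (f i, i, q i)) (filter P xs)) = foldl (res_step \<omega>) p' (map (\<lambda>i. (f i, i, q i)) xs)"
    if "0 \<le> fst p'" for p'
    using Cons.prems(2,3) by (intro Cons.IH[OF that]) simp_all
  show ?case
  proof (cases "P i")
    case True
    then show ?thesis using IH[OF step] by simp
  next
    case False
    have "0 \<le> \<omega> (f i) * fst p" using seed_bounds(1)[OF assms(1)] Cons.prems(1) by simp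
    then have "res_step \<omega> p (f i, i, q i) = p" using Cons.prems(3)[of i] False by (cases p) (simp add: res_step_def)
    then show ?thesis using IH[OF Cons.prems(1)] False by simp
  qed
qed simp

context ram
begin

lemma is_filter: "is = filter (\<lambda>i. x i \<noteq> 0) [1..<Suc n]"
proof (rule sorted_distinct_set_unique)
  show "set is = set (filter (\<lambda>i. x i \<noteq> 0) [1..<Suc n])"
    unfolding is_props(2) set_filter set_upt nonzeros_def by auto
  show "sorted (filter (\<lambda>i. x i \<noteq> 0) [1..<Suc n])" "distinct (filter (\<lambda>i. x i \<noteq> 0) [1..<Suc n])"
    by (simp_all add: sorted_wrt_filter del: upt_Suc)
qed (simp_all add: is_props)

abbreviation "v \<kappa> \<equiv> vv n r h x \<kappa>"
abbreviation "entry g \<kappa> \<equiv> (\<lambda>i. (saddr n g i, i, wt n g * v \<kappa> i))"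

text \<open>The state of the reservoir of cell \<open>\<kappa>\<close> after all passes above
  \<open>g\<close> and the first \<open>j\<close> nonzero items of pass \<open>g\<close>. All cells
  are served in a single scan.\<close>

definition "rs g j \<kappa> = foldl (res_step \<omega>) (res \<omega> (passes n (v \<kappa>) (Suc g))) (map (entry g \<kappa>) (take j is))"

lemma rs_Suc: "j < N \<Longrightarrow> rs g (Suc j) \<kappa> = res_step \<omega> (rs g j \<kappa>) (entry g \<kappa> (is ! j))"
  by (simp add: rs_def take_Suc_conv_app_nth is_props)

lemma v_nonneg: "i \<in> {1..n} \<Longrightarrow> 0 \<le> v \<kappa> i" by (rule vv_nonneg[OF fx rr])

lemma fst_res_passes: "0 \<le> fst (res \<omega> (passes n (v \<kappa>) g))"
proof -
  have "\<forall>e\<in>set (passes n (v \<kappa>) g). 0 \<le> snd (snd e)"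
    unfolding passes_def using entries_nonneg(1)[OF n, of "v \<kappa>", OF v_nonneg] by auto
  then show ?thesis unfolding fst_res by (rule total_nonneg)
qed

lemma rs_nonneg: "j \<le> N \<Longrightarrow> 0 \<le> fst (rs g j \<kappa>)"
proof (induction j)
  case 0
  then show ?case using fst_res_passes by (simp add: rs_def)
next
  case (Suc j)
  have "0 \<le> wt n g * v \<kappa> (is ! j)" using wt_nonneg[OF n] v_nonneg[OF is_range] Suc.prems by simp
  then show ?case using Suc by (cases "rs g j \<kappa>") (simp add: rs_Suc res_step_def)
qed

lemma v_zero: "i \<in> {1..n} \<Longrightarrow> x i = 0 \<Longrightarrow> v \<kappa> i = 0"
proof -
  assume i: "i \<in> {1..n}" and x0: "x i = 0"
  have "pc1 r h x i = 0" using pc1_range[OF fx rr i, of h] unfolding x0 by (rule antisym[rotated])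
  then show ?thesis unfolding vv_def x0 by (simp only: if_cancel diff_self)
qed

lemma rs_N: "g \<le> npass n \<Longrightarrow> rs g N \<kappa> = res \<omega> (passes n (v \<kappa>) g)"
proof -
  assume g: "g \<le> npass n"
  have "rs g N \<kappa> = foldl (res_step \<omega>) (res \<omega> (passes n (v \<kappa>) (Suc g))) (map (entry g \<kappa>) (filter (\<lambda>i. x i \<noteq> 0) [1..<Suc n]))"
  proof -
    have "take N is = is" by (simp add: is_props(1))
    then show ?thesis by (simp only: rs_def is_filter[symmetric])
  qed
  also have "\<dots> = foldl (res_step \<omega>) (res \<omega> (passes n (v \<kappa>) (Suc g))) (map (entry g \<kappa>) [1..<Suc n])"
  proof (rule foldl_res_filter[OF om fst_res_passes])
    fix i assume "i \<in> set [1..<Suc n]"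
    then have i: "i \<in> {1..n}" by auto
    show "0 \<le> wt n g * v \<kappa> i" using wt_nonneg[OF n] v_nonneg[OF i] by simp
    show "wt n g * v \<kappa> i = 0" if "\<not> x i \<noteq> 0" using v_zero[OF i] that by simp
  qed
  finally show ?thesis by (simp only: passes_step[OF g] pass_def res_def foldl_append)
qed

text \<open>An item has no share in cells other than its two, so a constant number of updates per
  item keeps every reservoir correct.\<close>

lemma rs_step_other: "j < N \<Longrightarrow> \<kappa> \<noteq> ce (is ! j) \<Longrightarrow> \<kappa> \<noteq> Suc (ce (is ! j)) \<Longrightarrow> rs g (Suc j) \<kappa> = rs g j \<kappa>"
proof -
  assume a: "j < N" "\<kappa> \<noteq> ce (is ! j)" "\<kappa> \<noteq> Suc (ce (is ! j))"
  then have "v \<kappa> (is ! j) = 0" by (simp add: vv_def)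
  moreover have "0 \<le> \<omega> (saddr n g (is ! j)) * fst (rs g j \<kappa>)"
    using seed_bounds(1)[OF om] rs_nonneg[of j g \<kappa>] a(1) by simp
  ultimately show ?thesis using a(1) by (cases "rs g j \<kappa>") (simp add: rs_Suc res_step_def)
qed

definition "Q5 s \<longleftrightarrow> C s \<and> zero_arrs 1 (wmem s) \<and> zero_arrs 1 (rmem s) \<and> wreg s 17 = 0 \<and> wreg s 8 = 2 ^ d \<and> items N s \<and>
  (\<forall>\<kappa>. arr n (rmem s) 1 \<kappa> = fst (tk n (v \<kappa>) \<omega>) \<and> arr n (wmem s) 1 \<kappa> = snd (tk n (v \<kappa>) \<omega>))"

lemma ev_addc:
  assumes "wreg s 6 = 8" "wreg s 21 = fb n 1" "wreg s 19 = \<kappa>" "ad n 1 \<kappa> < 2 ^ w"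
  shows "ev w \<omega> addc s = s\<lparr>wreg := (wreg s)(30 := ad n 1 \<kappa>),
    rreg := (rreg s)(13 := arr n (rmem s) 1 \<kappa> + rreg s 12, 14 := rreg s 11 * (arr n (rmem s) 1 \<kappa> + rreg s 12)),
    rmem := (rmem s)(ad n 1 \<kappa> := arr n (rmem s) 1 \<kappa> + rreg s 12),
    wmem := (if rreg s 11 * (arr n (rmem s) 1 \<kappa> + rreg s 12) < rreg s 12 then (wmem s)(ad n 1 \<kappa> := wreg s 14) else wmem s)\<rparr>"
proof (cases "rreg s 11 * (arr n (rmem s) 1 \<kappa> + rreg s 12) < rreg s 12")
  case True
  then show ?thesis using assms unfolding addc_def by (simp add: ev_mem)
next
  case False
  then show ?thesis using assms unfolding addc_def by (simp add: ev_mem)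
qed

definition "J5 g j s \<longleftrightarrow> C s \<and> zero_arrs 1 (wmem s) \<and> zero_arrs 1 (rmem s) \<and> SCH (rmem s) \<and> wreg s 17 = 0 \<and> wreg s 8 = 2 ^ d \<and> items N s \<and>
  wreg s 15 = g \<and> wreg s 16 = g * (n + 1) \<and> rreg s 6 = 1 / real (dd n g) \<and> rreg s 7 = wt n g \<and> wreg s 13 = j \<and>
  (\<forall>\<kappa>. arr n (rmem s) 1 \<kappa> = fst (rs g j \<kappa>) \<and> arr n (wmem s) 1 \<kappa> = snd (rs g j \<kappa>))"

lemma J5_step:
  assumes I: "J5 g j s" and j: "j < N" and g: "g \<le> npass n"
  shows "J5 g (Suc j) (ev w \<omega> b5 s)"
proof -
  let ?i = "is ! j"
  define \<kappa> where "\<kappa> = ce ?i"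
  define gm where "gm = g * (n + 1)"
  define u where "u = \<omega> (saddr n g ?i)"
  define q1 where "q1 = wt n g * pc1 r h x ?i"
  define q2 where "q2 = wt n g * (x ?i - pc1 r h x ?i)"
  have i: "?i \<in> {1..n}" by (rule is_range[OF j])
  have c: "cregs (wreg s)" "cregsr (rreg s)" using I by (simp_all add: J5_def C_def)
  note cr = cregsD[OF c(1)] cregsrD[OF c(2)]
  have s1: "wmem s j = ?i" using I j by (simp add: J5_def C_def inp_def)
  have s2: "wreg s 13 = j" "wreg s 16 = gm" "rreg s 7 = wt n g" using I by (simp_all add: J5_def gm_def)
  have s3: "arr n (wmem s) 2 j = \<kappa>" "arr n (rmem s) 2 j = pc1 r h x ?i" "arr n (rmem s) 3 j = x ?i - pc1 r h x ?i"
    using I j by (simp_all add: J5_def items_def \<kappa>_def)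
  have s4: "arr n (rmem s) (Suc 0) \<kappa>' = fst (rs g j \<kappa>')" "arr n (wmem s) (Suc 0) \<kappa>' = snd (rs g j \<kappa>')" for \<kappa>'
    using I by (simp_all add: J5_def)
  have a1: "ad n f j < 2 ^ w" if "f < 8" for f
    using j N_le by (intro small that) simp
  have a2: "ad n f \<kappa> < 2 ^ w" "ad n f (Suc \<kappa>) < 2 ^ w" if "f < 8" for f
    using cel_less(1)[OF i] unfolding \<kappa>_def by (intro bigs(2) that; linarith)+
  have gi: "gm + ?i < 64 * ((n + 1) * (n + 1))"
  proof -
    have "gm \<le> (n + 1) * (n + 1)" unfolding gm_def using g npass_less by (intro mult_right_mono) auto
    moreover have "n + 1 \<le> (n + 1) * (n + 1)" by simp
    moreover have "?i \<le> n" using i by simp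
    ultimately show ?thesis by linarith
  qed
  have m: "(gm + ?i) mod 2 ^ w = gm + ?i" "(gm * 8 + ?i * 8) mod 2 ^ w = gm * 8 + ?i * 8"
    "Suc (Suc (gm * 8 + ?i * 8)) mod 2 ^ w = Suc (Suc (gm * 8 + ?i * 8))" "Suc j mod 2 ^ w = Suc j" "Suc \<kappa> mod 2 ^ w = Suc \<kappa>"
  proof -
    have b: "Suc (Suc (gm * 8 + ?i * 8)) < 2 ^ w" using bigs(3)[OF gi] by simp
    have "Suc j < 2 ^ w" using j N_le bigs(1) by linarith
    moreover have "Suc \<kappa> < 2 ^ w" using cel_less(1)[OF i] big unfolding \<kappa>_def by linarith
    moreover have "gm + ?i < 2 ^ w" "gm * 8 + ?i * 8 < 2 ^ w" using b by linarith+
    ultimately show "(gm + ?i) mod 2 ^ w = gm + ?i" "(gm * 8 + ?i * 8) mod 2 ^ w = gm * 8 + ?i * 8"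
    "Suc (Suc (gm * 8 + ?i * 8)) mod 2 ^ w = Suc (Suc (gm * 8 + ?i * 8))" "Suc j mod 2 ^ w = Suc j" "Suc \<kappa> mod 2 ^ w = Suc \<kappa>"
      using b by (simp_all only: mod_less)
  qed
  have u: "\<omega> (Suc (Suc (gm * 8 + ?i * 8))) = u" unfolding u_def saddr_def gm_def by (simp add: algebra_simps)
  have q: "wt n g * pc1 r h x ?i = q1" "wt n g * (x ?i - pc1 r h x ?i) = q2" by (simp_all add: q1_def q2_def)
  have r1: "rs g (Suc j) \<kappa> = (fst (rs g j \<kappa>) + q1, if u * (fst (rs g j \<kappa>) + q1) < q1 then ?i else snd (rs g j \<kappa>))"
    by (cases "rs g j \<kappa>") (simp add: rs_Suc[OF j] res_step_def vv_def \<kappa>_def q1_def u_def)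
  have r2: "rs g (Suc j) (Suc \<kappa>) = (fst (rs g j (Suc \<kappa>)) + q2, if u * (fst (rs g j (Suc \<kappa>)) + q2) < q2 then ?i else snd (rs g j (Suc \<kappa>)))"
    by (cases "rs g j (Suc \<kappa>)") (simp add: rs_Suc[OF j] res_step_def vv_def \<kappa>_def q2_def u_def)
  have r3: "rs g (Suc j) \<kappa>' = rs g j \<kappa>'" if "\<kappa>' \<noteq> \<kappa>" "\<kappa>' \<noteq> Suc \<kappa>" for \<kappa>'
    using rs_step_other[OF j] that by (simp add: \<kappa>_def)
  note eva = cr s1 s2 s3 s4 ev_mem ev_addc arr_upd u q m a1 a2
  have fin: "(\<forall>\<kappa>'. arr n R (Suc 0) \<kappa>' = fst (rs g (Suc j) \<kappa>') \<and> arr n W (Suc 0) \<kappa>' = snd (rs g (Suc j) \<kappa>'))"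
    if "arr n R (Suc 0) = (arr n (rmem s) (Suc 0))(\<kappa> := fst (rs g (Suc j) \<kappa>), Suc \<kappa> := fst (rs g (Suc j) (Suc \<kappa>)))"
      "arr n W (Suc 0) = (arr n (wmem s) (Suc 0))(\<kappa> := snd (rs g (Suc j) \<kappa>), Suc \<kappa> := snd (rs g (Suc j) (Suc \<kappa>)))" for R W
    using that r3 s4 by simp
  show ?thesis
  proof (cases "u * (fst (rs g j \<kappa>) + q1) < q1"; cases "u * (fst (rs g j (Suc \<kappa>)) + q2) < q2")
    assume t: "u * (fst (rs g j \<kappa>) + q1) < q1" "u * (fst (rs g j (Suc \<kappa>)) + q2) < q2"
    show ?thesis unfolding b5_def
      by (simp add: eva t del: mod_less)
        (use I in \<open>simp add: J5_def C_def items_def s4 arr_upd zero_arrs_upd SCH_upd r1 r2 r3 t\<close>)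
  next
    assume t: "u * (fst (rs g j \<kappa>) + q1) < q1" "\<not> u * (fst (rs g j (Suc \<kappa>)) + q2) < q2"
    show ?thesis unfolding b5_def
      by (simp add: eva t del: mod_less)
        (use I in \<open>simp add: J5_def C_def items_def s4 arr_upd zero_arrs_upd SCH_upd r1 r2 r3 t\<close>)
  next
    assume t: "\<not> u * (fst (rs g j \<kappa>) + q1) < q1" "u * (fst (rs g j (Suc \<kappa>)) + q2) < q2"
    show ?thesis unfolding b5_def
      by (simp add: eva t del: mod_less)
        (use I in \<open>simp add: J5_def C_def items_def s4 arr_upd zero_arrs_upd SCH_upd r1 r2 r3 t\<close>)
  next
    assume t: "\<not> u * (fst (rs g j \<kappa>) + q1) < q1" "\<not> u * (fst (rs g j (Suc \<kappa>)) + q2) < q2"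
    show ?thesis unfolding b5_def
      by (simp add: eva t del: mod_less)
        (use I in \<open>simp add: J5_def C_def items_def s4 arr_upd zero_arrs_upd SCH_upd r1 r2 r3 t\<close>)
  qed
qed

lemma run_p5:
  assumes "Q4 s"
  shows "run w \<omega> p5 s (Suc (npass n) * (60 * N + 20) + 1) Q5"
proof -
  let ?m = "Suc (npass n)"
  \<comment> \<open>Real register 6 keeps the reciprocal of the pass just finished, and 0 before the
    highest one; the difference formed at the start of a pass is then \<open>wt n g\<close>.\<close>
  define I where "I t s \<longleftrightarrow> C s \<and> zero_arrs 1 (wmem s) \<and> zero_arrs 1 (rmem s) \<and> SCH (rmem s) \<and> wreg s 17 = 0 \<and> wreg s 8 = 2 ^ d \<and> items N s \<and>
    wreg s 15 = ?m - t \<and> rreg s 6 = (if t = 0 then 0 else 1 / real (dd n (?m - t))) \<and>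
    (\<forall>\<kappa>. arr n (rmem s) 1 \<kappa> = fst (res \<omega> (passes n (v \<kappa>) (?m - t))) \<and> arr n (wmem s) 1 \<kappa> = snd (res \<omega> (passes n (v \<kappa>) (?m - t))))" for t s
  have "run w \<omega> p5 s ((?m - 0) * ((sz o5 + ((N - 0) * (sz b5 + 1) + 1)) + 1) + 1) (I ?m)"
    unfolding p5_def
  proof (rule run_While)
    have z: "zero_arrs 1 (wmem s)" "zero_arrs 1 (rmem s)" "arr n (rmem s) (Suc 0) \<kappa> = 0" "arr n (wmem s) (Suc 0) \<kappa> = 0" for \<kappa>
      using assms by (auto simp: Q4_def zero_arrs_def)
    show "I 0 s" using assms z by (simp add: I_def Q4_def passes_end res_def)
    show "\<not> holds (WLess 3 15) s" if "I ?m s" for s using that by (simp add: I_def)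
    fix t s assume I: "I t s" and t: "t < ?m"
    define g where "g = npass n - t"
    have g: "g \<le> npass n" "?m - t = Suc g" "?m - Suc t = g" using t by (simp_all add: g_def)
    have c: "cregs (wreg s)" "cregsr (rreg s)" using I by (simp_all add: I_def C_def)
    have h1: "holds (WLess 3 15) s" using I t c by (simp add: I_def cregsD)
    have "run w \<omega> o5 s (sz o5) (J5 g 0)"
    proof (rule run_loopfree)
      have s15: "wreg s 15 = Suc g" using I g by (simp add: I_def)
      have sch: "arr n (rmem s) 5 g = 1 / real (dd n g)" using I g by (simp add: I_def SCH_def)
      have g2: "Suc g < 2 ^ w" using g npass_less bigs(1) by linarith
      then have m1: "(Suc g + 2 ^ w - Suc 0) mod 2 ^ w = g" using wsub_1[of "Suc g"] by simp
      have m1': "g mod 2 ^ w = g" using g2 by simp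
      have m2: "(g * Suc n) mod 2 ^ w = g * Suc n"
      proof -
        have "g * (n + 1) \<le> (n + 1) * (n + 1)" using g npass_less by (intro mult_right_mono) auto
        then have "g * (n + 1) < 2 ^ w" using big by linarith
        then show ?thesis by (simp only: Suc_eq_plus1 mod_less)
      qed
      have a: "ad n 5 g < 2 ^ w" using g npass_less by (intro small) simp_all
      have r6: "rreg s 6 = (if g = npass n then 0 else 1 / real (dd n (Suc g)))"
        using I t unfolding I_def g_def by (auto simp: Suc_diff_le)
      have rs0: "rs g' 0 \<kappa> = res \<omega> (passes n (v \<kappa>) (Suc g'))" for g' \<kappa> by (simp add: rs_def)
      show "J5 g 0 (ev w \<omega> o5 s)" unfolding o5_def
        by (simp add: cregsD[OF c(1)] cregsrD[OF c(2)] s15 sch m1 m1' m2 a ev_mem r6 del: mod_less mult_Suc_right dd.simps)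
         (use I in \<open>simp add: J5_def I_def C_def items_def g rs0 r6 wt_def del: mult_Suc_right dd.simps\<close>)
    qed (simp add: o5_def)
    moreover have "run w \<omega> (While (WLess 13 2) b5) s ((N - 0) * (sz b5 + 1) + 1) (J5 g N)" if "J5 g 0 s" for s
    proof (rule run_While)
      show "J5 g 0 s" by (rule that)
      show "\<not> holds (WLess 13 2) s" if "J5 g N s" for s using that by (simp add: J5_def C_def cregs_def)
      fix j s assume J: "J5 g j s" and j: "j < N"
      have "loopfree b5" by (simp add: b5_def addc_def)
      then show "holds (WLess 13 2) s \<and> run w \<omega> b5 s (sz b5) (J5 g (Suc j))"
        using J j J5_step[OF J j g(1)] by (intro conjI run_loopfree) (simp_all add: J5_def C_def cregs_def)
    qed simp
    ultimately have "run w \<omega> (Seq o5 (While (WLess 13 2) b5)) s (sz o5 + ((N - 0) * (sz b5 + 1) + 1)) (J5 g N)"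
      by (rule run_Seq)
    then have "run w \<omega> (Seq o5 (While (WLess 13 2) b5)) s (sz o5 + ((N - 0) * (sz b5 + 1) + 1)) (I (Suc t))"
      by (rule run_mono) (simp_all add: J5_def I_def rs_N[OF g(1)] g_def[symmetric])
    then show "holds (WLess 3 15) s \<and> run w \<omega> (Seq o5 (While (WLess 13 2) b5)) s (sz o5 + ((N - 0) * (sz b5 + 1) + 1)) (I (Suc t))"
      using h1 by blast
  qed simp
  then show ?thesis
  proof (rule run_mono)
    have *: "sz o5 + ((N - 0) * (sz b5 + 1) + 1) + 1 \<le> 60 * N + 20" by (simp add: o5_def b5_def addc_def)
    show "(?m - 0) * ((sz o5 + ((N - 0) * (sz b5 + 1) + 1)) + 1) + 1 \<le> ?m * (60 * N + 20) + 1"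
      unfolding diff_zero[of ?m] add_le_cancel_right by (rule mult_le_mono2[OF *])
    fix s' assume "I ?m s'"
    moreover have "tk n (v \<kappa>) \<omega> = res \<omega> (passes n (v \<kappa>) 0)" for \<kappa> by (simp add: tk_def entries_def passes_def)
    ultimately show "Q5 s'" by (simp add: I_def Q5_def)
  qed
qed

end

text \<open>Zero mass leaves the carried item undetermined, which allows the program to skip the items that
  lost their mass.\<close>

definition carries :: "(nat \<Rightarrow> real) \<Rightarrow> (nat \<Rightarrow> real) \<Rightarrow> tree \<Rightarrow> nat \<Rightarrow> real \<Rightarrow> bool" where
  "carries \<omega> z t a f \<longleftrightarrow> f = mfr z t \<and> (0 < f \<longrightarrow> sel (mlab z) z \<omega> t True = insert a (sel (mlab z) z \<omega> t False))"

section \<open>Pivotal rounding from the leaves upwards\<close>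

text \<open>The result consists of the carried item, its mass and the items settled as selected by
  this merge.\<close>

definition pivot :: "real \<Rightarrow> nat \<Rightarrow> real \<Rightarrow> nat \<Rightarrow> real \<Rightarrow> nat \<times> real \<times> nat set" where
  "pivot u a f b g = (if f + g < 1 then (if u * (f + g) < f then a else b, f + g, {})
     else if u * (2 - (f + g)) < 1 - g then (b, f + g - 1, {a}) else (a, f + g - 1, {b}))"

text \<open>\<open>sel\<close> is defined from the root downwards, while the program works upwards.
  This is possible since the two final bits of a node lead to sets that differ only in the carried
  item: one name and the settled items describe both.\<close>

lemma pivot_carries:
  assumes l: "carries \<omega> z l a f" "0 \<le> f" "f \<le> 1" and r: "carries \<omega> z r b g" "0 \<le> g" "g \<le> 1"
    and om: "\<omega> \<in> space seed_space" and p: "pivot (\<omega> p) a f b g = (c, t, S)"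
  shows "carries \<omega> z (Node p l r) c t"
    "sel (mlab z) z \<omega> (Node p l r) False = S \<union> sel (mlab z) z \<omega> l False \<union> sel (mlab z) z \<omega> r False"
proof -
  let ?u = "\<omega> p"
  note u = seed_bounds[OF om, of p]
  have m: "mfr z l = f" "mfr z r = g" using l r by (simp_all add: carries_def)
  have lam: "mlab z (Node p l r) \<longleftrightarrow> \<not> f + g < 1" by (simp add: mlab_def m)
  have fl: "0 < f \<Longrightarrow> sel (mlab z) z \<omega> l True = insert a (sel (mlab z) z \<omega> l False)"
    and gr: "0 < g \<Longrightarrow> sel (mlab z) z \<omega> r True = insert b (sel (mlab z) z \<omega> r False)"
    using l r by (simp_all add: carries_def)
  have "carries \<omega> z (Node p l r) c t \<and>
    sel (mlab z) z \<omega> (Node p l r) False = S \<union> sel (mlab z) z \<omega> l False \<union> sel (mlab z) z \<omega> r False"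
  proof (cases "f + g < 1")
    case lo: True
    show ?thesis
    proof (cases "?u * (f + g) < f")
      case True
      have "0 < f" using True u l(2) r(2) by (metis add_nonneg_nonneg le_less_trans mult_nonneg_nonneg)
      then show ?thesis using p lo True fl
        by (simp add: pivot_def carries_def m lam fr_mlab left_wins_def Un_commute)
    next
      case False
      have "0 < g" if "0 < f + g"
      proof -
        have "?u * (f + g) < 1 * (f + g)" using that u by (intro mult_strict_right_mono) auto
        then show ?thesis using False by simp
      qed
      then show ?thesis using p lo False gr
        by (simp add: pivot_def carries_def m lam fr_mlab left_wins_def Un_commute)
    qed
  next
    case hi: False
    have T: "sel (mlab z) z \<omega> l True = insert a (sel (mlab z) z \<omega> l False)"
      "sel (mlab z) z \<omega> r True = insert b (sel (mlab z) z \<omega> r False)" if "0 < f + g - 1"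
      using that l(3) r(3) fl gr by simp_all
    show ?thesis
    proof (cases "?u * (2 - (f + g)) < 1 - g")
      case True
      have "0 < f"
      proof (rule ccontr)
        assume "\<not> 0 < f"
        then have "f = 0" "g = 1" using l(2) hi r(3) by linarith+
        then show False using True u by simp
      qed
      then show ?thesis using p hi True T fl
        by (auto simp: pivot_def carries_def m lam fr_mlab left_wins_def)
    next
      case False
      have "0 < g"
      proof (rule ccontr)
        assume "\<not> 0 < g"
        then have "g = 0" "f = 1" using r(2) hi l(3) by linarith+
        then show False using False u by simp
      qed
      then show ?thesis using p hi False T gr
        by (auto simp: pivot_def carries_def m lam fr_mlab left_wins_def)
    qed
  qed
  then show "carries \<omega> z (Node p l r) c t"
    "sel (mlab z) z \<omega> (Node p l r) False = S \<union> sel (mlab z) z \<omega> l False \<union> sel (mlab z) z \<omega> r False" by blast+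
qed

text \<open>The bound \<open>f < 1\<close> keeps the merge low, where a positive mass wins against 0
  for every coin. With f = 1 the total would be exactly 1 and the carried item would be settled;
  caterpillars never reach this mass.\<close>

lemma carries_zero_leaf:
  assumes l: "carries \<omega> z l a f" "0 \<le> f" "f < 1" and z: "z i = 0" and om: "\<omega> \<in> space seed_space"
  shows "carries \<omega> z (Node p l (Leaf i)) a f"
    "sel (mlab z) z \<omega> (Node p l (Leaf i)) False = sel (mlab z) z \<omega> l False"
proof -
  have r: "carries \<omega> z (Leaf i) i 0" by (simp add: carries_def z)
  have u: "\<omega> p * f < f" if "0 < f"
    using that seed_bounds(2)[OF om, of p] by simp
  define c where "c = (if \<omega> p * (f + 0) < f then a else i)"
  have p: "pivot (\<omega> p) a f i 0 = (c, f, {})" using l by (simp add: pivot_def c_def)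
  have "carries \<omega> z (Node p l (Leaf i)) c f"
    by (rule pivot_carries[OF l(1,2) _ r _ _ om p]) (use l in auto)
  then show "carries \<omega> z (Node p l (Leaf i)) a f" using u by (simp add: carries_def c_def)
  show "sel (mlab z) z \<omega> (Node p l (Leaf i)) False = sel (mlab z) z \<omega> l False"
    using pivot_carries(2)[OF l(1,2) _ r _ _ om p] l by simp
qed

lemma mfr_btl:
  assumes "\<And>i. 0 \<le> z i \<and> z i \<le> 1"
  shows "0 \<le> mfr z (btl h b xs)" "mfr z (btl h b xs) < 1"
proof -
  have "0 \<le> mfr z (btl h b xs) \<and> mfr z (btl h b xs) < 1"
  proof (induction xs rule: rev_induct)
    case (snoc i xs)
    then show ?case using assms[of i] by (simp add: btl_snoc)
  qed simp
  then show "0 \<le> mfr z (btl h b xs)" "mfr z (btl h b xs) < 1" by blast+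
qed

lemma carries_btl_zeros:
  assumes z: "\<And>i. 0 \<le> z i \<and> z i \<le> 1" and om: "\<omega> \<in> space seed_space"
    and c: "carries \<omega> z (btl h b xs) a f" and 0: "\<And>i. i \<in> set ys \<Longrightarrow> z i = 0"
  shows "carries \<omega> z (btl h b (xs @ ys)) a f \<and>
    sel (mlab z) z \<omega> (btl h b (xs @ ys)) False = sel (mlab z) z \<omega> (btl h b xs) False"
  using 0
proof (induction ys rule: rev_induct)
  case Nil
  then show ?case using c by simp
next
  case (snoc i ys)
  have IH: "carries \<omega> z (btl h b (xs @ ys)) a f \<and>
    sel (mlab z) z \<omega> (btl h b (xs @ ys)) False = sel (mlab z) z \<omega> (btl h b xs) False"
    using snoc.prems by (intro snoc.IH) simp
  have f: "f = mfr z (btl h b (xs @ ys))" using IH by (simp add: carries_def)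
  have zi: "z i = 0" using snoc.prems by simp
  note cz = carries_zero_leaf[OF IH[THEN conjunct1] _ _ zi om, of "paddr i"]
  have "btl h b (xs @ ys @ [i]) = (if h i = b then Node (paddr i) (btl h b (xs @ ys)) (Leaf i) else btl h b (xs @ ys))"
    using btl_snoc[of h b "xs @ ys" i] by simp
  then show ?case using IH cz mfr_btl[OF z] f by simp
qed

text \<open>The subtree at heap number \<open>u\<close>, determined by the depth of the whole tree
  instead of its own height. The number 0 is cut off because it would be its own child.\<close>

function hT :: "(nat \<Rightarrow> tree) \<Rightarrow> nat \<Rightarrow> nat \<Rightarrow> tree" where
  "hT B d u = (if 2 ^ d \<le> u \<or> u = 0 then B u else Node (taddr u) (hT B d (2 * u)) (hT B d (Suc (2 * u))))"
  by pat_completeness auto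
termination by (relation "Wellfounded.measure (\<lambda>(B, d, u). 2 ^ d - u)") auto

declare hT.simps [simp del]

lemma ht_hT: "2 ^ l \<le> u \<Longrightarrow> u < 2 ^ Suc l \<Longrightarrow> ht B e u = hT B (l + e) u"
proof (induction e arbitrary: l u)
  case 0
  then show ?case by (simp add: hT.simps)
next
  case (Suc e)
  have "(2::nat) ^ Suc l \<le> 2 ^ (l + Suc e)" by (intro power_increasing) auto
  then have u: "\<not> (2 ^ (l + Suc e) \<le> u \<or> u = 0)" using Suc.prems by (auto simp: not_le intro: less_le_trans)
  have "ht B e (2 * u) = hT B (Suc l + e) (2 * u)" using Suc.prems by (intro Suc.IH) auto
  moreover have "ht B e (2 * u + 1) = hT B (Suc l + e) (2 * u + 1)" using Suc.prems by (intro Suc.IH) auto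
  ultimately show ?case using u by (subst hT.simps) simp
qed

section \<open>Merging along the caterpillars and the binary tree\<close>

text \<open>Disjunction with word register 3 and addition of real register 0 act as moves, both
  registers being 0.\<close>

definition "pivlo = sq [Instr (ROp RMul 13 11 16), Cond (RLess 13 15) Skip (Instr (WOp WOr 31 14 3)), Instr (ROp RAdd 15 16 0)]"
definition "pivhi = sq [blk [ROp RSub 13 1 16, ROp RAdd 13 13 1, ROp RMul 13 11 13, ROp RSub 14 1 12, ROp RSub 15 16 1],
  Cond (RLess 13 14) (blk [WStore 17 31, WOp WOr 31 14 3]) (Instr (WStore 17 14)), Instr (WOp WAdd 17 17 4)]"
definition "piv = sq [Instr (ROp RAdd 16 15 12), Cond (RLess 16 1) pivlo pivhi]"
definition "mrg t = sq [piv, stw 0 t 31, str 0 t 15]"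

definition "b6a = sq [Instr (WLoad 14 13), ldw 2 13 19, Instr (ROp RAdd 12 0 0), ldw 1 19 18, Cond (WEq 18 14) (ldr 1 19 12) Skip,
  Instr (WOp WAdd 19 19 4), ldw 1 19 18, Cond (WEq 18 14) (sq [ldr 1 19 13, Instr (ROp RAdd 12 12 13)]) Skip]"
definition "psh = sq [blk [WOp WMul 18 14 6, WOp WAdd 18 18 32, RandReal 11 18], ldw 3 13 19, ldw 0 19 31, ldr 0 19 15]"
definition "b6 = sq [b6a, Cond (RLess 0 12) (Seq psh (mrg 19)) Skip, Instr (WOp WAdd 13 13 4)]"
definition "p6 = Seq (Instr (WOp WAdd 13 3 3)) (While (WLess 13 2) b6)"

definition "b7a = sq [blk [WOp WMul 18 13 6, WOp WAdd 18 18 33, RandReal 11 18, WOp WAdd 19 13 13], ldw 0 19 31, ldr 0 19 15,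
  Instr (WOp WAdd 19 19 4), ldw 0 19 14, ldr 0 19 12]"
definition "b7 = sq [b7a, mrg 13, Instr (WOp WSub 13 13 4)]"
definition "p7 = Seq (Instr (WOp WSub 13 8 4)) (While (WLess 3 13) b7)"

definition "p8 = sq [ldw 0 4 31, ldr 0 4 15, blk [WConst 18 5, RandReal 11 18],
  Cond (RLess 11 15) (blk [WStore 17 31, WOp WAdd 17 17 4]) Skip, Instr (WOp WOr 0 17 3)]"

definition outs :: "state \<Rightarrow> nat set" where "outs s = wmem s ` {..<wreg s 17}"

context ram
begin

definition "piv_post s c t S s' \<longleftrightarrow> (\<forall>q. q \<notin> {17, 31} \<longrightarrow> wreg s' q = wreg s q) \<and> wreg s' 31 = c \<and>
  (\<forall>q. q \<notin> {13, 14, 15, 16} \<longrightarrow> rreg s' q = rreg s q) \<and> rreg s' 15 = t \<and> rmem s' = rmem s \<and>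
  (\<forall>f. arr n (wmem s') f = arr n (wmem s) f) \<and> (\<forall>a. a \<noteq> wreg s 17 \<longrightarrow> wmem s' a = wmem s a) \<and>
  wreg s' 17 \<le> Suc (wreg s 17) \<and> outs s' = S \<union> outs s"

lemma ev_piv:
  assumes c: "cregs (wreg s)" "cregsr (rreg s)" and cnt: "wreg s 17 \<le> 5 * n"
    and p: "pivot (rreg s 11) (wreg s 31) (rreg s 15) (wreg s 14) (rreg s 12) = (c, t, S)"
  shows "piv_post s c t S (ev w \<omega> piv s)"
proof -
  note cr = cregsD[OF c(1)] cregsrD[OF c(2)]
  have m: "Suc (wreg s 17) mod 2 ^ w = Suc (wreg s 17)" using cnt bigs(1) by (intro mod_less) linarith
  have low: "arr n (fun_upd M (wreg s 17) b) f = arr n M f" for M :: "nat \<Rightarrow> nat" and b f using cnt by (intro arr_upd_low) simp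
  have img: "fun_upd M k b ` {..<Suc k} = insert b (M ` {..<k})" for M :: "nat \<Rightarrow> nat" and k b
    by (auto simp: lessThan_Suc)
  show ?thesis
  proof (cases "rreg s 15 + rreg s 12 < 1")
    case lo: True
    show ?thesis
    proof (cases "rreg s 11 * (rreg s 15 + rreg s 12) < rreg s 15")
      case True
      then show ?thesis using p lo unfolding piv_def pivlo_def piv_post_def pivot_def
        by (auto simp: cr outs_def)
    next
      case False
      then show ?thesis using p lo unfolding piv_def pivlo_def piv_post_def pivot_def
        by (auto simp: cr outs_def)
    qed
  next
    case hi: False
    have e: "1 - (rreg s 15 + rreg s 12) + 1 = 2 - (rreg s 15 + rreg s 12)" by simp
    show ?thesis
    proof (cases "rreg s 11 * (2 - (rreg s 15 + rreg s 12)) < 1 - rreg s 12")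
      case True
      then show ?thesis using p hi unfolding piv_def pivhi_def piv_post_def pivot_def
        by (simp add: cr e del: mod_less) (auto simp: outs_def m low img simp del: mod_less)
    next
      case False
      then show ?thesis using p hi unfolding piv_def pivhi_def piv_post_def pivot_def
        by (simp add: cr e del: mod_less) (auto simp: outs_def m low img simp del: mod_less)
    qed
  qed
qed

definition "mrg_post s \<nu> c t S s' \<longleftrightarrow> (\<forall>q. q \<notin> {17, 30, 31} \<longrightarrow> wreg s' q = wreg s q) \<and>
  (\<forall>q. q \<notin> {13, 14, 15, 16} \<longrightarrow> rreg s' q = rreg s q) \<and>
  arr n (wmem s') 0 = (arr n (wmem s) 0)(\<nu> := c) \<and> arr n (rmem s') 0 = (arr n (rmem s) 0)(\<nu> := t) \<and>
  (\<forall>f. 0 < f \<longrightarrow> f < 8 \<longrightarrow> arr n (wmem s') f = arr n (wmem s) f \<and> arr n (rmem s') f = arr n (rmem s) f) \<and>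
  (\<forall>a<8 * (n + 1). a \<noteq> wreg s 17 \<longrightarrow> wmem s' a = wmem s a) \<and>
  wreg s' 17 \<le> Suc (wreg s 17) \<and> outs s' = S \<union> outs s"

lemma ev_mrg:
  assumes c: "cregs (wreg s)" "cregsr (rreg s)" and cnt: "wreg s 17 \<le> 5 * n"
    and p: "pivot (rreg s 11) (wreg s 31) (rreg s 15) (wreg s 14) (rreg s 12) = (c, t, S)"
    and \<nu>: "wreg s q = \<nu>" "q \<notin> {17, 30, 31}" "\<nu> \<le> 8 * (n + 1)"
  shows "mrg_post s \<nu> c t S (ev w \<omega> (mrg q) s)"
proof -
  define s1 where "s1 = ev w \<omega> piv s"
  have P: "piv_post s c t S s1" unfolding s1_def by (rule ev_piv[OF c cnt p])
  have r1: "wreg s1 6 = 8" "wreg s1 20 = fb n 0" "wreg s1 q = \<nu>" "wreg s1 31 = c" "rreg s1 15 = t"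
    using P \<nu> cregsD[OF c(1)] by (simp_all add: piv_post_def)
  have a: "ad n 0 \<nu> < 2 ^ w" using \<nu>(3) by (intro small) auto
  have e: "ev w \<omega> (mrg q) s = s1\<lparr>wreg := (wreg s1)(30 := ad n 0 \<nu>), wmem := (wmem s1)(ad n 0 \<nu> := c), rmem := (rmem s1)(ad n 0 \<nu> := t)\<rparr>"
    using r1 a \<nu>(2) unfolding mrg_def by (simp add: s1_def[symmetric] ev_mem del: One_nat_def)
  have o: "outs (s1\<lparr>wreg := (wreg s1)(30 := ad n 0 \<nu>), wmem := (wmem s1)(ad n 0 \<nu> := c), rmem := R\<rparr>) = outs s1" for R
  proof -
    have "wreg s1 17 \<le> Suc (5 * n)" using P cnt by (simp add: piv_post_def)
    then have "j < wreg s1 17 \<Longrightarrow> j < 8 * (n + 1)" for j by simp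
    then show ?thesis unfolding outs_def by (intro image_cong) (simp, simp add: upd_low del: fun_upd_apply)
  qed
  show ?thesis unfolding e mrg_post_def o
    using P by (auto simp: piv_post_def arr_upd upd_low fun_upd_other simp del: fun_upd_apply)
qed

end

context ram
begin

abbreviation "z \<equiv> zr n r h x \<omega>"
abbreviation "sF t \<equiv> sel (mlab z) z \<omega> t False"
definition "bound j = (if j < N then is ! j else Suc n)"
text \<open>The part of the caterpillar up to, but excluding, the next nonzero coordinate: zero
  coordinates in between count as already merged.\<close>

definition "bt j b = btl h b [1..<bound j]"

lemma z_range: "0 \<le> z i \<and> z i \<le> 1" using zr_range[OF fx rr om] by blast

lemma z_zero: "x i = 0 \<Longrightarrow> z i = 0"
proof (rule ccontr)
  assume x0: "x i = 0" and "z i \<noteq> 0"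
  then have i: "i \<in> {1..n}" and "zcell n r h x \<omega> (ce i) i \<noteq> 0 \<or> zcell n r h x \<omega> (Suc (ce i)) i \<noteq> 0"
    by (auto simp: zr_def zv_def split: if_splits)
  then obtain \<kappa> where k: "zcell n r h x \<omega> \<kappa> i \<noteq> 0" by blast
  show False using zcell_pos(2)[OF fx rr om k n] v_zero[OF i x0] by simp
qed

lemma is_gap: 
  assumes "i \<in> {1..n}" "x i \<noteq> 0"
  obtains l where "l < N" "i = is ! l"
proof -
  have "i \<in> set is" using assms by (simp add: is_props(2) nonzeros_def)
  then show ?thesis using that is_props(1) by (auto simp: in_set_conv_nth)
qed

lemma gap_zero:
  assumes j: "j < N" and i: "i \<in> set [Suc (is ! j)..<bound (Suc j)]"
  shows "z i = 0"
proof (rule z_zero, rule ccontr)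
  assume x0: "x i \<noteq> 0"
  have i1: "i \<in> {1..n}" using x0 x_outside by blast
  obtain l where l: "l < N" "i = is ! l" by (rule is_gap[OF i1 x0])
  have "\<not> l \<le> j" using sorted_nth_mono[OF is_props(3), of l j] i l j by (auto simp: is_props(1))
  then have "Suc j \<le> l" "Suc j < N" using l by auto
  then have "is ! Suc j \<le> is ! l" using sorted_nth_mono[OF is_props(3), of "Suc j" l] l by (simp add: is_props(1))
  then show False using i l \<open>Suc j < N\<close> by (simp add: bound_def)
qed

lemma start_zero:
  assumes i: "i \<in> set [1..<bound 0]"
  shows "z i = 0"
proof (rule z_zero, rule ccontr)
  assume x0: "x i \<noteq> 0"
  have i1: "i \<in> {1..n}" using x0 x_outside by blast
  obtain l where l: "l < N" "i = is ! l" by (rule is_gap[OF i1 x0])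
  have "is ! 0 \<le> is ! l" using sorted_nth_mono[OF is_props(3), of 0 l] l by (simp add: is_props(1))
  then show False using i l N_pos by (simp add: bound_def)
qed

lemma upt_bound: "j < N \<Longrightarrow> [1..<bound (Suc j)] = ([1..<is ! j] @ [is ! j]) @ [Suc (is ! j)..<bound (Suc j)]"
proof -
  assume j: "j < N"
  have "is ! j < bound (Suc j)"
  proof (cases "Suc j < N")
    case True
    have "is ! j \<le> is ! Suc j" using sorted_nth_mono[OF is_props(3), of j "Suc j"] True by (simp add: is_props(1))
    moreover have "is ! j \<noteq> is ! Suc j" using nth_eq_iff_index_eq[OF is_props(4), of j "Suc j"] True by (simp add: is_props(1))
    ultimately show ?thesis using True by (simp add: bound_def)
  next
    case False
    then show ?thesis using is_range[OF j] by (simp add: bound_def)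
  qed
  then have "[is ! j..<bound (Suc j)] = is ! j # [Suc (is ! j)..<bound (Suc j)]" by (rule upt_conv_Cons)
  moreover have "[1..<bound (Suc j)] = [1..<is ! j] @ [is ! j..<bound (Suc j)]"
    using is_range[OF j] \<open>is ! j < bound (Suc j)\<close> upt_add_eq_append[of 1 "is ! j" "bound (Suc j) - is ! j"] by simp
  ultimately show ?thesis by simp
qed

lemma bt_Suc_gap:
  assumes j: "j < N" and c: "carries \<omega> z (btl h b ([1..<is ! j] @ [is ! j])) a f"
  shows "carries \<omega> z (bt (Suc j) b) a f \<and> sF (bt (Suc j) b) = sF (btl h b ([1..<is ! j] @ [is ! j]))"
  unfolding bt_def upt_bound[OF j] by (rule carries_btl_zeros[OF z_range om c gap_zero[OF j]])

lemma bt_skip: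
  assumes j: "j < N" and 0: "h (is ! j) \<noteq> b \<or> z (is ! j) = 0" and c: "carries \<omega> z (bt j b) a f"
  shows "carries \<omega> z (bt (Suc j) b) a f \<and> sF (bt (Suc j) b) = sF (bt j b)"
proof -
  have b: "bt j b = btl h b [1..<is ! j]" using j by (simp add: bt_def bound_def)
  have "carries \<omega> z (btl h b ([1..<is ! j] @ [is ! j])) a f \<and> sF (btl h b ([1..<is ! j] @ [is ! j])) = sF (bt j b)"
  proof (cases "h (is ! j) = b")
    case False
    then show ?thesis using c by (simp add: btl_snoc b)
  next
    case True
    then show ?thesis using carries_btl_zeros[OF z_range om c[unfolded b], of "[is ! j]"] 0 by (simp add: b)
  qed
  then show ?thesis using bt_Suc_gap[OF j] by metis
qed

lemma bt_push:
  assumes j: "j < N" and b: "h (is ! j) = b" and c: "carries \<omega> z (bt j b) a f"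
    and p: "pivot (\<omega> (paddr (is ! j))) a f (is ! j) (z (is ! j)) = (c', t, S)"
  shows "carries \<omega> z (bt (Suc j) b) c' t \<and> sF (bt (Suc j) b) = S \<union> sF (bt j b)"
proof -
  have e: "bt j b = btl h b [1..<is ! j]" using j by (simp add: bt_def bound_def)
  have f: "0 \<le> f" "f \<le> 1" using c mfr_btl[where z=z and h=h and b=b and xs="[1..<is ! j]", OF z_range] by (simp_all add: carries_def e)
  have r: "carries \<omega> z (Leaf (is ! j)) (is ! j) (z (is ! j))" by (simp add: carries_def)
  note pc = pivot_carries[OF c f r z_range[THEN conjunct1] z_range[THEN conjunct2] om p]
  have N: "Node (paddr (is ! j)) (bt j b) (Leaf (is ! j)) = btl h b ([1..<is ! j] @ [is ! j])"
    using b by (simp add: btl_snoc e)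
  show ?thesis using bt_Suc_gap[OF j pc(1)[unfolded N]] pc(2)[unfolded N] by simp
qed

definition "tokens s \<longleftrightarrow> (\<forall>\<kappa>. arr n (rmem s) 1 \<kappa> = fst (tk n (v \<kappa>) \<omega>) \<and> arr n (wmem s) 1 \<kappa> = snd (tk n (v \<kappa>) \<omega>))"

text \<open>The output is written over the input. Each item settles at most one other, so at most
  \<open>j\<close> cells are overwritten, all of them already read.\<close>

definition "J6 j s \<longleftrightarrow> cregs (wreg s) \<and> cregsr (rreg s) \<and> wreg s 8 = 2 ^ d \<and> wreg s 13 = j \<and> wreg s 17 \<le> j \<and>
  items N s \<and> tokens s \<and> (\<forall>l. j \<le> l \<and> l < N \<longrightarrow> wmem s l = is ! l) \<and>
  (\<forall>b<2 ^ d. carries \<omega> z (bt j b) (arr n (wmem s) 0 (2 ^ d + b)) (arr n (rmem s) 0 (2 ^ d + b))) \<and>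
  outs s = (\<Union>b<2 ^ d. sF (bt j b))"

lemma ev_b6a:
  assumes J: "J6 j s" and j: "j < N"
  defines "s' \<equiv> ev w \<omega> b6a s"
  shows "wreg s' 14 = is ! j" "rreg s' 12 = z (is ! j)" "wmem s' = wmem s" "rmem s' = rmem s"
    "cregs (wreg s')" "cregsr (rreg s')" "wreg s' 8 = 2 ^ d" "wreg s' 13 = j" "wreg s' 17 = wreg s 17"
proof -
  let ?i = "is ! j"
  define \<kappa> where "\<kappa> = ce ?i"
  have i: "?i \<in> {1..n}" by (rule is_range[OF j])
  have c: "cregs (wreg s)" "cregsr (rreg s)" using J by (simp_all add: J6_def)
  note cr = cregsD[OF c(1)] cregsrD[OF c(2)]
  have s1: "wmem s j = ?i" "wreg s 13 = j" "wreg s 8 = 2 ^ d" using J j by (simp_all add: J6_def)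
  have s2: "arr n (wmem s) 2 j = \<kappa>" using J j by (simp add: J6_def items_def \<kappa>_def)
  have s3: "arr n (rmem s) (Suc 0) \<kappa>' = vtot n (v \<kappa>')" "arr n (wmem s) (Suc 0) \<kappa>' = snd (tk n (v \<kappa>') \<omega>)" for \<kappa>'
    using J by (simp_all add: J6_def tokens_def)
  have a1: "ad n f j < 2 ^ w" if "f < 8" for f
    using j N_le by (intro small that) simp
  have a2: "ad n f \<kappa> < 2 ^ w" "ad n f (Suc \<kappa>) < 2 ^ w" if "f < 8" for f
    using cel_less(1)[OF i] unfolding \<kappa>_def by (intro bigs(2) that; linarith)+
  have m: "Suc \<kappa> mod 2 ^ w = Suc \<kappa>" using cel_less(1)[OF i] big unfolding \<kappa>_def by (intro mod_less) linarith
  have z: "z ?i = (if snd (tk n (v \<kappa>) \<omega>) = ?i then vtot n (v \<kappa>) else 0) + (if snd (tk n (v (Suc \<kappa>)) \<omega>) = ?i then vtot n (v (Suc \<kappa>)) else 0)"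
    using i by (simp add: zr_def zv_def zcell_def \<kappa>_def)
  have *: "wreg s' 14 = ?i \<and> rreg s' 12 = z ?i \<and> wmem s' = wmem s \<and> rmem s' = rmem s \<and>
    cregs (wreg s') \<and> cregsr (rreg s') \<and> wreg s' 8 = 2 ^ d \<and> wreg s' 13 = j \<and> wreg s' 17 = wreg s 17"
  proof (cases "snd (tk n (v \<kappa>) \<omega>) = ?i"; cases "snd (tk n (v (Suc \<kappa>)) \<omega>) = ?i")
  qed (unfold s'_def b6a_def z, simp_all add: cr c s1 s2 s3 a1 a2 m ev_mem del: mod_less)
  then show "wreg s' 14 = is ! j" "rreg s' 12 = z (is ! j)" "wmem s' = wmem s" "rmem s' = rmem s"
    "cregs (wreg s')" "cregsr (rreg s')" "wreg s' 8 = 2 ^ d" "wreg s' 13 = j" "wreg s' 17 = wreg s 17" by blast+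
qed

lemma J6_step:
  assumes J: "J6 j s" and j: "j < N"
  shows "J6 (Suc j) (ev w \<omega> b6 s)"
proof -
  let ?i = "is ! j"
  have i: "?i \<in> {1..n}" by (rule is_range[OF j])
  define s1 where "s1 = ev w \<omega> b6a s"
  note e1 = ev_b6a[OF J j, folded s1_def]
  have mj: "Suc j mod 2 ^ w = Suc j" using j N_le bigs(1) by (intro mod_less) linarith
  have cJ: "carries \<omega> z (bt j b) (arr n (wmem s) 0 (2 ^ d + b)) (arr n (rmem s) 0 (2 ^ d + b))" if "b < 2 ^ d" for b
    using J that by (simp add: J6_def)
  have oJ: "outs s = (\<Union>b<2 ^ d. sF (bt j b))" using J by (simp add: J6_def)
  have o1: "outs s1 = outs s" by (simp add: outs_def e1)
  have outs13: "outs (s'\<lparr>wreg := (wreg s')(13 := k)\<rparr>) = outs s'" for s' k by (simp add: outs_def)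
  show ?thesis
  proof (cases "0 < z ?i")
    case False
    then have z0: "z ?i = 0" using z_range[of ?i] by simp
    have e: "ev w \<omega> b6 s = s1\<lparr>wreg := (wreg s1)(13 := Suc j)\<rparr>"
      using z0 unfolding b6_def by (simp add: s1_def[symmetric] e1 cregsD[OF e1(5)] cregsrD[OF e1(6)] mj del: mod_less)
    have sk: "carries \<omega> z (bt (Suc j) b) (arr n (wmem s) 0 (2 ^ d + b)) (arr n (rmem s) 0 (2 ^ d + b)) \<and> sF (bt (Suc j) b) = sF (bt j b)"
      if "b < 2 ^ d" for b
      by (rule bt_skip[OF j _ cJ[OF that]]) (simp add: z0)
    have "items N (s1\<lparr>wreg := (wreg s1)(13 := Suc j)\<rparr>)" "tokens (s1\<lparr>wreg := (wreg s1)(13 := Suc j)\<rparr>)"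
      using J by (simp_all add: items_def tokens_def e1 J6_def)
    then show ?thesis unfolding e using J sk
      by (simp add: J6_def e1 outs13 o1 oJ)
  next
    case True
    let ?\<nu> = "2 ^ d + h ?i"
    have hb: "h ?i < 2 ^ d" by (rule h_less)
    define s2 where "s2 = ev w \<omega> psh s1"
    have c1: "cregs (wreg s1)" "cregsr (rreg s1)" by (rule e1)+
    have it: "arr n (wmem s1) 3 j = ?\<nu>" using J j by (simp add: J6_def items_def e1)
    have a1: "ad n f j < 2 ^ w" "ad n f ?\<nu> < 2 ^ w" if "f < 8" for f
      using j N_le hb K_le_n by (intro small that; simp)+
    have b: "?i * 8 + 3 < 2 ^ w" using i bigs(1) by simp
    have m: "(?i * 8) mod 2 ^ w = ?i * 8" "(?i * 8 + 3) mod 2 ^ w = ?i * 8 + 3" using b by (intro mod_less; linarith)+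
    have u: "\<omega> (?i * 8 + 3) = \<omega> (paddr ?i)" by (simp add: paddr_def mult.commute)
    have E2: "wreg s2 19 = ?\<nu> \<and> wreg s2 31 = arr n (wmem s) 0 ?\<nu> \<and> rreg s2 15 = arr n (rmem s) 0 ?\<nu> \<and> rreg s2 11 = \<omega> (paddr ?i) \<and>
      wreg s2 14 = ?i \<and> rreg s2 12 = z ?i \<and> wmem s2 = wmem s \<and> rmem s2 = rmem s \<and> cregs (wreg s2) \<and> cregsr (rreg s2) \<and>
      wreg s2 8 = 2 ^ d \<and> wreg s2 13 = j \<and> wreg s2 17 = wreg s 17"
      unfolding s2_def psh_def
      by (simp add: cregsD[OF c1(1)] cregsrD[OF c1(2)] c1 e1(1-4) e1(7-9) it[unfolded e1] a1 m u ev_mem del: mod_less)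
    obtain c t S where p: "pivot (\<omega> (paddr ?i)) (arr n (wmem s) 0 ?\<nu>) (arr n (rmem s) 0 ?\<nu>) ?i (z ?i) = (c, t, S)"
      by (metis prod_cases3)
    define s3 where "s3 = ev w \<omega> (mrg 19) s2"
    have P: "mrg_post s2 ?\<nu> c t S s3" unfolding s3_def
    proof (rule ev_mrg)
      show "wreg s2 17 \<le> 5 * n" using J j N_le E2 by (simp add: J6_def)
      show "?\<nu> \<le> 8 * (n + 1)" using hb K_le_n by simp
    qed (use E2 p in simp_all)
    have c3: "cregs (wreg s3)" "cregsr (rreg s3)"
      using P E2 by (simp_all add: mrg_post_def cregs_def cregsr_def)
    have r3: "wreg s3 13 = j" "wreg s3 8 = 2 ^ d" "wreg s3 17 \<le> Suc (wreg s 17)" "outs s3 = S \<union> outs s"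
      "arr n (wmem s3) 0 = (arr n (wmem s) 0)(?\<nu> := c)" "arr n (rmem s3) 0 = (arr n (rmem s) 0)(?\<nu> := t)"
      using P E2 by (simp_all add: mrg_post_def outs_def)
    have f3: "arr n (wmem s3) f = arr n (wmem s) f" "arr n (rmem s3) f = arr n (rmem s) f" if "0 < f" "f < 8" for f
      using P E2 that by (simp_all add: mrg_post_def)
    have w3: "wmem s3 a = wmem s a" if "a < 8 * (n + 1)" "a \<noteq> wreg s 17" for a
      using P E2 that by (simp add: mrg_post_def)
    have e: "ev w \<omega> b6 s = s3\<lparr>wreg := (wreg s3)(13 := Suc j)\<rparr>"
    proof -
      have "ev w \<omega> b6 s = ev w \<omega> (Instr (WOp WAdd 13 13 4)) s3"
        using True unfolding b6_def by (simp add: s1_def[symmetric] s2_def[symmetric] s3_def[symmetric] e1(2) cregsrD[OF e1(6)] del: step.simps)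
      then show ?thesis by (simp add: r3 cregsD[OF c3(1)] mj del: mod_less)
    qed
    have it3: "items N (s3\<lparr>wreg := (wreg s3)(13 := Suc j)\<rparr>)" "tokens (s3\<lparr>wreg := (wreg s3)(13 := Suc j)\<rparr>)"
      using J by (simp_all add: items_def tokens_def f3 J6_def)
    have l3: "wmem s3 l = is ! l" if "Suc j \<le> l" "l < N" for l
    proof -
      have "l < 8 * (n + 1)" using that N_le by simp
      moreover have "wreg s 17 \<le> j" "wmem s l = is ! l" using J that by (simp_all add: J6_def)
      ultimately show ?thesis using w3[of l] that by simp
    qed
    have pu: "carries \<omega> z (bt (Suc j) (h ?i)) c t \<and> sF (bt (Suc j) (h ?i)) = S \<union> sF (bt j (h ?i))"
      by (rule bt_push[OF j refl cJ[OF hb] p])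
    have sk: "carries \<omega> z (bt (Suc j) b) (arr n (wmem s) 0 (2 ^ d + b)) (arr n (rmem s) 0 (2 ^ d + b)) \<and> sF (bt (Suc j) b) = sF (bt j b)"
      if "b < 2 ^ d" "b \<noteq> h ?i" for b
      by (rule bt_skip[OF j _ cJ[OF that(1)]]) (use that in auto)
    have ca: "carries \<omega> z (bt (Suc j) b) (arr n (wmem s3) 0 (2 ^ d + b)) (arr n (rmem s3) 0 (2 ^ d + b))" if "b < 2 ^ d" for b
      using pu sk[OF that] by (cases "b = h ?i") (simp_all add: r3)
    have "(\<Union>b<2 ^ d. sF (bt (Suc j) b)) = S \<union> (\<Union>b<2 ^ d. sF (bt j b))"
    proof (intro equalityI subsetI)
      fix y assume "y \<in> (\<Union>b<2 ^ d. sF (bt (Suc j) b))"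
      then obtain b where b: "b < 2 ^ d" "y \<in> sF (bt (Suc j) b)" by blast
      then show "y \<in> S \<union> (\<Union>b<2 ^ d. sF (bt j b))" using pu sk[OF b(1)] by (cases "b = h ?i") auto
    next
      fix y assume y: "y \<in> S \<union> (\<Union>b<2 ^ d. sF (bt j b))"
      show "y \<in> (\<Union>b<2 ^ d. sF (bt (Suc j) b))"
      proof (cases "y \<in> S")
        case True
        then show ?thesis using pu hb by blast
      next
        case False
        then obtain b where b: "b < 2 ^ d" "y \<in> sF (bt j b)" using y by blast
        then have "y \<in> sF (bt (Suc j) b)" using pu sk[OF b(1)] by (cases "b = h ?i") auto
        then show ?thesis using b by blast
      qed
    qed
    then have "outs s3 = (\<Union>b<2 ^ d. sF (bt (Suc j) b))" by (simp add: r3 oJ)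
    then show ?thesis unfolding e using J c3 r3(1-3) ca l3 it3
      by (simp add: J6_def outs13)
  qed
qed

lemma run_p6:
  assumes "Q5 s"
  shows "run w \<omega> p6 s (100 * N + 5) (J6 N)"
proof -
  let ?i1 = "Instr (WOp WAdd 13 3 3)"
  have "run w \<omega> ?i1 s (sz ?i1) (J6 0)"
  proof (rule run_loopfree)
    have z: "arr n (wmem s) 0 b = 0" "arr n (rmem s) 0 b = 0" for b using assms by (simp_all add: Q5_def zero_arrs_def)
    have "carries \<omega> z (btl h b []) 0 0" for b by (simp add: carries_def)
    then have "carries \<omega> z (btl h b ([] @ [1..<bound 0])) 0 0 \<and> sF (btl h b ([] @ [1..<bound 0])) = sF (btl h b [])" for b
      by (rule carries_btl_zeros[OF z_range om]) (rule start_zero)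
    then have b0: "carries \<omega> z (bt 0 b) 0 0" "sF (bt 0 b) = {}" for b by (simp_all add: bt_def)
    have "tokens (s\<lparr>wreg := (wreg s)(13 := 0)\<rparr>)" "items N (s\<lparr>wreg := (wreg s)(13 := 0)\<rparr>)"
      using assms by (simp_all add: Q5_def tokens_def items_def)
    then show "J6 0 (ev w \<omega> ?i1 s)"
      using assms z b0 by (simp add: Q5_def J6_def C_def cregsD inp_def outs_def)
  qed simp
  moreover have "run w \<omega> (While (WLess 13 2) b6) s ((N - 0) * (sz b6 + 1) + 1) (J6 N)" if "J6 0 s" for s
  proof (rule run_While)
    show "J6 0 s" by (rule that)
    show "\<not> holds (WLess 13 2) s" if "J6 N s" for s using that by (simp add: J6_def cregs_def)
    fix j s assume J: "J6 j s" and j: "j < N"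
    have "loopfree b6" by (simp add: b6_def b6a_def psh_def mrg_def piv_def pivlo_def pivhi_def)
    then show "holds (WLess 13 2) s \<and> run w \<omega> b6 s (sz b6) (J6 (Suc j))"
      using J j J6_step[OF J j] by (intro conjI run_loopfree) (simp_all add: J6_def cregs_def)
  qed simp
  ultimately have "run w \<omega> p6 s (sz ?i1 + ((N - 0) * (sz b6 + 1) + 1)) (J6 N)"
    unfolding p6_def by (rule run_Seq)
  then show ?thesis
    by (rule run_mono) (simp_all add: b6_def b6a_def psh_def mrg_def piv_def pivlo_def pivhi_def)
qed

definition "bkt u = btl h (u - 2 ^ d) [1..<Suc n]"
abbreviation "tr u \<equiv> hT bkt d u"
text \<open>The frontier when the nodes above \<open>k\<close> have been processed: finished nodes
  whose parent is still to come.\<close>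

definition fro :: "nat \<Rightarrow> nat set" where "fro k = {u. k < u \<and> u < 2 * 2 ^ d \<and> u div 2 \<le> k}"

text \<open>Each merge lowers \<open>k\<close> by one and settles at most one item, which bounds the
  output by N + 2^d, at most 5n. It never reaches the arrays, which begin at 8 (n + 1).\<close>

definition "K7 k s \<longleftrightarrow> cregs (wreg s) \<and> cregsr (rreg s) \<and> wreg s 13 = k \<and> k < 2 ^ d \<and> wreg s 17 + k < N + 2 ^ d \<and>
  (\<forall>u\<in>fro k. carries \<omega> z (tr u) (arr n (wmem s) 0 u) (arr n (rmem s) 0 u)) \<and> outs s = (\<Union>u\<in>fro k. sF (tr u))"

lemma tr_range: "0 \<le> mfr z (tr u) \<and> mfr z (tr u) \<le> 1"
  by (rule mfr_range) (rule z_range)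

lemma K7_step:
  assumes K: "K7 (Suc k) s"
  shows "K7 k (ev w \<omega> b7 s)"
proof -
  let ?v = "Suc k"
  have c: "cregs (wreg s)" "cregsr (rreg s)" and v: "wreg s 13 = ?v" "?v < 2 ^ d" and cnt: "wreg s 17 + ?v < N + 2 ^ d"
    using K by (simp_all add: K7_def)
  have mem: "2 * ?v \<in> fro ?v" "Suc (2 * ?v) \<in> fro ?v" using v by (auto simp: fro_def)
  have cl: "carries \<omega> z (tr u) (arr n (wmem s) 0 u) (arr n (rmem s) 0 u)" if "u \<in> fro ?v" for u
    using K that by (simp add: K7_def)
  have oK: "outs s = (\<Union>u\<in>fro ?v. sF (tr u))" using K by (simp add: K7_def)
  have f: "0 \<le> arr n (rmem s) 0 u" "arr n (rmem s) 0 u \<le> 1" if "u \<in> fro ?v" for u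
    using cl[OF that] tr_range by (simp_all add: carries_def)
  have trv: "tr ?v = Node (taddr ?v) (tr (2 * ?v)) (tr (Suc (2 * ?v)))" using v by (subst hT.simps) simp
  define V where "V = ?v"
  define s1 where "s1 = ev w \<omega> b7a s"
  have vn: "V < 4 * n" using v K_le_n unfolding V_def by linarith
  have a1: "ad n 0 (V + V) < 2 ^ w" "ad n 0 (Suc (V + V)) < 2 ^ w"
    using vn by (intro small; simp)+
  have b: "V * 8 + 4 < 2 ^ w" "Suc (V + V) < 2 ^ w" using vn bigs(1) by simp_all
  have m: "(V * 8) mod 2 ^ w = V * 8" "(V * 8 + 4) mod 2 ^ w = V * 8 + 4" "(V + V) mod 2 ^ w = V + V" "Suc (V + V) mod 2 ^ w = Suc (V + V)"
    using b by (intro mod_less; linarith)+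
  have u: "\<omega> (V * 8 + 4) = \<omega> (taddr V)" by (simp add: taddr_def mult.commute)
  have E1: "wreg s1 31 = arr n (wmem s) 0 (V + V) \<and> rreg s1 15 = arr n (rmem s) 0 (V + V) \<and>
     wreg s1 14 = arr n (wmem s) 0 (Suc (V + V)) \<and> rreg s1 12 = arr n (rmem s) 0 (Suc (V + V)) \<and> rreg s1 11 = \<omega> (taddr V) \<and>
     wmem s1 = wmem s \<and> rmem s1 = rmem s \<and> cregs (wreg s1) \<and> cregsr (rreg s1) \<and> wreg s1 13 = V \<and> wreg s1 17 = wreg s 17"
    unfolding s1_def b7a_def
    by (simp add: cregsD[OF c(1)] cregsrD[OF c(2)] c v(1)[folded V_def] a1 m u ev_mem del: mod_less)
  obtain c' t S where p: "pivot (\<omega> (taddr V)) (arr n (wmem s) 0 (V + V)) (arr n (rmem s) 0 (V + V))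
      (arr n (wmem s) 0 (Suc (V + V))) (arr n (rmem s) 0 (Suc (V + V))) = (c', t, S)"
    by (metis prod_cases3)
  have VV: "2 * ?v = V + V" by (simp add: V_def)
  have pc: "carries \<omega> z (tr ?v) c' t" "sF (tr ?v) = S \<union> sF (tr (2 * ?v)) \<union> sF (tr (Suc (2 * ?v)))"
    unfolding trv
    by (rule pivot_carries[OF cl[OF mem(1)] f[OF mem(1)] cl[OF mem(2)] f[OF mem(2)] om p[folded VV, unfolded V_def]])+
  define s2 where "s2 = ev w \<omega> (mrg 13) s1"
  have P: "mrg_post s1 V c' t S s2" unfolding s2_def
  proof (rule ev_mrg)
    show "wreg s1 17 \<le> 5 * n" using cnt E1 N_le K_le_n by linarith
    show "V \<le> 8 * (n + 1)" using vn by simp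
  qed (use E1 p in simp_all)
  have c2: "cregs (wreg s2)" "cregsr (rreg s2)"
    using P E1 by (simp_all add: mrg_post_def cregs_def cregsr_def)
  have r2: "wreg s2 13 = Suc k" "wreg s2 17 \<le> Suc (wreg s 17)" "outs s2 = S \<union> outs s"
    "arr n (wmem s2) 0 = (arr n (wmem s) 0)(?v := c')" "arr n (rmem s2) 0 = (arr n (rmem s) 0)(?v := t)"
    using P E1 by (simp_all add: mrg_post_def outs_def V_def)
  have e: "ev w \<omega> b7 s = s2\<lparr>wreg := (wreg s2)(13 := k)\<rparr>"
  proof -
    have "k < 2 ^ w" using vn bigs(1) unfolding V_def by linarith
    then have "(k + 2 ^ w) mod 2 ^ w = k" by simp
    moreover have "ev w \<omega> b7 s = ev w \<omega> (Instr (WOp WSub 13 13 4)) s2"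
      unfolding b7_def by (simp add: s1_def[symmetric] s2_def[symmetric] del: step.simps)
    ultimately show ?thesis by (simp add: r2 cregsD[OF c2(1)])
  qed
  \<comment> \<open>The merged node takes the place of its two children; the rest of the frontier is
    untouched.\<close>
  have F: "fro k = insert ?v (fro ?v - {2 * ?v, Suc (2 * ?v)})"
  proof (rule set_eqI)
    fix u
    have "u div 2 = Suc k \<longleftrightarrow> u = 2 * Suc k \<or> u = Suc (2 * Suc k)" by presburger
    moreover have "?v div 2 \<le> k" "?v < 2 * 2 ^ d" using v by simp_all
    ultimately show "u \<in> fro k \<longleftrightarrow> u \<in> insert ?v (fro ?v - {2 * ?v, Suc (2 * ?v)})"
      using v unfolding fro_def by auto
  qed
  have ca: "carries \<omega> z (tr u) (arr n (wmem s2) 0 u) (arr n (rmem s2) 0 u)" if "u \<in> fro k" for u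
  proof (cases "u = ?v")
    case True
    then show ?thesis using pc(1) by (simp add: r2)
  next
    case False
    then show ?thesis using that cl[of u] unfolding F by (simp add: r2)
  qed
  have "(\<Union>u\<in>fro k. sF (tr u)) = S \<union> (\<Union>u\<in>fro ?v. sF (tr u))"
    unfolding F using pc(2) mem by blast
  then have "outs s2 = (\<Union>u\<in>fro k. sF (tr u))" by (simp add: r2 oK)
  moreover have "outs (s2\<lparr>wreg := (wreg s2)(13 := k)\<rparr>) = outs s2" by (simp add: outs_def)
  moreover have "wreg s2 17 + k < N + 2 ^ d" using r2(2) cnt by simp
  ultimately show ?thesis unfolding e using c2 v ca by (simp add: K7_def)
qed

lemma run_p7:
  assumes "J6 N s"
  shows "run w \<omega> p7 s (60 * 2 ^ d + 5) (K7 0)"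
proof -
  let ?i1 = "Instr (WOp WSub 13 8 4)"
  let ?m = "2 ^ d - 1 :: nat"
  have "run w \<omega> ?i1 s (sz ?i1) (K7 ?m)"
  proof (rule run_loopfree)
    have c: "cregs (wreg s)" "cregsr (rreg s)" and s8: "wreg s 8 = 2 ^ d" and cnt: "wreg s 17 \<le> N" using assms by (simp_all add: J6_def)
    have "(2::nat) ^ d < 2 ^ w" using K_le_n bigs(1) by linarith
    then have m: "(2 ^ d + 2 ^ w - Suc 0) mod 2 ^ w = ?m" by (intro wsub_1) simp_all
    have e: "ev w \<omega> ?i1 s = s\<lparr>wreg := (wreg s)(13 := ?m)\<rparr>" using m by (simp add: cregsD[OF c(1)] s8)
    have F: "fro ?m = {2 ^ d..<2 * 2 ^ d}" by (auto simp: fro_def)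
    have t: "tr u = bt N (u - 2 ^ d)" if "u \<in> fro ?m" for u
      using that unfolding F by (subst hT.simps) (simp add: bkt_def bt_def bound_def)
    have ca: "carries \<omega> z (tr u) (arr n (wmem s) 0 u) (arr n (rmem s) 0 u)" if "u \<in> fro ?m" for u
    proof -
      have "u - 2 ^ d < 2 ^ d" "2 ^ d + (u - 2 ^ d) = u" using that unfolding F by auto
      then show ?thesis using assms t[OF that] unfolding J6_def by metis
    qed
    have "(\<Union>b<2 ^ d. sF (bt N b)) = (\<Union>u\<in>fro ?m. sF (tr u))"
    proof -
      have "{..<2 ^ d} = (\<lambda>u. u - 2 ^ d) ` fro ?m"
      proof (intro equalityI subsetI)
        fix b :: nat assume "b \<in> {..<2 ^ d}"
        then show "b \<in> (\<lambda>u. u - 2 ^ d) ` fro ?m" unfolding F by (intro image_eqI[of _ _ "2 ^ d + b"]) auto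
      qed (auto simp: F[unfolded One_nat_def])
      then have "(\<Union>b<2 ^ d. sF (bt N b)) = (\<Union>u\<in>fro ?m. sF (bt N (u - 2 ^ d)))" by simp
      then show ?thesis using t by simp
    qed
    then have "outs s = (\<Union>u\<in>fro ?m. sF (tr u))" using assms by (simp add: J6_def)
    moreover have "outs (s\<lparr>wreg := (wreg s)(13 := ?m)\<rparr>) = outs s" by (simp add: outs_def)
    moreover have "wreg s 17 + ?m < N + 2 ^ d"
    proof -
      have "?m < 2 ^ d" by simp
      then show ?thesis using cnt by linarith
    qed
    ultimately show "K7 ?m (ev w \<omega> ?i1 s)" unfolding e using c ca by (simp add: K7_def)
  qed simp
  moreover have "run w \<omega> (While (WLess 3 13) b7) s ((?m - 0) * (sz b7 + 1) + 1) (\<lambda>s. K7 (?m - ?m) s)" if "K7 ?m s" for s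
  proof (rule run_While[where I="\<lambda>t. K7 (?m - t)" and m=0 and m'="?m"])
    show "K7 (?m - 0) s" using that by simp
    show "\<not> holds (WLess 3 13) s" if "K7 (?m - ?m) s" for s using that by (simp add: K7_def)
    fix t s assume K: "K7 (?m - t) s" and t: "t < ?m"
    have e: "?m - t = Suc (?m - Suc t)" using t by simp
    have "loopfree b7" by (simp add: b7_def b7a_def mrg_def piv_def pivlo_def pivhi_def)
    moreover have "holds (WLess 3 13) s" using K t by (simp add: K7_def cregs_def)
    ultimately show "holds (WLess 3 13) s \<and> run w \<omega> b7 s (sz b7) (K7 (?m - Suc t))"
      using K7_step[OF K[unfolded e]] by (intro conjI run_loopfree)
  qed simp
  ultimately have "run w \<omega> p7 s (sz ?i1 + ((?m - 0) * (sz b7 + 1) + 1)) (\<lambda>s. K7 (?m - ?m) s)"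
    unfolding p7_def by (rule run_Seq)
  then show ?thesis
  proof (rule run_mono)
    have "sz b7 + 1 \<le> 60" by (simp add: b7_def b7a_def mrg_def piv_def pivlo_def pivhi_def)
    then have "?m * (sz b7 + 1) \<le> 2 ^ d * 60" by (intro mult_le_mono) simp_all
    then show "sz ?i1 + ((?m - 0) * (sz b7 + 1) + 1) \<le> 60 * 2 ^ d + 5" by simp
  qed simp
qed

lemma run_p8:
  assumes "K7 0 s"
  shows "run w \<omega> p8 s 20 (\<lambda>s. output_set s = Alg n \<omega> x)"
proof -
  let ?t = "bucket_tree n h d"
  have c: "cregs (wreg s)" "cregsr (rreg s)" and cnt: "wreg s 17 < 5 * n + 1" using assms K_le_n N_le by (simp_all add: K7_def)
  have "(1::nat) \<le> 2 ^ d" by simp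
  then have "(1::nat) < 2 * 2 ^ d" by linarith
  then have "fro 0 = {1}" by (auto simp: fro_def)
  moreover have "tr 1 = ?t" using ht_hT[of 0 1 bkt d] by (simp add: bucket_tree_def bkt_def[abs_def])
  ultimately have ca: "carries \<omega> z ?t (arr n (wmem s) 0 1) (arr n (rmem s) 0 1)" and o: "outs s = sF ?t"
    using assms by (simp_all add: K7_def)
  define a f where "a = arr n (wmem s) 0 1" and "f = arr n (rmem s) 0 1"
  have A: "Alg n \<omega> x = sel (mlab z) z \<omega> ?t (\<omega> 5 < f)"
    using ca by (simp add: Alg_def Asub_def Aset_def final_def fr_mlab carries_def f_def)
  have ad1: "ad n 0 (Suc 0) < 2 ^ w" by (intro small) simp_all
  have m: "5 mod 2 ^ w = (5::nat)" "Suc (wreg s 17) mod 2 ^ w = Suc (wreg s 17)" using cnt bigs(1) n by (intro mod_less; linarith)+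
  have img: "{..<Suc k} \<inter> {x. x \<noteq> k} = {..<k}" for k :: nat by auto
  have "run w \<omega> p8 s (sz p8) (\<lambda>s. output_set s = Alg n \<omega> x)"
  proof (rule run_loopfree)
    show "loopfree p8" by (simp add: p8_def)
    have af: "arr n (wmem s) 0 (Suc 0) = a" "arr n (rmem s) 0 (Suc 0) = f" by (simp_all add: a_def f_def)
    show "output_set (ev w \<omega> p8 s) = Alg n \<omega> x"
    proof (cases "\<omega> 5 < f")
      case True
      \<comment> \<open>Only a carried item of positive mass is meaningful, and the last coin
        selects it only in that case.\<close>
      then have "0 < f" using seed_bounds(1)[OF om, of 5] by linarith
      then have "Alg n \<omega> x = insert a (outs s)" using ca True by (simp add: A carries_def o a_def f_def)
      then show ?thesis using True unfolding p8_def output_set_def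
        by (simp add: cregsD[OF c(1)] af ad1 m ev_mem img outs_def del: mod_less)
    next
      case False
      then have "Alg n \<omega> x = outs s" by (simp add: A o)
      then show ?thesis using False unfolding p8_def output_set_def
        by (simp add: cregsD[OF c(1)] af ad1 m ev_mem outs_def del: mod_less)
    qed
  qed
  then show ?thesis by (rule run_mono) (simp_all add: p8_def)
qed

end

section \<open>The complete program and its running time\<close>

definition main_prog :: program where
  "main_prog = Seq p0 (Seq p1 (Seq p2 (Seq p3 (Seq p4 (Seq p5 (Seq p6 (Seq p7 p8)))))))"

text \<open>Initially word register 3 is 0 and register 2 is the number of nonzero coordinates. For
  the zero vector it is enough to set the output length to 0.\<close>

definition prog :: program where
  "prog = Cond (WLess 3 2) main_prog (Instr (WOp WOr 0 3 3))"

context ram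
begin

text \<open>Since 2^d is at most 4N and \<open>N\<close> is positive, all summands are absorbed into
  multiples of \<open>N * Suc (npass n)\<close>.\<close>

lemma run_main:
  "run w \<omega> main_prog (input_state n k x) (700 * N * Suc (npass n)) (\<lambda>s. output_set s = Alg n \<omega> x)"
proof -
  let ?K = "2 ^ d :: nat" and ?m = "Suc (npass n)"
  have "run w \<omega> main_prog (input_state n k x)
    (17 + ((4 * N + 1) + ((3 * ?K + 10) + ((30 * npass n + 20) + ((60 * N + 2) + ((?m * (60 * N + 20) + 1)
      + ((100 * N + 5) + ((60 * ?K + 5) + 20)))))))) (\<lambda>s. output_set s = Alg n \<omega> x)"
    unfolding main_prog_def
    by (intro run_Seq[OF run_p0] run_Seq[OF run_p1] run_Seq[OF run_p2] run_Seq[OF run_p3] run_Seq[OF run_p4]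
        run_Seq[OF run_p5] run_Seq[OF run_p6] run_Seq[OF run_p7] run_p8)
  then show ?thesis
  proof (rule run_mono)
    have 1: "?m * (60 * N + 20) \<le> ?m * (80 * N)" using N_pos by (intro mult_le_mono2) simp
    have 2: "?m \<le> N * ?m" "N \<le> N * ?m" using mult_le_mono1[OF N_pos, of ?m] by (simp_all only: mult_1, simp)
    have 3: "?m * (80 * N) = 80 * (N * ?m)" by simp
    have 4: "700 * N * ?m = 700 * (N * ?m)" by (rule mult.assoc)
    show "17 + ((4 * N + 1) + ((3 * ?K + 10) + ((30 * npass n + 20) + ((60 * N + 2) + ((?m * (60 * N + 20) + 1)
      + ((100 * N + 5) + ((60 * ?K + 5) + 20))))))) \<le> 700 * N * ?m"
      using 1[unfolded 3] 2 K_le N_pos unfolding 4 by linarith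
  qed
qed

end

lemma holds_init: "holds (WLess 3 2) (input_state n k x) \<longleftrightarrow> nonzeros n x \<noteq> {}"
  by (simp add: input_state_def Let_def nnz_def nonzeros_def card_gt_0_iff)

text \<open>The 13 splits as 11 + 2: (n + 1)^11 is at least 2^11, which exceeds 1000.\<close>

lemma word_size:
  assumes "1 \<le> n" "real w \<ge> real 13 * log 2 (real n + 1)"
  shows "1000 * ((n + 1) * (n + 1)) < 2 ^ w"
proof -
  have n2: "2 \<le> n + 1" using assms by simp
  have "2 powr (13 * log 2 (real n + 1)) = (2 powr log 2 (real n + 1)) powr 13"
    by (simp only: powr_powr mult.commute)
  also have "\<dots> = (real n + 1) powr 13" by simp
  also have "\<dots> = (real n + 1) ^ 13" by (rule powr_numeral) simp
  also have "\<dots> = real ((n + 1) ^ 13)" by (simp add: add.commute)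
  finally have "real ((n + 1) ^ 13) \<le> 2 powr real w" using assms(2) by (metis of_nat_numeral powr_mono one_le_numeral)
  then have "real ((n + 1) ^ 13) \<le> real (2 ^ w)" by (simp add: powr_realpow)
  then have 1: "(n + 1) ^ 13 \<le> 2 ^ w" by (simp only: of_nat_le_iff)
  have "(2::nat) ^ 11 \<le> (n + 1) ^ 11" using n2 by (rule power_mono) simp
  then have "2 ^ 11 * ((n + 1) * (n + 1)) \<le> (n + 1) ^ 11 * ((n + 1) * (n + 1))" by (rule mult_le_mono1)
  also have "\<dots> = (n + 1) ^ 13" unfolding power2_eq_square[symmetric] power_add[symmetric] by simp
  finally have "2 ^ 11 * ((n + 1) * (n + 1)) \<le> 2 ^ w" using 1 by linarith
  moreover have "1000 * ((n + 1) * (n + 1)) < 2 ^ 11 * ((n + 1) * (n + 1))" by (intro mult_strict_right_mono) simp_all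
  ultimately show ?thesis by linarith
qed

lemma prog_computes:
  assumes n: "1 \<le> n" and w: "real w \<ge> real 13 * log 2 (real n + 1)"
    and om: "\<omega> \<in> space seed_space" and xD: "x \<in> Delta n k"
  shows "\<exists>t. computes w prog n k \<omega> x (Alg n \<omega> x) t \<and> real t \<le> 3000 * max 1 (real (nnz n x) * real (log_star n))"
proof (cases "nonzeros n x = {}")
  case True
  have x0: "vtot n x = 0" unfolding vtot_def using True by (intro sum.neutral) (auto simp: nonzeros_def)
  have fx: "frac_vec n x" using Delta_supp[OF xD] by (simp add: supp_vec_def)
  have "int (card (Alg n \<omega> x)) = 0"
    using card_Asub[OF fx rho_range[OF om] om n, of "lev (rho \<omega>) (vtot n x)"] unfolding Alg_def by (simp add: x0)
  then have A: "Alg n \<omega> x = {}" unfolding Alg_def using finite_Asub by (metis card_0_eq of_nat_eq_0_iff)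
  define s where "s = step w \<omega> (WOp WOr 0 3 3) (input_state n k x)"
  have "\<not> holds (WLess 3 2) (input_state n k x)" using True holds_init by blast
  then have "exec w \<omega> prog (input_state n k x) (1 + 1) s"
    unfolding prog_def s_def by (rule exec.CondFalse) (rule exec.Instr)
  moreover have "output_set s = {}" by (simp add: s_def output_set_def input_state_def Let_def)
  ultimately have "computes w prog n k \<omega> x (Alg n \<omega> x) (1 + 1)" unfolding computes_def A by blast
  then show ?thesis by (intro exI[of _ "1 + 1"]) (simp add: max_def)
next
  case False
  interpret ram n w \<omega> x
    by unfold_locales (use n word_size[OF n w] om Delta_supp[OF xD] False in simp_all)
  obtain t s where e: "exec w \<omega> main_prog (input_state n k x) t s" "t \<le> 700 * N * Suc (npass n)" "output_set s = Alg n \<omega> x"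
    using run_main[of k] unfolding run_def by blast
  have "holds (WLess 3 2) (input_state n k x)" using False holds_init by blast
  then have "computes w prog n k \<omega> x (Alg n \<omega> x) (t + 1)"
    unfolding computes_def prog_def using exec.CondTrue[OF _ e(1)] e(3) by blast
  moreover have "real (t + 1) \<le> 3000 * max 1 (real N * real (log_star n))"
  proof -
    have "700 * N * Suc (npass n) \<le> 700 * N * (log_star n + 2)" using npass_le[of n] by (intro mult_le_mono2) simp
    then have t: "t + 1 \<le> 700 * (N * log_star n) + 1400 * N + 1" using e(2) by (simp add: algebra_simps)
    show ?thesis
    \<comment> \<open>Only \<open>n = 1\<close> has iterated logarithm 0; there is then one item at
      most, and the running time is covered by the maximum with 1.\<close>
    proof (cases "log_star n = 0")
      case True
      then have "n = 1" using log_star_pos[of n] n by (cases "n = 1") auto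
      then have "t + 1 \<le> 1401" using t N_le True by simp
      then show ?thesis by (simp add: max_def True)
    next
      case False
      then have "N \<le> N * log_star n" by simp
      then have "t + 1 \<le> 3000 * (N * log_star n)" using t N_pos by linarith
      then have "real (t + 1) \<le> real (3000 * (N * log_star n))" by (simp only: of_nat_le_iff)
      also have "\<dots> = 3000 * (real N * real (log_star n))" by simp
      also have "\<dots> \<le> 3000 * max 1 (real N * real (log_star n))" by simp
      finally show ?thesis .
    qed
  qed
  ultimately show ?thesis by blast
qed

theorem theorem3p13:
  "\<exists>(P :: program) (c :: nat) (C\<^sub>1 :: real) (C\<^sub>2 :: real).
     \<forall>(n :: nat) (k :: nat) (w :: nat).
       n \<ge> 1 \<longrightarrow> k \<ge> 1 \<longrightarrow> real w \<ge> real c * log 2 (real n + 1) \<longrightarrow>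
       (\<exists>A :: (nat \<Rightarrow> real) \<Rightarrow> (nat \<Rightarrow> real) \<Rightarrow> nat set.
          correlated_sampling seed_space n k A \<and>
          has_stretch seed_space n k A (C\<^sub>1 * max 1 (log 2 (real k))) \<and>
          (\<forall>\<omega>\<in>space seed_space. \<forall>x\<in>Delta n k.
             \<exists>t. computes w P n k \<omega> x (A \<omega> x) t \<and>
                 real t \<le> C\<^sub>2 * max 1 (real (nnz n x) * real (log_star n))))"
proof (rule exI[of _ prog], rule exI[of _ 13], rule exI[of _ 40088], rule exI[of _ 3000], intro allI impI)
  fix n k w :: nat
  assume n: "n \<ge> 1" and k: "k \<ge> 1" and w: "real w \<ge> real 13 * log 2 (real n + 1)"
  show "\<exists>A. correlated_sampling seed_space n k A \<and>
      has_stretch seed_space n k A (40088 * max 1 (log 2 (real k))) \<and>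
      (\<forall>\<omega>\<in>space seed_space. \<forall>x\<in>Delta n k.
         \<exists>t. computes w prog n k \<omega> x (A \<omega> x) t \<and>
             real t \<le> 3000 * max 1 (real (nnz n x) * real (log_star n)))"
    using Alg_correlated[OF n] Alg_stretch[OF n k] prog_computes[OF n w] by blast
qed

end
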